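(* Let $m_n\to\infty$ be positive integers, let $w_n:\mathcal{Z}\to\mathbb{R}^{m_n}$ be measurable functions with $\int w_n\,dQ=0$ and $\int|w_n|^2\,dQ<\infty$, let $W_n=\int w_nw_n^{\top}\,dQ$, and let $\hat w_n$ be an estimator of $w_n$ based on $Z_1,\dots,Z_n$. Put $\bar W_n=\frac1n\sum_{j=1}^nw_n(Z_j)w_n^{\top}(Z_j)$ and $\hat W_n=\frac1n\sum_{j=1}^n\hat w_n(Z_j)\hat w_n^{\top}(Z_j)$. Suppose that the sequence $W_n$ is regular, that there is a constant $B$ such that $|w_n|\le B\sqrt{m_n}$ and $|\hat w_n|\le B\sqrt{m_n}$, that $m_n^3=o(n)$, and that one of the following three conditions holds: $$|\hat W_n-W_n|_o=o_p(m_n^{-1/2}),\qquad |\hat W_n-\bar W_n|_o=o_p(m_n^{-1/2}),\qquad \frac1n\sum_{j=1}^n|\hat w_n(Z_j)-w_n(Z_j)|^2=o_p(m_n^{-1}).$$ Then the following hold. (i) If $\frac1n\sum_{j=1}^n\hat w_n(Z_j)=\frac1n\sum_{j=1}^nw_n(Z_j)+o_p(n^{-1/2})$, then $(-2\log\hat{\mathscr{R}}_n-m_n)/\sqrt{2m_n}$ is asymptotically standard normal. (ii) If there is a measurable function $\psi$ from $\mathcal{Z}$ into $\mathbb{R}^q$ satisfying $\int\psi\,dQ=0$ and $\int\psi\psi^{\top}\,dQ=I_q$ such that, with $A_n=\int w_n\psi^{\top}\,dQ$, one has $$\frac1n\sum_{j=1}^n\hat w_n(Z_j)=\frac1n\sum_{j=1}^n\big(w_n(Z_j)-A_n\psi(Z_j)\big)+o_p(n^{-1/2})\quad\text{and}\quad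 \operatorname{trace}(A_n^{\top}W_n^{-1}A_n)\to q,$$ then $(-2\log\hat{\mathscr{R}}_n-m_n+q)/\sqrt{2(m_n-q)}$ is asymptotically standard normal.
   Context: $(\mathcal{Z},\mathscr{S})$ is a measurable space; $Z_1,\dots,Z_n$ are independent copies of a $\mathcal{Z}$-valued random variable $Z$ with distribution $Q$ (the same for all $n$). $|\cdot|$ is the Euclidean norm (for vectors, $o_p$ statements are in this norm), $|A|_o=\sup_{|u|=1}|Au|$ is the operator norm, and $I_q$ is the $q\times q$ identity matrix ($q$ fixed). An estimator $\hat w_n$ of $w_n$ is an $\mathbb{R}^{m_n}$-valued function on $\mathcal{Z}$ depending on the observations $Z_1,\dots,Z_n$, such that $\hat w_n(Z_j)$ are random vectors. A sequence $W_n$ of $m_n\times m_n$ dispersion (covariance) matrices is regular if $0<\inf_n\inf_{|u|=1}u^{\top}W_nu\le\sup_n\sup_{|u|=1}u^{\top}W_nu<\infty$. With $\mathscr{P}_n=\{\pi\in[0,1]^n:\pi_1+\dots+\pi_n=1\}$, $$\hat{\mathscr{R}}_n=\sup\Big\{\prod_{j=1}^n n\pi_j:\ \pi\in\mathscr{P}_n,\ \frac1n\sum_{j=1}^n\pi_j\hat w_n(Z_j)=0\Big\},$$ with the supremum taken in $[0,\infty)$, so that $\sup\emptyset=0$ and $-2\log 0=+\infty$. *)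

theory Defs
  imports
    "HOL-Probability.Probability"
    "HOL-Library.Landau_Symbols"
    "Jordan_Normal_Form.Gauss_Jordan_Elimination"
begin

no_notation Finite_Cartesian_Product.vec_nth (infixl "$" 90)

text \<open>
  Dimensions vary with the sample size, so vectors and matrices are those of
  \<^theory>\<open>Jordan_Normal_Form.Matrix\<close>. That library has no Euclidean norm, operator norm or
  trace, and its vector type carries no Borel algebra.
\<close>

definition vnorm :: "real Matrix.vec \<Rightarrow> real" where
  "vnorm v = sqrt (scalar_prod v v)"

definition unit_vecs :: "nat \<Rightarrow> real Matrix.vec set" where
  "unit_vecs d = {u \<in> carrier_vec d. vnorm u = 1}"

definition op_norm :: "real Matrix.mat \<Rightarrow> real" where
  "op_norm A = (SUP u\<in>unit_vecs (dim_col A). vnorm (A *\<^sub>v u))"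

definition mtrace :: "real Matrix.mat \<Rightarrow> real" where
  "mtrace A = (\<Sum>i<dim_row A. A $$ (i, i))"

definition quad_form :: "real Matrix.mat \<Rightarrow> real Matrix.vec \<Rightarrow> real" where
  "quad_form A u = scalar_prod u (A *\<^sub>v u)"

definition outer :: "real Matrix.vec \<Rightarrow> real Matrix.vec \<Rightarrow> real Matrix.mat" where
  "outer u v = Matrix.mat (dim_vec u) (dim_vec v) (\<lambda>(i, k). u $ i * v $ k)"

definition vec_measurable ::
    "'a measure \<Rightarrow> nat \<Rightarrow> ('a \<Rightarrow> real Matrix.vec) \<Rightarrow> bool" where
  "vec_measurable M d f \<longleftrightarrow>
     (\<forall>x\<in>space M. f x \<in> carrier_vec d) \<and> (\<forall>i<d. (\<lambda>x. f x $ i) \<in> borel_measurable M)"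

definition vec_integral ::
    "'a measure \<Rightarrow> nat \<Rightarrow> ('a \<Rightarrow> real Matrix.vec) \<Rightarrow> real Matrix.vec" where
  "vec_integral M d f = Matrix.vec d (\<lambda>i. \<integral>x. f x $ i \<partial>M)"

definition mat_integral ::
    "'a measure \<Rightarrow> nat \<Rightarrow> nat \<Rightarrow> ('a \<Rightarrow> real Matrix.mat) \<Rightarrow> real Matrix.mat" where
  "mat_integral M d e F = Matrix.mat d e (\<lambda>(i, k). \<integral>x. F x $$ (i, k) \<partial>M)"

definition vec_avg :: "nat \<Rightarrow> nat \<Rightarrow> (nat \<Rightarrow> real Matrix.vec) \<Rightarrow> real Matrix.vec" where
  "vec_avg d n x = Matrix.vec d (\<lambda>i. (1 / real n) * (\<Sum>j=1..n. x j $ i))"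

definition mat_avg :: "nat \<Rightarrow> nat \<Rightarrow> (nat \<Rightarrow> real Matrix.mat) \<Rightarrow> real Matrix.mat" where
  "mat_avg d n X = Matrix.mat d d (\<lambda>(i, k). (1 / real n) * (\<Sum>j=1..n. X j $$ (i, k)))"

text \<open>
  The infima and suprema are taken in the extended reals, so that finiteness of the supremum is a
  genuine condition; sample sizes start at 1.
\<close>

definition regular_seq :: "(nat \<Rightarrow> nat) \<Rightarrow> (nat \<Rightarrow> real Matrix.mat) \<Rightarrow> bool" where
  "regular_seq m W \<longleftrightarrow>
     0 < (INF n\<in>{1..}. INF u\<in>unit_vecs (m n). ereal (quad_form (W n) u)) \<and>
     (SUP n\<in>{1..}. SUP u\<in>unit_vecs (m n). ereal (quad_form (W n) u)) < \<infinity>"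

text \<open>The variables \<open>X n\<close> may live on different probability spaces \<open>M n\<close>.\<close>

definition small_op ::
    "(nat \<Rightarrow> 'w measure) \<Rightarrow> (nat \<Rightarrow> 'w \<Rightarrow> real) \<Rightarrow> (nat \<Rightarrow> real) \<Rightarrow> bool" where
  "small_op M X a \<longleftrightarrow>
     (\<forall>\<epsilon>>0. (\<lambda>n. measure (M n) {\<omega>\<in>space (M n). \<bar>X n \<omega>\<bar> > \<epsilon> * a n}) \<longlonglongrightarrow> 0)"

text \<open>
  Convergence in distribution of extended-real variables to the standard normal law: pointwise
  convergence of the distribution functions at real arguments. As the limit has total mass 1, no
  mass is lost at infinity.
\<close>

definition asymp_std_normal ::
    "(nat \<Rightarrow> 'w measure) \<Rightarrow> (nat \<Rightarrow> 'w \<Rightarrow> ereal) \<Rightarrow> bool" where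
  "asymp_std_normal M X \<longleftrightarrow>
     weak_conv (\<lambda>n x. measure (M n) {\<omega>\<in>space (M n). X n \<omega> \<le> ereal x})
               (cdf std_normal_distribution)"

definition prob_simplex :: "nat \<Rightarrow> (nat \<Rightarrow> real) set" where
  "prob_simplex n = {\<pi>. (\<forall>j\<in>{1..n}. 0 \<le> \<pi> j \<and> \<pi> j \<le> 1) \<and> (\<Sum>j=1..n. \<pi> j) = 1}"

text \<open>
  The empirical likelihood ratio for the data \<open>x 1, \<dots>, x n\<close> in dimension \<open>d\<close>. The products lie in
  \<open>[0, n ^ n]\<close>; the supremum over the empty set is 0.
\<close>

definition el_ratio :: "nat \<Rightarrow> nat \<Rightarrow> (nat \<Rightarrow> real Matrix.vec) \<Rightarrow> real" where
  "el_ratio d n x =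
     (let S = {\<Prod>j=1..n. real n * \<pi> j | \<pi>.
                 \<pi> \<in> prob_simplex n \<and> vec_avg d n (\<lambda>j. \<pi> j \<cdot>\<^sub>v x j) = 0\<^sub>v d}
      in if S = {} then 0 else Sup S)"

definition neg2log :: "real \<Rightarrow> ereal" where
  "neg2log r = (if r = 0 then \<infinity> else ereal (- 2 * ln r))"

end

theory Submission
  imports
    Defs
    "Jordan_Normal_Form.Determinant"
    "HOL-Real_Asymp.Real_Asymp"
begin

text \<open>
  Write \<open>P\<close> for the inverse of \<open>W n\<close>. The pairing \<open>K a b = w a \<bullet> P (w b)\<close> is a reproducing kernel in
  \<open>L\<^sup>2(Q)\<close>, and \<open>T = (1/n) \<Sum>\<Sum> K (Z i) (Z j)\<close> is \<open>n\<close> times the quadratic form of the mean of the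
  \<open>w (Z j)\<close> in \<open>P\<close>. Adding one observation changes the characteristic function of the centred
  double sum by an explicit factor up to a small error, because the reproducing property makes the
  conditional variance of the increment equal to \<open>4 N\<close> to first order, where the double sum \<open>N\<close>
  concentrates around its mean. Multiplying the factors gives \<open>exp (- t\<^sup>2/2)\<close>, and Levy's
  continuity theorem the central limit theorem for \<open>(T - m) / sqrt (2 m)\<close>.

  The empirical likelihood is squeezed without Lagrange multipliers. For every \<open>\<zeta>\<close> with
  \<open>1 + \<zeta> \<bullet> x j > 0\<close>, the inequality \<open>y \<le> exp (y - 1)\<close> bounds each admissible product by
  \<open>1 / (\<Prod> 1 + \<zeta> \<bullet> x j)\<close>; conversely the weights \<open>(1 - \<delta> j) / n\<close>, with \<open>\<delta>\<close> linear in \<open>x j\<close>, are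
  admissible. Both bounds equal the quadratic form of the mean of the \<open>x j\<close> in \<open>P\<close> up to
  \<open>o(sqrt m)\<close>, which is where \<open>m\<^sup>3 = o(n)\<close> and the rate \<open>m powr (-1/2)\<close> enter.

  In part (ii) the projection term \<open>A \<psi>\<close> lives in the fixed dimension \<open>q\<close>, so it changes the
  quadratic form only by a quantity bounded in probability. As \<open>m\<close> tends to infinity, this and the
  shift by \<open>q\<close> disappear after division by \<open>sqrt (2 m)\<close>.
\<close>

section \<open>Central limit theorem for degenerate quadratic statistics\<close>

text \<open>The dimension grows with \<open>n\<close>, so no limit theorem in a fixed space applies.
  \<open>K\<close> is the kernel of the orthogonal projection of L2(Q) onto the span of the
  components of \<open>w n\<close>, and its rank \<open>m\<close> is all that the central limit
  theorem sees of the dimension. Since the conditional variance of an increment is again the double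
  sum to first order, two moments of one scalar control the whole recursion.

  The rates come from three counts. With high probability the mean of the \<open>x j\<close> has
  norm of order sqrt (m / n), and each \<open>x j\<close> has norm of order at most sqrt m, so the
  weights deviate from 1 / n by a relative order m / sqrt n. The cubic term of the logarithm then
  contributes m * (m / sqrt n) = sqrt m * sqrt (m^3 / n). A matrix error g changes n times the
  quadratic form by order m * g, which is o(sqrt m) for g = o(m powr (-1/2)). The average of n outer
  products misses \<open>W\<close> by a mean square of order m^2 / n, and this is o(1 / m).\<close>

lemma norm_iexp_quadratic: "cmod (iexp x - (1 + \<i> * x - x\<^sup>2 / 2)) \<le> \<bar>x\<bar> ^ 3 / 6"
  using iexp_approx1[of x 2]
  by (simp add: numeral_2_eq_2 numeral_3_eq_3 fact_numeral power2_eq_square algebra_simps diff_diff_eq)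

lemma abs_exp_minus_linear: 
  fixes x :: real assumes "0 \<le> x" shows "\<bar>exp (- x) - (1 - x)\<bar> \<le> x\<^sup>2 / 2"
proof -
  obtain t where t: "\<bar>t\<bar> \<le> \<bar>-x\<bar>" "exp (-x) = (\<Sum>m<2. (-x) ^ m / fact m) + exp t / fact 2 * (-x) ^ 2"
    using Maclaurin_exp_le[of "-x" 2] by blast
  consider "x = 0" | "x > 0" using assms by linarith
  then show ?thesis
  proof cases
    case 2
    obtain u where u: "-x < u" "u < 0" "exp (-x) = (\<Sum>m<2. exp 0 / fact m * (-x) ^ m) + exp u / fact 2 * (-x) ^ 2"
      using Maclaurin_minus[of "-x" 2 "\<lambda>_. exp" exp] 2 by auto
    have eq: "exp (-x) - (1 - x) = exp u / 2 * x\<^sup>2" using u(3) by (simp add: numeral_2_eq_2)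
    have "exp u \<le> 1" using u by simp
    then have "exp u / 2 * x\<^sup>2 \<le> 1/2 * x\<^sup>2" by (intro mult_right_mono) auto
    then show ?thesis unfolding eq by (simp add: abs_mult)
  qed simp
qed

lemma (in prob_space) integrable_bounded:
  fixes f :: "'a \<Rightarrow> 'b::{banach, second_countable_topology}"
  assumes "f \<in> borel_measurable M" "\<And>x. x \<in> space M \<Longrightarrow> norm (f x) \<le> b"
  shows "integrable M f"
  using assms by (intro integrable_const_bound[of _ b]) auto

lemma (in prob_space) expectation_shift_square:
  fixes s :: "'a \<Rightarrow> real"
  assumes "integrable M s" "integrable M (\<lambda>z. (s z)\<^sup>2)"
  shows "(\<integral>z. (c + s z)\<^sup>2 \<partial>M) = c\<^sup>2 + 2 * c * (\<integral>z. s z \<partial>M) + (\<integral>z. (s z)\<^sup>2 \<partial>M)"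
  using assms by (simp add: power2_sum prob_space)

lemma (in prob_space) has_integral_quadratic_exp:
  fixes d :: "'a \<Rightarrow> real"
  assumes "integrable M d" "integrable M (\<lambda>z. (d z)\<^sup>2)"
  shows "has_bochner_integral M (\<lambda>z. 1 + \<i> * complex_of_real (\<tau> * d z) - complex_of_real ((\<tau> * d z)\<^sup>2 / 2))
    (1 + \<i> * complex_of_real (\<tau> * (\<integral>z. d z \<partial>M)) - complex_of_real (\<tau>\<^sup>2 / 2 * (\<integral>z. (d z)\<^sup>2 \<partial>M)))"
proof -
  have 1: "has_bochner_integral M (\<lambda>z. \<tau> * d z) (\<tau> * (\<integral>z. d z \<partial>M))"
    using assms(1) by (intro has_bochner_integral_mult_right has_bochner_integral_integrable) auto
  have 2: "has_bochner_integral M (\<lambda>z. \<tau>\<^sup>2 / 2 * (d z)\<^sup>2) (\<tau>\<^sup>2 / 2 * (\<integral>z. (d z)\<^sup>2 \<partial>M))"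
    using assms(2) by (intro has_bochner_integral_mult_right has_bochner_integral_integrable) auto
  have 3: "has_bochner_integral M (\<lambda>z. 1 :: complex) 1"
    by (simp add: has_bochner_integral_iff prob_space)
  have eq: "(\<tau> * d z)\<^sup>2 / 2 = \<tau>\<^sup>2 / 2 * (d z)\<^sup>2" for z by (simp add: power_mult_distrib)
  show ?thesis unfolding eq
    by (intro has_bochner_integral_diff has_bochner_integral_add has_bochner_integral_mult_right
         has_bochner_integral_of_real 1 2 3)
qed

text \<open>Evaluation at \<open>(- b, a)\<close> gives \<open>a * (a * c - b\<^sup>2)\<close>,
  which settles the case of nonzero \<open>a\<close>. For \<open>a = 0\<close> the form is affine in
  \<open>s\<close>, so it stays nonnegative only if \<open>b = 0\<close>.\<close>

lemma discriminant_nonpos: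
  fixes a b c :: real
  assumes q: "\<And>s t. 0 \<le> s\<^sup>2 * a + 2 * s * t * b + t\<^sup>2 * c"
  shows "b\<^sup>2 \<le> a * c"
proof (cases "a = 0")
  case True
  have "b = 0"
  proof (rule ccontr)
    assume "b \<noteq> 0"
    \<comment> \<open>With \<open>a = 0\<close> and \<open>t = 1\<close> this \<open>s\<close> gives
      the form the value -1.\<close>
    then show False using q[of "- (c + 1) / (2 * b)" 1] True by (simp add: field_simps)
  qed
  then show ?thesis using True by simp
next
  case False
  have "0 \<le> a" using q[of 1 0] by simp
  with False have "0 < a" by simp
  moreover have "0 \<le> a * (a * c - b\<^sup>2)" using q[of "- b" a] by (simp add: power2_eq_square algebra_simps)
  ultimately show ?thesis by (simp add: zero_le_mult_iff)
qed

lemma (in prob_space) Cauchy_Schwarz_integral: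
  fixes f g :: "'a \<Rightarrow> real"
  assumes "integrable M (\<lambda>z. (f z)\<^sup>2)" "integrable M (\<lambda>z. (g z)\<^sup>2)" "integrable M (\<lambda>z. f z * g z)"
    and [measurable]: "f \<in> borel_measurable M" "g \<in> borel_measurable M"
  shows "(\<integral>z. f z * g z \<partial>M)\<^sup>2 \<le> (\<integral>z. (f z)\<^sup>2 \<partial>M) * (\<integral>z. (g z)\<^sup>2 \<partial>M)"
proof (rule discriminant_nonpos)
  fix s t :: real
  have "0 \<le> (\<integral>z. (s * f z + t * g z)\<^sup>2 \<partial>M)" by (intro integral_nonneg_AE) auto
  also have "\<dots> = (\<integral>z. s\<^sup>2 * (f z)\<^sup>2 + (2 * s * t) * (f z * g z) + t\<^sup>2 * (g z)\<^sup>2 \<partial>M)"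
    by (intro Bochner_Integration.integral_cong) (auto simp: power2_eq_square algebra_simps)
  also have "\<dots> = s\<^sup>2 * (\<integral>z. (f z)\<^sup>2 \<partial>M) + 2 * s * t * (\<integral>z. f z * g z \<partial>M) + t\<^sup>2 * (\<integral>z. (g z)\<^sup>2 \<partial>M)"
    using assms(1-3) by simp
  finally show "0 \<le> s\<^sup>2 * (\<integral>z. (f z)\<^sup>2 \<partial>M) + 2 * s * t * (\<integral>z. f z * g z \<partial>M) + t\<^sup>2 * (\<integral>z. (g z)\<^sup>2 \<partial>M)" .
qed

section \<open>Characteristic function of a single increment\<close>

text \<open>Second order Taylor expansion: the increment has mean 0 and variance
  \<open>4 * N\<close> up to the diagonal part \<open>g\<close>. The three error terms come from
  replacing the variance by \<open>4 * \<mu>\<close>, from the cubic remainder, and from replacing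
  \<open>1 - 2 * \<tau>\<^sup>2 * \<mu>\<close> by an exponential. In the recursion
  \<open>\<mu>\<close> is instantiated with the mean of the double sum after \<open>k\<close>
  observations.\<close>

lemma (in prob_space) char_step:
  fixes L g :: "'a \<Rightarrow> real" and \<tau> N \<kappa> \<mu> :: real
  assumes [measurable]: "L \<in> borel_measurable M" "g \<in> borel_measurable M"
    and L0: "(\<integral>z. L z \<partial>M) = 0" and L2: "(\<integral>z. (L z)\<^sup>2 \<partial>M) = N"
    and Lb: "\<And>z. z \<in> space M \<Longrightarrow> (L z)\<^sup>2 \<le> N * \<kappa>"
    and g0: "(\<integral>z. g z \<partial>M) = 0" and gb: "\<And>z. z \<in> space M \<Longrightarrow> \<bar>g z\<bar> \<le> \<kappa>"
    and k0: "0 \<le> \<kappa>" and mu: "0 \<le> \<mu>"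
  shows "cmod ((\<integral>z. iexp (\<tau> * (2 * L z + g z)) \<partial>M) - exp (- (2 * \<tau>\<^sup>2 * \<mu>)))
    \<le> \<tau>\<^sup>2 / 2 * (4 * \<bar>N - \<mu>\<bar> + 4 * \<kappa> * sqrt N + \<kappa>\<^sup>2)
      + \<bar>\<tau>\<bar> ^ 3 / 6 * ((2 * sqrt (N * \<kappa>) + \<kappa>) * (8 * N + 2 * \<kappa>\<^sup>2)) + (2 * \<tau>\<^sup>2 * \<mu>)\<^sup>2 / 2"
    and "(\<integral>z. (2 * L z + g z) \<partial>M) = 0" and "(\<integral>z. (2 * L z + g z)\<^sup>2 \<partial>M) \<le> 8 * N + 2 * \<kappa>\<^sup>2"
proof -
  let ?d = "\<lambda>z. 2 * L z + g z"
  have N0: "0 \<le> N" unfolding L2[symmetric] by (intro integral_nonneg_AE) auto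
  have Lb': "\<bar>L z\<bar> \<le> sqrt (N * \<kappa>)" if "z \<in> space M" for z
    using real_sqrt_le_mono[OF Lb[OF that]] by simp
  let ?S = "2 * sqrt (N * \<kappa>) + \<kappa>"
  have db: "\<bar>?d z\<bar> \<le> ?S" if "z \<in> space M" for z
    using Lb'[OF that] gb[OF that] by linarith
  have S0: "0 \<le> ?S" using k0 N0 by simp
  have iL: "integrable M L" using Lb' by (intro integrable_bounded) auto
  have ig: "integrable M g" using gb by (intro integrable_bounded) auto
  have id: "integrable M ?d" using iL ig by simp
  have sq: "x\<^sup>2 \<le> b\<^sup>2" if "\<bar>x\<bar> \<le> b" for x b :: real using that by (metis abs_ge_zero power2_abs power_mono)
  have iL2: "integrable M (\<lambda>z. (L z)\<^sup>2)" using sq[OF Lb'] by (intro integrable_bounded) auto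
  have ig2: "integrable M (\<lambda>z. (g z)\<^sup>2)" using sq[OF gb] by (intro integrable_bounded) auto
  have iLg: "integrable M (\<lambda>z. L z * g z)"
    using mult_mono[OF Lb' gb] N0 k0 by (intro integrable_bounded[where b="sqrt (N*\<kappa>) * \<kappa>"]) (auto simp: abs_mult)
  have id2: "integrable M (\<lambda>z. (?d z)\<^sup>2)" using sq[OF db] by (intro integrable_bounded) auto
  have id3: "integrable M (\<lambda>z. \<bar>?d z\<bar>^3)" using power_mono[OF db, of _ 3] by (intro integrable_bounded) auto
  show d0: "(\<integral>z. ?d z \<partial>M) = 0" using iL ig L0 g0 by simp
  have G2: "(\<integral>z. (g z)\<^sup>2 \<partial>M) \<le> \<kappa>\<^sup>2" "0 \<le> (\<integral>z. (g z)\<^sup>2 \<partial>M)"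
    using sq[OF gb] ig2 by (auto intro!: integral_le_const integral_nonneg_AE AE_I2)
  have "(\<integral>z. (?d z)\<^sup>2 \<partial>M) \<le> (\<integral>z. 8 * (L z)\<^sup>2 + 2 * (g z)\<^sup>2 \<partial>M)"
  proof (intro integral_mono id2)
    show "(?d z)\<^sup>2 \<le> 8 * (L z)\<^sup>2 + 2 * (g z)\<^sup>2" for z
      using zero_le_power2[of "2 * L z - g z"] by (simp add: power2_eq_square algebra_simps)
  qed (use iL2 ig2 in simp)
  also have "\<dots> \<le> 8 * N + 2 * \<kappa>\<^sup>2" using iL2 ig2 G2 L2 by simp
  finally show D2: "(\<integral>z. (?d z)\<^sup>2 \<partial>M) \<le> 8 * N + 2 * \<kappa>\<^sup>2" .
  have d2: "(\<integral>z. (?d z)\<^sup>2 \<partial>M) = 4 * N + 4 * (\<integral>z. L z * g z \<partial>M) + (\<integral>z. (g z)\<^sup>2 \<partial>M)"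
  proof -
    have "(\<integral>z. (?d z)\<^sup>2 \<partial>M) = (\<integral>z. 4 * (L z)\<^sup>2 + 4 * (L z * g z) + (g z)\<^sup>2 \<partial>M)"
      by (intro Bochner_Integration.integral_cong) (auto simp: power2_eq_square algebra_simps)
    then show ?thesis using iL2 ig2 iLg L2 by simp
  qed
  have Lg: "\<bar>\<integral>z. L z * g z \<partial>M\<bar> \<le> \<kappa> * sqrt N"
  proof -
    have "\<bar>\<integral>z. L z * g z \<partial>M\<bar> \<le> (\<integral>z. \<bar>L z * g z\<bar> \<partial>M)" by (rule integral_abs_bound)
    also have "\<dots> \<le> (\<integral>z. \<kappa> * \<bar>L z\<bar> \<partial>M)"
      using iL integrable_abs[OF iLg] gb by (intro integral_mono) (auto simp: abs_mult mult.commute[of \<kappa>] intro!: mult_left_mono)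
    also have "\<dots> = \<kappa> * (\<integral>z. \<bar>L z\<bar> \<partial>M)" by simp
    also have "(\<integral>z. \<bar>L z\<bar> \<partial>M) \<le> sqrt N"
    proof (rule real_le_rsqrt)
      have "0 \<le> (\<integral>z. (\<bar>L z\<bar> - (\<integral>z. \<bar>L z\<bar> \<partial>M))\<^sup>2 \<partial>M)" by (intro integral_nonneg_AE) auto
      also have "\<dots> = N - (\<integral>z. \<bar>L z\<bar> \<partial>M)\<^sup>2"
        using iL iL2 L2 variance_eq[of "\<lambda>z. \<bar>L z\<bar>"] by simp
      finally show "(\<integral>z. \<bar>L z\<bar> \<partial>M)\<^sup>2 \<le> N" by simp
    qed
    finally show ?thesis using k0 by (simp add: mult_left_mono)
  qed
  have h1: "cmod ((\<integral>z. iexp (\<tau> * ?d z) \<partial>M) - (1 - \<tau>\<^sup>2 / 2 * (\<integral>z. (?d z)\<^sup>2 \<partial>M)))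
     \<le> \<bar>\<tau>\<bar> ^ 3 / 6 * (?S * (8 * N + 2 * \<kappa>\<^sup>2))"
  proof -
    have i1: "complex_integrable M (\<lambda>z. iexp (\<tau> * ?d z))" by (intro integrable_bounded[where b=1]) auto
    note q = has_integral_quadratic_exp[OF id id2, of \<tau>]
    have i2: "complex_integrable M (\<lambda>z. 1 + \<i> * (\<tau> * ?d z) - (\<tau> * ?d z)\<^sup>2 / 2)"
      using integrable.intros[OF q] by simp
    have e2: "(\<integral>z. 1 + \<i> * (\<tau> * ?d z) - (\<tau> * ?d z)\<^sup>2 / 2 \<partial>M) = 1 - \<tau>\<^sup>2 / 2 * (\<integral>z. (?d z)\<^sup>2 \<partial>M)"
      using has_bochner_integral_integral_eq[OF q] unfolding d0 by simp
    have "cmod ((\<integral>z. iexp (\<tau> * ?d z) \<partial>M) - (\<integral>z. 1 + \<i> * (\<tau> * ?d z) - (\<tau> * ?d z)\<^sup>2 / 2 \<partial>M))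
       = cmod (\<integral>z. iexp (\<tau> * ?d z) - (1 + \<i> * (\<tau> * ?d z) - (\<tau> * ?d z)\<^sup>2 / 2) \<partial>M)"
      using i1 i2 by (subst Bochner_Integration.integral_diff) auto
    also have "\<dots> \<le> (\<integral>z. cmod (iexp (\<tau> * ?d z) - (1 + \<i> * (\<tau> * ?d z) - (\<tau> * ?d z)\<^sup>2 / 2)) \<partial>M)"
      by (rule integral_norm_bound)
    also have "\<dots> \<le> (\<integral>z. \<bar>\<tau>\<bar>^3/6 * \<bar>?d z\<bar>^3 \<partial>M)"
    proof (rule integral_mono[OF integrable_norm[OF Bochner_Integration.integrable_diff[OF i1 i2]]])
      show "cmod (iexp (\<tau> * ?d z) - (1 + \<i> * (\<tau> * ?d z) - (\<tau> * ?d z)\<^sup>2 / 2)) \<le> \<bar>\<tau>\<bar>^3/6 * \<bar>?d z\<bar>^3" for z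
        using norm_iexp_quadratic[of "\<tau> * ?d z"] by (simp add: abs_mult power_mult_distrib)
    qed (use id3 in simp)
    \<comment> \<open>One factor of the cube is replaced by its uniform bound \<open>?S\<close>;
      what remains is the second moment already bounded by \<open>D2\<close>.\<close>
    also have "\<dots> \<le> (\<integral>z. \<bar>\<tau>\<bar>^3/6 * (?S * (?d z)\<^sup>2) \<partial>M)"
    proof (intro integral_mono)
      show "\<bar>\<tau>\<bar>^3/6 * \<bar>?d z\<bar>^3 \<le> \<bar>\<tau>\<bar>^3/6 * (?S * (?d z)\<^sup>2)" if "z \<in> space M" for z
      proof -
        have "\<bar>?d z\<bar>^3 = \<bar>?d z\<bar> * (?d z)\<^sup>2" by (simp add: power3_eq_cube power2_eq_square)
        also have "\<dots> \<le> ?S * (?d z)\<^sup>2" by (intro mult_right_mono db that) auto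
        finally show ?thesis by (intro mult_left_mono) auto
      qed
    qed (use id3 id2 in simp_all)
    also have "\<dots> = \<bar>\<tau>\<bar>^3/6 * (?S * (\<integral>z. (?d z)\<^sup>2 \<partial>M))" by simp
    also have "\<dots> \<le> \<bar>\<tau>\<bar>^3/6 * (?S * (8 * N + 2 * \<kappa>\<^sup>2))"
      by (intro mult_left_mono D2 S0) auto
    finally show ?thesis unfolding e2 .
  qed
  have h2: "cmod (complex_of_real (1 - \<tau>\<^sup>2 / 2 * (\<integral>z. (?d z)\<^sup>2 \<partial>M)) - complex_of_real (1 - 2 * \<tau>\<^sup>2 * \<mu>))
     \<le> \<tau>\<^sup>2 / 2 * (4 * \<bar>N - \<mu>\<bar> + 4 * \<kappa> * sqrt N + \<kappa>\<^sup>2)"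
  proof -
    have "\<bar>4 * \<mu> - (\<integral>z. (?d z)\<^sup>2 \<partial>M)\<bar> \<le> 4 * \<bar>N - \<mu>\<bar> + 4 * \<kappa> * sqrt N + \<kappa>\<^sup>2"
    proof -
      have "\<bar>4 * \<mu> - (4 * N + 4 * E + G)\<bar> \<le> 4 * \<bar>N - \<mu>\<bar> + 4 * c + k" 
        if "\<bar>E\<bar> \<le> c" "G \<le> k" "0 \<le> G" for E G c k :: real
        using that abs_ge_self[of "N - \<mu>"] abs_ge_minus_self[of "N - \<mu>"] unfolding abs_le_iff by (auto simp: algebra_simps)
      from this[OF Lg G2] show ?thesis unfolding d2 by (simp only: mult.assoc)
    qed
    then have "\<tau>\<^sup>2 / 2 * \<bar>4 * \<mu> - (\<integral>z. (?d z)\<^sup>2 \<partial>M)\<bar> \<le> \<tau>\<^sup>2 / 2 * (4 * \<bar>N - \<mu>\<bar> + 4 * \<kappa> * sqrt N + \<kappa>\<^sup>2)"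
      by (intro mult_left_mono) auto
    moreover have "\<bar>(1 - \<tau>\<^sup>2 / 2 * (\<integral>z. (?d z)\<^sup>2 \<partial>M)) - (1 - 2 * \<tau>\<^sup>2 * \<mu>)\<bar> = \<tau>\<^sup>2 / 2 * \<bar>4 * \<mu> - (\<integral>z. (?d z)\<^sup>2 \<partial>M)\<bar>"
    proof -
      have "(1 - \<tau>\<^sup>2 / 2 * (\<integral>z. (?d z)\<^sup>2 \<partial>M)) - (1 - 2 * \<tau>\<^sup>2 * \<mu>) = \<tau>\<^sup>2 / 2 * (4 * \<mu> - (\<integral>z. (?d z)\<^sup>2 \<partial>M))"
        by (simp add: algebra_simps)
      then show ?thesis by (simp only: abs_mult) simp
    qed
    ultimately show ?thesis unfolding of_real_diff[symmetric] norm_of_real by simp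
  qed
  have h3: "cmod (complex_of_real (1 - 2 * \<tau>\<^sup>2 * \<mu>) - complex_of_real (exp (- (2 * \<tau>\<^sup>2 * \<mu>)))) \<le> (2 * \<tau>\<^sup>2 * \<mu>)\<^sup>2 / 2"
    using abs_exp_minus_linear[of "2 * \<tau>\<^sup>2 * \<mu>"] mu unfolding of_real_diff[symmetric] norm_of_real by (subst abs_minus_commute) simp
  show "cmod ((\<integral>z. iexp (\<tau> * ?d z) \<partial>M) - exp (- (2 * \<tau>\<^sup>2 * \<mu>)))
    \<le> \<tau>\<^sup>2 / 2 * (4 * \<bar>N - \<mu>\<bar> + 4 * \<kappa> * sqrt N + \<kappa>\<^sup>2)
      + \<bar>\<tau>\<bar> ^ 3 / 6 * (?S * (8 * N + 2 * \<kappa>\<^sup>2)) + (2 * \<tau>\<^sup>2 * \<mu>)\<^sup>2 / 2"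
  proof -
    have tri: "cmod (a - d) \<le> p + q + r" if "cmod (a - b) \<le> q" "cmod (b - c) \<le> p" "cmod (c - d) \<le> r" for a b c d p q r
      using that norm_triangle_ineq[of "a - b" "b - c"] norm_triangle_ineq[of "a - c" "c - d"] by simp
    from tri[OF h1 _ h3] h2 show ?thesis by simp
  qed
qed

declare One_nat_def [simp del] \<comment> \<open>otherwise index ranges \<open>{1..n}\<close> turn into \<open>{Suc 0..n}\<close>\<close>

section \<open>The degenerate double sum: structure and first two moments\<close>

text \<open>The axioms describe a bounded kernel of an orthogonal projection onto mean-zero
  functions in L2(Q): reproduction is idempotence combined with symmetry, and the trace
  \<open>\<mu>\<close> is the rank.\<close>

locale reproducing_kernel = prob_space Q for Q :: "'z measure" +
  fixes K :: "'z \<Rightarrow> 'z \<Rightarrow> real" and \<kappa> \<mu> :: real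
  assumes kernel_measurable: "case_prod K \<in> borel_measurable (Q \<Otimes>\<^sub>M Q)"
    and kernel_bound: "a \<in> space Q \<Longrightarrow> b \<in> space Q \<Longrightarrow> \<bar>K a b\<bar> \<le> \<kappa>"
    and kernel_centred: "a \<in> space Q \<Longrightarrow> (\<integral>z. K a z \<partial>Q) = 0"
    and kernel_reproducing: "a \<in> space Q \<Longrightarrow> b \<in> space Q \<Longrightarrow> (\<integral>z. K a z * K b z \<partial>Q) = K a b"
    and kernel_trace: "(\<integral>z. K z z \<partial>Q) = \<mu>"
begin

text \<open>The section of the double sum at a new point: it supplies the row and the column that an
  observation \<open>z\<close> adds to \<open>N\<close>.\<close>

definition L :: "(nat \<Rightarrow> 'z) \<Rightarrow> nat \<Rightarrow> 'z \<Rightarrow> real" where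
  "L x k z = (\<Sum>i=1..k. K (x i) z)"

definition N :: "(nat \<Rightarrow> 'z) \<Rightarrow> nat \<Rightarrow> real" where
  "N x k = (\<Sum>i=1..k. \<Sum>j=1..k. K (x i) (x j))"

abbreviation samples :: "nat \<Rightarrow> (nat \<Rightarrow> 'z) measure" where
  "samples k \<equiv> Pi\<^sub>M {1..k} (\<lambda>_. Q)"

lemma kernel_measurable' [measurable (raw)]:
  "f \<in> measurable M Q \<Longrightarrow> g \<in> measurable M Q \<Longrightarrow> (\<lambda>x. K (f x) (g x)) \<in> borel_measurable M"
  using measurable_compose[OF measurable_Pair kernel_measurable, of f M g] by simp

text \<open>The integral on the left of the reproducing property is symmetric in its two
  arguments.\<close>

lemma kernel_commute: "a \<in> space Q \<Longrightarrow> b \<in> space Q \<Longrightarrow> K a b = K b a"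
  using kernel_reproducing[of a b] kernel_reproducing[of b a] by (simp add: mult.commute)

lemma bound_nonneg: "0 \<le> \<kappa>"
proof -
  obtain a where "a \<in> space Q" using not_empty by auto
  then show ?thesis using kernel_bound[of a a] by linarith
qed

lemma trace_nonneg: "0 \<le> \<mu>"
proof -
  have "0 \<le> K a a" if "a \<in> space Q" for a
    using kernel_reproducing[OF that that, symmetric] by simp
  then show ?thesis unfolding kernel_trace[symmetric] by (intro integral_nonneg_AE AE_I2) auto
qed

lemma diag_bounds: assumes "a \<in> space Q" shows "0 \<le> K a a" "K a a \<le> \<kappa>"
  using kernel_reproducing[OF assms assms, symmetric] kernel_bound[OF assms assms] by auto

lemma trace_le_bound: "\<mu> \<le> \<kappa>"
proof -
  have "integrable Q (\<lambda>z. K z z)" using kernel_bound by (intro integrable_bounded[of _ \<kappa>]) auto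
  then show ?thesis unfolding kernel_trace[symmetric] by (intro integral_le_const AE_I2) (auto simp: diag_bounds)
qed

lemma integrable_kernel: "a \<in> space Q \<Longrightarrow> integrable Q (K a)"
  using kernel_bound by (intro integrable_bounded[of _ \<kappa>]) auto

lemma integrable_kernel_mult:
  assumes "a \<in> space Q" "b \<in> space Q" shows "integrable Q (\<lambda>z. K a z * K b z)"
  using assms mult_mono[OF kernel_bound[of a] kernel_bound[of b]] bound_nonneg 
  by (intro integrable_bounded[of _ "\<kappa> * \<kappa>"]) (auto simp: abs_mult)

context
  fixes x :: "nat \<Rightarrow> 'z" and k :: nat
  assumes x_samples: "x \<in> space (samples k)"
begin

lemma x: "i \<in> {1..k} \<Longrightarrow> x i \<in> space Q"
  using x_samples by (auto simp: space_PiM)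

lemma L_measurable: "L x k \<in> borel_measurable Q"
  unfolding L_def using x by measurable

lemma L_integral: "(\<integral>z. L x k z \<partial>Q) = 0"
  unfolding L_def using x
  by (subst Bochner_Integration.integral_sum) (auto simp: integrable_kernel kernel_centred intro!: sum.neutral)

lemma L_bound: "z \<in> space Q \<Longrightarrow> \<bar>L x k z\<bar> \<le> real k * \<kappa>"
  unfolding L_def using x kernel_bound
  by (intro order_trans[OF sum_abs] order_trans[OF sum_bounded_above[of _ _ \<kappa>]]) auto

text \<open>Reproduction evaluates every product of two kernel sections, so \<open>N\<close> is the
  squared L2 norm of \<open>L\<close>. This identity is why the conditional variance of an increment
  is known in terms of \<open>N\<close> itself.\<close>

lemma L_square_integral: "(\<integral>z. (L x k z)\<^sup>2 \<partial>Q) = N x k"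
proof -
  have "(\<integral>z. (L x k z)\<^sup>2 \<partial>Q) = (\<integral>z. (\<Sum>i=1..k. \<Sum>j=1..k. K (x i) z * K (x j) z) \<partial>Q)"
    by (simp add: L_def power2_eq_square sum_product)
  also have "\<dots> = (\<Sum>i=1..k. \<Sum>j=1..k. \<integral>z. K (x i) z * K (x j) z \<partial>Q)"
    using x by (subst Bochner_Integration.integral_sum)
      (auto intro!: Bochner_Integration.integrable_sum integrable_kernel_mult sum.cong Bochner_Integration.integral_sum)
  finally show ?thesis unfolding N_def using x by (simp add: kernel_reproducing)
qed

lemma N_nonneg: "0 \<le> N x k"
  unfolding L_square_integral[symmetric] by (intro integral_nonneg_AE) auto

lemma L_kernel_integral: "a \<in> space Q \<Longrightarrow> (\<integral>z. L x k z * K a z \<partial>Q) = L x k a"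
  unfolding L_def sum_distrib_right using x
  by (subst Bochner_Integration.integral_sum) (auto simp: integrable_kernel_mult kernel_reproducing)

text \<open>Point evaluation is a bounded functional on a reproducing kernel space:
  \<open>L x k a\<close> is the inner product of \<open>L x k\<close> with \<open>K a\<close>, and
  Cauchy-Schwarz applies. The resulting size sqrt (\<open>N\<close> * \<open>\<kappa>\<close>) is
  what keeps the cubic remainder small; the trivial bound \<open>k * \<kappa>\<close> would be too
  large.\<close>

lemma L_square_le: assumes a: "a \<in> space Q" shows "(L x k a)\<^sup>2 \<le> N x k * \<kappa>"
proof -
  note [measurable] = L_measurable
  have i: "integrable Q (\<lambda>z. (L x k z)\<^sup>2)" "integrable Q (\<lambda>z. L x k z * K a z)" "integrable Q (\<lambda>z. (K a z)\<^sup>2)"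
  proof -
    show "integrable Q (\<lambda>z. (K a z)\<^sup>2)" using integrable_kernel_mult[OF a a] by (simp add: power2_eq_square)
    show "integrable Q (\<lambda>z. (L x k z)\<^sup>2)" using power_mono[OF L_bound, of _ 2] by (intro integrable_bounded[of _ "(real k * \<kappa>)\<^sup>2"]) auto
    show "integrable Q (\<lambda>z. L x k z * K a z)" unfolding L_def sum_distrib_right
      using x a by (intro Bochner_Integration.integrable_sum integrable_kernel_mult) auto
  qed
  have "(L x k a)\<^sup>2 \<le> N x k * K a a"
    using Cauchy_Schwarz_integral[OF i(1,3,2) L_measurable borel_measurable_integrable[OF integrable_kernel[OF a]]] kernel_reproducing[OF a a]
    by (simp add: L_square_integral L_kernel_integral[OF a] power2_eq_square[of "K a _"])
  also have "\<dots> \<le> N x k * \<kappa>" by (intro mult_left_mono diag_bounds a N_nonneg)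
  finally show ?thesis .
qed

text \<open>The new row and the new column agree by symmetry, hence the factor 2; the corner is the
  diagonal value \<open>K z z\<close>.\<close>

lemma N_Suc: 
  assumes z: "z \<in> space Q" 
  shows "N (x(Suc k := z)) (Suc k) = N x k + (2 * L x k z + K z z)"
proof -
  let ?y = "x(Suc k := z)"
  have y: "?y i = x i" if "i \<in> {1..k}" for i using that by simp
  have "N ?y (Suc k) = (\<Sum>i=1..k. (\<Sum>j=1..k. K (?y i) (?y j)) + K (?y i) z) + ((\<Sum>j=1..k. K z (?y j)) + K z z)"
    by (simp add: N_def)
  also have "\<dots> = (\<Sum>i=1..k. (\<Sum>j=1..k. K (x i) (x j)) + K (x i) z) + ((\<Sum>j=1..k. K (x j) z) + K z z)"
    using x z by (intro arg_cong2[where f="(+)"] sum.cong refl) (auto simp: kernel_commute)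
  finally show ?thesis by (simp add: N_def L_def sum.distrib)
qed

lemma N_bound: "N x k \<le> (real k)\<^sup>2 * \<kappa>"
proof -
  have "N x k \<le> (\<Sum>i=1..k. \<Sum>j=1..k. \<kappa>)" unfolding N_def using x kernel_bound
    by (intro sum_mono) (auto intro: order_trans[OF abs_ge_self])
  then show ?thesis by (simp add: power2_eq_square)
qed

end

lemma N_measurable [measurable]: "(\<lambda>x. N x k) \<in> borel_measurable (samples k)"
  unfolding N_def by measurable

sublocale product: product_prob_space "\<lambda>_::nat. Q" UNIV
  by unfold_locales

lemma samples_prob: "prob_space (samples k)"
  by (intro prob_space_PiM) unfold_locales

text \<open>Fubini for the last coordinate. The inner integral plays the role of the conditional
  expectation given the first \<open>k\<close> observations.\<close>

lemma samples_integral_Suc: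
  fixes f :: "(nat \<Rightarrow> 'z) \<Rightarrow> 'b::{banach, second_countable_topology}"
  assumes "integrable (samples (Suc k)) f"
  shows "integral\<^sup>L (samples (Suc k)) f = (\<integral>x. (\<integral>z. f (x(Suc k := z)) \<partial>Q) \<partial>samples k)"
proof -
  have "{1..Suc k} = insert (Suc k) {1..k}" by auto
  with assms show ?thesis using product.product_integral_insert[of "{1..k}" "Suc k" f] by simp
qed

lemma integrable_N [simp]:
  "integrable (samples k) (\<lambda>x. N x k)" "integrable (samples k) (\<lambda>x. (N x k)\<^sup>2)"
  "integrable (samples k) (\<lambda>x. (N x k - c)\<^sup>2)" "integrable (samples k) (\<lambda>x. \<bar>N x k - c\<bar>)"
  "integrable (samples k) (\<lambda>x. sqrt (N x k))"
proof -
  interpret S: prob_space "samples k" by (rule samples_prob)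
  have b: "\<bar>N x k\<bar> \<le> (real k)\<^sup>2 * \<kappa>" if "x \<in> space (samples k)" for x
    using N_nonneg[OF that] N_bound[OF that] by simp
  show 1: "integrable (samples k) (\<lambda>x. N x k)"
    using b by (intro S.integrable_bounded) auto
  show 2: "integrable (samples k) (\<lambda>x. (N x k)\<^sup>2)"
    using power_mono[OF b, of _ 2] by (intro S.integrable_bounded) auto
  show "integrable (samples k) (\<lambda>x. (N x k - c)\<^sup>2)"
    using 1 2 by (simp add: power2_diff)
  show "integrable (samples k) (\<lambda>x. \<bar>N x k - c\<bar>)" using 1 by simp
  show "integrable (samples k) (\<lambda>x. sqrt (N x k))"
    using b N_nonneg by (intro S.integrable_bounded[of _ "sqrt ((real k)\<^sup>2 * \<kappa>)"]) auto
qed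

abbreviation (input) step :: "(nat \<Rightarrow> 'z) \<Rightarrow> nat \<Rightarrow> 'z \<Rightarrow> real" where
  "step x k z \<equiv> 2 * L x k z + (K z z - \<mu>)"

lemma N_Suc_centred:
  assumes "x \<in> space (samples k)" "z \<in> space Q" 
  shows "N (x(Suc k := z)) (Suc k) - \<mu> * real (Suc k) = (N x k - \<mu> * real k) + step x k z"
  using N_Suc[OF assms(1) assms(2)] by (simp add: algebra_simps)

text \<open>Subtracting \<open>\<mu>\<close> from the diagonal makes the step a martingale
  difference. \<open>char_step\<close> applies with \<open>g z = K z z - \<mu>\<close>, which is
  bounded by \<open>\<kappa>\<close> because both terms lie between 0 and
  \<open>\<kappa>\<close>.\<close>

lemma step_facts:
  assumes x: "x \<in> space (samples k)"
  shows "cmod ((\<integral>z. iexp (\<tau> * step x k z) \<partial>Q) - exp (- (2 * \<tau>\<^sup>2 * (\<mu> * real k))))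
    \<le> \<tau>\<^sup>2 / 2 * (4 * \<bar>N x k - \<mu> * real k\<bar> + 4 * \<kappa> * sqrt (N x k) + \<kappa>\<^sup>2)
      + \<bar>\<tau>\<bar> ^ 3 / 6 * ((2 * sqrt (N x k * \<kappa>) + \<kappa>) * (8 * N x k + 2 * \<kappa>\<^sup>2)) + (2 * \<tau>\<^sup>2 * (\<mu> * real k))\<^sup>2 / 2"
    and "(\<integral>z. step x k z \<partial>Q) = 0" and "(\<integral>z. (step x k z)\<^sup>2 \<partial>Q) \<le> 8 * N x k + 2 * \<kappa>\<^sup>2"
    and "integrable Q (step x k)" "integrable Q (\<lambda>z. (step x k z)\<^sup>2)"
proof -
  note [measurable] = L_measurable[OF x]
  have g0: "(\<integral>z. K z z - \<mu> \<partial>Q) = 0"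
  proof -
    have "integrable Q (\<lambda>z. K z z)" using kernel_bound by (intro integrable_bounded[of _ \<kappa>]) auto
    then show ?thesis by (simp add: kernel_trace prob_space)
  qed
  have gb: "\<bar>K z z - \<mu>\<bar> \<le> \<kappa>" if "z \<in> space Q" for z
    using diag_bounds[OF that] trace_nonneg trace_le_bound by linarith
  show "cmod ((\<integral>z. iexp (\<tau> * step x k z) \<partial>Q) - exp (- (2 * \<tau>\<^sup>2 * (\<mu> * real k))))
    \<le> \<tau>\<^sup>2 / 2 * (4 * \<bar>N x k - \<mu> * real k\<bar> + 4 * \<kappa> * sqrt (N x k) + \<kappa>\<^sup>2)
      + \<bar>\<tau>\<bar> ^ 3 / 6 * ((2 * sqrt (N x k * \<kappa>) + \<kappa>) * (8 * N x k + 2 * \<kappa>\<^sup>2)) + (2 * \<tau>\<^sup>2 * (\<mu> * real k))\<^sup>2 / 2"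
    by (rule char_step) (use L_integral[OF x] L_square_integral[OF x] L_square_le[OF x] g0 gb bound_nonneg trace_nonneg in auto)
  show "(\<integral>z. step x k z \<partial>Q) = 0"
    by (rule char_step(2)[where N="N x k" and \<kappa>=\<kappa> and \<mu>=\<mu>]) (use L_integral[OF x] L_square_integral[OF x] L_square_le[OF x] g0 gb bound_nonneg trace_nonneg in auto)
  show "(\<integral>z. (step x k z)\<^sup>2 \<partial>Q) \<le> 8 * N x k + 2 * \<kappa>\<^sup>2"
    by (rule char_step(3)[where \<mu>=\<mu>]) (use L_integral[OF x] L_square_integral[OF x] L_square_le[OF x] g0 gb bound_nonneg trace_nonneg in auto)
  have b: "\<bar>step x k z\<bar> \<le> 2 * (real k * \<kappa>) + \<kappa>" if "z \<in> space Q" for z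
    using L_bound[OF x that] gb[OF that] by linarith
  show "integrable Q (step x k)" using b by (intro integrable_bounded) auto
  show "integrable Q (\<lambda>z. (step x k z)\<^sup>2)"
    using power_mono[OF b, of _ 2] by (intro integrable_bounded) auto
qed

text \<open>Martingale property: given the first \<open>k\<close> observations, the step has mean
  zero.\<close>

lemma N_mean: "(\<integral>x. N x k - \<mu> * real k \<partial>samples k) = 0"
proof (induction k)
  case 0
  then show ?case by (simp add: N_def)
next
  case (Suc k)
  interpret S: prob_space "samples (Suc k)" by (rule samples_prob)
  have "(\<integral>x. N x (Suc k) - \<mu> * real (Suc k) \<partial>samples (Suc k))
     = (\<integral>x. (\<integral>z. N (x(Suc k := z)) (Suc k) - \<mu> * real (Suc k) \<partial>Q) \<partial>samples k)"
    by (rule samples_integral_Suc) (simp del: of_nat_Suc)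
  also have "\<dots> = (\<integral>x. N x k - \<mu> * real k \<partial>samples k)"
  proof (intro Bochner_Integration.integral_cong refl)
    fix x assume x: "x \<in> space (samples k)"
    have "(\<integral>z. N (x(Suc k := z)) (Suc k) - \<mu> * real (Suc k) \<partial>Q) = (\<integral>z. (N x k - \<mu> * real k) + step x k z \<partial>Q)"
      by (intro Bochner_Integration.integral_cong refl N_Suc_centred x)
    also have "\<dots> = N x k - \<mu> * real k"
      using step_facts(2,4)[OF x] by (subst Bochner_Integration.integral_add) (auto simp: prob_space)
    finally show "(\<integral>z. N (x(Suc k := z)) (Suc k) - \<mu> * real (Suc k) \<partial>Q) = N x k - \<mu> * real k" .
  qed
  finally show ?case using Suc by simp
qed

lemma N_mean': "(\<integral>x. N x k \<partial>samples k) = \<mu> * real k"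
proof -
  interpret S: prob_space "samples k" by (rule samples_prob)
  show ?thesis using N_mean[of k] by (simp add: S.prob_space)
qed

text \<open>Martingale increments are orthogonal, so their second moments add up. The increment at
  stage \<open>k\<close> contributes at most \<open>8 * N + 2 * \<kappa>\<^sup>2\<close>, whose mean
  is known from \<open>N_mean'\<close>.\<close>

lemma N_variance: "(\<integral>x. (N x k - \<mu> * real k)\<^sup>2 \<partial>samples k) \<le> 8 * \<mu> * (real k)\<^sup>2 + 2 * \<kappa>\<^sup>2 * real k"
proof (induction k)
  case 0
  then show ?case by (simp add: N_def)
next
  case (Suc k)
  interpret S: prob_space "samples k" by (rule samples_prob)
  have "(\<integral>x. (N x (Suc k) - \<mu> * real (Suc k))\<^sup>2 \<partial>samples (Suc k))
     = (\<integral>x. (\<integral>z. (N (x(Suc k := z)) (Suc k) - \<mu> * real (Suc k))\<^sup>2 \<partial>Q) \<partial>samples k)"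
    by (rule samples_integral_Suc) (simp del: of_nat_Suc)
  also have "\<dots> = (\<integral>x. (N x k - \<mu> * real k)\<^sup>2 + (\<integral>z. (step x k z)\<^sup>2 \<partial>Q) \<partial>samples k)"
  proof (intro Bochner_Integration.integral_cong refl)
    fix x assume x: "x \<in> space (samples k)"
    let ?D = "N x k - \<mu> * real k"
    have "(\<integral>z. (N (x(Suc k := z)) (Suc k) - \<mu> * real (Suc k))\<^sup>2 \<partial>Q) = (\<integral>z. (?D + step x k z)\<^sup>2 \<partial>Q)"
      by (intro Bochner_Integration.integral_cong refl arg_cong[where f="\<lambda>u. u\<^sup>2"] N_Suc_centred x)
    also have "\<dots> = ?D\<^sup>2 + 2 * ?D * (\<integral>z. step x k z \<partial>Q) + (\<integral>z. (step x k z)\<^sup>2 \<partial>Q)"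
      by (rule expectation_shift_square[OF step_facts(4,5)[OF x]])
    finally show "(\<integral>z. (N (x(Suc k := z)) (Suc k) - \<mu> * real (Suc k))\<^sup>2 \<partial>Q) = ?D\<^sup>2 + (\<integral>z. (step x k z)\<^sup>2 \<partial>Q)" 
      using step_facts(2)[OF x] by simp
  qed
  also have "\<dots> \<le> (\<integral>x. (N x k - \<mu> * real k)\<^sup>2 + (8 * N x k + 2 * \<kappa>\<^sup>2) \<partial>samples k)"
  proof (rule integral_mono_AE')
    show "AE x in samples k. (N x k - \<mu> * real k)\<^sup>2 + (\<integral>z. (step x k z)\<^sup>2 \<partial>Q) \<le> (N x k - \<mu> * real k)\<^sup>2 + (8 * N x k + 2 * \<kappa>\<^sup>2)"
      using step_facts(3) by (intro AE_I2) simp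
    show "AE x in samples k. 0 \<le> (N x k - \<mu> * real k)\<^sup>2 + (8 * N x k + 2 * \<kappa>\<^sup>2)"
      using N_nonneg by (intro AE_I2) simp
  qed simp
  also have "\<dots> = (\<integral>x. (N x k - \<mu> * real k)\<^sup>2 \<partial>samples k) + (8 * (\<mu> * real k) + 2 * \<kappa>\<^sup>2)"
    by (simp add: N_mean' S.prob_space)
  also have "\<dots> \<le> 8 * \<mu> * (real k)\<^sup>2 + 2 * \<kappa>\<^sup>2 * real k + (8 * (\<mu> * real k) + 2 * \<kappa>\<^sup>2)"
    using Suc by simp
  \<comment> \<open>The square grows by \<open>2 * k + 1\<close>, which leaves room for the
    increment \<open>8 * (\<mu> * k)\<close>.\<close>
  also have "\<dots> \<le> 8 * \<mu> * (real (Suc k))\<^sup>2 + 2 * \<kappa>\<^sup>2 * real (Suc k)"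
    using trace_nonneg by (simp add: power2_eq_square algebra_simps)
  finally show ?case .
qed

end

text \<open>
  The parameters \<open>b\<close>, \<open>c\<close>, \<open>r\<close> are weights for the arithmetic-geometric mean inequality: they replace
  the non-polynomial terms of the one-step error by polynomials of degree 2 in \<open>N\<close>, whose means are
  known.
\<close>

definition step_error :: "real \<Rightarrow> real \<Rightarrow> real \<Rightarrow> real \<Rightarrow> real \<Rightarrow> real \<Rightarrow> real \<Rightarrow> real" where
  "step_error \<mu> \<kappa> n \<tau> b c r =
     \<tau>\<^sup>2 / 2 * (2 * ((8 * \<mu> * n\<^sup>2 + 2 * \<kappa>\<^sup>2 * n) / b + b) + 2 * \<kappa> * (\<mu> * n / c + c) + \<kappa>\<^sup>2)
     + \<bar>\<tau>\<bar> ^ 3 / 6 * (8 / r * ((8 * \<mu> * n\<^sup>2 + 2 * \<kappa>\<^sup>2 * n) + (\<mu> * n)\<^sup>2)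
         + (2 * \<kappa>\<^sup>2 / r + 8 * \<kappa> * r + 8 * \<kappa>) * (\<mu> * n) + 2 * \<kappa> ^ 3 * (r + 1))
     + (2 * \<tau>\<^sup>2 * (\<mu> * n))\<^sup>2 / 2"

section \<open>Recursion for the characteristic function of the centred double sum\<close>

context reproducing_kernel begin

definition phi :: "real \<Rightarrow> nat \<Rightarrow> complex" where
  "phi \<tau> k = (\<integral>x. iexp (\<tau> * (N x k - \<mu> * real k)) \<partial>samples k)"

text \<open>Three applications of \<open>2 * u \<le> u\<^sup>2 / b + b\<close>, each with its own
  weight: \<open>b\<close> for the deviation of \<open>N\<close> from its mean, \<open>c\<close> for
  the square root of \<open>N\<close>, and \<open>r\<close> for the square root of
  \<open>N * \<kappa>\<close>.\<close>

lemma step_bound_le: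
  assumes x: "x \<in> space (samples k)" and pos: "0 < b" "0 < c" "0 < r"
  shows "\<tau>\<^sup>2 / 2 * (4 * \<bar>N x k - \<mu> * real k\<bar> + 4 * \<kappa> * sqrt (N x k) + \<kappa>\<^sup>2)
      + \<bar>\<tau>\<bar> ^ 3 / 6 * ((2 * sqrt (N x k * \<kappa>) + \<kappa>) * (8 * N x k + 2 * \<kappa>\<^sup>2)) + (2 * \<tau>\<^sup>2 * (\<mu> * real k))\<^sup>2 / 2
    \<le> \<tau>\<^sup>2 / 2 * (2 * ((N x k - \<mu> * real k)\<^sup>2 / b + b) + 2 * \<kappa> * (N x k / c + c) + \<kappa>\<^sup>2)
      + \<bar>\<tau>\<bar> ^ 3 / 6 * (8 / r * (N x k)\<^sup>2 + (2 * \<kappa>\<^sup>2 / r + 8 * \<kappa> * r + 8 * \<kappa>) * N x k + 2 * \<kappa> ^ 3 * (r + 1)) 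
      + (2 * \<tau>\<^sup>2 * (\<mu> * real k))\<^sup>2 / 2"
proof -
  have amgm: "2 * u \<le> u\<^sup>2 / b + b" if "0 < b" for u b :: real
  proof -
    have "0 \<le> (u - b)\<^sup>2 / b" using that by simp
    also have "\<dots> = u\<^sup>2 / b - 2 * u + b" using that by (simp add: field_simps power2_eq_square)
    finally show ?thesis by simp
  qed
  have N0: "0 \<le> N x k" by (rule N_nonneg[OF x])
  have 1: "4 * \<bar>N x k - \<mu> * real k\<bar> \<le> 2 * ((N x k - \<mu> * real k)\<^sup>2 / b + b)"
    using amgm[OF pos(1), of "\<bar>N x k - \<mu> * real k\<bar>"] by simp
  have 2: "4 * \<kappa> * sqrt (N x k) \<le> 2 * \<kappa> * (N x k / c + c)"
    using mult_left_mono[OF amgm[OF pos(2), of "sqrt (N x k)"], of "2 * \<kappa>"] bound_nonneg N0 by simp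
  have "2 * sqrt (N x k * \<kappa>) \<le> N x k / r + \<kappa> * r"
  proof -
    have "sqrt (N x k * \<kappa>) = sqrt ((N x k / r) * (\<kappa> * r))" using pos by simp
    also have "\<dots> \<le> (N x k / r + \<kappa> * r) / 2" using N0 bound_nonneg pos by (intro arith_geo_mean_sqrt) auto
    finally show ?thesis by simp
  qed
  then have "(2 * sqrt (N x k * \<kappa>) + \<kappa>) * (8 * N x k + 2 * \<kappa>\<^sup>2) \<le> (N x k / r + \<kappa> * r + \<kappa>) * (8 * N x k + 2 * \<kappa>\<^sup>2)"
    using N0 by (intro mult_right_mono) auto
  also have "\<dots> = 8 / r * (N x k)\<^sup>2 + (2 * \<kappa>\<^sup>2 / r + 8 * \<kappa> * r + 8 * \<kappa>) * N x k + 2 * \<kappa> ^ 3 * (r + 1)"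
    using pos by (simp add: field_simps power2_eq_square power3_eq_cube)
  finally have 3: "(2 * sqrt (N x k * \<kappa>) + \<kappa>) * (8 * N x k + 2 * \<kappa>\<^sup>2) \<le> \<dots>" .
  show ?thesis using 1 2 by (intro add_mono mult_left_mono 3) auto
qed

text \<open>Conditioning on the first \<open>k\<close> observations splits the exponential into its
  old value, of modulus 1, and the conditional characteristic function of the step. The latter is
  close to a constant, and the pointwise error is averaged by means of the first two moments of
  \<open>N\<close>. The error is expressed by \<open>n\<close> instead of \<open>k\<close>, so that
  one bound serves all steps.\<close>

lemma phi_Suc:
  assumes k: "k < n" and pos: "0 < b" "0 < c" "0 < r"
  shows "cmod (phi \<tau> (Suc k) - exp (- (2 * \<tau>\<^sup>2 * (\<mu> * real k))) * phi \<tau> k) \<le> step_error \<mu> \<kappa> (real n) \<tau> b c r"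
proof -
  interpret S: prob_space "samples k" by (rule samples_prob)
  interpret S': prob_space "samples (Suc k)" by (rule samples_prob)
  let ?D = "\<lambda>x. N x k - \<mu> * real k"
  let ?e = "exp (- (2 * \<tau>\<^sup>2 * (\<mu> * real k)))"
  let ?I = "\<lambda>x. \<integral>z. iexp (\<tau> * step x k z) \<partial>Q"
  let ?B = "\<lambda>x. \<tau>\<^sup>2 / 2 * (2 * ((?D x)\<^sup>2 / b + b) + 2 * \<kappa> * (N x k / c + c) + \<kappa>\<^sup>2)
      + \<bar>\<tau>\<bar> ^ 3 / 6 * (8 / r * (N x k)\<^sup>2 + (2 * \<kappa>\<^sup>2 / r + 8 * \<kappa> * r + 8 * \<kappa>) * N x k + 2 * \<kappa> ^ 3 * (r + 1)) 
      + (2 * \<tau>\<^sup>2 * (\<mu> * real k))\<^sup>2 / 2"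
  have i1: "complex_integrable (samples (Suc k)) (\<lambda>x. iexp (\<tau> * (N x (Suc k) - \<mu> * real (Suc k))))"
    by (intro S'.integrable_bounded[of _ 1]) auto
  have i0: "complex_integrable (samples k) (\<lambda>x. iexp (\<tau> * ?D x))"
    by (intro S.integrable_bounded[of _ 1]) auto
  have eq: "(\<integral>z. iexp (\<tau> * (N (x(Suc k := z)) (Suc k) - \<mu> * real (Suc k))) \<partial>Q) = iexp (\<tau> * ?D x) * ?I x"
    if x: "x \<in> space (samples k)" for x
  proof -
    have "(\<integral>z. iexp (\<tau> * (N (x(Suc k := z)) (Suc k) - \<mu> * real (Suc k))) \<partial>Q) = (\<integral>z. iexp (\<tau> * ?D x) * iexp (\<tau> * step x k z) \<partial>Q)"
    proof (intro Bochner_Integration.integral_cong refl)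
      fix z assume z: "z \<in> space Q"
      show "iexp (\<tau> * (N (x(Suc k := z)) (Suc k) - \<mu> * real (Suc k))) = iexp (\<tau> * ?D x) * iexp (\<tau> * step x k z)"
        unfolding N_Suc_centred[OF x z] exp_add[symmetric] by (simp only: of_real_add of_real_mult distrib_left)
    qed
    then show ?thesis by simp
  qed
  have phi1: "phi \<tau> (Suc k) = (\<integral>x. iexp (\<tau> * ?D x) * ?I x \<partial>samples k)"
    unfolding phi_def using samples_integral_Suc[OF i1] eq by (simp cong: Bochner_Integration.integral_cong)
  have i2: "complex_integrable (samples k) (\<lambda>x. iexp (\<tau> * ?D x) * ?I x)"
  proof -
    have [measurable]: "(\<lambda>x. iexp (\<tau> * ?D x) * ?I x) \<in> borel_measurable (samples k)"
    proof (intro borel_measurable_times)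
      show "?I \<in> borel_measurable (samples k)"
        unfolding L_def by measurable
    qed measurable
    have "cmod (?I x) \<le> 1" for x
      using integral_norm_bound[of Q "\<lambda>z. iexp (\<tau> * step x k z)"] by (simp add: prob_space)
    then show ?thesis by (intro S.integrable_bounded[of _ 1]) (simp_all only: norm_mult norm_exp_i_times mult_1_left, measurable)
  qed
  have iB: "integrable (samples k) ?B" by simp
  have le: "cmod (iexp (\<tau> * ?D x) * (?I x - ?e)) \<le> ?B x" if x: "x \<in> space (samples k)" for x
    using order_trans[OF step_facts(1)[OF x] step_bound_le[OF x pos]] by (simp only: norm_mult norm_exp_i_times mult_1_left)
  have "cmod (phi \<tau> (Suc k) - ?e * phi \<tau> k) = cmod (\<integral>x. iexp (\<tau> * ?D x) * ?I x - ?e * iexp (\<tau> * ?D x) \<partial>samples k)"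
    unfolding phi1 unfolding phi_def using i2 i0 by (subst Bochner_Integration.integral_diff) auto
  also have "\<dots> = cmod (\<integral>x. iexp (\<tau> * ?D x) * (?I x - ?e) \<partial>samples k)"
    by (simp add: algebra_simps)
  also have "\<dots> \<le> (\<integral>x. cmod (iexp (\<tau> * ?D x) * (?I x - ?e)) \<partial>samples k)"
    by (rule integral_norm_bound)
  also have "\<dots> \<le> (\<integral>x. ?B x \<partial>samples k)"
    by (rule integral_mono_AE'[OF iB]) (intro AE_I2 le order_trans[OF norm_ge_zero le], assumption)+
  also have "\<dots> = \<tau>\<^sup>2 / 2 * (2 * ((\<integral>x. (?D x)\<^sup>2 \<partial>samples k) / b + b) + 2 * \<kappa> * ((\<integral>x. N x k \<partial>samples k) / c + c) + \<kappa>\<^sup>2)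
      + \<bar>\<tau>\<bar> ^ 3 / 6 * (8 / r * (\<integral>x. (N x k)\<^sup>2 \<partial>samples k) + (2 * \<kappa>\<^sup>2 / r + 8 * \<kappa> * r + 8 * \<kappa>) * (\<integral>x. N x k \<partial>samples k) + 2 * \<kappa> ^ 3 * (r + 1)) 
      + (2 * \<tau>\<^sup>2 * (\<mu> * real k))\<^sup>2 / 2" 
    by (simp add: S.prob_space)
  also have "\<dots> \<le> step_error \<mu> \<kappa> (real n) \<tau> b c r"
  proof -
    have kn: "real k \<le> real n" using k by simp
    have m: "0 \<le> \<mu> * real k" "\<mu> * real k \<le> \<mu> * real n" using trace_nonneg kn by (auto intro: mult_left_mono)
    have "(real k)\<^sup>2 \<le> (real n)\<^sup>2" using kn by (intro power_mono) auto
    then have "8 * \<mu> * (real k)\<^sup>2 + 2 * \<kappa>\<^sup>2 * real k \<le> 8 * \<mu> * (real n)\<^sup>2 + 2 * \<kappa>\<^sup>2 * real n"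
      using trace_nonneg kn by (intro add_mono mult_left_mono) auto
    then have V: "(\<integral>x. (?D x)\<^sup>2 \<partial>samples k) \<le> 8 * \<mu> * (real n)\<^sup>2 + 2 * \<kappa>\<^sup>2 * real n"
      using N_variance[of k] by linarith
    have "(\<integral>x. (?D x)\<^sup>2 \<partial>samples k) = (\<integral>x. (N x k)\<^sup>2 \<partial>samples k) - (\<mu> * real k)\<^sup>2"
      using S.variance_eq[of "\<lambda>x. N x k"] by (simp add: N_mean')
    moreover have "(\<mu> * real k)\<^sup>2 \<le> (\<mu> * real n)\<^sup>2" using m by (intro power_mono) auto
    ultimately have S: "(\<integral>x. (N x k)\<^sup>2 \<partial>samples k) \<le> (8 * \<mu> * (real n)\<^sup>2 + 2 * \<kappa>\<^sup>2 * real n) + (\<mu> * real n)\<^sup>2"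
      using V by linarith
    have "(2 * \<tau>\<^sup>2 * (\<mu> * real k))\<^sup>2 \<le> (2 * \<tau>\<^sup>2 * (\<mu> * real n))\<^sup>2"
    proof (rule power_mono)
      show "2 * \<tau>\<^sup>2 * (\<mu> * real k) \<le> 2 * \<tau>\<^sup>2 * (\<mu> * real n)" by (rule mult_left_mono[OF m(2)]) simp
      show "0 \<le> 2 * \<tau>\<^sup>2 * (\<mu> * real k)" by (rule mult_nonneg_nonneg[OF _ m(1)]) simp
    qed
    then show ?thesis unfolding step_error_def N_mean' using pos bound_nonneg m V S trace_nonneg k
      by (intro add_mono mult_left_mono divide_right_mono order_refl) auto
  qed
  finally show ?thesis .
qed

text \<open>The factors multiply to the exponential of \<open>- 2 * \<tau>\<^sup>2 * \<mu>\<close>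
  times \<open>0 + 1 + \<dots> + (k - 1)\<close>. No factor exceeds 1, so earlier errors are not
  amplified and the errors simply add.\<close>

lemma phi_approx:
  assumes pos: "0 < b" "0 < c" "0 < r" and k: "k \<le> n"
  shows "cmod (phi \<tau> k - exp (- (\<tau>\<^sup>2 * \<mu> * (real k * (real k - 1))))) \<le> real k * step_error \<mu> \<kappa> (real n) \<tau> b c r"
  using k
proof (induction k)
  case 0
  interpret S: prob_space "samples 0" by (rule samples_prob)
  show ?case using S.prob_space by (simp add: phi_def N_def)
next
  case (Suc k)
  let ?e = "exp (- (2 * \<tau>\<^sup>2 * (\<mu> * real k)))" and ?g = "\<lambda>k. exp (- (\<tau>\<^sup>2 * \<mu> * (real k * (real k - 1))))"
  have g: "?g (Suc k) = ?e * ?g k" by (simp add: exp_add[symmetric] algebra_simps)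
  have e1: "?e \<le> 1" using trace_nonneg by simp
  have "phi \<tau> (Suc k) - ?g (Suc k) = (phi \<tau> (Suc k) - ?e * phi \<tau> k) + ?e * (phi \<tau> k - ?g k)"
    unfolding g by (simp add: algebra_simps)
  then have "cmod (phi \<tau> (Suc k) - ?g (Suc k)) \<le> cmod (phi \<tau> (Suc k) - ?e * phi \<tau> k) + ?e * cmod (phi \<tau> k - ?g k)"
    by (metis norm_triangle_ineq norm_mult norm_of_real abs_exp_cancel)
  also have "\<dots> \<le> step_error \<mu> \<kappa> (real n) \<tau> b c r + 1 * (real k * step_error \<mu> \<kappa> (real n) \<tau> b c r)"
    using Suc e1 by (intro add_mono mult_mono phi_Suc pos) auto
  finally show ?case by (simp add: algebra_simps)
qed

end

section \<open>Explicit rate for the normalised double sum\<close>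

text \<open>A common majorant for the coefficients of all error terms in
  \<open>step_error_le\<close>. It depends on \<open>C\<close> and \<open>t\<close> alone, so the
  limit in \<open>n\<close> is governed by the factor next to it.\<close>

definition char_constant :: "real \<Rightarrow> real \<Rightarrow> real" where
  "char_constant C t = t\<^sup>2 * (5 + C + 2 * C\<^sup>2) + \<bar>t\<bar> ^ 3 * (72 + 16 * C + 18 * C\<^sup>2 + 4 * C ^ 3) + t ^ 4"

text \<open>Exponent count for the cubic term: one power of \<open>s\<close> survives in the
  numerator and one power of \<open>\<rho>\<close> in the denominator.\<close>

lemma power_cancellation:
  fixes s \<rho> H a :: real assumes p: "s \<noteq> 0" "\<rho> \<noteq> 0"
  shows "\<rho>\<^sup>2 * (a / (\<rho>^6 * s^3) * (H * (s^4 * \<rho>^3))) = a * H * (s / \<rho>)"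
proof -
  have 1: "\<rho>^6 = \<rho>\<^sup>2 * \<rho>^3 * \<rho>" "s^4 = s^3 * s" by (simp_all add: eval_nat_numeral One_nat_def)
  have 2: "x * (a / (x * y * \<rho> * z) * (H * ((z * s) * y))) = a * H * (s / \<rho>)" if "x \<noteq> 0" "y \<noteq> 0" "z \<noteq> 0" for x y z
    using that p by (simp only: times_divide_eq_left times_divide_eq_right) (simp add: ac_simps)
  show ?thesis unfolding 1 by (rule 2) (use p in simp_all)
qed

text \<open>Here \<open>s\<close> and \<open>\<rho>\<close> are the square roots of the trace and of
  the sample size, which keeps all exponents integral. The weights balance the two summands of each
  mean inequality at the typical sizes: \<open>N\<close> has standard deviation of order
  \<open>s * \<rho>\<^sup>2\<close>, its square root has order \<open>s * \<rho>\<close>, and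
  \<open>\<rho>\<close> is the order of sqrt (\<open>N\<close> / \<open>\<kappa>\<close>).\<close>

lemma step_error_le:
  fixes s \<rho> C t :: real
  assumes s: "1 \<le> s" "s \<le> \<rho>" and C: "0 \<le> C"
  defines "\<tau> \<equiv> t / (\<rho>\<^sup>2 * (sqrt 2 * s))"
  shows "\<rho>\<^sup>2 * step_error (s\<^sup>2) (C * s\<^sup>2) (\<rho>\<^sup>2) \<tau> (s * \<rho>\<^sup>2) (s * \<rho>) \<rho> \<le> char_constant C t * (1 / s + s / \<rho>)"
proof -
  have p: "0 < s" "0 < \<rho>" "1 \<le> \<rho>" "s\<^sup>2 \<le> \<rho>\<^sup>2" "s \<noteq> 0" "\<rho> \<noteq> 0" using s by (auto intro: power_mono)
  have t2: "\<tau>\<^sup>2 = t\<^sup>2 / (2 * \<rho>^4 * s\<^sup>2)" by (simp add: \<tau>_def power_divide power_mult_distrib)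
  have t3: "\<bar>\<tau>\<bar>^3 \<le> \<bar>t\<bar>^3 / (\<rho>^6 * s^3)"
  proof -
    have "\<bar>\<tau>\<bar> \<le> \<bar>t\<bar> / (\<rho>\<^sup>2 * s)"
    proof -
      have "1 * s \<le> sqrt 2 * s" using p by (intro mult_right_mono) auto
      then have "\<rho>\<^sup>2 * s \<le> \<rho>\<^sup>2 * (sqrt 2 * s)" using p by (intro mult_left_mono) auto
      then have "\<bar>t\<bar> / (\<rho>\<^sup>2 * (sqrt 2 * s)) \<le> \<bar>t\<bar> / (\<rho>\<^sup>2 * s)" using p by (intro divide_left_mono) auto
      then show ?thesis using p by (simp add: \<tau>_def abs_mult)
    qed
    then have "\<bar>\<tau>\<bar>^3 \<le> (\<bar>t\<bar> / (\<rho>\<^sup>2 * s))^3" by (intro power_mono) auto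
    also have "\<dots> = \<bar>t\<bar>^3 / (\<rho>^6 * s^3)" by (simp add: power_divide power_mult_distrib)
    finally show ?thesis .
  qed
  define V where "V = 8 * s\<^sup>2 * (\<rho>\<^sup>2)\<^sup>2 + 2 * (C * s\<^sup>2)\<^sup>2 * \<rho>\<^sup>2"
  have V: "V \<le> (8 + 2 * C\<^sup>2) * (s\<^sup>2 * \<rho>^4)"
  proof -
    have "(2 * C\<^sup>2 * s\<^sup>2 * \<rho>\<^sup>2) * s\<^sup>2 \<le> (2 * C\<^sup>2 * s\<^sup>2 * \<rho>\<^sup>2) * \<rho>\<^sup>2" using p by (intro mult_left_mono) auto
    then show ?thesis by (simp add: V_def power_mult_distrib algebra_simps power4_eq_xxxx power2_eq_square)
  qed
  have T1: "\<rho>\<^sup>2 * (\<tau>\<^sup>2 / 2 * (2 * (V / (s * \<rho>\<^sup>2) + s * \<rho>\<^sup>2) + 2 * (C * s\<^sup>2) * (s\<^sup>2 * \<rho>\<^sup>2 / (s * \<rho>) + s * \<rho>) + (C * s\<^sup>2)\<^sup>2))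
     \<le> t\<^sup>2 * (5 + C\<^sup>2) * (1 / s) + t\<^sup>2 * (C + C\<^sup>2) * (s / \<rho>)"
  proof -
    have "V / (s * \<rho>\<^sup>2) \<le> (8 + 2 * C\<^sup>2) * (s\<^sup>2 * \<rho>^4) / (s * \<rho>\<^sup>2)" using V p by (intro divide_right_mono) auto
    also have "\<dots> = (8 + 2 * C\<^sup>2) * (s * \<rho>\<^sup>2)" using p by (simp add: power2_eq_square power4_eq_xxxx)
    finally have v: "V / (s * \<rho>\<^sup>2) \<le> (8 + 2 * C\<^sup>2) * (s * \<rho>\<^sup>2)" .
    have "\<rho>\<^sup>2 * (\<tau>\<^sup>2 / 2 * (2 * (V / (s * \<rho>\<^sup>2) + s * \<rho>\<^sup>2) + 2 * (C * s\<^sup>2) * (s\<^sup>2 * \<rho>\<^sup>2 / (s * \<rho>) + s * \<rho>) + (C * s\<^sup>2)\<^sup>2))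
      \<le> \<rho>\<^sup>2 * (\<tau>\<^sup>2 / 2 * (2 * ((8 + 2 * C\<^sup>2) * (s * \<rho>\<^sup>2) + s * \<rho>\<^sup>2) + 2 * (C * s\<^sup>2) * (s\<^sup>2 * \<rho>\<^sup>2 / (s * \<rho>) + s * \<rho>) + (C * s\<^sup>2)\<^sup>2))"
      using v by (intro mult_left_mono add_mono order_refl) auto
    also have "\<dots> = t\<^sup>2 * ((18 + 4 * C\<^sup>2) / 4) * (1 / s) + t\<^sup>2 * C * (s / \<rho>) + t\<^sup>2 * (C\<^sup>2 / 4) * ((s / \<rho>) * (s / \<rho>))"
    proof -
      have 1: "\<rho>\<^sup>2 * (\<tau>\<^sup>2 / 2 * X) = t\<^sup>2 / 4 * (X / (\<rho>\<^sup>2 * s\<^sup>2))" for X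
        unfolding t2 using p by (simp add: power4_eq_xxxx power2_eq_square)
      have 2: "s\<^sup>2 * \<rho>\<^sup>2 / (s * \<rho>) = s * \<rho>" using p by (simp add: power2_eq_square)
      have 3: "(2 * ((8 + 2 * C\<^sup>2) * (s * \<rho>\<^sup>2) + s * \<rho>\<^sup>2)) / (\<rho>\<^sup>2 * s\<^sup>2) = (18 + 4 * C\<^sup>2) * (1 / s)"
        "2 * (C * s\<^sup>2) * (s * \<rho> + s * \<rho>) / (\<rho>\<^sup>2 * s\<^sup>2) = 4 * C * (s / \<rho>)"
        "(C * s\<^sup>2)\<^sup>2 / (\<rho>\<^sup>2 * s\<^sup>2) = C\<^sup>2 * ((s / \<rho>) * (s / \<rho>))"
        using p by (simp_all add: power2_eq_square field_simps)
      show ?thesis unfolding 1 2 add_divide_distrib 3 by (simp add: algebra_simps)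
    qed
    also have "\<dots> \<le> t\<^sup>2 * (5 + C\<^sup>2) * (1 / s) + t\<^sup>2 * C * (s / \<rho>) + t\<^sup>2 * C\<^sup>2 * ((s / \<rho>) * 1)"
      using p s by (intro add_mono mult_mono order_refl) auto
    finally show ?thesis by (simp add: algebra_simps)
  qed
  have T2: "\<rho>\<^sup>2 * (\<bar>\<tau>\<bar> ^ 3 / 6 * (8 / \<rho> * (V + (s\<^sup>2 * \<rho>\<^sup>2)\<^sup>2)
         + (2 * (C * s\<^sup>2)\<^sup>2 / \<rho> + 8 * (C * s\<^sup>2) * \<rho> + 8 * (C * s\<^sup>2)) * (s\<^sup>2 * \<rho>\<^sup>2) + 2 * (C * s\<^sup>2) ^ 3 * (\<rho> + 1)))
     \<le> \<bar>t\<bar> ^ 3 * (72 + 16 * C + 18 * C\<^sup>2 + 4 * C ^ 3) * (s / \<rho>)" (is "_ * (_ * ?X) \<le> _")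
  proof -
    have s4: "1 \<le> s\<^sup>2" using s by simp
    have a: "8 / \<rho> * (V + (s\<^sup>2 * \<rho>\<^sup>2)\<^sup>2) \<le> (72 + 16 * C\<^sup>2) * (s^4 * \<rho>^3)"
    proof -
      have "(8 + 2 * C\<^sup>2) * (s\<^sup>2 * \<rho>^4) * 1 \<le> (8 + 2 * C\<^sup>2) * (s\<^sup>2 * \<rho>^4) * s\<^sup>2"
        using s4 by (intro mult_left_mono) auto
      then have "V + (s\<^sup>2 * \<rho>\<^sup>2)\<^sup>2 \<le> (9 + 2 * C\<^sup>2) * (s^4 * \<rho>^4)"
        using V by (simp add: algebra_simps power2_eq_square power4_eq_xxxx)
      then have "8 / \<rho> * (V + (s\<^sup>2 * \<rho>\<^sup>2)\<^sup>2) \<le> 8 / \<rho> * ((9 + 2 * C\<^sup>2) * (s^4 * \<rho>^4))" using p by (intro mult_left_mono) auto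
      also have "\<dots> = (72 + 16 * C\<^sup>2) * (s^4 * \<rho>^3)" using p by (simp add: field_simps power4_eq_xxxx power3_eq_cube)
      finally show ?thesis .
    qed
    have b: "(2 * (C * s\<^sup>2)\<^sup>2 / \<rho> + 8 * (C * s\<^sup>2) * \<rho> + 8 * (C * s\<^sup>2)) * (s\<^sup>2 * \<rho>\<^sup>2) \<le> (2 * C\<^sup>2 + 16 * C) * (s^4 * \<rho>^3)"
    proof -
      have "2 * (C * s\<^sup>2)\<^sup>2 / \<rho> \<le> 2 * C\<^sup>2 * s\<^sup>2 * \<rho>"
      proof -
        have "2 * (C * s\<^sup>2)\<^sup>2 / \<rho> = (2 * C\<^sup>2 * s\<^sup>2) * (s\<^sup>2 / \<rho>)" by (simp add: power_mult_distrib power2_eq_square)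
        also have "\<dots> \<le> (2 * C\<^sup>2 * s\<^sup>2) * (\<rho>\<^sup>2 / \<rho>)" using p by (intro mult_left_mono divide_right_mono) auto
        finally show ?thesis using p by (simp add: power2_eq_square)
      qed
      moreover have "8 * (C * s\<^sup>2) * 1 \<le> 8 * (C * s\<^sup>2) * \<rho>" using p C by (intro mult_left_mono) auto
      ultimately have "2 * (C * s\<^sup>2)\<^sup>2 / \<rho> + 8 * (C * s\<^sup>2) * \<rho> + 8 * (C * s\<^sup>2) \<le> (2 * C\<^sup>2 + 16 * C) * (s\<^sup>2 * \<rho>)"
        by (simp add: algebra_simps)
      then have "(2 * (C * s\<^sup>2)\<^sup>2 / \<rho> + 8 * (C * s\<^sup>2) * \<rho> + 8 * (C * s\<^sup>2)) * (s\<^sup>2 * \<rho>\<^sup>2) \<le> (2 * C\<^sup>2 + 16 * C) * (s\<^sup>2 * \<rho>) * (s\<^sup>2 * \<rho>\<^sup>2)"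
        by (rule mult_right_mono) auto
      then show ?thesis by (simp add: power2_eq_square power4_eq_xxxx power3_eq_cube algebra_simps)
    qed
    have c: "2 * (C * s\<^sup>2) ^ 3 * (\<rho> + 1) \<le> 4 * C^3 * (s^4 * \<rho>^3)"
    proof -
      have "2 * (C * s\<^sup>2) ^ 3 * (\<rho> + 1) \<le> 2 * (C * s\<^sup>2) ^ 3 * (2 * \<rho>)" using p C by (intro mult_left_mono) auto
      also have "\<dots> = 4 * C^3 * s^4 * \<rho> * s\<^sup>2" by (simp add: power_mult_distrib power2_eq_square power4_eq_xxxx power3_eq_cube)
      also have "\<dots> \<le> 4 * C^3 * s^4 * \<rho> * \<rho>\<^sup>2" using p C by (intro mult_left_mono) auto
      finally show ?thesis by (simp add: power2_eq_square power3_eq_cube algebra_simps)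
    qed
    define H where "H = 72 + 16 * C + 18 * C\<^sup>2 + 4 * C ^ 3"
    have H0: "0 \<le> H" using C by (simp add: H_def)
    have X: "?X \<le> H * (s^4 * \<rho>^3)" using a b c by (simp add: H_def algebra_simps)
    have "\<bar>\<tau>\<bar> ^ 3 / 6 * ?X \<le> \<bar>\<tau>\<bar> ^ 3 / 6 * (H * (s^4 * \<rho>^3))" using X by (intro mult_left_mono) auto
    also have "\<dots> \<le> \<bar>t\<bar>^3 / (\<rho>^6 * s^3) * (H * (s^4 * \<rho>^3))"
    proof (rule mult_right_mono)
      show "\<bar>\<tau>\<bar> ^ 3 / 6 \<le> \<bar>t\<bar>^3 / (\<rho>^6 * s^3)" 
      proof -
        have "a / 6 \<le> y" if "a \<le> y" "0 \<le> a" for a y :: real using that by simp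
        from this[OF t3] show ?thesis by simp
      qed
    qed (use H0 p in auto)
    finally have "\<rho>\<^sup>2 * (\<bar>\<tau>\<bar> ^ 3 / 6 * ?X) \<le> \<rho>\<^sup>2 * (\<bar>t\<bar>^3 / (\<rho>^6 * s^3) * (H * (s^4 * \<rho>^3)))" by (rule mult_left_mono[OF _ zero_le_power2])
    also have "\<dots> = \<bar>t\<bar>^3 * H * (s / \<rho>)"
      by (rule power_cancellation) (use p in auto)
    finally show ?thesis unfolding H_def .
  qed
  have T3: "\<rho>\<^sup>2 * ((2 * \<tau>\<^sup>2 * (s\<^sup>2 * \<rho>\<^sup>2))\<^sup>2 / 2) \<le> t^4 * (s / \<rho>)"
  proof -
    have "\<rho>\<^sup>2 * ((2 * \<tau>\<^sup>2 * (s\<^sup>2 * \<rho>\<^sup>2))\<^sup>2 / 2) = t^4 / 2 * (1 / \<rho> * (1 / \<rho>))"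
    proof -
      have "2 * \<tau>\<^sup>2 * (s\<^sup>2 * \<rho>\<^sup>2) = t\<^sup>2 / \<rho>\<^sup>2"
        unfolding t2 using p by (simp add: power4_eq_xxxx power2_eq_square)
      then show ?thesis using p by (simp add: power_divide power4_eq_xxxx power2_eq_square)
    qed
    also have "\<dots> \<le> t^4 * (s / \<rho> * 1)" using p s by (intro mult_mono divide_right_mono) auto
    finally show ?thesis by simp
  qed
  have "\<rho>\<^sup>2 * step_error (s\<^sup>2) (C * s\<^sup>2) (\<rho>\<^sup>2) \<tau> (s * \<rho>\<^sup>2) (s * \<rho>) \<rho>
    \<le> (t\<^sup>2 * (5 + C\<^sup>2) * (1 / s) + t\<^sup>2 * (C + C\<^sup>2) * (s / \<rho>)) + \<bar>t\<bar> ^ 3 * (72 + 16 * C + 18 * C\<^sup>2 + 4 * C ^ 3) * (s / \<rho>) + t^4 * (s / \<rho>)"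
    unfolding step_error_def V_def[symmetric] distrib_left[of "\<rho>\<^sup>2"] by (intro add_mono T1 T2 T3)
  also have "\<dots> \<le> char_constant C t * (1 / s) + char_constant C t * (s / \<rho>)"
  proof -
    have "t\<^sup>2 * (5 + C\<^sup>2) * (1 / s) \<le> char_constant C t * (1 / s)"
      using p C by (intro mult_right_mono) (auto simp: char_constant_def algebra_simps)
    moreover have "(t\<^sup>2 * (C + C\<^sup>2) + \<bar>t\<bar> ^ 3 * (72 + 16 * C + 18 * C\<^sup>2 + 4 * C ^ 3) + t^4) * (s / \<rho>) \<le> char_constant C t * (s / \<rho>)"
      using p C by (intro mult_right_mono) (auto simp: char_constant_def algebra_simps)
    ultimately show ?thesis by (simp add: algebra_simps)
  qed
  finally show ?thesis by (simp add: algebra_simps)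
qed

text \<open>With this normalisation \<open>\<tau>\<^sup>2 * \<mu> * n * (n - 1)\<close> equals
  \<open>t\<^sup>2 / 2 * (1 - 1 / n)\<close>, so the product of the factors is the Gaussian
  characteristic function up to the term \<open>1 / n\<close>.\<close>

lemma (in reproducing_kernel) phi_error:
  assumes k: "\<kappa> = C * \<mu>" and C: "0 \<le> C" and mu: "1 \<le> \<mu>" "\<mu> \<le> real n"
  shows "cmod (phi (t / (real n * sqrt (2 * \<mu>))) n - exp (- (t\<^sup>2 / 2 * (1 - 1 / real n))))
    \<le> char_constant C t * (1 / sqrt \<mu> + sqrt \<mu> / sqrt (real n))"
proof -
  let ?s = "sqrt \<mu>" and ?r = "sqrt (real n)"
  have p: "1 \<le> ?s" "?s \<le> ?r" "?s\<^sup>2 = \<mu>" "?r\<^sup>2 = real n" "0 < ?s" "0 < ?r" using mu by auto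
  let ?\<tau> = "t / (?r\<^sup>2 * (sqrt 2 * ?s))"
  have tau: "?\<tau> = t / (real n * sqrt (2 * \<mu>))" using mu by (simp add: real_sqrt_mult)
  have "cmod (phi ?\<tau> n - exp (- (?\<tau>\<^sup>2 * \<mu> * (real n * (real n - 1))))) 
     \<le> real n * step_error \<mu> \<kappa> (real n) ?\<tau> (?s * ?r\<^sup>2) (?s * ?r) ?r"
    by (rule phi_approx) (use p mu in auto)
  also have "\<dots> = ?r\<^sup>2 * step_error (?s\<^sup>2) (C * ?s\<^sup>2) (?r\<^sup>2) ?\<tau> (?s * ?r\<^sup>2) (?s * ?r) ?r" using p k by simp
  also have "\<dots> \<le> char_constant C t * (1 / ?s + ?s / ?r)" by (rule step_error_le[OF p(1,2) C])
  also have "?\<tau>\<^sup>2 * \<mu> * (real n * (real n - 1)) = t\<^sup>2 / 2 * (1 - 1 / real n)"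
    using p mu by (simp add: power_divide power_mult_distrib) (simp add: field_simps power2_eq_square)
  finally show ?thesis unfolding tau .
qed

section \<open>Triangular arrays and convergence in distribution\<close>

text \<open>Carries computations on the product space over to the sample spaces, which may change
  with the sample size.\<close>

lemma (in prob_space) iid_distr_PiM:
  fixes n :: nat
  assumes n: "n \<ge> 1" and ind: "indep_vars (\<lambda>_. Q) Z {1..n}" and d: "\<And>j. j \<in> {1..n} \<Longrightarrow> distr M Q (Z j) = Q"
  shows "distr M (Pi\<^sub>M {1..n} (\<lambda>_. Q)) (\<lambda>x. \<lambda>i\<in>{1..n}. Z i x) = Pi\<^sub>M {1..n} (\<lambda>_. Q)"
proof -
  have "{1..n} \<noteq> {}" using n by auto
  moreover have "random_variable Q (Z i)" if "i \<in> {1..n}" for i using ind that by (auto simp: indep_vars_def)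
  ultimately have "distr M (Pi\<^sub>M {1..n} (\<lambda>_. Q)) (\<lambda>x. \<lambda>i\<in>{1..n}. Z i x) = (\<Pi>\<^sub>M i\<in>{1..n}. distr M Q (Z i))"
    using indep_vars_iff_distr_eq_PiM'[where I="{1..n}" and M'="\<lambda>_. Q" and X=Z] ind by simp
  also have "\<dots> = Pi\<^sub>M {1..n} (\<lambda>_. Q)" by (intro PiM_cong d) auto
  finally show ?thesis .
qed

lemma isCont_std_normal_cdf: "isCont (cdf std_normal_distribution) x"
proof -
  interpret real_distribution std_normal_distribution by (rule real_dist_normal_dist)
  have "measure std_normal_distribution {x} = 0"
    unfolding measure_def by (subst emeasure_density) (auto simp: nn_integral_indicator_singleton')
  then show ?thesis using isCont_cdf by simp
qed

text \<open>Monotonicity encloses the value at the moving point between the values at two fixed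
  points on either side of \<open>x\<close>. The moving point later absorbs the shift by
  \<open>q\<close> and the change of scale.\<close>

lemma weak_conv_moving_point:
  fixes F :: "nat \<Rightarrow> real \<Rightarrow> real"
  assumes lim: "\<And>x. (\<lambda>n. F n x) \<longlonglongrightarrow> G x" and mono: "\<And>n. mono (F n)" and G: "isCont G x" and x: "u \<longlonglongrightarrow> x"
  shows "(\<lambda>n. F n (u n)) \<longlonglongrightarrow> G x"
proof (rule tendstoI)
  fix e :: real assume e: "0 < e"
  obtain d where d: "0 < d" "\<And>y. \<bar>y - x\<bar> < d \<Longrightarrow> \<bar>G y - G x\<bar> < e / 2"
    using G[unfolded continuous_at_eps_delta, rule_format, of "e / 2"] e by (auto simp: dist_real_def)
  have g: "\<bar>G (x + d / 2) - G x\<bar> < e / 2" "\<bar>G (x - d / 2) - G x\<bar> < e / 2" using d by auto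
  have e1: "\<forall>\<^sub>F n in sequentially. dist (F n (x + d / 2)) (G (x + d / 2)) < e / 2"
    and e2: "\<forall>\<^sub>F n in sequentially. dist (F n (x - d / 2)) (G (x - d / 2)) < e / 2"
    using tendstoD[OF lim, of "e / 2"] e by simp_all
  have "\<forall>\<^sub>F n in sequentially. dist (u n) x < d / 2" using x d by (intro tendstoD) auto
  with e1 e2 show "\<forall>\<^sub>F n in sequentially. dist (F n (u n)) (G x) < e"
  proof eventually_elim
    case (elim n)
    have "u n - x < d / 2" "x - u n < d / 2" using elim(3) unfolding dist_real_def abs_less_iff by simp_all
    then have "F n (x - d / 2) \<le> F n (u n)" "F n (u n) \<le> F n (x + d / 2)"
      by (auto intro!: monoD[OF mono])
    with elim(1,2) g show ?case unfolding dist_real_def by linarith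
  qed
qed

locale kernel_array =
  fixes Q :: "'z measure" and M :: "nat \<Rightarrow> 'w measure" and Z :: "nat \<Rightarrow> nat \<Rightarrow> 'w \<Rightarrow> 'z"
    and K :: "nat \<Rightarrow> 'z \<Rightarrow> 'z \<Rightarrow> real" and m :: "nat \<Rightarrow> real" and C :: real
  assumes prob_M: "\<And>n. n \<ge> 1 \<Longrightarrow> prob_space (M n)"
    and indep: "\<And>n. n \<ge> 1 \<Longrightarrow> prob_space.indep_vars (M n) (\<lambda>_. Q) (Z n) {1..n}"
    and distr: "\<And>n j. n \<ge> 1 \<Longrightarrow> j \<in> {1..n} \<Longrightarrow> distr (M n) Q (Z n j) = Q"
    and kernel: "\<And>n. n \<ge> 1 \<Longrightarrow> reproducing_kernel Q (K n) (C * m n) (m n)"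
    and m_ge_1: "\<And>n. n \<ge> 1 \<Longrightarrow> 1 \<le> m n"
    and C_nonneg: "0 \<le> C"
    and m_infinity: "filterlim m at_top sequentially"
    and m_small: "(\<lambda>n. m n / real n) \<longlonglongrightarrow> 0"
begin

definition T :: "nat \<Rightarrow> 'w \<Rightarrow> real" where
  "T n \<omega> = (\<Sum>i=1..n. \<Sum>j=1..n. K n (Z n i \<omega>) (Z n j \<omega>)) / real n"

definition V :: "nat \<Rightarrow> 'w \<Rightarrow> real" where
  "V n \<omega> = (T n \<omega> - m n) / sqrt (2 * m n)"

lemma Z_measurable: assumes "n \<ge> 1" "j \<in> {1..n}" shows "Z n j \<in> measurable (M n) Q"
proof -
  interpret prob_space "M n" using assms by (intro prob_M)
  show ?thesis using indep[OF assms(1)] assms(2) by (auto simp: indep_vars_def)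
qed

lemma T_measurable: assumes n: "n \<ge> 1" shows "T n \<in> borel_measurable (M n)"
proof -
  interpret K: reproducing_kernel Q "K n" "C * m n" "m n" by (rule kernel[OF n])
  note [measurable] = Z_measurable[OF n]
  show ?thesis unfolding T_def by measurable
qed

lemma V_measurable: assumes n: "n \<ge> 1" shows "V n \<in> borel_measurable (M n)"
  using T_measurable[OF n] unfolding V_def by measurable

text \<open>The double sum is \<open>n * T\<close>, so \<open>T - m\<close> is the centred double
  sum divided by \<open>n\<close>, and \<open>t * V\<close> is \<open>?\<tau>\<close> times the
  centred double sum.\<close>

lemma char_V:
  assumes n: "n \<ge> 1"
  shows "(\<integral>\<omega>. iexp (t * V n \<omega>) \<partial>M n) = reproducing_kernel.phi Q (K n) (m n) (t / (real n * sqrt (2 * m n))) n"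
proof -
  interpret K: reproducing_kernel Q "K n" "C * m n" "m n" by (rule kernel[OF n])
  interpret prob_space "M n" using n by (intro prob_M)
  let ?\<tau> = "t / (real n * sqrt (2 * m n))"
  let ?Z = "\<lambda>\<omega>. \<lambda>i\<in>{1..n}. Z n i \<omega>"
  have d: "distr (M n) (Pi\<^sub>M {1..n} (\<lambda>_. Q)) ?Z = Pi\<^sub>M {1..n} (\<lambda>_. Q)"
    by (rule iid_distr_PiM[OF n indep[OF n] distr[OF n]])
  have Zm: "?Z \<in> measurable (M n) (Pi\<^sub>M {1..n} (\<lambda>_. Q))"
    by (intro measurable_restrict Z_measurable n)
  have "K.phi ?\<tau> n = (\<integral>x. iexp (?\<tau> * (K.N x n - m n * real n)) \<partial>distr (M n) (Pi\<^sub>M {1..n} (\<lambda>_. Q)) ?Z)"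
    unfolding K.phi_def d ..
  also have "\<dots> = (\<integral>\<omega>. iexp (?\<tau> * (K.N (?Z \<omega>) n - m n * real n)) \<partial>M n)"
    by (rule integral_distr[OF Zm]) measurable
  also have "\<dots> = (\<integral>\<omega>. iexp (t * V n \<omega>) \<partial>M n)"
  proof (intro Bochner_Integration.integral_cong refl)
    fix \<omega>
    have N: "K.N (?Z \<omega>) n = real n * T n \<omega>" using n by (simp add: K.N_def T_def)
    have "?\<tau> * (K.N (?Z \<omega>) n - m n * real n) = t * V n \<omega>"
      unfolding N V_def using n m_ge_1[OF n] by (simp add: field_simps)
    then show "iexp (?\<tau> * (K.N (?Z \<omega>) n - m n * real n)) = iexp (t * V n \<omega>)" by simp
  qed
  finally show ?thesis ..
qed

lemma char_V_limit: "(\<lambda>n. (\<integral>\<omega>. iexp (t * V n \<omega>) \<partial>M n)) \<longlonglongrightarrow> exp (- (t\<^sup>2 / 2))"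
proof -
  let ?f = "\<lambda>n. (\<integral>\<omega>. iexp (t * V n \<omega>) \<partial>M n)" and ?g = "\<lambda>n. complex_of_real (exp (- (t\<^sup>2 / 2 * (1 - 1 / real n))))"
  \<comment> \<open>Provides the requirement that the trace be at most \<open>n\<close> in
    \<open>phi_error\<close>.\<close>
  have "\<forall>\<^sub>F n in sequentially. m n / real n < 1" by (intro order_tendstoD[OF m_small]) auto
  then have ev: "\<forall>\<^sub>F n in sequentially. norm (?f n - ?g n) \<le> char_constant C t * (1 / sqrt (m n) + sqrt (m n / real n))"
    using eventually_ge_at_top[of 1]
  proof eventually_elim
    case (elim n)
    interpret K: reproducing_kernel Q "K n" "C * m n" "m n" by (rule kernel[OF elim(2)])
    show ?case unfolding char_V[OF elim(2)] real_sqrt_divide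
      by (rule K.phi_error) (use elim m_ge_1 C_nonneg in \<open>auto simp: field_simps\<close>)
  qed
  have "(\<lambda>n. 1 / sqrt (m n)) \<longlonglongrightarrow> 0"
    using m_infinity by (intro tendsto_divide_0[OF tendsto_const] filterlim_at_top_imp_at_infinity filterlim_compose[OF sqrt_at_top])
  moreover have "(\<lambda>n. sqrt (m n / real n)) \<longlonglongrightarrow> 0" using tendsto_real_sqrt[OF m_small] by simp
  ultimately have "(\<lambda>n. char_constant C t * (1 / sqrt (m n) + sqrt (m n / real n))) \<longlonglongrightarrow> char_constant C t * (0 + 0)"
    by (intro tendsto_intros)
  then have "(\<lambda>n. char_constant C t * (1 / sqrt (m n) + sqrt (m n / real n))) \<longlonglongrightarrow> 0" by simp
  from Lim_null_comparison[OF ev this] have "(\<lambda>n. ?f n - ?g n) \<longlonglongrightarrow> 0" .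
  moreover have "?g \<longlonglongrightarrow> complex_of_real (exp (- (t\<^sup>2 / 2 * (1 - 0))))"
    by (intro tendsto_intros lim_1_over_n)
  ultimately have "(\<lambda>n. (?f n - ?g n) + ?g n) \<longlonglongrightarrow> 0 + complex_of_real (exp (- (t\<^sup>2 / 2 * (1 - 0))))"
    by (rule tendsto_add)
  then show ?thesis by simp
qed

lemma V_cdf_limit: "(\<lambda>n. measure (M n) {\<omega>\<in>space (M n). V n \<omega> \<le> x}) \<longlonglongrightarrow> cdf std_normal_distribution x"
proof -
  \<comment> \<open>The assumptions start at \<open>n = 1\<close>, whereas Levy's theorem wants a
    distribution at every index; the value at 0 is a filler.\<close>
  define D where "D n = (if n \<ge> 1 then distr (M n) borel (V n) else std_normal_distribution)" for n
  interpret N: real_distribution std_normal_distribution by (rule real_dist_normal_dist)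
  have D: "real_distribution (D n)" for n
  proof (cases "n \<ge> 1")
    case True
    interpret prob_space "M n" using True by (rule prob_M)
    show ?thesis using True V_measurable[OF True] by (simp add: D_def real_distribution_distr)
  qed (simp add: D_def N.real_distribution_axioms)
  have "(\<lambda>n. char (D n) t) \<longlonglongrightarrow> char std_normal_distribution t" for t
  proof -
    have "\<forall>\<^sub>F n in sequentially. (\<integral>\<omega>. iexp (t * V n \<omega>) \<partial>M n) = char (D n) t"
      using eventually_ge_at_top[of 1]
    proof eventually_elim
      case (elim n)
      then show ?case using V_measurable[OF elim] by (simp add: D_def char_def integral_distr)
    qed
    then have "(\<lambda>n. char (D n) t) \<longlonglongrightarrow> complex_of_real (exp (- (t\<^sup>2 / 2)))"
      using char_V_limit by (rule Lim_transform_eventually[rotated])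
    then show ?thesis by (simp add: char_std_normal_distribution)
  qed
  then have "weak_conv_m D std_normal_distribution"
    by (intro levy_continuity D N.real_distribution_axioms)
  then have "(\<lambda>n. cdf (D n) x) \<longlonglongrightarrow> cdf std_normal_distribution x"
    using isCont_std_normal_cdf by (simp add: weak_conv_m_def weak_conv_def)
  moreover have "\<forall>\<^sub>F n in sequentially. cdf (D n) x = measure (M n) {\<omega>\<in>space (M n). V n \<omega> \<le> x}"
    using eventually_ge_at_top[of 1]
  proof eventually_elim
    case (elim n)
    then show ?case using V_measurable[OF elim]
      by (simp add: D_def cdf_def measure_distr) (auto intro!: arg_cong[where f="measure (M n)"])
  qed
  ultimately show ?thesis by (rule Lim_transform_eventually)
qed

text \<open>The value 0 at \<open>n = 0\<close> makes the function monotone at every index, as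
  \<open>weak_conv_moving_point\<close> requires.\<close>

definition F :: "nat \<Rightarrow> real \<Rightarrow> real" where
  "F n x = (if n \<ge> 1 then measure (M n) {\<omega>\<in>space (M n). V n \<omega> \<le> x} else 0)"

lemma mono_F: "mono (F n)"
proof (cases "n \<ge> 1")
  case True
  interpret prob_space "M n" using True by (rule prob_M)
  note [measurable] = V_measurable[OF True]
  show ?thesis using True by (auto simp: F_def intro!: monoI finite_measure_mono)
qed (simp add: F_def monoI)

lemma F_limit: "(\<lambda>n. F n x) \<longlonglongrightarrow> cdf std_normal_distribution x"
  by (rule Lim_transform_eventually[OF V_cdf_limit]) (auto simp: F_def eventually_at_top_linorder)

lemma F_limit_moving: "u \<longlonglongrightarrow> x \<Longrightarrow> (\<lambda>n. F n (u n)) \<longlonglongrightarrow> cdf std_normal_distribution x"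
  by (rule weak_conv_moving_point[OF F_limit mono_F isCont_std_normal_cdf])

text \<open>\<open>T > 2 * m\<close> means that \<open>V\<close> exceeds sqrt (\<open>m\<close> /
  2), a threshold that passes every fixed quantile \<open>x\<close> as soon as
  \<open>2 * x\<^sup>2 \<le> m\<close>. Off this event the sample mean has the size expected from
  its second moment.\<close>

lemma T_exceeds_limit: "(\<lambda>n. measure (M n) {\<omega>\<in>space (M n). T n \<omega> > 2 * m n}) \<longlonglongrightarrow> 0"
proof (rule tendstoI)
  fix e :: real assume e: "0 < e"
  interpret N: real_distribution std_normal_distribution by (rule real_dist_normal_dist)
  have "\<forall>\<^sub>F x in at_top. 1 - e / 2 < cdf std_normal_distribution x"
    using e by (intro order_tendstoD(1)[OF N.cdf_lim_at_top_prob]) auto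
  then obtain x where x: "1 - e / 2 < cdf std_normal_distribution x" by (auto dest: eventually_happens)
  then have "\<forall>\<^sub>F n in sequentially. 1 - e / 2 < F n x" by (intro order_tendstoD(1)[OF F_limit])
  moreover have "\<forall>\<^sub>F n in sequentially. 2 * x\<^sup>2 \<le> m n" using m_infinity by (simp add: filterlim_at_top)
  ultimately show "\<forall>\<^sub>F n in sequentially. dist (measure (M n) {\<omega>\<in>space (M n). T n \<omega> > 2 * m n}) 0 < e"
    using eventually_ge_at_top[of 1]
  proof eventually_elim
    case (elim n)
    interpret prob_space "M n" using elim(3) by (rule prob_M)
    note [measurable] = V_measurable[OF elim(3)] T_measurable[OF elim(3)]
    have m: "1 \<le> m n" by (rule m_ge_1[OF elim(3)])
    have "x * sqrt (2 * m n) \<le> m n"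
    proof -
      have "x * sqrt (2 * m n) \<le> sqrt (m n / 2) * sqrt (2 * m n)"
        using elim(2) m by (intro mult_right_mono real_le_rsqrt) auto
      also have "\<dots> = sqrt ((m n)\<^sup>2)" by (simp only: real_sqrt_mult[symmetric]) (simp add: power2_eq_square)
      finally show ?thesis using m by simp
    qed
    then have "{\<omega>\<in>space (M n). V n \<omega> \<le> x} \<subseteq> space (M n) - {\<omega>\<in>space (M n). T n \<omega> > 2 * m n}"
      using m by (auto simp: V_def field_simps)
    then have "F n x \<le> prob (space (M n) - {\<omega>\<in>space (M n). T n \<omega> > 2 * m n})"
      using elim(3) unfolding F_def by (auto intro!: finite_measure_mono)
    also have "\<dots> = 1 - prob {\<omega>\<in>space (M n). T n \<omega> > 2 * m n}" by (intro prob_compl) measurable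
    finally show ?case using elim(1) e by (simp add: dist_real_def)
  qed
qed

text \<open>A Slutsky argument for extended-real variables. Closeness is demanded on sets
  \<open>G n\<close> whose probability tends to 1, instead of for a difference
  \<open>X n - T n\<close> that could be infinite.\<close>

lemma asymptotic_cdf:
  fixes X :: "nat \<Rightarrow> 'w \<Rightarrow> ereal"
  assumes X: "\<And>n x. n \<ge> 1 \<Longrightarrow> {\<omega>\<in>space (M n). X n \<omega> \<le> ereal x} \<in> sets (M n)"
    and close: "\<And>\<epsilon>. 0 < \<epsilon> \<Longrightarrow> \<exists>G. (\<forall>n\<ge>1. G n \<in> sets (M n)) \<and> (\<lambda>n. measure (M n) (G n)) \<longlonglongrightarrow> 1 \<and>
       (\<forall>\<^sub>F n in sequentially. \<forall>\<omega>\<in>G n. ereal (T n \<omega> - \<epsilon> * sqrt (m n)) \<le> X n \<omega> \<and> X n \<omega> \<le> ereal (T n \<omega> + \<epsilon> * sqrt (m n)))"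
    and u: "u \<longlonglongrightarrow> x"
  shows "(\<lambda>n. measure (M n) {\<omega>\<in>space (M n). X n \<omega> \<le> ereal (m n + u n * sqrt (2 * m n))}) \<longlonglongrightarrow> cdf std_normal_distribution x"
proof (rule tendstoI)
  let ?\<Phi> = "cdf std_normal_distribution"
  fix e :: real assume e: "0 < e"
  obtain d where d: "0 < d" "\<And>y. \<bar>y - x\<bar> < d \<Longrightarrow> \<bar>?\<Phi> y - ?\<Phi> x\<bar> < e / 3"
    using isCont_std_normal_cdf[of x, unfolded continuous_at_eps_delta, rule_format, of "e / 3"] e by (auto simp: dist_real_def)
  \<comment> \<open>Chosen so that an error of \<epsilon> times sqrt m in \<open>X\<close> shifts
    the standardised threshold by exactly \<open>d / 2\<close>.\<close>
  define \<epsilon> where "\<epsilon> = d / 2 * sqrt 2"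
  have "0 < \<epsilon>" using d by (simp add: \<epsilon>_def)
  then obtain G where G: "\<And>n. n \<ge> 1 \<Longrightarrow> G n \<in> sets (M n)" and G1: "(\<lambda>n. measure (M n) (G n)) \<longlonglongrightarrow> 1" and
    Gb: "\<forall>\<^sub>F n in sequentially. \<forall>\<omega>\<in>G n. ereal (T n \<omega> - \<epsilon> * sqrt (m n)) \<le> X n \<omega> \<and> X n \<omega> \<le> ereal (T n \<omega> + \<epsilon> * sqrt (m n))"
    using close[OF \<open>0 < \<epsilon>\<close>] by blast
  have l: "(\<lambda>n. F n (u n + d / 2)) \<longlonglongrightarrow> ?\<Phi> (x + d / 2)" "(\<lambda>n. F n (u n - d / 2)) \<longlonglongrightarrow> ?\<Phi> (x - d / 2)"
    by (intro F_limit_moving tendsto_intros u)+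
  have g: "\<bar>?\<Phi> (x + d / 2) - ?\<Phi> x\<bar> < e / 3" "\<bar>?\<Phi> (x - d / 2) - ?\<Phi> x\<bar> < e / 3" using d by auto
  have ev: "\<forall>\<^sub>F n in sequentially. dist (F n (u n + d / 2)) (?\<Phi> (x + d / 2)) < e / 3"
    "\<forall>\<^sub>F n in sequentially. dist (F n (u n - d / 2)) (?\<Phi> (x - d / 2)) < e / 3"
    "\<forall>\<^sub>F n in sequentially. dist (measure (M n) (G n)) 1 < e / 3"
    using e by (intro tendstoD l G1; simp)+
  show "\<forall>\<^sub>F n in sequentially. dist (measure (M n) {\<omega>\<in>space (M n). X n \<omega> \<le> ereal (m n + u n * sqrt (2 * m n))}) (?\<Phi> x) < e"
    using ev Gb eventually_ge_at_top[of 1]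
  proof eventually_elim
    case (elim n)
    interpret prob_space "M n" using elim(5) by (rule prob_M)
    note [measurable] = V_measurable[OF elim(5)] T_measurable[OF elim(5)] G[OF elim(5)]
    let ?A = "{\<omega>\<in>space (M n). X n \<omega> \<le> ereal (m n + u n * sqrt (2 * m n))}"
    note [measurable] = X[OF elim(5), of "m n + u n * sqrt (2 * m n)"]
    have m: "1 \<le> m n" by (rule m_ge_1[OF elim(5)])
    have Gs: "G n \<subseteq> space (M n)" using G[OF elim(5)] by (rule sets.sets_into_space)
    have eps: "d / 2 * sqrt (2 * m n) = \<epsilon> * sqrt (m n)" by (simp add: \<epsilon>_def real_sqrt_mult)
    have V: "V n \<omega> \<le> y \<longleftrightarrow> T n \<omega> \<le> m n + y * sqrt (2 * m n)" for y \<omega>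
      using m by (auto simp: V_def divide_le_eq algebra_simps)
    have comp: "prob (space (M n) - G n) = 1 - prob (G n)" by (intro prob_compl) measurable
    have "prob {\<omega>\<in>space (M n). V n \<omega> \<le> u n - d / 2} \<le> prob (?A \<union> (space (M n) - G n))"
    proof (intro finite_measure_mono subsetI)
      fix \<omega> assume w: "\<omega> \<in> {\<omega>\<in>space (M n). V n \<omega> \<le> u n - d / 2}"
      show "\<omega> \<in> ?A \<union> (space (M n) - G n)"
      proof (cases "\<omega> \<in> G n")
        case True
        have "T n \<omega> + \<epsilon> * sqrt (m n) \<le> m n + u n * sqrt (2 * m n)"
          using w unfolding V left_diff_distrib eps by simp
        then have "X n \<omega> \<le> ereal (m n + u n * sqrt (2 * m n))"
          using elim(4) True by (meson ereal_less_eq(3) order_trans)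
        then show ?thesis using w by simp
      qed (use w in simp)
    qed measurable
    also have "\<dots> \<le> prob ?A + prob (space (M n) - G n)" by (intro measure_Un_le) measurable
    finally have lower: "F n (u n - d / 2) \<le> prob ?A + (1 - prob (G n))" unfolding comp using elim(5) by (simp add: F_def)
    have "prob ?A \<le> prob ({\<omega>\<in>space (M n). V n \<omega> \<le> u n + d / 2} \<union> (space (M n) - G n))"
    proof (intro finite_measure_mono subsetI)
      fix \<omega> assume w: "\<omega> \<in> ?A"
      show "\<omega> \<in> {\<omega>\<in>space (M n). V n \<omega> \<le> u n + d / 2} \<union> (space (M n) - G n)"
      proof (cases "\<omega> \<in> G n")
        case True
        have "ereal (T n \<omega> - \<epsilon> * sqrt (m n)) \<le> ereal (m n + u n * sqrt (2 * m n))"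
        proof (rule order_trans)
          show "ereal (T n \<omega> - \<epsilon> * sqrt (m n)) \<le> X n \<omega>" using elim(4) True by blast
          show "X n \<omega> \<le> ereal (m n + u n * sqrt (2 * m n))" using w by simp
        qed
        then have "V n \<omega> \<le> u n + d / 2" unfolding V distrib_right eps by simp
        then show ?thesis using w by simp
      qed (use w in simp)
    qed measurable
    also have "\<dots> \<le> prob {\<omega>\<in>space (M n). V n \<omega> \<le> u n + d / 2} + prob (space (M n) - G n)" 
      by (intro measure_Un_le) measurable
    finally have upper: "prob ?A \<le> F n (u n + d / 2) + (1 - prob (G n))" unfolding comp using elim(5) by (simp add: F_def)
    show ?case using lower upper elim(1,2,3) g unfolding dist_real_def by linarith
  qed
qed

end

section \<open>Euclidean norm and averages\<close>

lemma vnorm_eq_L2_set: "vnorm v = L2_set (\<lambda>i. v $ i) {0..<dim_vec v}"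
  by (simp add: vnorm_def L2_set_def scalar_prod_def power2_eq_square)

lemma vnorm_nonneg [simp]: "0 \<le> vnorm v"
  by (simp add: vnorm_eq_L2_set)

lemma vnorm_square: "(vnorm v)\<^sup>2 = scalar_prod v v"
proof -
  have "0 \<le> scalar_prod v v" by (simp add: scalar_prod_def sum_nonneg)
  then show ?thesis by (simp add: vnorm_def)
qed

lemma vnorm_square_sum: "v \<in> carrier_vec d \<Longrightarrow> (vnorm v)\<^sup>2 = (\<Sum>i<d. (v $ i)\<^sup>2)"
  unfolding vnorm_square by (simp add: scalar_prod_def power2_eq_square atLeast0LessThan)

lemma vnorm_Cauchy_Schwarz:
  assumes "u \<in> carrier_vec d" "v \<in> carrier_vec d"
  shows "\<bar>scalar_prod u v\<bar> \<le> vnorm u * vnorm v"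
proof -
  have "\<bar>scalar_prod u v\<bar> \<le> (\<Sum>i\<in>{0..<d}. \<bar>u $ i\<bar> * \<bar>v $ i\<bar>)"
    using assms by (auto simp: scalar_prod_def abs_mult[symmetric] intro!: sum_abs)
  also have "\<dots> \<le> L2_set (\<lambda>i. u $ i) {0..<d} * L2_set (\<lambda>i. v $ i) {0..<d}" by (rule L2_set_mult_ineq)
  finally show ?thesis using assms by (simp add: vnorm_eq_L2_set)
qed

lemma vnorm_triangle:
  assumes "u \<in> carrier_vec d" "v \<in> carrier_vec d"
  shows "vnorm (u + v) \<le> vnorm u + vnorm v"
proof -
  have "L2_set (\<lambda>i. (u + v) $ i) {0..<d} = L2_set (\<lambda>i. u $ i + v $ i) {0..<d}"
    using assms by (intro L2_set_cong) auto
  then show ?thesis using assms L2_set_triangle_ineq[of "\<lambda>i. u $ i" "\<lambda>i. v $ i" "{0..<d}"] by (simp add: vnorm_eq_L2_set)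
qed

lemma vnorm_smult [simp]: "vnorm (c \<cdot>\<^sub>v v) = \<bar>c\<bar> * vnorm v"
  by (simp add: vnorm_def real_sqrt_mult)

lemma vnorm_uminus [simp]: "vnorm (- v) = vnorm v"
  by (simp add: vnorm_eq_L2_set L2_set_def)

lemma vnorm_triangle_minus:
  assumes "u \<in> carrier_vec d" "v \<in> carrier_vec d"
  shows "vnorm (u - v) \<le> vnorm u + vnorm v"
  using vnorm_triangle[of u d "- v"] assms by (simp add: minus_add_uminus_vec)

lemma vnorm_eq_0_iff: "v \<in> carrier_vec d \<Longrightarrow> vnorm v = 0 \<longleftrightarrow> v = 0\<^sub>v d"
  by (auto simp: vnorm_eq_L2_set L2_set_eq_0_iff)

lemma vnorm_0 [simp]: "vnorm (0\<^sub>v d) = 0"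
  using vnorm_eq_0_iff[of "0\<^sub>v d" d] by simp

text \<open>Testing with \<open>u = v\<close> suffices. It turns bounds on bilinear forms into
  bounds on norms.\<close>

lemma vnorm_le_scalar_prod:
  assumes "v \<in> carrier_vec d" "0 \<le> c" "\<And>u. u \<in> carrier_vec d \<Longrightarrow> \<bar>scalar_prod u v\<bar> \<le> c * vnorm u"
  shows "vnorm v \<le> c"
proof (cases "vnorm v = 0")
  case False
  have "vnorm v * vnorm v \<le> c * vnorm v"
    using assms(3)[OF assms(1)] vnorm_square[of v] by (simp add: power2_eq_square)
  then show ?thesis using False by (simp add: less_le)
qed (use assms in simp)

lemma scalar_prod_vec_avg:
  assumes "\<And>j. j \<in> {1..n} \<Longrightarrow> x j \<in> carrier_vec d"
  shows "scalar_prod u (vec_avg d n x) = (1 / real n) * (\<Sum>j=1..n. scalar_prod u (x j))"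
proof -
  have "scalar_prod u (vec_avg d n x) = (\<Sum>i\<in>{0..<d}. \<Sum>j=1..n. u $ i * ((1 / real n) * x j $ i))"
    by (simp add: scalar_prod_def vec_avg_def sum_distrib_left)
  also have "\<dots> = (\<Sum>j=1..n. \<Sum>i\<in>{0..<d}. u $ i * ((1 / real n) * x j $ i))" by (rule sum.swap)
  also have "\<dots> = (\<Sum>j=1..n. (1 / real n) * scalar_prod u (x j))"
    using assms[THEN carrier_vecD] by (intro sum.cong refl) (auto simp: scalar_prod_def sum_distrib_left mult_ac)
  finally show ?thesis by (simp add: sum_distrib_left)
qed

lemma vec_avg_carrier [simp]: "vec_avg d n x \<in> carrier_vec d"
  by (simp add: vec_avg_def)

lemma mat_avg_carrier [simp]: "mat_avg d n X \<in> carrier_mat d d"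
  by (simp add: mat_avg_def)

lemma mat_avg_outer_mult_vec:
  assumes x: "\<And>j. j \<in> {1..n} \<Longrightarrow> x j \<in> carrier_vec d" and v: "v \<in> carrier_vec d"
  shows "mat_avg d n (\<lambda>j. outer (x j) (x j)) *\<^sub>v v = vec_avg d n (\<lambda>j. scalar_prod v (x j) \<cdot>\<^sub>v x j)"
proof (rule eq_vecI)
  fix i assume "i < dim_vec (vec_avg d n (\<lambda>j. scalar_prod v (x j) \<cdot>\<^sub>v x j))"
  then have i: "i < d" by (simp add: vec_avg_def)
  have "(mat_avg d n (\<lambda>j. outer (x j) (x j)) *\<^sub>v v) $ i = (\<Sum>k\<in>{0..<d}. (1 / real n) * (\<Sum>j=1..n. (outer (x j) (x j)) $$ (i, k)) * v $ k)"
    using i v by (simp add: scalar_prod_def mat_avg_def)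
  also have "\<dots> = (\<Sum>k\<in>{0..<d}. \<Sum>j=1..n. (1 / real n) * (x j $ i * (x j $ k * v $ k)))"
    using x[THEN carrier_vecD] i by (intro sum.cong refl) (auto simp: outer_def sum_distrib_left sum_distrib_right mult_ac intro!: sum.cong)
  also have "\<dots> = (\<Sum>j=1..n. \<Sum>k\<in>{0..<d}. (1 / real n) * (x j $ i * (x j $ k * v $ k)))" by (rule sum.swap)
  also have "\<dots> = (\<Sum>j=1..n. (1 / real n) * (scalar_prod v (x j) * x j $ i))"
    using x[THEN carrier_vecD] by (intro sum.cong refl) (auto simp: scalar_prod_def sum_distrib_left sum_distrib_right mult_ac intro!: sum.cong)
  also have "\<dots> = vec_avg d n (\<lambda>j. scalar_prod v (x j) \<cdot>\<^sub>v x j) $ i"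
    using x[THEN carrier_vecD] i by (auto simp: vec_avg_def sum_distrib_left intro!: sum.cong)
  finally show "(mat_avg d n (\<lambda>j. outer (x j) (x j)) *\<^sub>v v) $ i = vec_avg d n (\<lambda>j. scalar_prod v (x j) \<cdot>\<^sub>v x j) $ i" .
qed (simp add: mat_avg_def vec_avg_def)

lemma scalar_prod_mat_avg_outer:
  assumes x: "\<And>j. j \<in> {1..n} \<Longrightarrow> x j \<in> carrier_vec d" and u: "u \<in> carrier_vec d" and v: "v \<in> carrier_vec d"
  shows "scalar_prod u (mat_avg d n (\<lambda>j. outer (x j) (x j)) *\<^sub>v v) = (1 / real n) * (\<Sum>j=1..n. scalar_prod u (x j) * scalar_prod v (x j))"
proof -
  have "mat_avg d n (\<lambda>j. outer (x j) (x j)) *\<^sub>v v = vec_avg d n (\<lambda>j. scalar_prod v (x j) \<cdot>\<^sub>v x j)"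
    using x v by (rule mat_avg_outer_mult_vec)
  moreover have "scalar_prod u (vec_avg d n (\<lambda>j. scalar_prod v (x j) \<cdot>\<^sub>v x j))
      = (1 / real n) * (\<Sum>j=1..n. scalar_prod u (scalar_prod v (x j) \<cdot>\<^sub>v x j))"
    using x by (intro scalar_prod_vec_avg) simp
  moreover have "\<dots> = (1 / real n) * (\<Sum>j=1..n. scalar_prod u (x j) * scalar_prod v (x j))"
    using x u by (intro arg_cong2[where f="(*)"] sum.cong refl) (auto simp: scalar_prod_smult_right[of _ _ _])
  ultimately show ?thesis by simp
qed

text \<open>A singular matrix has a nonzero null vector, on which its quadratic form vanishes.
  Symmetry does not enter, so the empirical matrix and \<open>W\<close> are treated alike.\<close>

lemma positive_definite_inverse:
  fixes A :: "real mat"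
  assumes A: "A \<in> carrier_mat d d" and pos: "\<And>v. v \<in> carrier_vec d \<Longrightarrow> v \<noteq> 0\<^sub>v d \<Longrightarrow> 0 < scalar_prod v (A *\<^sub>v v)"
  obtains P where "P \<in> carrier_mat d d" "A * P = 1\<^sub>m d" "P * A = 1\<^sub>m d"
proof -
  have "Determinant.det A \<noteq> 0"
  proof
    assume "Determinant.det A = 0"
    then obtain v where "v \<in> carrier_vec d" "v \<noteq> 0\<^sub>v d" "A *\<^sub>v v = 0\<^sub>v d"
      using det_0_iff_vec_prod_zero_field[OF A] by auto
    then show False using pos[of v] by simp
  qed
  from det_non_zero_imp_unit[OF A this, of "()"] show ?thesis
    using that unfolding Units_def ring_mat_def by auto
qed

section \<open>Bounds for the empirical likelihood ratio\<close>

text \<open>The two sides agree at 0. For positive arguments the difference without the cubic term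
  has derivative \<open>x\<^sup>2 / (1 + x)\<close>; for negative arguments the cubic term turns the
  derivative into \<open>x\<^sup>2 * (1 / (1 + x) - 3)\<close>, which is at most 0 because
  \<open>1 + x\<close> is at least 1/2.\<close>

lemma ln_one_plus_lower:
  fixes a :: real assumes "\<bar>a\<bar> \<le> 1 / 2"
  shows "a - a\<^sup>2 / 2 - \<bar>a\<bar> ^ 3 \<le> ln (1 + a)"
proof (cases "0 \<le> a")
  case True
  let ?g = "\<lambda>a :: real. ln (1 + a) - a + a\<^sup>2 / 2"
  have "?g 0 \<le> ?g a"
  proof (rule DERIV_nonneg_imp_nondecreasing[OF True])
    fix x :: real assume x: "0 \<le> x" "x \<le> a"
    have "DERIV ?g x :> 1 / (1 + x) - 1 + x"
      using x by (auto intro!: derivative_eq_intros simp: field_simps)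
    moreover have "1 / (1 + x) - 1 + x = x\<^sup>2 / (1 + x)" using x by (simp add: field_simps power2_eq_square)
    ultimately show "\<exists>y. DERIV ?g x :> y \<and> 0 \<le> y" using x by auto
  qed
  then have "a - a\<^sup>2 / 2 \<le> ln (1 + a)" by simp
  moreover have "0 \<le> \<bar>a\<bar> ^ 3" by (rule zero_le_power) simp
  ultimately show ?thesis by linarith
next
  case False
  let ?h = "\<lambda>a :: real. ln (1 + a) - a + a\<^sup>2 / 2 - a ^ 3"
  have "?h 0 \<le> ?h a"
  proof (rule DERIV_nonpos_imp_nonincreasing[where a=a and b=0 and f="?h"])
    fix x :: real assume x: "a \<le> x" "x \<le> 0"
    have x1: "1 / 2 \<le> 1 + x" using x assms by auto
    have "DERIV ?h x :> 1 / (1 + x) - 1 + x - 3 * x\<^sup>2"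
      using x1 by (auto intro!: derivative_eq_intros simp: field_simps)
    moreover have "1 / (1 + x) - 1 + x - 3 * x\<^sup>2 = x\<^sup>2 * (1 / (1 + x) - 3)" using x1 by (simp add: field_simps power2_eq_square)
    moreover have "1 / (1 + x) \<le> 3" using x1 by (simp add: field_simps)
    ultimately show "\<exists>y. DERIV ?h x :> y \<and> y \<le> 0" by (auto intro!: mult_nonneg_nonpos)
  qed (use False in simp)
  then show ?thesis using False by (simp add: abs_if power3_eq_cube)
qed

text \<open>The cubic term is absorbed into the quadratic one at the price of a factor
  \<open>1 + 2 * \<epsilon>\<close>. Both bounds for the likelihood ratio use this form, with
  \<open>a\<close> a trial pairing in one and a negative weight deviation in the other.\<close>

lemma ln_one_plus_lower':
  fixes a :: real assumes "\<bar>a\<bar> \<le> \<epsilon>" "\<epsilon> \<le> 1 / 2"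
  shows "2 * a - (1 + 2 * \<epsilon>) * a\<^sup>2 \<le> 2 * ln (1 + a)"
proof -
  have "\<bar>a\<bar> ^ 3 = \<bar>a\<bar> * a\<^sup>2" by (simp add: power3_eq_cube power2_eq_square)
  also have "\<dots> \<le> \<epsilon> * a\<^sup>2" using assms by (intro mult_right_mono) auto
  finally show ?thesis using ln_one_plus_lower[of a] assms by (simp add: algebra_simps)
qed

definition el_products :: "nat \<Rightarrow> nat \<Rightarrow> (nat \<Rightarrow> real Matrix.vec) \<Rightarrow> real set" where
  "el_products d n x = {\<Prod>j=1..n. real n * \<pi> j | \<pi>.
     \<pi> \<in> prob_simplex n \<and> vec_avg d n (\<lambda>j. \<pi> j \<cdot>\<^sub>v x j) = 0\<^sub>v d}"

lemma el_ratio_altdef: "el_ratio d n x = (if el_products d n x = {} then 0 else Sup (el_products d n x))"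
  unfolding el_ratio_def el_products_def Let_def by (rule refl)

lemma el_products_iff: "p \<in> el_products d n x \<longleftrightarrow>
    (\<exists>\<pi>. p = (\<Prod>j=1..n. real n * \<pi> j) \<and> \<pi> \<in> prob_simplex n \<and> vec_avg d n (\<lambda>j. \<pi> j \<cdot>\<^sub>v x j) = 0\<^sub>v d)"
  unfolding el_products_def by blast

lemma el_products_nonneg: "p \<in> el_products d n x \<Longrightarrow> 0 \<le> p"
  by (auto simp: el_products_def prob_simplex_def intro!: prod_nonneg)

lemma el_products_bdd: "bdd_above (el_products d n x)"
proof (rule bdd_aboveI)
  fix p assume "p \<in> el_products d n x"
  then obtain \<pi> where \<pi>: "p = (\<Prod>j=1..n. real n * \<pi> j)" "\<pi> \<in> prob_simplex n" by (auto simp: el_products_def)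
  have "(\<Prod>j=1..n. real n * \<pi> j) \<le> (\<Prod>j=1..n. real n)"
    using \<pi>(2) by (intro prod_mono) (auto simp: prob_simplex_def mult_left_le)
  then show "p \<le> real n ^ n" using \<pi>(1) by simp
qed

lemma neg2log_ge:
  assumes "0 \<le> r" "r \<le> exp (- L / 2)" shows "ereal L \<le> neg2log r"
proof (cases "r = 0")
  case False
  then have "ln r \<le> ln (exp (- L / 2))" using assms by (subst ln_le_cancel_iff) auto
  then show ?thesis using False by (simp add: neg2log_def)
qed (simp add: neg2log_def)

lemma neg2log_le:
  assumes "exp (- L / 2) \<le> r" shows "neg2log r \<le> ereal L"
proof -
  have r: "0 < r" using assms by (meson exp_gt_zero less_le_trans)
  then have "ln (exp (- L / 2)) \<le> ln r" using assms by (subst ln_le_cancel_iff) auto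
  then show ?thesis using r by (simp add: neg2log_def)
qed

text \<open>Weak duality: every trial vector \<zeta> with small pairings bounds all admissible
  products at once. If no weights are admissible, the ratio is 0 and \<open>neg2log\<close> is
  infinite, so the bound covers this case as well.\<close>

lemma neg2log_el_ratio_ge:
  assumes n: "n \<ge> 1" and x: "\<And>j. j \<in> {1..n} \<Longrightarrow> x j \<in> carrier_vec d" and \<zeta>: "\<zeta> \<in> carrier_vec d"
    and b: "\<And>j. j \<in> {1..n} \<Longrightarrow> \<bar>scalar_prod \<zeta> (x j)\<bar> \<le> \<epsilon>" and e: "\<epsilon> \<le> 1 / 2"
  shows "ereal (2 * (\<Sum>j=1..n. scalar_prod \<zeta> (x j)) - (1 + 2 * \<epsilon>) * (\<Sum>j=1..n. (scalar_prod \<zeta> (x j))\<^sup>2)) \<le> neg2log (el_ratio d n x)"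
proof (rule neg2log_ge)
  let ?a = "\<lambda>j. scalar_prod \<zeta> (x j)"
  let ?L = "2 * (\<Sum>j=1..n. ?a j) - (1 + 2 * \<epsilon>) * (\<Sum>j=1..n. (?a j)\<^sup>2)"
  have a1: "0 < 1 + ?a j" if "j \<in> {1..n}" for j using b[OF that] e by auto
  have "p \<le> exp (- ?L / 2)" if pin: "p \<in> el_products d n x" for p
  proof -
    obtain \<pi> where p: "p = (\<Prod>j=1..n. real n * \<pi> j)" and \<pi>: "\<pi> \<in> prob_simplex n"
      and 0: "vec_avg d n (\<lambda>j. \<pi> j \<cdot>\<^sub>v x j) = 0\<^sub>v d" using el_products_iff[THEN iffD1, OF pin] by metis
    have "0 = scalar_prod \<zeta> (vec_avg d n (\<lambda>j. \<pi> j \<cdot>\<^sub>v x j))" using \<zeta> by (simp add: 0)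
    also have "\<dots> = (1 / real n) * (\<Sum>j=1..n. \<pi> j * ?a j)" using x \<zeta> by (subst scalar_prod_vec_avg) auto
    finally have \<pi>a: "(\<Sum>j=1..n. \<pi> j * ?a j) = 0" using n by simp
    have \<pi>1: "(\<Sum>j=1..n. \<pi> j) = 1" "\<And>j. j \<in> {1..n} \<Longrightarrow> 0 \<le> \<pi> j" using \<pi> by (auto simp: prob_simplex_def)
    have "(\<Prod>j=1..n. real n * \<pi> j) * (\<Prod>j=1..n. 1 + ?a j) = (\<Prod>j=1..n. real n * \<pi> j * (1 + ?a j))" by (simp add: prod.distrib)
    also have "\<dots> \<le> (\<Prod>j=1..n. exp (real n * \<pi> j * (1 + ?a j) - 1))"
    proof (rule prod_mono, rule conjI)
      fix j assume "j \<in> {1..n}"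
      then show "0 \<le> real n * \<pi> j * (1 + ?a j)" using a1[of j] \<pi>1 by (simp add: less_imp_le)
      show "real n * \<pi> j * (1 + ?a j) \<le> exp (real n * \<pi> j * (1 + ?a j) - 1)"
        using exp_ge_add_one_self[of "real n * \<pi> j * (1 + ?a j) - 1"] by simp
    qed
    also have "\<dots> = exp (\<Sum>j=1..n. real n * \<pi> j * (1 + ?a j) - 1)" by (simp add: exp_sum)
    \<comment> \<open>Both constraints enter here: total weight 1 and weighted mean 0 make the
      exponents cancel.\<close>
    also have "(\<Sum>j=1..n. real n * \<pi> j * (1 + ?a j) - 1) = real n * (\<Sum>j=1..n. \<pi> j) + real n * (\<Sum>j=1..n. \<pi> j * ?a j) - real n"
      by (simp add: sum_subtractf sum.distrib sum_distrib_left algebra_simps)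
    also have "\<dots> = 0" by (simp add: \<pi>1 \<pi>a)
    finally have le1: "p * (\<Prod>j=1..n. 1 + ?a j) \<le> 1" using p by simp
    have "exp (?L / 2) \<le> (\<Prod>j=1..n. 1 + ?a j)"
    proof -
      have "?L / 2 = (\<Sum>j=1..n. (2 * ?a j - (1 + 2 * \<epsilon>) * (?a j)\<^sup>2) / 2)"
        by (simp add: sum_subtractf sum_distrib_left sum_divide_distrib[symmetric])
      also have "\<dots> \<le> (\<Sum>j=1..n. ln (1 + ?a j))"
      proof (intro sum_mono)
        fix j assume "j \<in> {1..n}"
        have half: "u / 2 \<le> v" if "u \<le> 2 * v" for u v :: real using that by simp
        show "(2 * ?a j - (1 + 2 * \<epsilon>) * (?a j)\<^sup>2) / 2 \<le> ln (1 + ?a j)"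
          by (rule half[OF ln_one_plus_lower'[OF b[OF \<open>j \<in> {1..n}\<close>] e]])
      qed
      also have "exp \<dots> = (\<Prod>j=1..n. 1 + ?a j)" using a1 by (simp add: exp_sum)
      finally show ?thesis by simp
    qed
    then have "p * exp (?L / 2) \<le> 1"
      using le1 el_products_nonneg[OF that] by (meson mult_left_mono order_trans)
    moreover have "p \<le> exp (- u)" if "p * exp u \<le> 1" for u
      using that by (simp add: exp_minus inverse_eq_divide pos_le_divide_eq)
    ultimately show ?thesis by (simp only: minus_divide_left[symmetric])
  qed
  then show "el_ratio d n x \<le> exp (- ?L / 2)" unfolding el_ratio_altdef by (auto intro: cSup_least)
  show "0 \<le> el_ratio d n x" unfolding el_ratio_altdef
    by (auto intro: order_trans[OF el_products_nonneg cSup_upper] el_products_bdd)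
qed

text \<open>A single admissible point bounds the supremum from below. The linear terms of the
  logarithms cancel by \<open>sum0\<close>, so only the sum of squares is left.\<close>

lemma neg2log_el_ratio_le:
  assumes n: "n \<ge> 1" and x: "\<And>j. j \<in> {1..n} \<Longrightarrow> x j \<in> carrier_vec d"
    and sum0: "(\<Sum>j=1..n. \<delta> j) = 0" and constr: "\<And>i. i < d \<Longrightarrow> (\<Sum>j=1..n. (1 - \<delta> j) * x j $ i) = 0"
    and b: "\<And>j. j \<in> {1..n} \<Longrightarrow> \<bar>\<delta> j\<bar> \<le> \<epsilon>" and e: "\<epsilon> \<le> 1 / 2"
  shows "neg2log (el_ratio d n x) \<le> ereal ((1 + 2 * \<epsilon>) * (\<Sum>j=1..n. (\<delta> j)\<^sup>2))"
proof (rule neg2log_le)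
  let ?L = "(1 + 2 * \<epsilon>) * (\<Sum>j=1..n. (\<delta> j)\<^sup>2)"
  let ?\<pi> = "\<lambda>j. (1 - \<delta> j) / real n"
  have d1: "0 < 1 - \<delta> j" if "j \<in> {1..n}" for j using b[OF that] e by auto
  have s1: "(\<Sum>j=1..n. ?\<pi> j) = 1" using n sum0 by (simp add: sum_divide_distrib[symmetric] sum_subtractf)
  have "?\<pi> \<in> prob_simplex n"
  proof -
    have nn: "0 \<le> ?\<pi> j" if "j \<in> {1..n}" for j using d1[OF that] by simp
    then have "?\<pi> j \<le> 1" if "j \<in> {1..n}" for j
      using member_le_sum[OF that, of ?\<pi>] s1 by auto
    then show ?thesis using nn s1 by (simp add: prob_simplex_def)
  qed
  moreover have "vec_avg d n (\<lambda>j. ?\<pi> j \<cdot>\<^sub>v x j) = 0\<^sub>v d"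
  proof (rule eq_vecI)
    fix i assume "i < dim_vec (0\<^sub>v d)"
    then have i: "i < d" by simp
    have "(\<Sum>j=1..n. (?\<pi> j \<cdot>\<^sub>v x j) $ i) = (\<Sum>j=1..n. (1 - \<delta> j) * x j $ i) / real n"
      using x[THEN carrier_vecD] i by (auto simp: sum_divide_distrib intro!: sum.cong)
    then show "vec_avg d n (\<lambda>j. ?\<pi> j \<cdot>\<^sub>v x j) $ i = 0\<^sub>v d $ i"
      using i constr[OF i] by (simp add: vec_avg_def)
  qed (simp add: vec_avg_def)
  ultimately have "(\<Prod>j=1..n. real n * ?\<pi> j) \<in> el_products d n x" unfolding el_products_iff
    by (intro exI[of _ ?\<pi>] conjI) (rule refl, assumption+)
  then have "(\<Prod>j=1..n. real n * ?\<pi> j) \<le> el_ratio d n x"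
    unfolding el_ratio_altdef by (auto intro: cSup_upper el_products_bdd)
  moreover have "(\<Prod>j=1..n. real n * ?\<pi> j) = (\<Prod>j=1..n. 1 - \<delta> j)" using n by simp
  moreover have "exp (- ?L / 2) \<le> (\<Prod>j=1..n. 1 - \<delta> j)"
  proof -
    have "- ?L / 2 = (\<Sum>j=1..n. (2 * (- \<delta> j) - (1 + 2 * \<epsilon>) * (- \<delta> j)\<^sup>2) / 2)"
      using sum0 by (simp add: sum_subtractf sum_distrib_left[symmetric] sum_divide_distrib[symmetric] sum_negf)
    also have "\<dots> \<le> (\<Sum>j=1..n. ln (1 + (- \<delta> j)))"
    proof (intro sum_mono)
      fix j assume "j \<in> {1..n}"
      then show "(2 * (- \<delta> j) - (1 + 2 * \<epsilon>) * (- \<delta> j)\<^sup>2) / 2 \<le> ln (1 + (- \<delta> j))"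
        using ln_one_plus_lower'[of "- \<delta> j" \<epsilon>] b e by auto
    qed
    also have "exp \<dots> = (\<Prod>j=1..n. 1 - \<delta> j)" using d1 by (simp add: exp_sum)
    finally show ?thesis by simp
  qed
  ultimately show "exp (- ?L / 2) \<le> el_ratio d n x" by simp
qed

section \<open>Two-sided bounds with explicit errors\<close>

text \<open>Coercivity and Cauchy-Schwarz give \<open>c * (vnorm u)\<^sup>2 \<le> scalar_prod u v
  \<le> vnorm u * vnorm v\<close>. This replaces spectral bounds for the inverse matrix.\<close>

lemma positive_definite_solution_norm:
  fixes A :: "real mat"
  assumes u: "u \<in> carrier_vec d" and v: "v \<in> carrier_vec d" and A: "A *\<^sub>v u = v" and c: "0 < c"
    and pd: "c * (vnorm u)\<^sup>2 \<le> scalar_prod u (A *\<^sub>v u)"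
  shows "vnorm u \<le> vnorm v / c" and "scalar_prod u v \<le> (vnorm v)\<^sup>2 / c" and "0 \<le> scalar_prod u v"
proof -
  have 1: "c * (vnorm u)\<^sup>2 \<le> scalar_prod u v" using pd A by simp
  also have 2: "\<dots> \<le> vnorm u * vnorm v" using vnorm_Cauchy_Schwarz[OF u v] by simp
  finally have 3: "(c * vnorm u) * vnorm u \<le> vnorm v * vnorm u" by (simp add: power2_eq_square mult_ac)
  show le: "vnorm u \<le> vnorm v / c"
  proof (cases "vnorm u = 0")
    case False
    then have "0 < vnorm u" using vnorm_nonneg[of u] by linarith
    then show ?thesis using 3 c by (simp add: pos_le_divide_eq mult.commute)
  qed (use c in simp)
  have "vnorm u * vnorm v \<le> vnorm v / c * vnorm v" by (intro mult_right_mono le) simp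
  then show "scalar_prod u v \<le> (vnorm v)\<^sup>2 / c" using 2 by (simp add: power2_eq_square)
  have "0 \<le> c * (vnorm u)\<^sup>2" using c by simp
  then show "0 \<le> scalar_prod u v" using 1 by linarith
qed

text \<open>
  The lower bound uses \<open>\<zeta> = P xbar\<close>. The upper bound needs the moment constraint to hold exactly, so
  there \<open>\<zeta>\<close> solves the linear system of the empirical second moment matrix instead.
\<close>

locale el_data =
  fixes d n :: nat and x :: "nat \<Rightarrow> real Matrix.vec" and W P :: "real mat" and c g b :: real
  assumes n: "n \<ge> 1" and x: "\<And>j. j \<in> {1..n} \<Longrightarrow> x j \<in> carrier_vec d"
    and W: "W \<in> carrier_mat d d" and P: "P \<in> carrier_mat d d" and WP: "W * P = 1\<^sub>m d"
    and sym: "\<And>u v. u \<in> carrier_vec d \<Longrightarrow> v \<in> carrier_vec d \<Longrightarrow> scalar_prod u (W *\<^sub>v v) = scalar_prod v (W *\<^sub>v u)"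
    and pd: "\<And>u. u \<in> carrier_vec d \<Longrightarrow> c * (vnorm u)\<^sup>2 \<le> scalar_prod u (W *\<^sub>v u)"
    and c: "0 < c"
    and close: "\<And>u v. u \<in> carrier_vec d \<Longrightarrow> v \<in> carrier_vec d \<Longrightarrow>
      \<bar>scalar_prod u (mat_avg d n (\<lambda>j. outer (x j) (x j)) *\<^sub>v v) - scalar_prod u (W *\<^sub>v v)\<bar> \<le> g * vnorm u * vnorm v"
    and g: "0 \<le> g" "g \<le> c / 2"
    and b: "\<And>j. j \<in> {1..n} \<Longrightarrow> vnorm (x j) \<le> b"
    and small: "8 * (vnorm (vec_avg d n x) * b / c) \<le> 1 / 2"
begin

definition xbar :: "real Matrix.vec" where "xbar = vec_avg d n x"
definition W_emp :: "real mat" where "W_emp = mat_avg d n (\<lambda>j. outer (x j) (x j))"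
definition a :: real where "a = vnorm xbar"
text \<open>\<open>a * b / c\<close> bounds the pairings of \<open>p\<close> with the data. The
  factor 8 leaves room for the solution of the perturbed system, which is twice as large, and for
  the centring and rescaling that turn its pairings into weight deviations.\<close>

definition \<epsilon> :: real where "\<epsilon> = 8 * (a * b / c)"
definition p :: "real Matrix.vec" where "p = P *\<^sub>v xbar"
definition \<theta> :: real where "\<theta> = scalar_prod xbar p"

lemma carriers [simp]: "xbar \<in> carrier_vec d" "p \<in> carrier_vec d" "W_emp \<in> carrier_mat d d"
  using P by (auto simp: xbar_def p_def W_emp_def)

lemma b_nonneg: "0 \<le> b"
  using order_trans[OF vnorm_nonneg b[of 1]] n by simp

lemma a_nonneg: "0 \<le> a" by (simp add: a_def)

lemma eps: "0 \<le> \<epsilon>" "\<epsilon> \<le> 1 / 2" "a * b / c = \<epsilon> / 8"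
  using small b_nonneg a_nonneg c by (auto simp: \<epsilon>_def a_def xbar_def)

lemma sum_scalar_prod: "(\<Sum>j=1..n. scalar_prod u (x j)) = real n * scalar_prod u xbar"
  using scalar_prod_vec_avg[of n x d u, OF x] n by (simp add: xbar_def)

lemma sum_scalar_prod_mult: 
  "u \<in> carrier_vec d \<Longrightarrow> v \<in> carrier_vec d \<Longrightarrow> (\<Sum>j=1..n. scalar_prod u (x j) * scalar_prod v (x j)) = real n * scalar_prod u (W_emp *\<^sub>v v)"
  using scalar_prod_mat_avg_outer[of n x d u v, OF x] n by (simp add: W_emp_def)

text \<open>The squared norm of the mean is the average of its pairings with the data. The
  comparison makes \<open>a\<^sup>2 / c\<close>, and with it the statistic per observation, as small
  as the pairings.\<close>

lemma a_le_b: "a \<le> b"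
proof -
  have "real n * (a * a) = (\<Sum>j=1..n. scalar_prod xbar (x j))"
    unfolding sum_scalar_prod a_def using vnorm_square[of xbar] by (simp add: power2_eq_square)
  also have "\<dots> \<le> (\<Sum>j=1..n. a * b)"
  proof (intro sum_mono)
    fix j assume j: "j \<in> {1..n}"
    have "scalar_prod xbar (x j) \<le> vnorm xbar * vnorm (x j)" using vnorm_Cauchy_Schwarz[OF carriers(1) x[OF j]] by simp
    also have "\<dots> \<le> a * b" unfolding a_def by (intro mult_left_mono b j) simp
    finally show "scalar_prod xbar (x j) \<le> a * b" .
  qed
  finally have "a * a \<le> a * b" using n by simp
  then show ?thesis using a_nonneg b_nonneg by (cases "a = 0") auto
qed

lemma W_p: "W *\<^sub>v p = xbar"
proof -
  have "W *\<^sub>v p = (W * P) *\<^sub>v xbar" unfolding p_def using W P by (simp add: assoc_mult_mat_vec[of _ d d _ d])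
  then show ?thesis by (simp add: WP)
qed

lemma p_norm: "vnorm p \<le> a / c" and theta_le: "\<theta> \<le> a\<^sup>2 / c" and theta_nonneg: "0 \<le> \<theta>"
proof -
  note * = positive_definite_solution_norm[OF carriers(2,1) W_p c pd[OF carriers(2)]]
  have "\<theta> = scalar_prod p xbar" unfolding \<theta>_def by (rule comm_scalar_prod[OF carriers(1,2)])
  then show "vnorm p \<le> a / c" "\<theta> \<le> a\<^sup>2 / c" "0 \<le> \<theta>" using * by (auto simp: a_def)
qed

text \<open>The term with \<open>g\<close> is the cost of the matrix error, the term with \<epsilon>
  that of the cubic term of the logarithm. Both are relative to \<open>n * a\<^sup>2\<close>, the
  order of the statistic itself.\<close>

definition err :: real where "err = real n * a\<^sup>2 * (2 * g / c\<^sup>2 + 6 * \<epsilon> / c)"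

text \<open>With trial vector \<open>p\<close> the linear part is \<open>2 * n * \<theta>\<close>.
  The quadratic part is \<open>n\<close> times the form of \<open>p\<close> in \<open>W_emp\<close>,
  which exceeds \<open>\<theta>\<close> by at most \<open>g * (a / c)\<^sup>2\<close>; the
  difference leaves \<open>n * \<theta>\<close> up to \<open>err\<close>.\<close>

lemma lower: "ereal (real n * \<theta> - err) \<le> neg2log (el_ratio d n x)"
proof -
  have \<theta>: "scalar_prod p xbar = \<theta>" unfolding \<theta>_def by (rule comm_scalar_prod[OF carriers(2,1)])
  have bd: "\<bar>scalar_prod p (x j)\<bar> \<le> \<epsilon>" if j: "j \<in> {1..n}" for j
  proof -
    have "\<bar>scalar_prod p (x j)\<bar> \<le> vnorm p * vnorm (x j)" by (rule vnorm_Cauchy_Schwarz[OF carriers(2) x[OF j]])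
    also have "\<dots> \<le> a / c * b" using p_norm b[OF j] a_nonneg c by (intro mult_mono) auto
    also have "\<dots> = \<epsilon> / 8" using eps(3) by simp
    finally show ?thesis using eps(1) by simp
  qed
  have sq: "(\<Sum>j=1..n. (scalar_prod p (x j))\<^sup>2) \<le> real n * (\<theta> + g * (a / c)\<^sup>2)"
  proof -
    have "(\<Sum>j=1..n. (scalar_prod p (x j))\<^sup>2) = real n * scalar_prod p (W_emp *\<^sub>v p)"
      using sum_scalar_prod_mult[OF carriers(2,2)] by (simp add: power2_eq_square)
    moreover have "scalar_prod p (W_emp *\<^sub>v p) \<le> \<theta> + g * (a / c)\<^sup>2"
    proof -
      have "g * vnorm p * vnorm p \<le> g * (a / c)\<^sup>2" 
      proof -
        have "vnorm p * vnorm p \<le> (a / c) * (a / c)" using p_norm by (intro mult_mono) (auto intro: order_trans[OF vnorm_nonneg])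
        from mult_left_mono[OF this g(1)] show ?thesis by (simp only: power2_eq_square mult.assoc)
      qed
      then show ?thesis using close[OF carriers(2,2)] unfolding W_emp_def[symmetric] W_p \<theta> by linarith
    qed
    ultimately show ?thesis by (simp add: mult_left_mono)
  qed
  have "real n * \<theta> - err \<le> 2 * (real n * \<theta>) - (1 + 2 * \<epsilon>) * (real n * (\<theta> + g * (a / c)\<^sup>2))"
  proof -
    have 1: "\<epsilon> * \<theta> \<le> \<epsilon> * (a\<^sup>2 / c)" by (intro mult_left_mono theta_le eps)
    have 2: "\<epsilon> * (g * (a / c)\<^sup>2) \<le> 1 / 2 * (g * (a / c)\<^sup>2)" using eps g by (intro mult_right_mono) auto
    have 3: "0 \<le> \<epsilon> * (a\<^sup>2 / c)" using eps c by simp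
    have "2 * (\<epsilon> * \<theta>) + g * (a / c)\<^sup>2 + 2 * (\<epsilon> * (g * (a / c)\<^sup>2)) \<le> 2 * (g * (a / c)\<^sup>2) + 6 * (\<epsilon> * (a\<^sup>2 / c))"
      using 1 2 3 by linarith
    also have "\<dots> = a\<^sup>2 * (2 * g / c\<^sup>2 + 6 * \<epsilon> / c)" by (simp add: algebra_simps power_divide)
    finally have "real n * (2 * (\<epsilon> * \<theta>) + g * (a / c)\<^sup>2 + 2 * (\<epsilon> * (g * (a / c)\<^sup>2))) \<le> err"
      unfolding err_def mult.assoc by (intro mult_left_mono) auto
    then show ?thesis by (simp add: algebra_simps)
  qed
  also have "\<dots> \<le> 2 * (real n * \<theta>) - (1 + 2 * \<epsilon>) * (\<Sum>j=1..n. (scalar_prod p (x j))\<^sup>2)"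
    using sq eps by (intro diff_left_mono mult_left_mono) auto
  also have "ereal \<dots> \<le> neg2log (el_ratio d n x)"
  proof -
    have "ereal (2 * (\<Sum>j=1..n. scalar_prod p (x j)) - (1 + 2 * \<epsilon>) * (\<Sum>j=1..n. (scalar_prod p (x j))\<^sup>2)) \<le> neg2log (el_ratio d n x)"
      by (rule neg2log_el_ratio_ge) (use n x bd eps in auto)
    then show ?thesis unfolding sum_scalar_prod \<theta> .
  qed
  finally show ?thesis by simp
qed

text \<open>As \<open>g \<le> c / 2\<close>, the empirical matrix is still positive definite with
  constant \<open>c / 2\<close>, so the linear system for \<zeta> is solvable. The deviations built
  from \<zeta> satisfy both constraints exactly, and their squares sum to
  \<open>n * (\<theta>' / (1 - \<theta>'))\<close>, where \<theta>' is the quadratic form of the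
  mean in the inverse of \<open>W_emp\<close>.\<close>

lemma upper: "neg2log (el_ratio d n x) \<le> ereal (real n * \<theta> + err)"
proof -
  have pd': "c / 2 * (vnorm u)\<^sup>2 \<le> scalar_prod u (W_emp *\<^sub>v u)" if u: "u \<in> carrier_vec d" for u
  proof -
    have "scalar_prod u (W *\<^sub>v u) - g * vnorm u * vnorm u \<le> scalar_prod u (W_emp *\<^sub>v u)"
      using close[OF u u] unfolding W_emp_def[symmetric] by linarith
    moreover have "g * vnorm u * vnorm u \<le> c / 2 * (vnorm u)\<^sup>2"
      using mult_right_mono[OF g(2), of "vnorm u * vnorm u"] by (simp only: power2_eq_square mult.assoc mult_nonneg_nonneg vnorm_nonneg)
    ultimately show ?thesis using pd[OF u] by (simp add: algebra_simps)
  qed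
  obtain P' where P': "P' \<in> carrier_mat d d" "W_emp * P' = 1\<^sub>m d"
  proof (rule positive_definite_inverse[OF carriers(3)])
    fix v :: "real Matrix.vec" assume v: "v \<in> carrier_vec d" "v \<noteq> 0\<^sub>v d"
    then have "vnorm v \<noteq> 0" by (simp add: vnorm_eq_0_iff)
    then have "0 < c / 2 * (vnorm v)\<^sup>2" using c by simp
    then show "0 < scalar_prod v (W_emp *\<^sub>v v)" using pd'[OF v(1)] by linarith
  qed
  define \<zeta> where "\<zeta> = P' *\<^sub>v xbar"
  have \<zeta> [simp]: "\<zeta> \<in> carrier_vec d" using P' by (simp add: \<zeta>_def)
  have W\<zeta>: "W_emp *\<^sub>v \<zeta> = xbar"
  proof -
    have "W_emp *\<^sub>v \<zeta> = (W_emp * P') *\<^sub>v xbar" unfolding \<zeta>_def by (rule assoc_mult_mat_vec[symmetric, OF carriers(3) P'(1) carriers(1)])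
    then show ?thesis by (simp add: P')
  qed
  define \<theta>' where "\<theta>' = scalar_prod \<zeta> xbar"
  have c2: "0 < c / 2" using c by simp
  note * = positive_definite_solution_norm[OF \<zeta> carriers(1) W\<zeta> c2 pd'[OF \<zeta>], folded a_def \<theta>'_def]
  have z: "vnorm \<zeta> \<le> 2 * a / c" and t1: "\<theta>' \<le> 2 * a\<^sup>2 / c" and t0: "0 \<le> \<theta>'" using * by (simp_all add: mult.commute)
  have t2: "\<theta>' \<le> \<epsilon> / 4"
  proof -
    have "2 * a\<^sup>2 / c \<le> 2 * (a * b / c)"
      using a_le_b a_nonneg c by (simp add: power2_eq_square divide_right_mono mult_left_mono)
    then show ?thesis using t1 eps(3) by linarith
  qed
  have t3: "\<theta>' \<le> 1 / 8" using t2 eps by linarith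
  \<comment> \<open>The pairings of \<zeta> have average \<theta>', so subtracting it makes the
    deviations sum to 0. Since the data weighted by the pairings sum to \<open>n\<close> times
    \<open>xbar\<close>, division by \<open>1 - \<theta>'\<close> then makes the moment constraint
    exact.\<close>
  define \<delta> where "\<delta> j = (scalar_prod \<zeta> (x j) - \<theta>') / (1 - \<theta>')" for j
  have "\<bar>\<delta> j\<bar> \<le> \<epsilon>" if j: "j \<in> {1..n}" for j
  proof -
    have "\<bar>scalar_prod \<zeta> (x j)\<bar> \<le> vnorm \<zeta> * vnorm (x j)" by (rule vnorm_Cauchy_Schwarz[OF \<zeta> x[OF j]])
    also have "\<dots> \<le> 2 * a / c * b" using z b[OF j] a_nonneg c by (intro mult_mono) auto
    also have "\<dots> = 2 * (a * b / c)" by simp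
    also have "\<dots> = \<epsilon> / 4" unfolding eps(3) by simp
    finally have "\<bar>scalar_prod \<zeta> (x j) - \<theta>'\<bar> \<le> \<epsilon> / 2" using t2 t0 by linarith
    also have "\<epsilon> / 2 \<le> \<epsilon> * (1 - \<theta>')" using t3 eps(1) mult_left_mono[of "1/2" "1 - \<theta>'" \<epsilon>] by simp
    finally show ?thesis using t3 by (simp add: \<delta>_def divide_le_eq abs_divide)
  qed
  moreover have "(\<Sum>j=1..n. \<delta> j) = 0"
    unfolding \<delta>_def sum_divide_distrib[symmetric] sum_subtractf sum_scalar_prod by (simp add: \<theta>'_def)
  moreover have "(\<Sum>j=1..n. (1 - \<delta> j) * x j $ i) = 0" if i: "i < d" for i
  proof -
    have "(\<Sum>j=1..n. scalar_prod \<zeta> (x j) * x j $ i) = (\<Sum>j=1..n. (scalar_prod \<zeta> (x j) \<cdot>\<^sub>v x j) $ i)"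
      using i x[THEN carrier_vecD] by (intro sum.cong) auto
    also have "\<dots> = real n * vec_avg d n (\<lambda>j. scalar_prod \<zeta> (x j) \<cdot>\<^sub>v x j) $ i"
      using i n by (simp add: vec_avg_def)
    also have "\<dots> = real n * xbar $ i"
      using W\<zeta> mat_avg_outer_mult_vec[of n x d \<zeta>] x by (simp add: W_emp_def)
    finally have 1: "(\<Sum>j=1..n. scalar_prod \<zeta> (x j) * x j $ i) = real n * xbar $ i" .
    have 2: "(\<Sum>j=1..n. x j $ i) = real n * xbar $ i" using i n by (simp add: vec_avg_def xbar_def)
    have "(\<Sum>j=1..n. (1 - \<delta> j) * x j $ i) = (\<Sum>j=1..n. (x j $ i - scalar_prod \<zeta> (x j) * x j $ i) / (1 - \<theta>'))"
      using t3 by (intro sum.cong refl) (simp add: \<delta>_def field_simps)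
    also have "\<dots> = 0" unfolding sum_divide_distrib[symmetric] sum_subtractf 1 2 by simp
    finally show ?thesis .
  qed
  ultimately have main: "neg2log (el_ratio d n x) \<le> ereal ((1 + 2 * \<epsilon>) * (\<Sum>j=1..n. (\<delta> j)\<^sup>2))"
    by (intro neg2log_el_ratio_le n x eps)
  have "(\<Sum>j=1..n. (\<delta> j)\<^sup>2) = real n * (\<theta>' / (1 - \<theta>'))"
  proof -
    have "(\<Sum>j=1..n. (scalar_prod \<zeta> (x j) - \<theta>')\<^sup>2)
      = (\<Sum>j=1..n. scalar_prod \<zeta> (x j) * scalar_prod \<zeta> (x j) - 2 * \<theta>' * scalar_prod \<zeta> (x j) + \<theta>'\<^sup>2)"
      by (intro sum.cong refl) (simp add: power2_eq_square algebra_simps)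
    also have "\<dots> = (\<Sum>j=1..n. scalar_prod \<zeta> (x j) * scalar_prod \<zeta> (x j)) - 2 * \<theta>' * (\<Sum>j=1..n. scalar_prod \<zeta> (x j)) + real n * \<theta>'\<^sup>2"
      by (simp add: sum_subtractf sum.distrib sum_distrib_left)
    also have "\<dots> = real n * \<theta>' * (1 - \<theta>')"
      unfolding sum_scalar_prod sum_scalar_prod_mult[OF \<zeta> \<zeta>] W\<zeta> \<theta>'_def[symmetric] by (simp add: algebra_simps power2_eq_square)
    finally show ?thesis using t3 unfolding \<delta>_def power_divide sum_divide_distrib[symmetric]
      by (simp add: power2_eq_square)
  qed
  moreover have "(1 + 2 * \<epsilon>) * (\<theta>' / (1 - \<theta>')) \<le> \<theta> + a\<^sup>2 * (2 * g / c\<^sup>2 + 6 * \<epsilon> / c)"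
  proof -
    have "\<theta>' / (1 - \<theta>') \<le> \<theta>' * (1 + 2 * \<theta>')"
    proof -
      have "0 \<le> \<theta>' * (\<theta>' * (1 - 2 * \<theta>'))" using t0 t3 by (intro mult_nonneg_nonneg) auto
      then have "\<theta>' \<le> (\<theta>' * (1 + 2 * \<theta>')) * (1 - \<theta>')" by (simp add: algebra_simps)
      then show ?thesis using t3 by (simp add: pos_divide_le_eq)
    qed
    then have "(1 + 2 * \<epsilon>) * (\<theta>' / (1 - \<theta>')) \<le> (1 + 2 * \<epsilon>) * (\<theta>' * (1 + 2 * \<theta>'))" using eps by (intro mult_left_mono) auto
    also have "\<dots> = \<theta>' * ((1 + 2 * \<epsilon>) * (1 + 2 * \<theta>'))" by simp
    also have "\<dots> \<le> \<theta>' * (1 + 3 * \<epsilon>)"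
    proof (intro mult_left_mono t0)
      have "\<epsilon> * \<theta>' \<le> 1 / 2 * \<theta>'" using eps t0 by (intro mult_right_mono) auto
      moreover have "(1 + 2 * \<epsilon>) * (1 + 2 * \<theta>') = 1 + 2 * \<epsilon> + 2 * \<theta>' + 4 * (\<epsilon> * \<theta>')" by (simp add: algebra_simps)
      ultimately show "(1 + 2 * \<epsilon>) * (1 + 2 * \<theta>') \<le> 1 + 3 * \<epsilon>" using t2 by linarith
    qed
    also have "\<dots> = \<theta>' + 3 * (\<epsilon> * \<theta>')" by (simp add: algebra_simps)
    also have "\<dots> \<le> \<theta>' + 3 * (\<epsilon> * (2 * a\<^sup>2 / c))" by (intro add_left_mono mult_left_mono t1 eps) auto
    \<comment> \<open>A resolvent identity in weak form: both numbers pair \<open>p\<close> with an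
      image of \<zeta>, under \<open>W_emp\<close> for \<theta> and under \<open>W\<close> for
      \<theta>', so \<open>close\<close> compares them directly.\<close>
    also have "\<theta>' \<le> \<theta> + g * (a / c) * (2 * a / c)"
    proof -
      have "\<theta> = scalar_prod p (W_emp *\<^sub>v \<zeta>)" unfolding W\<zeta> \<theta>_def by (rule comm_scalar_prod[OF carriers(1,2)])
      moreover have "\<theta>' = scalar_prod p (W *\<^sub>v \<zeta>)" unfolding \<theta>'_def sym[OF carriers(2) \<zeta>] W_p ..
      moreover have "g * vnorm p * vnorm \<zeta> \<le> g * (a / c) * (2 * a / c)"
        using p_norm z g a_nonneg c by (intro mult_mono mult_left_mono) auto
      ultimately show ?thesis using close[OF carriers(2) \<zeta>] unfolding W_emp_def[symmetric] by linarith
    qed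
    also have "\<theta> + g * (a / c) * (2 * a / c) + 3 * (\<epsilon> * (2 * a\<^sup>2 / c)) = \<theta> + a\<^sup>2 * (2 * g / c\<^sup>2 + 6 * \<epsilon> / c)"
      by (simp add: algebra_simps power2_eq_square)
    finally show ?thesis by simp
  qed
  then have "real n * ((1 + 2 * \<epsilon>) * (\<theta>' / (1 - \<theta>'))) \<le> real n * (\<theta> + a\<^sup>2 * (2 * g / c\<^sup>2 + 6 * \<epsilon> / c))"
    by (intro mult_left_mono) auto
  ultimately have "(1 + 2 * \<epsilon>) * (\<Sum>j=1..n. (\<delta> j)\<^sup>2) \<le> real n * \<theta> + err"
    by (simp add: err_def algebra_simps)
  then show ?thesis using main by (meson ereal_less_eq(3) order_trans)
qed

end

section \<open>The operator norm\<close>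

lemma vnorm_mult_mat_vec_Frobenius:
  assumes A: "A \<in> carrier_mat d d" and v: "v \<in> carrier_vec d"
  shows "vnorm (A *\<^sub>v v) \<le> sqrt (\<Sum>i<d. \<Sum>k<d. (A $$ (i, k))\<^sup>2) * vnorm v"
proof (rule power2_le_imp_le)
  have "(vnorm (A *\<^sub>v v))\<^sup>2 = (\<Sum>i<d. (scalar_prod (row A i) v)\<^sup>2)"
    using A v by (subst vnorm_square_sum[of _ d]) (auto intro!: sum.cong)
  also have "\<dots> \<le> (\<Sum>i<d. (vnorm (row A i))\<^sup>2 * (vnorm v)\<^sup>2)"
  proof (intro sum_mono)
    fix i assume "i \<in> {..<d}"
    then have "\<bar>scalar_prod (row A i) v\<bar> \<le> vnorm (row A i) * vnorm v"
      using A v by (intro vnorm_Cauchy_Schwarz[of _ d]) auto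
    from power_mono[OF this, of 2] show "(scalar_prod (row A i) v)\<^sup>2 \<le> (vnorm (row A i))\<^sup>2 * (vnorm v)\<^sup>2"
      by (simp add: power_mult_distrib)
  qed
  also have "\<dots> = (\<Sum>i<d. \<Sum>k<d. (A $$ (i, k))\<^sup>2) * (vnorm v)\<^sup>2"
  proof -
    have "(vnorm (row A i))\<^sup>2 = (\<Sum>k<d. (A $$ (i, k))\<^sup>2)" if "i < d" for i
      using A that by (subst vnorm_square_sum[of _ d]) auto
    then show ?thesis unfolding sum_distrib_right[symmetric] by simp
  qed
  finally show "(vnorm (A *\<^sub>v v))\<^sup>2 \<le> (sqrt (\<Sum>i<d. \<Sum>k<d. (A $$ (i, k))\<^sup>2) * vnorm v)\<^sup>2"
    by (simp add: power_mult_distrib sum_nonneg)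
qed (simp add: sum_nonneg)

text \<open>The operator norm is a supremum in the reals, so boundedness must be known before the
  supremum dominates anything. The Frobenius norm provides it.\<close>

lemma bdd_above_unit_vecs:
  assumes A: "A \<in> carrier_mat d d"
  shows "bdd_above ((\<lambda>u. vnorm (A *\<^sub>v u)) ` unit_vecs d)"
proof (rule bdd_aboveI2)
  fix u assume "u \<in> unit_vecs d"
  then show "vnorm (A *\<^sub>v u) \<le> sqrt (\<Sum>i<d. \<Sum>k<d. (A $$ (i, k))\<^sup>2)"
    using vnorm_mult_mat_vec_Frobenius[OF A, of u] by (auto simp: unit_vecs_def)
qed

text \<open>In dimension 0 there are no unit vectors and the supremum would run over the empty set,
  hence the hypothesis on \<open>d\<close> here and below.\<close>

lemma unit_vecs_nonempty: assumes "1 \<le> d" shows "unit_vec d 0 \<in> unit_vecs d"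
proof -
  have "scalar_prod (unit_vec d 0) (unit_vec d 0) = (1 :: real)" using assms by (subst scalar_prod_left_unit) auto
  then show ?thesis by (simp add: unit_vecs_def vnorm_def)
qed

lemma normalize_unit_vecs:
  assumes "v \<in> carrier_vec d" "vnorm v \<noteq> 0" shows "(1 / vnorm v) \<cdot>\<^sub>v v \<in> unit_vecs d"
  using assms by (simp add: unit_vecs_def)

lemma vnorm_mult_le_op_norm:
  assumes A: "A \<in> carrier_mat d d" and v: "v \<in> carrier_vec d"
  shows "vnorm (A *\<^sub>v v) \<le> op_norm A * vnorm v"
proof (cases "vnorm v = 0")
  case True
  then have "v = 0\<^sub>v d" using v by (simp add: vnorm_eq_0_iff)
  then show ?thesis using A vnorm_mult_mat_vec_Frobenius[OF A v] by simp
next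
  case False
  then have pos: "0 < vnorm v" using vnorm_nonneg[of v] by linarith
  have "vnorm (A *\<^sub>v ((1 / vnorm v) \<cdot>\<^sub>v v)) \<le> op_norm A"
    unfolding op_norm_def using A normalize_unit_vecs[OF v False] bdd_above_unit_vecs[OF A]
    by (intro cSUP_upper) auto
  then show ?thesis using pos A v by (simp add: mult_mat_vec[of _ d d] divide_le_eq)
qed

lemma op_norm_least:
  assumes A: "A \<in> carrier_mat d d" and d: "1 \<le> d" and "\<And>v. v \<in> carrier_vec d \<Longrightarrow> vnorm (A *\<^sub>v v) \<le> c * vnorm v"
  shows "op_norm A \<le> c"
  unfolding op_norm_def
proof (rule cSUP_least)
  show "unit_vecs (dim_col A) \<noteq> {}" using unit_vecs_nonempty[OF d] A by auto
  fix u assume "u \<in> unit_vecs (dim_col A)"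
  then show "vnorm (A *\<^sub>v u) \<le> c" using assms(3)[of u] A by (auto simp: unit_vecs_def)
qed

lemma op_norm_nonneg: assumes "A \<in> carrier_mat d d" "1 \<le> d" shows "0 \<le> op_norm A"
proof -
  have "unit_vec d 0 \<in> unit_vecs d" by (rule unit_vecs_nonempty[OF assms(2)])
  then have "vnorm (A *\<^sub>v unit_vec d 0) \<le> op_norm A" using vnorm_mult_le_op_norm[OF assms(1), of "unit_vec d 0"]
    by (auto simp: unit_vecs_def)
  then show ?thesis using vnorm_nonneg order_trans by blast
qed

lemma op_norm_le_Frobenius:
  assumes "A \<in> carrier_mat d d" "1 \<le> d" shows "op_norm A \<le> sqrt (\<Sum>i<d. \<Sum>k<d. (A $$ (i, k))\<^sup>2)"
  by (rule op_norm_least[OF assms vnorm_mult_mat_vec_Frobenius[OF assms(1)]])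

lemma op_norm_bilinear:
  assumes A: "A \<in> carrier_mat d d" and u: "u \<in> carrier_vec d" and v: "v \<in> carrier_vec d"
  shows "\<bar>scalar_prod u (A *\<^sub>v v)\<bar> \<le> op_norm A * vnorm u * vnorm v"
proof -
  have "\<bar>scalar_prod u (A *\<^sub>v v)\<bar> \<le> vnorm u * vnorm (A *\<^sub>v v)" using A u v by (intro vnorm_Cauchy_Schwarz[of _ d]) auto
  also have "\<dots> \<le> vnorm u * (op_norm A * vnorm v)" by (intro mult_left_mono vnorm_mult_le_op_norm[OF A v]) simp
  finally show ?thesis by (simp add: mult_ac)
qed

lemma op_norm_le_bilinear:
  assumes A: "A \<in> carrier_mat d d" and d: "1 \<le> d" and c: "0 \<le> c"
    and le: "\<And>u v. u \<in> carrier_vec d \<Longrightarrow> v \<in> carrier_vec d \<Longrightarrow> \<bar>scalar_prod u (A *\<^sub>v v)\<bar> \<le> c * vnorm u * vnorm v"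
  shows "op_norm A \<le> c"
proof (rule op_norm_least[OF A d])
  fix v :: "real Matrix.vec" assume v: "v \<in> carrier_vec d"
  show "vnorm (A *\<^sub>v v) \<le> c * vnorm v"
    using A v c le[OF _ v] by (intro vnorm_le_scalar_prod[of _ d]) (auto simp: mult_ac)
qed

lemma op_norm_triangle_minus:
  assumes A: "A \<in> carrier_mat d d" and B: "B \<in> carrier_mat d d" and C: "C \<in> carrier_mat d d" and d: "1 \<le> d"
  shows "op_norm (A - C) \<le> op_norm (A - B) + op_norm (B - C)"
proof (rule op_norm_least[OF _ d])
  have AB: "A - B \<in> carrier_mat d d" and BC: "B - C \<in> carrier_mat d d" and AC: "A - C \<in> carrier_mat d d" using A B C by auto
  show "A - C \<in> carrier_mat d d" by (rule AC)
  fix v :: "real Matrix.vec" assume v: "v \<in> carrier_vec d"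
  have "(A - C) *\<^sub>v v = (A - B) *\<^sub>v v + (B - C) *\<^sub>v v"
  proof -
    have "A - C = (A - B) + (B - C)" using A B C by auto
    then show ?thesis using add_mult_distrib_mat_vec[OF AB BC v] by simp
  qed
  then have "vnorm ((A - C) *\<^sub>v v) \<le> vnorm ((A - B) *\<^sub>v v) + vnorm ((B - C) *\<^sub>v v)"
    using AB BC v vnorm_triangle[of "(A - B) *\<^sub>v v" d "(B - C) *\<^sub>v v"] by auto
  also have "\<dots> \<le> op_norm (A - B) * vnorm v + op_norm (B - C) * vnorm v"
    by (intro add_mono vnorm_mult_le_op_norm[OF AB v] vnorm_mult_le_op_norm[OF BC v])
  finally show "vnorm ((A - C) *\<^sub>v v) \<le> (op_norm (A - B) + op_norm (B - C)) * vnorm v" by (simp add: distrib_right)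
qed

section \<open>Measurability of the operator norm\<close>

text \<open>Indexing by lists of rationals makes a quantifier over this dense set a quantifier over
  a countable type.\<close>

definition rational_vecs :: "nat \<Rightarrow> real Matrix.vec set" where
  "rational_vecs d = (\<lambda>l :: rat list. Matrix.vec d (\<lambda>i. real_of_rat (l ! i))) ` UNIV"

lemma rational_vecs_dense:
  fixes v :: "real Matrix.vec"
  obtains r where "\<And>k. r k \<in> rational_vecs d" "\<And>i. i < d \<Longrightarrow> (\<lambda>k. r k $ i) \<longlonglongrightarrow> v $ i"
proof -
  have "\<exists>q. \<forall>k. \<bar>real_of_rat (q k) - v $ i\<bar> < 1 / real (Suc k)" for i
  proof (rule choice, rule allI)
    fix k
    obtain q where "v $ i - 1 / real (Suc k) < real_of_rat q" "real_of_rat q < v $ i"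
      using of_rat_dense[of "v $ i - 1 / real (Suc k)" "v $ i"] by auto
    then show "\<exists>q. \<bar>real_of_rat q - v $ i\<bar> < 1 / real (Suc k)" by (intro exI[of _ q]) (auto simp: abs_less_iff)
  qed
  then obtain q where q: "\<bar>real_of_rat (q i k) - v $ i\<bar> < 1 / real (Suc k)" for i k by metis
  define r where "r k = Matrix.vec d (\<lambda>i. real_of_rat (map (\<lambda>i. q i k) [0..<d] ! i))" for k
  have "(\<lambda>k. r k $ i) \<longlonglongrightarrow> v $ i" if "i < d" for i
  proof (rule Lim_transform2[OF tendsto_const, of "v $ i"])
    have "(\<lambda>k. v $ i - r k $ i) \<longlonglongrightarrow> 0"
    proof (rule Lim_null_comparison[OF _ LIMSEQ_inverse_real_of_nat])
      show "\<forall>\<^sub>F k in sequentially. norm (v $ i - r k $ i) \<le> inverse (real (Suc k))"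
      proof (rule always_eventually, rule allI)
        fix k show "norm (v $ i - r k $ i) \<le> inverse (real (Suc k))"
          using q[of i k] that by (simp add: r_def abs_minus_commute inverse_eq_divide less_imp_le del: of_nat_Suc)
      qed
    qed
    then show "(\<lambda>k. v $ i - r k $ i) \<longlonglongrightarrow> 0" .
  qed
  moreover have "r k \<in> rational_vecs d" for k unfolding rational_vecs_def r_def by blast
  ultimately show ?thesis using that by blast
qed

lemma rational_vecs_carrier: "r \<in> rational_vecs d \<Longrightarrow> r \<in> carrier_vec d"
  by (auto simp: rational_vecs_def)

lemma vnorm_mult_le_from_rational:
  assumes A: "A \<in> carrier_mat d d" and v: "v \<in> carrier_vec d"
    and r: "\<And>r. r \<in> rational_vecs d \<Longrightarrow> vnorm (A *\<^sub>v r) \<le> c * vnorm r"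
  shows "vnorm (A *\<^sub>v v) \<le> c * vnorm v"
proof -
  obtain r where rr: "\<And>k. r k \<in> rational_vecs d" and rl: "\<And>i. i < d \<Longrightarrow> (\<lambda>k. r k $ i) \<longlonglongrightarrow> v $ i"
    using rational_vecs_dense[where d=d and v=v] by blast
  have rc: "r k \<in> carrier_vec d" for k by (rule rational_vecs_carrier[OF rr])
  have nrm: "vnorm u = sqrt (\<Sum>i<d. (u $ i)\<^sup>2)" if "u \<in> carrier_vec d" for u
    using vnorm_square_sum[OF that] vnorm_nonneg[of u] by (metis real_sqrt_abs abs_of_nonneg)
  have comp: "(A *\<^sub>v u) $ i = (\<Sum>k<d. A $$ (i, k) * u $ k)" if "u \<in> carrier_vec d" "i < d" for u i
    using that A by (simp add: scalar_prod_def atLeast0LessThan)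
  have l1: "(\<lambda>k. vnorm (r k)) \<longlonglongrightarrow> vnorm v"
    unfolding nrm[OF rc] nrm[OF v] by (intro tendsto_intros rl) auto
  have l2: "(\<lambda>k. vnorm (A *\<^sub>v r k)) \<longlonglongrightarrow> vnorm (A *\<^sub>v v)"
  proof -
    have "(\<lambda>k. sqrt (\<Sum>i<d. (\<Sum>l<d. A $$ (i, l) * r k $ l)\<^sup>2)) \<longlonglongrightarrow> sqrt (\<Sum>i<d. (\<Sum>l<d. A $$ (i, l) * v $ l)\<^sup>2)"
      by (intro tendsto_intros rl) auto
    moreover have "vnorm (A *\<^sub>v u) = sqrt (\<Sum>i<d. (\<Sum>l<d. A $$ (i, l) * u $ l)\<^sup>2)" if "u \<in> carrier_vec d" for u
      using that A comp[OF that] by (subst nrm) auto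
    ultimately show ?thesis using rc v by simp
  qed
  show ?thesis by (rule LIMSEQ_le[OF l2 tendsto_mult_left[OF l1, of c]]) (use r[OF rr] in auto)
qed

text \<open>A bound on the operator norm is tested by the homogeneous inequality
  \<open>vnorm (A *\<^sub>v r) \<le> c * vnorm r\<close> on rational vectors. Homogeneity avoids
  approximating unit vectors by rational vectors of norm exactly 1.\<close>

lemma op_norm_measurable:
  assumes A: "\<And>\<omega>. \<omega> \<in> space M \<Longrightarrow> A \<omega> \<in> carrier_mat d d" and d: "1 \<le> d"
    and meas: "\<And>i k. i < d \<Longrightarrow> k < d \<Longrightarrow> (\<lambda>\<omega>. A \<omega> $$ (i, k)) \<in> borel_measurable M"
  shows "(\<lambda>\<omega>. op_norm (A \<omega>)) \<in> borel_measurable M"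
  unfolding borel_measurable_iff_le
proof (rule allI)
  fix c
  have m: "(\<lambda>\<omega>. vnorm (A \<omega> *\<^sub>v r)) \<in> borel_measurable M" if r: "r \<in> carrier_vec d" for r
  proof -
    have "(\<lambda>\<omega>. sqrt (\<Sum>i<d. (\<Sum>l<d. A \<omega> $$ (i, l) * r $ l)\<^sup>2)) \<in> borel_measurable M"
    proof -
      have [measurable]: "(\<lambda>\<omega>. (\<Sum>i<d. (\<Sum>l<d. A \<omega> $$ (i, l) * r $ l)\<^sup>2)) \<in> borel_measurable M"
        by (intro borel_measurable_sum borel_measurable_power borel_measurable_times) (use meas in auto)
      show ?thesis by measurable
    qed
    moreover have "vnorm (A \<omega> *\<^sub>v r) = sqrt (\<Sum>i<d. (\<Sum>l<d. A \<omega> $$ (i, l) * r $ l)\<^sup>2)" if "\<omega> \<in> space M" for \<omega>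
      using A[OF that] r by (simp add: vnorm_def scalar_prod_def atLeast0LessThan power2_eq_square)
    ultimately show ?thesis by (simp cong: measurable_cong)
  qed
  have "{\<omega>\<in>space M. op_norm (A \<omega>) \<le> c} = {\<omega>\<in>space M. \<forall>r\<in>rational_vecs d. vnorm (A \<omega> *\<^sub>v r) \<le> c * vnorm r}"
  proof (rule Collect_cong, rule conj_cong[OF refl])
    fix \<omega> assume w: "\<omega> \<in> space M"
    show "op_norm (A \<omega>) \<le> c \<longleftrightarrow> (\<forall>r\<in>rational_vecs d. vnorm (A \<omega> *\<^sub>v r) \<le> c * vnorm r)"
    proof
      assume le: "op_norm (A \<omega>) \<le> c"
      show "\<forall>r\<in>rational_vecs d. vnorm (A \<omega> *\<^sub>v r) \<le> c * vnorm r"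
      proof
        fix r :: "real Matrix.vec" assume "r \<in> rational_vecs d"
        then have "vnorm (A \<omega> *\<^sub>v r) \<le> op_norm (A \<omega>) * vnorm r" by (intro vnorm_mult_le_op_norm[OF A[OF w]] rational_vecs_carrier)
        also have "\<dots> \<le> c * vnorm r" by (intro mult_right_mono le) simp
        finally show "vnorm (A \<omega> *\<^sub>v r) \<le> c * vnorm r" .
      qed
    next
      assume le: "\<forall>r\<in>rational_vecs d. vnorm (A \<omega> *\<^sub>v r) \<le> c * vnorm r"
      show "op_norm (A \<omega>) \<le> c"
      proof (rule op_norm_least[OF A[OF w] d])
        fix v :: "real Matrix.vec" assume "v \<in> carrier_vec d"
        then show "vnorm (A \<omega> *\<^sub>v v) \<le> c * vnorm v"
          by (rule vnorm_mult_le_from_rational[OF A[OF w]]) (use le in blast)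
      qed
    qed
  qed
  also have "\<dots> \<in> sets M"
  proof -
    let ?V = "\<lambda>l :: rat list. Matrix.vec d (\<lambda>i. real_of_rat (l ! i))"
    have "{\<omega>\<in>space M. \<forall>r\<in>rational_vecs d. vnorm (A \<omega> *\<^sub>v r) \<le> c * vnorm r}
      = {\<omega>\<in>space M. \<forall>l. vnorm (A \<omega> *\<^sub>v ?V l) \<le> c * vnorm (?V l)}"
      by (auto simp: rational_vecs_def)
    also have "\<dots> \<in> sets M"
    proof (rule sets.sets_Collect_countable_All)
      fix l
      have [measurable]: "(\<lambda>\<omega>. vnorm (A \<omega> *\<^sub>v ?V l)) \<in> borel_measurable M" by (intro m) simp
      show "{\<omega>\<in>space M. vnorm (A \<omega> *\<^sub>v ?V l) \<le> c * vnorm (?V l)} \<in> sets M" by measurable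
    qed
    finally show ?thesis .
  qed
  finally show "{\<omega>\<in>space M. op_norm (A \<omega>) \<le> c} \<in> sets M" .
qed

section \<open>Measurability of the empirical likelihood ratio\<close>

text \<open>Projection along a compact factor is a closed map, which is the tube lemma.\<close>

lemma closed_projection_compact:
  assumes K: "compact K" and S: "closed (S :: ('a :: topological_space \<times> 'b :: topological_space) set)"
  shows "closed {y. \<exists>x\<in>K. (x, y) \<in> S}"
proof -
  have "closed_map (prod_topology (top_of_set K) euclidean) euclidean (snd :: 'a \<times> 'b \<Rightarrow> 'b)"
    using K by (intro Abstract_Topological_Spaces.closed_map_snd) (simp add: compact_space_subtopology)
  moreover have "closedin (prod_topology (top_of_set K) euclidean) (S \<inter> (K \<times> UNIV))"
    unfolding prod_topology_subtopology prod_topology_euclidean using S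
    by (auto simp: closedin_closed)
  ultimately have "closedin euclidean (snd ` (S \<inter> (K \<times> UNIV)))" by (auto simp: closed_map_def)
  moreover have "snd ` (S \<inter> (K \<times> UNIV)) = {y. \<exists>x\<in>K. (x, y) \<in> S}" by force
  ultimately show ?thesis by simp
qed

text \<open>Weights vanish outside \<open>{1..n}\<close>, which makes the simplex compact in the product topology.\<close>

definition simplex_functions :: "nat \<Rightarrow> (nat \<Rightarrow> real) set" where
  "simplex_functions n = (PiE UNIV (\<lambda>j. if j \<in> {1..n} then {0..1} else {0})) \<inter> {\<pi>. (\<Sum>j=1..n. \<pi> j) = 1}"

lemma compact_simplex_functions: "compact (simplex_functions n)"
proof -
  have "compactin (product_topology (\<lambda>_. euclidean) UNIV) (PiE UNIV (\<lambda>j :: nat. if j \<in> {1..n} then {0..1 :: real} else {0}))"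
    unfolding compactin_PiE by auto
  then have "compact (PiE UNIV (\<lambda>j :: nat. if j \<in> {1..n} then {0..1 :: real} else {0}))"
    by (simp add: euclidean_product_topology)
  moreover have "closed {\<pi> :: nat \<Rightarrow> real. (\<Sum>j=1..n. \<pi> j) = 1}"
    by (intro closed_Collect_eq continuous_intros continuous_on_product_coordinates)
  ultimately show ?thesis unfolding simplex_functions_def by (rule compact_Int_closed)
qed

text \<open>The data are recoded as a function \<open>y\<close> on index pairs, an element of a
  product space with a topology. Clearing the weights outside \<open>{1..n}\<close> changes neither
  the products nor the constraints.\<close>

lemma el_products_eq_image:
  assumes x: "\<And>j i. j \<in> {1..n} \<Longrightarrow> i < d \<Longrightarrow> x j $ i = y (j, i)" and xc: "\<And>j. j \<in> {1..n} \<Longrightarrow> x j \<in> carrier_vec d" and n: "n \<ge> 1"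
  shows "el_products d n x = (\<lambda>\<pi>. \<Prod>j=1..n. real n * \<pi> j) ` {\<pi>\<in>simplex_functions n. \<forall>i<d. (\<Sum>j=1..n. \<pi> j * y (j, i)) = 0}"
proof -
  have avg: "vec_avg d n (\<lambda>j. \<pi> j \<cdot>\<^sub>v x j) = 0\<^sub>v d \<longleftrightarrow> (\<forall>i<d. (\<Sum>j=1..n. \<pi> j * y (j, i)) = 0)" for \<pi>
  proof -
    have "(\<Sum>j=1..n. (\<pi> j \<cdot>\<^sub>v x j) $ i) = (\<Sum>j=1..n. \<pi> j * y (j, i))" if "i < d" for i
      using x xc[THEN carrier_vecD] that by (intro sum.cong) auto
    then show ?thesis using n by (auto simp: vec_avg_def vec_eq_iff)
  qed
  have ex: "\<exists>\<pi>'\<in>simplex_functions n. (\<forall>j\<in>{1..n}. \<pi>' j = \<pi> j)" if "\<pi> \<in> prob_simplex n" for \<pi>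
    using that by (intro bexI[of _ "\<lambda>j. if j \<in> {1..n} then \<pi> j else 0"]) (auto simp: simplex_functions_def prob_simplex_def)
  have sub: "\<pi> \<in> prob_simplex n" if "\<pi> \<in> simplex_functions n" for \<pi>
  proof -
    have "\<pi> j \<in> (if j \<in> {1..n} then {0..1} else {0})" for j using that by (auto simp: simplex_functions_def PiE_def Pi_def)
    then have "0 \<le> \<pi> j \<and> \<pi> j \<le> 1" if "j \<in> {1..n}" for j using that by (metis atLeastAtMost_iff)
    then show ?thesis using that by (auto simp: simplex_functions_def prob_simplex_def)
  qed
  show ?thesis
  proof (rule Set.set_eqI, rule iffI)
    fix p assume "p \<in> el_products d n x"
    then obtain \<pi> where p: "p = (\<Prod>j=1..n. real n * \<pi> j)" and \<pi>: "\<pi> \<in> prob_simplex n" "\<forall>i<d. (\<Sum>j=1..n. \<pi> j * y (j, i)) = 0"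
      unfolding el_products_iff avg by metis
    obtain \<pi>' where \<pi>': "\<pi>' \<in> simplex_functions n" "\<And>j. j \<in> {1..n} \<Longrightarrow> \<pi>' j = \<pi> j" using ex[OF \<pi>(1)] by blast
    have "p = (\<Prod>j=1..n. real n * \<pi>' j)" unfolding p using \<pi>'(2) by (intro prod.cong) auto
    moreover have "(\<Sum>j=1..n. \<pi>' j * y (j, i)) = 0" if "i < d" for i
      using \<pi>(2) \<pi>'(2) that by (metis (no_types, lifting) sum.cong)
    ultimately show "p \<in> (\<lambda>\<pi>. \<Prod>j=1..n. real n * \<pi> j) ` {\<pi>\<in>simplex_functions n. \<forall>i<d. (\<Sum>j=1..n. \<pi> j * y (j, i)) = 0}"
      using \<pi>'(1) by blast
  next
    fix p assume "p \<in> (\<lambda>\<pi>. \<Prod>j=1..n. real n * \<pi> j) ` {\<pi>\<in>simplex_functions n. \<forall>i<d. (\<Sum>j=1..n. \<pi> j * y (j, i)) = 0}"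
    then obtain \<pi> where "p = (\<Prod>j=1..n. real n * \<pi> j)" "\<pi> \<in> prob_simplex n" "\<forall>i<d. (\<Sum>j=1..n. \<pi> j * y (j, i)) = 0"
      using sub by blast
    then show "p \<in> el_products d n x" unfolding el_products_iff avg by metis
  qed
qed

text \<open>The supremum is attained, because the feasible set is closed in the compact simplex and
  the product is continuous. Positivity of \<open>c\<close> excludes the empty feasible set, where
  the ratio is 0 by convention and no maximiser exists.\<close>

lemma el_ratio_ge_iff:
  assumes x: "\<And>j i. j \<in> {1..n} \<Longrightarrow> i < d \<Longrightarrow> x j $ i = y (j, i)" and xc: "\<And>j. j \<in> {1..n} \<Longrightarrow> x j \<in> carrier_vec d" and n: "n \<ge> 1"
    and c: "0 < c"
  shows "c \<le> el_ratio d n x \<longleftrightarrow>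
    (\<exists>\<pi>\<in>simplex_functions n. c \<le> (\<Prod>j=1..n. real n * \<pi> j) \<and> (\<forall>i<d. (\<Sum>j=1..n. \<pi> j * y (j, i)) = 0))"
proof -
  let ?K = "{\<pi>\<in>simplex_functions n. \<forall>i<d. (\<Sum>j=1..n. \<pi> j * y (j, i)) = 0}"
  let ?f = "\<lambda>\<pi> :: nat \<Rightarrow> real. \<Prod>j=1..n. real n * \<pi> j"
  have eq: "el_products d n x = ?f ` ?K" by (rule el_products_eq_image[OF _ _ n]) (use x xc in auto)
  show ?thesis
  proof
    assume le: "c \<le> el_ratio d n x"
    then have ne: "?K \<noteq> {}" using c by (auto simp: el_ratio_altdef eq split: if_splits)
    have K: "?K = simplex_functions n \<inter> (\<Inter>i\<in>{..<d}. {\<pi>. (\<Sum>j=1..n. \<pi> j * y (j, i)) = 0})" by auto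
    have "closed (\<Inter>i\<in>{..<d}. {\<pi>. (\<Sum>j=1..n. \<pi> j * y (j, i)) = 0})"
      by (intro closed_INT ballI closed_Collect_eq continuous_intros continuous_on_product_coordinates)
    then have "compact ?K" unfolding K by (rule compact_Int_closed[OF compact_simplex_functions])
    moreover have "continuous_on ?K ?f"
      by (intro continuous_intros continuous_on_subset[OF continuous_on_product_coordinates]) auto
    ultimately obtain \<pi> where \<pi>: "\<pi> \<in> ?K" "\<And>\<pi>'. \<pi>' \<in> ?K \<Longrightarrow> ?f \<pi>' \<le> ?f \<pi>"
      using continuous_attains_sup[of ?K ?f] ne by blast
    have "Sup (?f ` ?K) \<le> ?f \<pi>" using ne \<pi>(2) by (intro cSUP_least) auto
    moreover have "el_ratio d n x = Sup (?f ` ?K)"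
    proof -
      have "el_products d n x \<noteq> {}" unfolding eq using ne by blast
      then have "el_ratio d n x = Sup (el_products d n x)" by (simp only: el_ratio_altdef if_False)
      then show ?thesis unfolding eq .
    qed
    ultimately have "c \<le> ?f \<pi>" using le by (simp only: order_trans)
    then show "\<exists>\<pi>\<in>simplex_functions n. c \<le> ?f \<pi> \<and> (\<forall>i<d. (\<Sum>j=1..n. \<pi> j * y (j, i)) = 0)" using \<pi>(1) by blast
  next
    assume "\<exists>\<pi>\<in>simplex_functions n. c \<le> ?f \<pi> \<and> (\<forall>i<d. (\<Sum>j=1..n. \<pi> j * y (j, i)) = 0)"
    then obtain \<pi> where \<pi>: "\<pi> \<in> ?K" "c \<le> ?f \<pi>" by blast
    have "?f \<pi> \<in> el_products d n x" unfolding eq using \<pi>(1) by blast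
    then have "?f \<pi> \<le> el_ratio d n x" unfolding el_ratio_altdef by (auto intro: cSup_upper el_products_bdd)
    then show "c \<le> el_ratio d n x" using \<pi>(2) by linarith
  qed
qed

text \<open>
  For positive thresholds the superlevel set is closed in the data: it is the projection of a closed
  set along the compact simplex.
\<close>

lemma el_ratio_ge_measurable:
  assumes n: "n \<ge> 1" and c: "0 < c"
    and xc: "\<And>j \<omega>. j \<in> {1..n} \<Longrightarrow> \<omega> \<in> space M \<Longrightarrow> x \<omega> j \<in> carrier_vec d"
    and meas: "\<And>j i. j \<in> {1..n} \<Longrightarrow> i < d \<Longrightarrow> (\<lambda>\<omega>. x \<omega> j $ i) \<in> borel_measurable M"
  shows "{\<omega>\<in>space M. c \<le> el_ratio d n (x \<omega>)} \<in> sets M"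
proof -
  \<comment> \<open>Padding with 0 outside the index range makes every coordinate measurable, hence
    also the map into the product space.\<close>
  define Y :: "'a \<Rightarrow> nat \<times> nat \<Rightarrow> real" where "Y \<omega> = (\<lambda>(j, i). if j \<in> {1..n} \<and> i < d then x \<omega> j $ i else 0)" for \<omega>
  define S :: "((nat \<Rightarrow> real) \<times> (nat \<times> nat \<Rightarrow> real)) set" where
    "S = {p. c \<le> (\<Prod>j=1..n. real n * fst p j)} \<inter> (\<Inter>i\<in>{..<d}. {p. (\<Sum>j=1..n. fst p j * snd p (j, i)) = 0})"
  have f: "continuous_on UNIV (\<lambda>p :: (nat \<Rightarrow> real) \<times> (nat \<times> nat \<Rightarrow> real). fst p j)" for j
    by (rule continuous_on_compose2[OF continuous_on_product_coordinates, where f=fst]) (auto intro: continuous_on_fst continuous_on_id)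
  have s: "continuous_on UNIV (\<lambda>p :: (nat \<Rightarrow> real) \<times> (nat \<times> nat \<Rightarrow> real). snd p k)" for k
    by (rule continuous_on_compose2[OF continuous_on_product_coordinates, where f=snd]) (auto intro: continuous_on_snd continuous_on_id)
  have "closed S" unfolding S_def
    by (intro closed_Int closed_INT ballI closed_Collect_eq closed_Collect_le continuous_intros f s)
  then have cl: "closed {y. \<exists>\<pi>\<in>simplex_functions n. (\<pi>, y) \<in> S}"
    by (rule closed_projection_compact[OF compact_simplex_functions])
  have "Y \<in> borel_measurable M"
  proof (rule measurable_coordinatewise_then_product)
    fix k :: "nat \<times> nat"
    obtain j i where k: "k = (j, i)" by (cases k)
    show "(\<lambda>\<omega>. Y \<omega> k) \<in> borel_measurable M" unfolding k Y_def using meas by (cases "j \<in> {1..n} \<and> i < d") auto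
  qed
  then have "Y -` {y. \<exists>\<pi>\<in>simplex_functions n. (\<pi>, y) \<in> S} \<inter> space M \<in> sets M"
    using cl by (intro measurable_sets[of Y M borel] borel_closed)
  moreover have "Y -` {y. \<exists>\<pi>\<in>simplex_functions n. (\<pi>, y) \<in> S} \<inter> space M = {\<omega>\<in>space M. c \<le> el_ratio d n (x \<omega>)}"
  proof -
    have "c \<le> el_ratio d n (x \<omega>) \<longleftrightarrow> (\<exists>\<pi>\<in>simplex_functions n. (\<pi>, Y \<omega>) \<in> S)" if "\<omega> \<in> space M" for \<omega>
      by (subst el_ratio_ge_iff[where y="Y \<omega>", OF _ _ n c]) (use xc that in \<open>auto simp: Y_def S_def\<close>)
    then show ?thesis by auto
  qed
  ultimately show ?thesis by simp
qed

text \<open>Sublevel sets of \<open>neg2log\<close> at real levels become superlevel sets of the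
  ratio at positive thresholds, the case covered by \<open>el_ratio_ge_measurable\<close>.\<close>

lemma neg2log_le_iff:
  assumes "0 \<le> r" shows "neg2log r \<le> ereal t \<longleftrightarrow> exp (- t / 2) \<le> r"
proof (cases "r = 0")
  case False
  then have r: "0 < r" using assms by simp
  have "exp (- t / 2) \<le> r \<longleftrightarrow> - t / 2 \<le> ln r" using r by (metis exp_le_cancel_iff exp_ln)
  then show ?thesis using r by (auto simp: neg2log_def)
qed (simp add: neg2log_def)

lemma el_ratio_nonneg: "0 \<le> el_ratio d n x"
  unfolding el_ratio_altdef by (auto intro: order_trans[OF el_products_nonneg cSup_upper] el_products_bdd)

section \<open>Second moments and small remainders\<close>

lemma (in prob_space) indep_centred_sum_square:
  fixes X :: "'i \<Rightarrow> 'a \<Rightarrow> real"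
  assumes fin: "finite I" and ind: "indep_vars (\<lambda>_. borel) X I"
    and i1: "\<And>i. i \<in> I \<Longrightarrow> integrable M (X i)" and i2: "\<And>i. i \<in> I \<Longrightarrow> integrable M (\<lambda>\<omega>. (X i \<omega>)\<^sup>2)"
    and z: "\<And>i. i \<in> I \<Longrightarrow> expectation (X i) = 0"
  shows "integrable M (\<lambda>\<omega>. (\<Sum>i\<in>I. X i \<omega>)\<^sup>2)"
    and "expectation (\<lambda>\<omega>. (\<Sum>i\<in>I. X i \<omega>)\<^sup>2) = (\<Sum>i\<in>I. expectation (\<lambda>\<omega>. (X i \<omega>)\<^sup>2))"
proof -
  have "integrable M (\<lambda>\<omega>. (\<Sum>i\<in>I. X i \<omega>)\<^sup>2) \<and> expectation (\<lambda>\<omega>. (\<Sum>i\<in>I. X i \<omega>)\<^sup>2) = (\<Sum>i\<in>I. expectation (\<lambda>\<omega>. (X i \<omega>)\<^sup>2))"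
    using assms
  proof (induction I rule: finite_induct)
    case (insert i I)
    let ?S = "\<lambda>\<omega>. \<Sum>i\<in>I. X i \<omega>"
    have IH: "integrable M (\<lambda>\<omega>. (?S \<omega>)\<^sup>2)" "expectation (\<lambda>\<omega>. (?S \<omega>)\<^sup>2) = (\<Sum>i\<in>I. expectation (\<lambda>\<omega>. (X i \<omega>)\<^sup>2))"
      using insert.IH insert.prems indep_vars_subset[OF insert.prems(1), of I] by auto
    have iv: "indep_var borel (X i) borel ?S" by (rule indep_vars_sum[OF insert.hyps insert.prems(1)])
    have iX: "integrable M (X i)" "integrable M (\<lambda>\<omega>. (X i \<omega>)\<^sup>2)" "expectation (X i) = 0" using insert.prems by auto
    have iS: "integrable M ?S" using insert.prems by (intro Bochner_Integration.integrable_sum) auto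
    have prod: "expectation (\<lambda>\<omega>. X i \<omega> * ?S \<omega>) = 0" "integrable M (\<lambda>\<omega>. X i \<omega> * ?S \<omega>)"
      using indep_var_lebesgue_integral[OF iv iX(1) iS] indep_var_integrable[OF iv iX(1) iS] iX(3) by auto
    have eq: "(\<Sum>k\<in>insert i I. X k \<omega>)\<^sup>2 = (X i \<omega>)\<^sup>2 + (2 * (X i \<omega> * ?S \<omega>) + (?S \<omega>)\<^sup>2)" for \<omega>
      using insert.hyps by (simp add: power2_sum algebra_simps)
    show ?case unfolding eq using insert.hyps prod iX IH by simp
  qed simp
  then show "integrable M (\<lambda>\<omega>. (\<Sum>i\<in>I. X i \<omega>)\<^sup>2)"
    "expectation (\<lambda>\<omega>. (\<Sum>i\<in>I. X i \<omega>)\<^sup>2) = (\<Sum>i\<in>I. expectation (\<lambda>\<omega>. (X i \<omega>)\<^sup>2))" by auto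
qed

lemma (in prob_space) iid_centred_sum_square:
  fixes f :: "'z \<Rightarrow> real" and n :: nat
  assumes ind: "indep_vars (\<lambda>_. Q) Z {1..n}" and d: "\<And>j. j \<in> {1..n} \<Longrightarrow> distr M Q (Z j) = Q"
    and f: "integrable Q f" "integrable Q (\<lambda>z. (f z)\<^sup>2)" "(\<integral>z. f z \<partial>Q) = 0"
  shows "integrable M (\<lambda>\<omega>. (\<Sum>j=1..n. f (Z j \<omega>))\<^sup>2)"
    and "expectation (\<lambda>\<omega>. (\<Sum>j=1..n. f (Z j \<omega>))\<^sup>2) = real n * (\<integral>z. (f z)\<^sup>2 \<partial>Q)"
proof -
  have Z: "Z j \<in> measurable M Q" if "j \<in> {1..n}" for j using ind that by (auto simp: indep_vars_def)
  have fm: "f \<in> borel_measurable Q" using f(1) by auto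
  have ind': "indep_vars (\<lambda>_. borel) (\<lambda>j \<omega>. f (Z j \<omega>)) {1..n}"
    by (rule indep_vars_compose2[OF ind]) (rule fm)
  have push: "integrable M (\<lambda>\<omega>. g (Z j \<omega>)) \<and> expectation (\<lambda>\<omega>. g (Z j \<omega>)) = (\<integral>z. g z \<partial>Q)"
    if j: "j \<in> {1..n}" and g: "integrable Q g" for j and g :: "'z \<Rightarrow> real"
    using integrable_distr[OF Z[OF j], of g] integral_distr[OF Z[OF j], of g] d[OF j] g by auto
  note * = indep_centred_sum_square[OF finite_atLeastAtMost ind']
  show "integrable M (\<lambda>\<omega>. (\<Sum>j=1..n. f (Z j \<omega>))\<^sup>2)"
    by (rule *(1)) (use push f in auto)
  have "expectation (\<lambda>\<omega>. (\<Sum>j=1..n. f (Z j \<omega>))\<^sup>2) = (\<Sum>j=1..n. expectation (\<lambda>\<omega>. (f (Z j \<omega>))\<^sup>2))"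
    by (rule *(2)) (use push f in auto)
  also have "\<dots> = (\<Sum>j=1..n. (\<integral>z. (f z)\<^sup>2 \<partial>Q))" using push[OF _ f(2)] by (intro sum.cong) auto
  finally show "expectation (\<lambda>\<omega>. (\<Sum>j=1..n. f (Z j \<omega>))\<^sup>2) = real n * (\<integral>z. (f z)\<^sup>2 \<partial>Q)" by simp
qed

lemma (in prob_space) variance_le_second_moment:
  fixes f :: "'a \<Rightarrow> real"
  assumes "integrable M f" "integrable M (\<lambda>z. (f z)\<^sup>2)"
  shows "(\<integral>z. (f z - (\<integral>z. f z \<partial>M))\<^sup>2 \<partial>M) \<le> (\<integral>z. (f z)\<^sup>2 \<partial>M)"
  using variance_eq[OF assms] by simp

lemma (in prob_space) prob_gt_le:
  fixes u :: "'a \<Rightarrow> real"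
  assumes u: "integrable M u" "\<And>\<omega>. \<omega> \<in> space M \<Longrightarrow> 0 \<le> u \<omega>" and E: "expectation u \<le> E" and c: "0 < c"
  shows "prob {\<omega>\<in>space M. c < u \<omega>} \<le> E / c"
proof -
  have [measurable]: "u \<in> borel_measurable M" using u by auto
  have "prob {\<omega>\<in>space M. c < u \<omega>} \<le> prob {\<omega>\<in>space M. c \<le> u \<omega>}" by (intro finite_measure_mono) auto
  also have "\<dots> \<le> expectation u / c"
    using u c by (intro integral_Markov_inequality_measure[where A="space M"]) auto
  also have "\<dots> \<le> E / c" using E c by (intro divide_right_mono) auto
  finally show ?thesis .
qed

section \<open>Calculus for variables that are small in probability\<close>

text \<open>Domination is expressed by inclusion of events with separate rates \<open>a\<close> and
  \<open>b\<close>, so that for example a square may control a norm.\<close>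

lemma small_op_mono:
  assumes Y: "small_op M Y b"
    and prob: "\<And>n. n \<ge> 1 \<Longrightarrow> prob_space (M n)" and meas: "\<And>n. n \<ge> 1 \<Longrightarrow> Y n \<in> borel_measurable (M n)"
    and dom: "\<And>\<epsilon>. 0 < \<epsilon> \<Longrightarrow> \<exists>\<delta>>0. \<forall>\<^sub>F n in sequentially. \<forall>\<omega>\<in>space (M n). \<epsilon> * a n < \<bar>X n \<omega>\<bar> \<longrightarrow> \<delta> * b n < \<bar>Y n \<omega>\<bar>"
  shows "small_op M X a"
  unfolding small_op_def
proof (intro allI impI)
  fix \<epsilon> :: real assume "0 < \<epsilon>"
  then obtain \<delta> where d: "0 < \<delta>" and ev: "\<forall>\<^sub>F n in sequentially. \<forall>\<omega>\<in>space (M n). \<epsilon> * a n < \<bar>X n \<omega>\<bar> \<longrightarrow> \<delta> * b n < \<bar>Y n \<omega>\<bar>"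
    using dom by blast
  have "(\<lambda>n. measure (M n) {\<omega>\<in>space (M n). \<delta> * b n < \<bar>Y n \<omega>\<bar>}) \<longlonglongrightarrow> 0"
    using Y d by (simp add: small_op_def)
  then show "(\<lambda>n. measure (M n) {\<omega>\<in>space (M n). \<epsilon> * a n < \<bar>X n \<omega>\<bar>}) \<longlonglongrightarrow> 0"
  proof (rule Lim_null_comparison[rotated])
    show "\<forall>\<^sub>F n in sequentially. norm (measure (M n) {\<omega>\<in>space (M n). \<epsilon> * a n < \<bar>X n \<omega>\<bar>}) \<le> measure (M n) {\<omega>\<in>space (M n). \<delta> * b n < \<bar>Y n \<omega>\<bar>}"
      using ev eventually_ge_at_top[of 1]
    proof eventually_elim
      case (elim n)
      interpret prob_space "M n" by (rule prob[OF elim(2)])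
      have [measurable]: "Y n \<in> borel_measurable (M n)" by (rule meas[OF elim(2)])
      have "prob {\<omega>\<in>space (M n). \<epsilon> * a n < \<bar>X n \<omega>\<bar>} \<le> prob {\<omega>\<in>space (M n). \<delta> * b n < \<bar>Y n \<omega>\<bar>}"
        using elim(1) by (intro finite_measure_mono) auto
      then show ?case by simp
    qed
  qed
qed

text \<open>The event that \<open>X\<close> is large is covered by the events that one of two other
  variables is large. The implication in \<open>dom\<close> is not tied to sums, so it serves
  equally for products and for estimates that hold only on a good event.\<close>

lemma small_op_add_mono:
  assumes Y: "small_op M Y b" and Y': "small_op M Y' b'"
    and prob: "\<And>n. n \<ge> 1 \<Longrightarrow> prob_space (M n)" and meas: "\<And>n. n \<ge> 1 \<Longrightarrow> Y n \<in> borel_measurable (M n)" "\<And>n. n \<ge> 1 \<Longrightarrow> Y' n \<in> borel_measurable (M n)"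
    and dom: "\<And>\<epsilon>. 0 < \<epsilon> \<Longrightarrow> \<exists>\<delta>>0. \<exists>\<delta>'>0. \<forall>\<^sub>F n in sequentially. \<forall>\<omega>\<in>space (M n). 
      \<bar>Y n \<omega>\<bar> \<le> \<delta> * b n \<longrightarrow> \<bar>Y' n \<omega>\<bar> \<le> \<delta>' * b' n \<longrightarrow> \<bar>X n \<omega>\<bar> \<le> \<epsilon> * a n"
  shows "small_op M X a"
  unfolding small_op_def
proof (intro allI impI)
  fix \<epsilon> :: real assume "0 < \<epsilon>"
  then obtain \<delta> \<delta>' where d: "0 < \<delta>" "0 < \<delta>'" and ev: "\<forall>\<^sub>F n in sequentially. \<forall>\<omega>\<in>space (M n). 
      \<bar>Y n \<omega>\<bar> \<le> \<delta> * b n \<longrightarrow> \<bar>Y' n \<omega>\<bar> \<le> \<delta>' * b' n \<longrightarrow> \<bar>X n \<omega>\<bar> \<le> \<epsilon> * a n"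
    using dom by blast
  have "(\<lambda>n. measure (M n) {\<omega>\<in>space (M n). \<delta> * b n < \<bar>Y n \<omega>\<bar>}) \<longlonglongrightarrow> 0"
    "(\<lambda>n. measure (M n) {\<omega>\<in>space (M n). \<delta>' * b' n < \<bar>Y' n \<omega>\<bar>}) \<longlonglongrightarrow> 0"
    using Y Y' d by (simp_all add: small_op_def)
  from tendsto_add[OF this] have "(\<lambda>n. measure (M n) {\<omega>\<in>space (M n). \<delta> * b n < \<bar>Y n \<omega>\<bar>} 
      + measure (M n) {\<omega>\<in>space (M n). \<delta>' * b' n < \<bar>Y' n \<omega>\<bar>}) \<longlonglongrightarrow> 0" by simp
  then show "(\<lambda>n. measure (M n) {\<omega>\<in>space (M n). \<epsilon> * a n < \<bar>X n \<omega>\<bar>}) \<longlonglongrightarrow> 0"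
  proof (rule Lim_null_comparison[rotated])
    show "\<forall>\<^sub>F n in sequentially. norm (measure (M n) {\<omega>\<in>space (M n). \<epsilon> * a n < \<bar>X n \<omega>\<bar>})
       \<le> measure (M n) {\<omega>\<in>space (M n). \<delta> * b n < \<bar>Y n \<omega>\<bar>} + measure (M n) {\<omega>\<in>space (M n). \<delta>' * b' n < \<bar>Y' n \<omega>\<bar>}"
      using ev eventually_ge_at_top[of 1]
    proof eventually_elim
      case (elim n)
      interpret prob_space "M n" by (rule prob[OF elim(2)])
      have [measurable]: "Y n \<in> borel_measurable (M n)" "Y' n \<in> borel_measurable (M n)" by (rule meas[OF elim(2)])+
      have "prob {\<omega>\<in>space (M n). \<epsilon> * a n < \<bar>X n \<omega>\<bar>} 
         \<le> prob ({\<omega>\<in>space (M n). \<delta> * b n < \<bar>Y n \<omega>\<bar>} \<union> {\<omega>\<in>space (M n). \<delta>' * b' n < \<bar>Y' n \<omega>\<bar>})"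
      proof (intro finite_measure_mono subsetI)
        fix \<omega> assume "\<omega> \<in> {\<omega>\<in>space (M n). \<epsilon> * a n < \<bar>X n \<omega>\<bar>}"
        then show "\<omega> \<in> {\<omega>\<in>space (M n). \<delta> * b n < \<bar>Y n \<omega>\<bar>} \<union> {\<omega>\<in>space (M n). \<delta>' * b' n < \<bar>Y' n \<omega>\<bar>}"
          using elim(1) by (auto simp: not_le[symmetric])
      qed measurable
      also have "\<dots> \<le> prob {\<omega>\<in>space (M n). \<delta> * b n < \<bar>Y n \<omega>\<bar>} + prob {\<omega>\<in>space (M n). \<delta>' * b' n < \<bar>Y' n \<omega>\<bar>}"
        by (intro measure_Un_le) measurable
      finally show ?case by simp
    qed
  qed
qed

lemma small_op_Markov:
  assumes prob: "\<And>n. n \<ge> 1 \<Longrightarrow> prob_space (M n)" 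
    and int: "\<And>n. n \<ge> 1 \<Longrightarrow> integrable (M n) (X n)" and nonneg: "\<And>n \<omega>. n \<ge> 1 \<Longrightarrow> \<omega> \<in> space (M n) \<Longrightarrow> 0 \<le> X n \<omega>"
    and E: "\<And>n. n \<ge> 1 \<Longrightarrow> (\<integral>\<omega>. X n \<omega> \<partial>M n) \<le> E n" and a: "\<And>n. n \<ge> 1 \<Longrightarrow> 0 < a n" and lim: "(\<lambda>n. E n / a n) \<longlonglongrightarrow> 0"
  shows "small_op M X a"
  unfolding small_op_def
proof (intro allI impI)
  fix \<epsilon> :: real assume e: "0 < \<epsilon>"
  have "(\<lambda>n. (1 / \<epsilon>) * (E n / a n)) \<longlonglongrightarrow> (1 / \<epsilon>) * 0" by (intro tendsto_intros lim)
  then have "(\<lambda>n. (1 / \<epsilon>) * (E n / a n)) \<longlonglongrightarrow> 0" by simp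
  then show "(\<lambda>n. measure (M n) {\<omega>\<in>space (M n). \<epsilon> * a n < \<bar>X n \<omega>\<bar>}) \<longlonglongrightarrow> 0"
  proof (rule Lim_null_comparison[rotated])
    show "\<forall>\<^sub>F n in sequentially. norm (measure (M n) {\<omega>\<in>space (M n). \<epsilon> * a n < \<bar>X n \<omega>\<bar>}) \<le> (1 / \<epsilon>) * (E n / a n)"
      using eventually_ge_at_top[of 1]
    proof eventually_elim
      case (elim n)
      interpret prob_space "M n" by (rule prob[OF elim])
      have "{\<omega>\<in>space (M n). \<epsilon> * a n < \<bar>X n \<omega>\<bar>} = {\<omega>\<in>space (M n). \<epsilon> * a n < X n \<omega>}" using nonneg[OF elim] by auto
      moreover have "prob {\<omega>\<in>space (M n). \<epsilon> * a n < X n \<omega>} \<le> E n / (\<epsilon> * a n)"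
        by (rule prob_gt_le) (use int nonneg E a elim e in auto)
      ultimately show ?case by simp
    qed
  qed
qed

section \<open>The quadratic form of the sample mean\<close>

text \<open>A real \<open>c\<close> is chosen strictly between 0 and the infimum and a natural
  number above the supremum; scaling then carries the bounds from unit vectors to all vectors. Every
  later use of regularity goes through these two quadratic bounds.\<close>

lemma regular_seq_bounds:
  assumes reg: "regular_seq m W" and W: "\<And>n. W n \<in> carrier_mat (m n) (m n)"
  obtains c C where "0 < c" "0 \<le> C"
    "\<And>n u. n \<ge> 1 \<Longrightarrow> u \<in> carrier_vec (m n) \<Longrightarrow> c * (vnorm u)\<^sup>2 \<le> scalar_prod u (W n *\<^sub>v u)"
    "\<And>n u. n \<ge> 1 \<Longrightarrow> u \<in> carrier_vec (m n) \<Longrightarrow> scalar_prod u (W n *\<^sub>v u) \<le> C * (vnorm u)\<^sup>2"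
proof -
  let ?I = "INF n\<in>{1..}. INF u\<in>unit_vecs (m n). ereal (quad_form (W n) u)"
  let ?S = "SUP n\<in>{1..}. SUP u\<in>unit_vecs (m n). ereal (quad_form (W n) u)"
  have I: "0 < ?I" and S: "?S < \<infinity>" using reg by (auto simp: regular_seq_def)
  obtain c where c: "0 < ereal c" "ereal c < ?I" using ereal_dense2[OF I] by (auto simp: zero_ereal_def)
  obtain k :: nat where k: "?S < ereal (real k)" using less_PInf_Ex_of_nat[of ?S] S by auto
  have unit: "c \<le> quad_form (W n) u \<and> quad_form (W n) u \<le> real k" if "n \<ge> 1" "u \<in> unit_vecs (m n)" for n u
  proof -
    have 1: "?I \<le> ereal (quad_form (W n) u)" using that by (intro INF_lower2[of n] INF_lower2[of u]) auto
    have 2: "ereal (quad_form (W n) u) \<le> ?S" using that by (intro SUP_upper2[of n] SUP_upper2[of u]) auto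
    show ?thesis using less_le_trans[OF c(2) 1] le_less_trans[OF 2 k] by simp
  qed
  have general: "c * (vnorm u)\<^sup>2 \<le> scalar_prod u (W n *\<^sub>v u) \<and> scalar_prod u (W n *\<^sub>v u) \<le> real k * (vnorm u)\<^sup>2"
    if n: "n \<ge> 1" and u: "u \<in> carrier_vec (m n)" for n u
  proof (cases "vnorm u = 0")
    case True
    then have "u = 0\<^sub>v (m n)" using u by (simp add: vnorm_eq_0_iff)
    then show ?thesis using True W[of n] by simp
  next
    case False
    then have pos: "0 < (vnorm u)\<^sup>2" by simp
    have "quad_form (W n) ((1 / vnorm u) \<cdot>\<^sub>v u) = scalar_prod u (W n *\<^sub>v u) / (vnorm u)\<^sup>2"
      using W[of n] u unfolding quad_form_def by (simp add: mult_mat_vec[of _ "m n" "m n"] power2_eq_square)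
    then show ?thesis using unit[OF n normalize_unit_vecs[OF u False]] pos by (simp add: pos_le_divide_eq pos_divide_le_eq)
  qed
  show ?thesis by (rule that[of c "real k"]) (use c general in auto)
qed

lemma moment_matrix_carrier: "mat_integral Q d e F \<in> carrier_mat d e"
  by (simp add: mat_integral_def)

locale el_setting =
  fixes Q :: "'z measure" and M :: "nat \<Rightarrow> 'w measure" and Z :: "nat \<Rightarrow> nat \<Rightarrow> 'w \<Rightarrow> 'z" and m :: "nat \<Rightarrow> nat"
    and w :: "nat \<Rightarrow> 'z \<Rightarrow> real Matrix.vec" and W P :: "nat \<Rightarrow> real mat" and B c C :: real
  assumes prob_Q: "prob_space Q"
    and prob_M: "\<And>n. n \<ge> 1 \<Longrightarrow> prob_space (M n)"
    and indep: "\<And>n. n \<ge> 1 \<Longrightarrow> prob_space.indep_vars (M n) (\<lambda>_. Q) (Z n) {1..n}"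
    and distr: "\<And>n j. n \<ge> 1 \<Longrightarrow> j \<in> {1..n} \<Longrightarrow> distr (M n) Q (Z n j) = Q"
    and m_pos: "\<And>n. n \<ge> 1 \<Longrightarrow> m n \<ge> 1"
    and m_infinity: "filterlim m at_top sequentially"
    and w_meas: "\<And>n. n \<ge> 1 \<Longrightarrow> vec_measurable Q (m n) (w n)"
    and w_mean: "\<And>n. n \<ge> 1 \<Longrightarrow> vec_integral Q (m n) (w n) = 0\<^sub>v (m n)"
    and W_def: "\<And>n. W n = mat_integral Q (m n) (m n) (\<lambda>z. outer (w n z) (w n z))"
    and w_bound: "\<And>n z. n \<ge> 1 \<Longrightarrow> z \<in> space Q \<Longrightarrow> vnorm (w n z) \<le> B * sqrt (real (m n))"
    and growth: "(\<lambda>n. real (m n) ^ 3) \<in> o(\<lambda>n. real n)"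
    and c_pos: "0 < c" and C_nonneg: "0 \<le> C"
    and W_lower: "\<And>n u. n \<ge> 1 \<Longrightarrow> u \<in> carrier_vec (m n) \<Longrightarrow> c * (vnorm u)\<^sup>2 \<le> scalar_prod u (W n *\<^sub>v u)"
    and W_upper: "\<And>n u. n \<ge> 1 \<Longrightarrow> u \<in> carrier_vec (m n) \<Longrightarrow> scalar_prod u (W n *\<^sub>v u) \<le> C * (vnorm u)\<^sup>2"
    and P: "\<And>n. n \<ge> 1 \<Longrightarrow> P n \<in> carrier_mat (m n) (m n)"
    and WP: "\<And>n. n \<ge> 1 \<Longrightarrow> W n * P n = 1\<^sub>m (m n)"
    and PW: "\<And>n. n \<ge> 1 \<Longrightarrow> P n * W n = 1\<^sub>m (m n)"
begin

interpretation Q: prob_space Q by (rule prob_Q)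

lemma W_carrier: "W n \<in> carrier_mat (m n) (m n)"
  unfolding W_def by (rule moment_matrix_carrier)

lemma B_nonneg: "0 \<le> B"
proof -
  obtain z where z: "z \<in> space Q" using Q.not_empty by auto
  have "0 \<le> B * sqrt (real (m 1))" using order_trans[OF vnorm_nonneg w_bound[OF order_refl z]] by simp
  moreover have "0 < sqrt (real (m 1))" using m_pos[of 1] by simp
  ultimately show ?thesis by (simp add: zero_le_mult_iff)
qed

lemma growth_limit: "(\<lambda>n. real (m n) ^ 3 / real n) \<longlonglongrightarrow> 0"
  using growth by (rule smalloD_tendsto)

context
  fixes n :: nat
  assumes n: "n \<ge> 1"
begin

lemma w_carrier: "z \<in> space Q \<Longrightarrow> w n z \<in> carrier_vec (m n)"
  using w_meas[OF n] by (simp add: vec_measurable_def)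

lemma w_component_measurable: "i < m n \<Longrightarrow> (\<lambda>z. w n z $ i) \<in> borel_measurable Q"
  using w_meas[OF n] by (simp add: vec_measurable_def)

lemma w_component_bound:
  assumes "z \<in> space Q" "i < m n" shows "\<bar>w n z $ i\<bar> \<le> B * sqrt (real (m n))"
proof -
  have "(w n z $ i)\<^sup>2 \<le> (\<Sum>k<m n. (w n z $ k)\<^sup>2)" using assms by (intro member_le_sum) auto
  also have "\<dots> = (vnorm (w n z))\<^sup>2" using vnorm_square_sum[OF w_carrier[OF assms(1)]] by simp
  finally have "\<bar>w n z $ i\<bar> \<le> vnorm (w n z)" by (simp add: abs_le_square_iff[symmetric])
  also have "\<dots> \<le> B * sqrt (real (m n))" by (rule w_bound[OF n assms(1)])
  finally show ?thesis .
qed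

lemma w_component_integrable: "i < m n \<Longrightarrow> integrable Q (\<lambda>z. w n z $ i)"
  using w_component_bound w_component_measurable by (intro Q.integrable_bounded) auto

lemma w_component_mult_integrable: "i < m n \<Longrightarrow> k < m n \<Longrightarrow> integrable Q (\<lambda>z. w n z $ i * w n z $ k)"
  using mult_mono[OF w_component_bound w_component_bound] w_component_measurable B_nonneg
  by (intro Q.integrable_bounded[where b="(B * sqrt (real (m n))) * (B * sqrt (real (m n)))"]) (auto simp: abs_mult)

lemma w_component_mean: "i < m n \<Longrightarrow> (\<integral>z. w n z $ i \<partial>Q) = 0"
  using w_mean[OF n] by (metis index_vec index_zero_vec(1) vec_integral_def)

lemma W_entry: "i < m n \<Longrightarrow> k < m n \<Longrightarrow> W n $$ (i, k) = (\<integral>z. w n z $ i * w n z $ k \<partial>Q)"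
  unfolding W_def mat_integral_def using w_carrier[THEN carrier_vecD]
  by (auto simp: outer_def intro!: Bochner_Integration.integral_cong)

lemma scalar_prod_w: 
  assumes u: "u \<in> carrier_vec (m n)"
  shows "integrable Q (\<lambda>z. scalar_prod u (w n z))" "(\<integral>z. scalar_prod u (w n z) \<partial>Q) = 0"
proof -
  have eq: "scalar_prod u (w n z) = (\<Sum>i<m n. u $ i * w n z $ i)" if "z \<in> space Q" for z
    using w_carrier[OF that] by (simp add: scalar_prod_def atLeast0LessThan)
  show "integrable Q (\<lambda>z. scalar_prod u (w n z))"
  proof -
    have "integrable Q (\<lambda>z. \<Sum>i<m n. u $ i * w n z $ i)"
      by (intro Bochner_Integration.integrable_sum integrable_mult_right w_component_integrable) auto
    then show ?thesis by (simp cong: Bochner_Integration.integrable_cong add: eq)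
  qed
  show "(\<integral>z. scalar_prod u (w n z) \<partial>Q) = 0"
    using w_component_integrable w_component_mean by (simp cong: Bochner_Integration.integral_cong add: eq)
qed

lemma scalar_prod_w_mult:
  assumes u: "u \<in> carrier_vec (m n)" and v: "v \<in> carrier_vec (m n)"
  shows "integrable Q (\<lambda>z. scalar_prod u (w n z) * scalar_prod v (w n z))"
    "(\<integral>z. scalar_prod u (w n z) * scalar_prod v (w n z) \<partial>Q) = scalar_prod u (W n *\<^sub>v v)"
proof -
  have eq: "scalar_prod u (w n z) * scalar_prod v (w n z) = (\<Sum>i<m n. \<Sum>k<m n. (u $ i * v $ k) * (w n z $ i * w n z $ k))" if "z \<in> space Q" for z
    using w_carrier[OF that] by (simp add: scalar_prod_def atLeast0LessThan sum_product mult_ac)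
  show "integrable Q (\<lambda>z. scalar_prod u (w n z) * scalar_prod v (w n z))"
  proof -
    have "integrable Q (\<lambda>z. \<Sum>i<m n. \<Sum>k<m n. (u $ i * v $ k) * (w n z $ i * w n z $ k))"
      by (intro Bochner_Integration.integrable_sum integrable_mult_right w_component_mult_integrable) auto
    then show ?thesis by (simp cong: Bochner_Integration.integrable_cong add: eq)
  qed
  have "(\<integral>z. scalar_prod u (w n z) * scalar_prod v (w n z) \<partial>Q) = (\<integral>z. (\<Sum>i<m n. \<Sum>k<m n. (u $ i * v $ k) * (w n z $ i * w n z $ k)) \<partial>Q)"
    by (intro Bochner_Integration.integral_cong refl eq)
  also have "\<dots> = (\<Sum>i<m n. \<Sum>k<m n. (u $ i * v $ k) * W n $$ (i, k))"
    using w_component_mult_integrable W_entry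
    by (subst Bochner_Integration.integral_sum) (auto intro!: sum.cong Bochner_Integration.integrable_sum)
  also have "\<dots> = scalar_prod u (W n *\<^sub>v v)"
    using W_carrier[of n] v by (simp add: scalar_prod_def atLeast0LessThan sum_distrib_left mult_ac)
  finally show "(\<integral>z. scalar_prod u (w n z) * scalar_prod v (w n z) \<partial>Q) = scalar_prod u (W n *\<^sub>v v)" .
qed

lemma W_symmetric:
  assumes "u \<in> carrier_vec (m n)" "v \<in> carrier_vec (m n)"
  shows "scalar_prod u (W n *\<^sub>v v) = scalar_prod v (W n *\<^sub>v u)"
  unfolding scalar_prod_w_mult(2)[OF assms, symmetric] scalar_prod_w_mult(2)[OF assms(2,1), symmetric] by (simp add: mult.commute)

lemma P_mult_carrier [simp]: "u \<in> carrier_vec (m n) \<Longrightarrow> P n *\<^sub>v u \<in> carrier_vec (m n)"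
  using P[OF n] by simp

lemma W_P: "u \<in> carrier_vec (m n) \<Longrightarrow> W n *\<^sub>v (P n *\<^sub>v u) = u"
  using assoc_mult_mat_vec[OF W_carrier P[OF n], of u] by (simp add: WP[OF n])

lemma P_symmetric:
  assumes u: "u \<in> carrier_vec (m n)" and v: "v \<in> carrier_vec (m n)"
  shows "scalar_prod u (P n *\<^sub>v v) = scalar_prod v (P n *\<^sub>v u)"
proof -
  have "scalar_prod u (P n *\<^sub>v v) = scalar_prod (P n *\<^sub>v v) (W n *\<^sub>v (P n *\<^sub>v u))"
    using u v by (simp add: W_P comm_scalar_prod[of u "m n"])
  also have "\<dots> = scalar_prod (P n *\<^sub>v u) (W n *\<^sub>v (P n *\<^sub>v v))" using u v by (intro W_symmetric) auto
  also have "\<dots> = scalar_prod v (P n *\<^sub>v u)" using u v by (simp add: W_P comm_scalar_prod[of v "m n"])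
  finally show ?thesis .
qed

lemma P_norm:
  assumes u: "u \<in> carrier_vec (m n)"
  shows "vnorm (P n *\<^sub>v u) \<le> vnorm u / c" "scalar_prod u (P n *\<^sub>v u) \<le> (vnorm u)\<^sup>2 / c" "0 \<le> scalar_prod u (P n *\<^sub>v u)"
proof -
  note * = positive_definite_solution_norm[OF P_mult_carrier[OF u] u W_P[OF u] c_pos W_lower[OF n P_mult_carrier[OF u]]]
  show "vnorm (P n *\<^sub>v u) \<le> vnorm u / c" "scalar_prod u (P n *\<^sub>v u) \<le> (vnorm u)\<^sup>2 / c" "0 \<le> scalar_prod u (P n *\<^sub>v u)"
    using * comm_scalar_prod[OF u P_mult_carrier[OF u]] by auto
qed

text \<open>\<open>W n\<close> is the Gram matrix of the components of \<open>w n\<close> in L2(Q),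
  so Cauchy-Schwarz for its form is Cauchy-Schwarz for integrals.\<close>

lemma W_Cauchy_Schwarz:
  assumes u: "u \<in> carrier_vec (m n)" and v: "v \<in> carrier_vec (m n)"
  shows "(scalar_prod u (W n *\<^sub>v v))\<^sup>2 \<le> scalar_prod u (W n *\<^sub>v u) * scalar_prod v (W n *\<^sub>v v)"
  using Q.Cauchy_Schwarz_integral[of "\<lambda>z. scalar_prod u (w n z)" "\<lambda>z. scalar_prod v (w n z)"]
    scalar_prod_w_mult[OF u u] scalar_prod_w_mult[OF v v] scalar_prod_w_mult[OF u v]
    scalar_prod_w(1)[OF u] scalar_prod_w(1)[OF v]
  by (simp add: power2_eq_square)

text \<open>The squared norm is the \<open>W\<close>-form of \<open>u\<close> and
  \<open>P n *\<^sub>v u\<close>, so Cauchy-Schwarz for that form gives the bound without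
  eigenvalues or matrix square roots. It converts an upper bound on \<open>T\<close> into one on the
  norm of the sample mean.\<close>

lemma norm_le_P_form:
  assumes u: "u \<in> carrier_vec (m n)" shows "(vnorm u)\<^sup>2 \<le> C * scalar_prod u (P n *\<^sub>v u)"
proof (cases "vnorm u = 0")
  case True
  then show ?thesis using P_norm(3)[OF u] C_nonneg by simp
next
  case False
  then have pos: "0 < (vnorm u)\<^sup>2" by simp
  have pu: "scalar_prod (P n *\<^sub>v u) u = scalar_prod u (P n *\<^sub>v u)" using u by (simp add: comm_scalar_prod[of u "m n"])
  have "((vnorm u)\<^sup>2)\<^sup>2 = (scalar_prod u (W n *\<^sub>v (P n *\<^sub>v u)))\<^sup>2" by (simp add: W_P[OF u] vnorm_square)
  also have "\<dots> \<le> scalar_prod u (W n *\<^sub>v u) * scalar_prod (P n *\<^sub>v u) (W n *\<^sub>v (P n *\<^sub>v u))"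
    by (rule W_Cauchy_Schwarz[OF u P_mult_carrier[OF u]])
  also have "\<dots> = scalar_prod u (W n *\<^sub>v u) * scalar_prod u (P n *\<^sub>v u)" by (simp only: W_P[OF u] pu)
  also have "\<dots> \<le> C * (vnorm u)\<^sup>2 * scalar_prod u (P n *\<^sub>v u)" by (intro mult_right_mono W_upper n u P_norm)
  finally have "(vnorm u)\<^sup>2 * (vnorm u)\<^sup>2 \<le> (C * scalar_prod u (P n *\<^sub>v u)) * (vnorm u)\<^sup>2"
    by (simp add: power2_eq_square mult_ac)
  then show ?thesis by (rule mult_right_le_imp_le[OF _ pos])
qed

definition K :: "'z \<Rightarrow> 'z \<Rightarrow> real" where "K a b = scalar_prod (w n a) (P n *\<^sub>v w n b)"

lemma K_alt: "a \<in> space Q \<Longrightarrow> b \<in> space Q \<Longrightarrow> K a b = scalar_prod (P n *\<^sub>v w n a) (w n b)"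
  unfolding K_def using w_carrier by (simp add: P_symmetric[of "w n a" "w n b"] comm_scalar_prod[of "w n b" "m n"])

lemma K_sum: "a \<in> space Q \<Longrightarrow> b \<in> space Q \<Longrightarrow> K a b = (\<Sum>i<m n. \<Sum>k<m n. P n $$ (i, k) * (w n a $ i * w n b $ k))"
  unfolding K_def using w_carrier[THEN carrier_vecD] P[OF n]
  by (simp add: scalar_prod_def atLeast0LessThan sum_distrib_left mult_ac)

text \<open>Reproduction is \<open>P * W * P = P\<close>, centring is the mean zero of
  \<open>w n\<close>, and the trace is that of \<open>P * W\<close>, the identity. The bound
  multiplies two norms of order sqrt m by the bound \<open>1 / c\<close> for
  \<open>P\<close>.\<close>

lemma kernel: "reproducing_kernel Q K (B\<^sup>2 / c * real (m n)) (real (m n))"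
proof
  have "(\<lambda>p. \<Sum>i<m n. \<Sum>k<m n. P n $$ (i, k) * (w n (fst p) $ i * w n (snd p) $ k)) \<in> borel_measurable (Q \<Otimes>\<^sub>M Q)"
  proof (intro borel_measurable_sum borel_measurable_times borel_measurable_const)
    fix i k assume "i \<in> {..<m n}" "k \<in> {..<m n}"
    then show "(\<lambda>p. w n (fst p) $ i) \<in> borel_measurable (Q \<Otimes>\<^sub>M Q)" "(\<lambda>p. w n (snd p) $ k) \<in> borel_measurable (Q \<Otimes>\<^sub>M Q)"
      using measurable_compose[OF measurable_fst w_component_measurable] measurable_compose[OF measurable_snd w_component_measurable] by auto
  qed
  moreover have "case_prod K p = (\<Sum>i<m n. \<Sum>k<m n. P n $$ (i, k) * (w n (fst p) $ i * w n (snd p) $ k))" if "p \<in> space (Q \<Otimes>\<^sub>M Q)" for p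
    using that K_sum by (auto simp: space_pair_measure)
  ultimately show "case_prod K \<in> borel_measurable (Q \<Otimes>\<^sub>M Q)" by (simp cong: measurable_cong)
next
  fix a b assume ab: "a \<in> space Q" "b \<in> space Q"
  have "\<bar>K a b\<bar> \<le> vnorm (w n a) * vnorm (P n *\<^sub>v w n b)"
    unfolding K_def using ab w_carrier by (intro vnorm_Cauchy_Schwarz[of _ "m n"]) auto
  also have "\<dots> \<le> (B * sqrt (real (m n))) * ((B * sqrt (real (m n))) / c)"
  proof (intro mult_mono w_bound n ab)
    show "vnorm (P n *\<^sub>v w n b) \<le> B * sqrt (real (m n)) / c"
      using P_norm(1)[OF w_carrier[OF ab(2)]] w_bound[OF n ab(2)] c_pos by (meson divide_right_mono less_imp_le order_trans)
  qed (use B_nonneg in auto)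
  also have "\<dots> = B\<^sup>2 / c * real (m n)" by (simp add: power2_eq_square)
  finally show "\<bar>K a b\<bar> \<le> B\<^sup>2 / c * real (m n)" .
  have pa: "P n *\<^sub>v w n a \<in> carrier_vec (m n)" and pb: "P n *\<^sub>v w n b \<in> carrier_vec (m n)" using ab w_carrier by auto
  have "(\<integral>z. K a z \<partial>Q) = (\<integral>z. scalar_prod (P n *\<^sub>v w n a) (w n z) \<partial>Q)" using ab by (intro Bochner_Integration.integral_cong K_alt) auto
  then show "(\<integral>z. K a z \<partial>Q) = 0" using scalar_prod_w(2)[OF pa] by simp
  have "(\<integral>z. K a z * K b z \<partial>Q) = (\<integral>z. scalar_prod (P n *\<^sub>v w n a) (w n z) * scalar_prod (P n *\<^sub>v w n b) (w n z) \<partial>Q)"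
    using ab by (intro Bochner_Integration.integral_cong arg_cong2[where f="(*)"] K_alt) auto
  also have "\<dots> = scalar_prod (P n *\<^sub>v w n a) (w n b)" unfolding scalar_prod_w_mult(2)[OF pa pb] W_P[OF w_carrier[OF ab(2)]] ..
  finally show "(\<integral>z. K a z * K b z \<partial>Q) = K a b" using K_alt[OF ab] by simp
next
  have "(\<integral>z. K z z \<partial>Q) = (\<integral>z. (\<Sum>i<m n. \<Sum>k<m n. P n $$ (i, k) * (w n z $ i * w n z $ k)) \<partial>Q)"
    by (intro Bochner_Integration.integral_cong refl K_sum)
  also have "\<dots> = (\<Sum>i<m n. \<Sum>k<m n. P n $$ (i, k) * W n $$ (k, i))"
    using w_component_mult_integrable W_entry
    by (subst Bochner_Integration.integral_sum) (auto intro!: sum.cong Bochner_Integration.integrable_sum simp: mult.commute)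
  also have "\<dots> = (\<Sum>i<m n. (P n * W n) $$ (i, i))"
    using P[OF n] W_carrier[of n] by (intro sum.cong) (auto simp: scalar_prod_def atLeast0LessThan)
  also have "\<dots> = real (m n)" by (simp add: PW[OF n])
  finally show "(\<integral>z. K z z \<partial>Q) = real (m n)" .
qed

end

lemma m_small: "(\<lambda>n. real (m n) / real n) \<longlonglongrightarrow> 0"
proof (rule Lim_null_comparison[OF _ growth_limit])
  show "\<forall>\<^sub>F n in sequentially. norm (real (m n) / real n) \<le> real (m n) ^ 3 / real n"
    using eventually_ge_at_top[of 1]
  proof eventually_elim
    case (elim n)
    have "real (m n) ^ 1 \<le> real (m n) ^ 3" using m_pos[OF elim] by (intro power_increasing) auto
    then show ?case using elim by (simp add: divide_right_mono)
  qed
qed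

text \<open>The constant of the array is \<open>B\<^sup>2 / c\<close>; it is unrelated to the upper
  bound \<open>C\<close> for the quadratic forms of \<open>W\<close>.\<close>

sublocale kernel_array Q M Z K "\<lambda>n. real (m n)" "B\<^sup>2 / c"
proof (rule kernel_array.intro)
  show "filterlim (\<lambda>n. real (m n)) at_top sequentially"
    by (rule filterlim_compose[OF filterlim_real_sequentially m_infinity])
  show "0 \<le> B\<^sup>2 / c" using c_pos by simp
  show "1 \<le> real (m n)" if "n \<ge> 1" for n using m_pos[OF that] by simp
  show "prob_space (M n)" if "n \<ge> 1" for n by (rule prob_M[OF that])
  show "prob_space.indep_vars (M n) (\<lambda>_. Q) (Z n) {1..n}" if "n \<ge> 1" for n by (rule indep[OF that])
  show "distr (M n) Q (Z n j) = Q" if "n \<ge> 1" "j \<in> {1..n}" for n j by (rule distr[OF that])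
  show "reproducing_kernel Q (K n) (B\<^sup>2 / c * real (m n)) (real (m n))" if "n \<ge> 1" for n by (rule kernel[OF that])
  show "(\<lambda>n. real (m n) / real n) \<longlonglongrightarrow> 0" by (rule m_small)
qed

end

section \<open>The sample second moment matrix\<close>

context el_setting begin

interpretation Q: prob_space Q by (rule prob_Q)

definition wbar :: "nat \<Rightarrow> 'w \<Rightarrow> real Matrix.vec" where
  "wbar n \<omega> = vec_avg (m n) n (\<lambda>j. w n (Z n j \<omega>))"

definition W_bar :: "nat \<Rightarrow> 'w \<Rightarrow> real mat" where
  "W_bar n \<omega> = mat_avg (m n) n (\<lambda>j. outer (w n (Z n j \<omega>)) (w n (Z n j \<omega>)))"

lemma wbar_carrier [simp]: "wbar n \<omega> \<in> carrier_vec (m n)"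
  by (simp add: wbar_def)

lemma W_bar_carrier [simp]: "W_bar n \<omega> \<in> carrier_mat (m n) (m n)"
  by (simp add: W_bar_def)

lemma Z_space: "n \<ge> 1 \<Longrightarrow> j \<in> {1..n} \<Longrightarrow> \<omega> \<in> space (M n) \<Longrightarrow> Z n j \<omega> \<in> space Q"
  using Z_measurable[of n j] by (auto dest: measurable_space)

lemma scalar_prod_wbar:
  assumes n: "n \<ge> 1" and \<omega>: "\<omega> \<in> space (M n)" and u: "u \<in> carrier_vec (m n)"
  shows "scalar_prod u (wbar n \<omega>) = (1 / real n) * (\<Sum>j=1..n. scalar_prod u (w n (Z n j \<omega>)))"
  unfolding wbar_def using w_carrier[OF n Z_space[OF n _ \<omega>]] by (intro scalar_prod_vec_avg) auto

lemma T_eq: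
  assumes n: "n \<ge> 1" and \<omega>: "\<omega> \<in> space (M n)"
  shows "T n \<omega> = real n * scalar_prod (wbar n \<omega>) (P n *\<^sub>v wbar n \<omega>)"
proof -
  note Zs = Z_space[OF n _ \<omega>]
  note wc = w_carrier[OF n Zs]
  let ?y = "wbar n \<omega>"
  have "scalar_prod ?y (P n *\<^sub>v ?y) = scalar_prod (P n *\<^sub>v ?y) ?y"
    using P_mult_carrier[OF n wbar_carrier] by (rule comm_scalar_prod[OF wbar_carrier])
  also have "\<dots> = (1 / real n) * (\<Sum>j=1..n. scalar_prod (P n *\<^sub>v ?y) (w n (Z n j \<omega>)))"
    by (rule scalar_prod_wbar[OF n \<omega> P_mult_carrier[OF n wbar_carrier]])
  also have "(\<Sum>j=1..n. scalar_prod (P n *\<^sub>v ?y) (w n (Z n j \<omega>))) = (\<Sum>j=1..n. (1 / real n) * (\<Sum>i=1..n. K n (Z n j \<omega>) (Z n i \<omega>)))"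
  proof (intro sum.cong refl)
    fix j assume j: "j \<in> {1..n}"
    have "scalar_prod (P n *\<^sub>v ?y) (w n (Z n j \<omega>)) = scalar_prod (w n (Z n j \<omega>)) (P n *\<^sub>v ?y)"
      by (rule comm_scalar_prod[OF P_mult_carrier[OF n wbar_carrier] wc[OF j]])
    also have "\<dots> = scalar_prod ?y (P n *\<^sub>v w n (Z n j \<omega>))" by (rule P_symmetric[OF n wc[OF j] wbar_carrier])
    also have "\<dots> = scalar_prod (P n *\<^sub>v w n (Z n j \<omega>)) ?y" by (rule comm_scalar_prod[OF wbar_carrier P_mult_carrier[OF n wc[OF j]]])
    also have "\<dots> = (1 / real n) * (\<Sum>i=1..n. scalar_prod (P n *\<^sub>v w n (Z n j \<omega>)) (w n (Z n i \<omega>)))"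
      by (rule scalar_prod_wbar[OF n \<omega> P_mult_carrier[OF n wc[OF j]]])
    also have "\<dots> = (1 / real n) * (\<Sum>i=1..n. K n (Z n j \<omega>) (Z n i \<omega>))"
      using K_alt[OF n Zs[OF j] Zs] by simp
    finally show "scalar_prod (P n *\<^sub>v ?y) (w n (Z n j \<omega>)) = (1 / real n) * (\<Sum>i=1..n. K n (Z n j \<omega>) (Z n i \<omega>))" .
  qed
  also have "(\<Sum>j=1..n. (1 / real n) * (\<Sum>i=1..n. K n (Z n j \<omega>) (Z n i \<omega>))) = (1 / real n) * (\<Sum>j=1..n. \<Sum>i=1..n. K n (Z n j \<omega>) (Z n i \<omega>))"
    by (simp only: sum_distrib_left)
  finally show ?thesis using n by (simp add: T_def)
qed

definition entry_dev :: "nat \<Rightarrow> nat \<Rightarrow> nat \<Rightarrow> 'z \<Rightarrow> real" where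
  "entry_dev n i k z = w n z $ i * w n z $ k - W n $$ (i, k)"

lemma W_bar_minus_entry:
  assumes n: "n \<ge> 1" and \<omega>: "\<omega> \<in> space (M n)" and ik: "i < m n" "k < m n"
  shows "(W_bar n \<omega> - W n) $$ (i, k) = (1 / real n) * (\<Sum>j=1..n. entry_dev n i k (Z n j \<omega>))"
proof -
  have "W_bar n \<omega> $$ (i, k) = (1 / real n) * (\<Sum>j=1..n. w n (Z n j \<omega>) $ i * w n (Z n j \<omega>) $ k)"
    using ik w_carrier[OF n Z_space[OF n _ \<omega>], THEN carrier_vecD] by (simp add: W_bar_def mat_avg_def outer_def)
  then show ?thesis using ik W_carrier[of n] n by (simp add: entry_dev_def sum_subtractf diff_divide_distrib)
qed

lemma entry_dev_facts:
  assumes n: "n \<ge> 1" and ik: "i < m n" "k < m n"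
  shows "integrable Q (entry_dev n i k)" "integrable Q (\<lambda>z. (entry_dev n i k z)\<^sup>2)" "(\<integral>z. entry_dev n i k z \<partial>Q) = 0"
    "integrable Q (\<lambda>z. (w n z $ i * w n z $ k)\<^sup>2)"
    "(\<integral>z. (entry_dev n i k z)\<^sup>2 \<partial>Q) \<le> (\<integral>z. (w n z $ i * w n z $ k)\<^sup>2 \<partial>Q)"
proof -
  let ?f = "\<lambda>z. w n z $ i * w n z $ k"
  have i1: "integrable Q ?f" by (rule w_component_mult_integrable[OF n ik])
  have b: "\<bar>?f z\<bar> \<le> (B * sqrt (real (m n))) * (B * sqrt (real (m n)))" if "z \<in> space Q" for z
    unfolding abs_mult using w_component_bound[OF n that] ik B_nonneg by (intro mult_mono) auto
  show i2: "integrable Q (\<lambda>z. (?f z)\<^sup>2)"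
    using power_mono[OF b, of _ 2] i1 by (intro Q.integrable_bounded) auto
  have eq: "entry_dev n i k z = ?f z - (\<integral>z. ?f z \<partial>Q)" for z using W_entry[OF n ik] by (simp add: entry_dev_def)
  show "integrable Q (entry_dev n i k)" unfolding eq[abs_def] using i1 by simp
  show "integrable Q (\<lambda>z. (entry_dev n i k z)\<^sup>2)" unfolding eq power2_diff using i1 i2 by simp
  show "(\<integral>z. entry_dev n i k z \<partial>Q) = 0" unfolding eq using i1 by (simp add: Q.prob_space)
  show "(\<integral>z. (entry_dev n i k z)\<^sup>2 \<partial>Q) \<le> (\<integral>z. (?f z)\<^sup>2 \<partial>Q)"
    unfolding eq by (rule Q.variance_le_second_moment[OF i1 i2])
qed

definition Frobenius_dev :: "nat \<Rightarrow> 'w \<Rightarrow> real" where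
  "Frobenius_dev n \<omega> = (\<Sum>i<m n. \<Sum>k<m n. ((1 / real n) * (\<Sum>j=1..n. entry_dev n i k (Z n j \<omega>)))\<^sup>2)"

text \<open>Each entry contributes its variance divided by \<open>n\<close>, bounded by a second
  moment. The squares \<open>(w n z $ i * w n z $ k)\<^sup>2\<close> are summed over
  \<open>i\<close> and \<open>k\<close> before they are estimated: the sum is the fourth power of
  the norm, at most \<open>B ^ 4 * m\<^sup>2\<close>, whereas a separate bound for each entry would
  lose a factor \<open>m\<^sup>2\<close>.\<close>

lemma Frobenius_dev_moment:
  assumes n: "n \<ge> 1"
  shows "integrable (M n) (Frobenius_dev n)" "(\<integral>\<omega>. Frobenius_dev n \<omega> \<partial>M n) \<le> B ^ 4 * real (m n) ^ 2 / real n"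
proof -
  interpret prob_space "M n" by (rule prob_M[OF n])
  let ?S = "\<lambda>i k \<omega>. (\<Sum>j=1..n. entry_dev n i k (Z n j \<omega>))"
  have s: "integrable (M n) (\<lambda>\<omega>. (?S i k \<omega>)\<^sup>2) \<and> (\<integral>\<omega>. (?S i k \<omega>)\<^sup>2 \<partial>M n) = real n * (\<integral>z. (entry_dev n i k z)\<^sup>2 \<partial>Q)"
    if "i < m n" "k < m n" for i k
    using iid_centred_sum_square[OF indep[OF n] distr[OF n] entry_dev_facts(1,2,3)[OF n that]] by blast
  have eq: "Frobenius_dev n \<omega> = (\<Sum>i<m n. \<Sum>k<m n. (1 / (real n)\<^sup>2) * (?S i k \<omega>)\<^sup>2)" for \<omega>
    unfolding Frobenius_dev_def by (simp only: power_mult_distrib power_one_over)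
  have int: "integrable (M n) (\<lambda>\<omega>. (1 / (real n)\<^sup>2) * (?S i k \<omega>)\<^sup>2)" if "i < m n" "k < m n" for i k
    using s[OF that] by (intro integrable_mult_right) auto
  show "integrable (M n) (Frobenius_dev n)"
    unfolding eq[abs_def] by (intro Bochner_Integration.integrable_sum int) auto
  have "(\<integral>\<omega>. Frobenius_dev n \<omega> \<partial>M n) = (\<Sum>i<m n. \<Sum>k<m n. (\<integral>\<omega>. (1 / (real n)\<^sup>2) * (?S i k \<omega>)\<^sup>2 \<partial>M n))"
    unfolding eq
    by (subst Bochner_Integration.integral_sum, (intro Bochner_Integration.integrable_sum int; simp),
        intro sum.cong refl Bochner_Integration.integral_sum int, simp_all)
  also have "\<dots> = (\<Sum>i<m n. \<Sum>k<m n. (1 / real n) * (\<integral>z. (entry_dev n i k z)\<^sup>2 \<partial>Q))"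
    using s n by (intro sum.cong refl) (simp add: power2_eq_square)
  also have "\<dots> \<le> (\<Sum>i<m n. \<Sum>k<m n. (1 / real n) * (\<integral>z. (w n z $ i * w n z $ k)\<^sup>2 \<partial>Q))"
    using entry_dev_facts(5)[OF n] by (intro sum_mono mult_left_mono) auto
  also have "\<dots> = (1 / real n) * (\<integral>z. (\<Sum>i<m n. \<Sum>k<m n. (w n z $ i * w n z $ k)\<^sup>2) \<partial>Q)"
    unfolding sum_distrib_left[symmetric] using entry_dev_facts(4)[OF n]
    by (subst Bochner_Integration.integral_sum) (auto intro!: Bochner_Integration.integrable_sum sum.cong Bochner_Integration.integral_sum[symmetric])
  also have "\<dots> \<le> (1 / real n) * (B ^ 4 * real (m n) ^ 2)"
  proof (intro mult_left_mono Q.integral_le_const AE_I2)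
    fix z assume z: "z \<in> space Q"
    have "(\<Sum>i<m n. \<Sum>k<m n. (w n z $ i * w n z $ k)\<^sup>2) = ((vnorm (w n z))\<^sup>2)\<^sup>2"
      unfolding vnorm_square_sum[OF w_carrier[OF n z]]
      by (simp add: power2_eq_square[of "sum _ _"] sum_product power_mult_distrib)
    also have "\<dots> \<le> ((B * sqrt (real (m n)))\<^sup>2)\<^sup>2"
      using w_bound[OF n z] by (intro power_mono) auto
    also have "\<dots> = B ^ 4 * real (m n) ^ 2" by (simp add: power_mult_distrib flip: power_mult)
    finally show "(\<Sum>i<m n. \<Sum>k<m n. (w n z $ i * w n z $ k)\<^sup>2) \<le> B ^ 4 * real (m n) ^ 2" .
  qed (auto intro!: Bochner_Integration.integrable_sum entry_dev_facts(4)[OF n])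
  finally show "(\<integral>\<omega>. Frobenius_dev n \<omega> \<partial>M n) \<le> B ^ 4 * real (m n) ^ 2 / real n" by simp
qed

lemma powr_minus_half: "0 < y \<Longrightarrow> y powr (- 1 / 2) = 1 / sqrt y" for y :: real
  by (simp add: powr_minus_divide powr_half_sqrt)

text \<open>The mean of the squared Frobenius norm is \<open>1 / m\<close> times a constant multiple
  of \<open>m ^ 3 / n\<close>, so Markov's inequality makes it small at rate \<open>1 / m\<close>;
  the square root halves the exponent.\<close>

lemma W_bar_close: "small_op M (\<lambda>n \<omega>. op_norm (W_bar n \<omega> - W n)) (\<lambda>n. real (m n) powr (- 1 / 2))"
proof (rule small_op_mono[where Y=Frobenius_dev and b="\<lambda>n. 1 / real (m n)"])
  show "small_op M Frobenius_dev (\<lambda>n. 1 / real (m n))"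
  proof (rule small_op_Markov[where E="\<lambda>n. B ^ 4 * real (m n) ^ 2 / real n"])
    show "0 < 1 / real (m n)" if "n \<ge> 1" for n using m_pos[OF that] by simp
    have "(\<lambda>n. B ^ 4 * (real (m n) ^ 3 / real n)) \<longlonglongrightarrow> B ^ 4 * 0" by (intro tendsto_intros growth_limit)
    moreover have "B ^ 4 * real (m n) ^ 2 / real n / (1 / real (m n)) = B ^ 4 * (real (m n) ^ 3 / real n)" for n
      by (simp add: power2_eq_square power3_eq_cube)
    ultimately show "(\<lambda>n. B ^ 4 * real (m n) ^ 2 / real n / (1 / real (m n))) \<longlonglongrightarrow> 0" by (simp only: mult_zero_right)
    show "0 \<le> Frobenius_dev n \<omega>" for n \<omega> by (simp add: Frobenius_dev_def sum_nonneg)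
  qed (auto intro: prob_M Frobenius_dev_moment)
  show "prob_space (M n)" if "n \<ge> 1" for n by (rule prob_M[OF that])
  show "Frobenius_dev n \<in> borel_measurable (M n)" if "n \<ge> 1" for n using Frobenius_dev_moment(1)[OF that] by auto
  fix \<epsilon> :: real assume e: "0 < \<epsilon>"
  show "\<exists>\<delta>>0. \<forall>\<^sub>F n in sequentially. \<forall>\<omega>\<in>space (M n). \<epsilon> * real (m n) powr (- 1 / 2) < \<bar>op_norm (W_bar n \<omega> - W n)\<bar> \<longrightarrow> \<delta> * (1 / real (m n)) < \<bar>Frobenius_dev n \<omega>\<bar>"
  proof (intro exI[of _ "\<epsilon>\<^sup>2"] conjI)
    show "\<forall>\<^sub>F n in sequentially. \<forall>\<omega>\<in>space (M n). \<epsilon> * real (m n) powr (- 1 / 2) < \<bar>op_norm (W_bar n \<omega> - W n)\<bar> \<longrightarrow> \<epsilon>\<^sup>2 * (1 / real (m n)) < \<bar>Frobenius_dev n \<omega>\<bar>"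
      using eventually_ge_at_top[of 1]
    proof eventually_elim
      case (elim n)
      have m: "0 < real (m n)" using m_pos[OF elim] by simp
      show ?case
      proof (intro ballI impI)
        fix \<omega> assume \<omega>: "\<omega> \<in> space (M n)" and gt: "\<epsilon> * real (m n) powr (- 1 / 2) < \<bar>op_norm (W_bar n \<omega> - W n)\<bar>"
        have D: "W_bar n \<omega> - W n \<in> carrier_mat (m n) (m n)" using W_carrier[of n] by (rule minus_carrier_mat)
        have "\<epsilon> * (1 / sqrt (real (m n))) < op_norm (W_bar n \<omega> - W n)"
          using gt op_norm_nonneg[OF D m_pos[OF elim]] unfolding powr_minus_half[OF m] by simp
        also have "\<dots> \<le> sqrt (\<Sum>i<m n. \<Sum>k<m n. ((W_bar n \<omega> - W n) $$ (i, k))\<^sup>2)"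
          by (rule op_norm_le_Frobenius[OF D m_pos[OF elim]])
        also have "\<dots> = sqrt (Frobenius_dev n \<omega>)"
          unfolding Frobenius_dev_def using W_bar_minus_entry[OF elim \<omega>] by (intro arg_cong[where f=sqrt] sum.cong refl) auto
        finally have "(\<epsilon> * (1 / sqrt (real (m n))))\<^sup>2 < (sqrt (Frobenius_dev n \<omega>))\<^sup>2"
          using e by (intro power_strict_mono) auto
        moreover have "0 \<le> Frobenius_dev n \<omega>" by (simp add: Frobenius_dev_def sum_nonneg)
        ultimately show "\<epsilon>\<^sup>2 * (1 / real (m n)) < \<bar>Frobenius_dev n \<omega>\<bar>" using m by (simp add: power_mult_distrib power_divide)
      qed
    qed
  qed (use e in simp)
qed

lemma w_Z_measurable: "n \<ge> 1 \<Longrightarrow> j \<in> {1..n} \<Longrightarrow> i < m n \<Longrightarrow> (\<lambda>\<omega>. w n (Z n j \<omega>) $ i) \<in> borel_measurable (M n)"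
  using measurable_compose[OF Z_measurable w_component_measurable] by blast

end

lemma mat_avg_outer_measurable:
  assumes x: "\<And>j \<omega>. j \<in> {1..n} \<Longrightarrow> \<omega> \<in> space M \<Longrightarrow> x \<omega> j \<in> carrier_vec d"
    and meas: "\<And>j i. j \<in> {1..n} \<Longrightarrow> i < d \<Longrightarrow> (\<lambda>\<omega>. x \<omega> j $ i) \<in> borel_measurable M"
    and ik: "i < d" "k < d"
  shows "(\<lambda>\<omega>. mat_avg d n (\<lambda>j. outer (x \<omega> j) (x \<omega> j)) $$ (i, k)) \<in> borel_measurable M"
proof -
  have "(\<lambda>\<omega>. (1 / real n) * (\<Sum>j=1..n. x \<omega> j $ i * x \<omega> j $ k)) \<in> borel_measurable M"
    by (intro borel_measurable_times borel_measurable_sum borel_measurable_const meas ik)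
  moreover have "mat_avg d n (\<lambda>j. outer (x \<omega> j) (x \<omega> j)) $$ (i, k) = (1 / real n) * (\<Sum>j=1..n. x \<omega> j $ i * x \<omega> j $ k)"
    if "\<omega> \<in> space M" for \<omega>
    using ik x[OF _ that, THEN carrier_vecD] by (simp add: mat_avg_def outer_def)
  ultimately show ?thesis by (simp cong: measurable_cong)
qed

lemma vec_avg_measurable:
  assumes "\<And>j. j \<in> {1..n} \<Longrightarrow> (\<lambda>\<omega>. x \<omega> j $ i) \<in> borel_measurable M" "i < d"
  shows "(\<lambda>\<omega>. vec_avg d n (x \<omega>) $ i) \<in> borel_measurable M"
  using assms by (simp add: vec_avg_def)

section \<open>Quadratic approximation of the log likelihood ratio\<close>

text \<open>The analysis sees the estimator only through its values \<open>x n \<omega> j\<close> at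
  the observations; these may depend on the whole sample.\<close>

locale el_estimator = el_setting Q M Z m w W P B c C
  for Q :: "'z measure" and M :: "nat \<Rightarrow> 'w measure" and Z m w W P B c C +
  fixes x :: "nat \<Rightarrow> 'w \<Rightarrow> nat \<Rightarrow> real Matrix.vec"
  assumes x_carrier: "\<And>n \<omega> j. n \<ge> 1 \<Longrightarrow> \<omega> \<in> space (M n) \<Longrightarrow> j \<in> {1..n} \<Longrightarrow> x n \<omega> j \<in> carrier_vec (m n)"
    and x_measurable: "\<And>n j i. n \<ge> 1 \<Longrightarrow> j \<in> {1..n} \<Longrightarrow> i < m n \<Longrightarrow> (\<lambda>\<omega>. x n \<omega> j $ i) \<in> borel_measurable (M n)"
    and x_bound: "\<And>n \<omega> j. n \<ge> 1 \<Longrightarrow> \<omega> \<in> space (M n) \<Longrightarrow> j \<in> {1..n} \<Longrightarrow> vnorm (x n \<omega> j) \<le> B * sqrt (real (m n))"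
begin

definition W_hat :: "nat \<Rightarrow> 'w \<Rightarrow> real mat" where
  "W_hat n \<omega> = mat_avg (m n) n (\<lambda>j. outer (x n \<omega> j) (x n \<omega> j))"

definition e :: "nat \<Rightarrow> 'w \<Rightarrow> real Matrix.vec" where
  "e n \<omega> = vec_avg (m n) n (x n \<omega>) - wbar n \<omega>"

text \<open>Half of the mixed term when \<open>n\<close> times the quadratic form in
  \<open>P\<close> is expanded at \<open>wbar + e\<close>.\<close>

definition cross :: "nat \<Rightarrow> 'w \<Rightarrow> real" where
  "cross n \<omega> = real n * scalar_prod (wbar n \<omega>) (P n *\<^sub>v e n \<omega>)"

lemma W_hat_carrier [simp]: "W_hat n \<omega> \<in> carrier_mat (m n) (m n)"
  by (simp add: W_hat_def)

lemma e_carrier [simp]: "e n \<omega> \<in> carrier_vec (m n)"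
  by (simp add: e_def)

text \<open>On the good event \<open>n\<close> times the squared norm of the mean of the
  \<open>x j\<close> is at most \<open>R * m\<close>: twice \<open>2 * C * m\<close> from
  \<open>wbar\<close> plus twice \<open>m\<close> from the remainder.\<close>

definition R :: real where "R = 4 * C + 2"
text \<open>Collects the contributions proportional to \<eta>: \<open>2 * R / c\<^sup>2\<close> from
  the matrix error, 2 from the cross term and \<open>1 / c\<close> from the quadratic term of the
  remainder.\<close>

definition S :: real where "S = 2 * R / c\<^sup>2 + 2 + 1 / c"
text \<open>Equals sqrt m times m / sqrt n, the order of the cubic error
  \<open>m * (m / sqrt n)\<close> in units of sqrt m.\<close>

definition rate :: "nat \<Rightarrow> real" where "rate n = sqrt (real (m n) ^ 3 / real n)"

lemma rate_limit: "rate \<longlonglongrightarrow> 0"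
  unfolding rate_def[abs_def] using tendsto_real_sqrt[OF growth_limit] by simp

text \<open>A deterministic statement: all randomness is confined to the four inequalities
  \<open>h1\<close> to \<open>h4\<close>, which describe the good event. On it
  \<open>el_data\<close> applies with matrix error \<open>\<eta> / sqrt m\<close> and data bound
  \<open>B * sqrt m\<close>.\<close>

lemma neg2log_close:
  assumes n: "n \<ge> 1" and \<omega>: "\<omega> \<in> space (M n)"
    and h1: "op_norm (W_hat n \<omega> - W n) \<le> \<eta> / sqrt (real (m n))" and h2: "T n \<omega> \<le> 2 * real (m n)"
    and h3: "\<bar>cross n \<omega>\<bar> \<le> \<eta> * sqrt (real (m n))" and h4: "real n * (vnorm (e n \<omega>))\<^sup>2 \<le> \<eta> * sqrt (real (m n))"
    and \<eta>: "0 < \<eta>" "\<eta> \<le> 1" "\<eta> \<le> c / 2" and small: "8 * B * sqrt R / c * rate n \<le> 1 / 2"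
  defines "\<delta> \<equiv> sqrt (real (m n)) * (\<eta> * S + 48 * B * sqrt R * R / c\<^sup>2 * rate n)"
  shows "ereal (T n \<omega> - \<delta>) \<le> neg2log (el_ratio (m n) n (x n \<omega>)) \<and> neg2log (el_ratio (m n) n (x n \<omega>)) \<le> ereal (T n \<omega> + \<delta>)"
proof -
  let ?m = "real (m n)" and ?xb = "vec_avg (m n) n (x n \<omega>)" and ?y = "wbar n \<omega>" and ?e = "e n \<omega>"
  have m: "1 \<le> ?m" using m_pos[OF n] by simp
  have n0: "0 < real n" using n by simp
  have s1: "1 \<le> sqrt ?m" using m by simp
  have sm: "sqrt ?m \<le> ?m" using m by (intro real_le_lsqrt) (auto simp: power2_eq_square)
  have R0: "0 \<le> R" using C_nonneg by (simp add: R_def)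
  have xb: "?xb = ?y + ?e" unfolding e_def using wbar_carrier by (auto simp: vec_avg_def wbar_def)
  have ny: "real n * (vnorm ?y)\<^sup>2 \<le> 2 * C * ?m"
  proof -
    have "real n * (vnorm ?y)\<^sup>2 \<le> real n * (C * scalar_prod ?y (P n *\<^sub>v ?y))"
      by (intro mult_left_mono norm_le_P_form n wbar_carrier) auto
    also have "\<dots> = C * T n \<omega>" by (simp add: T_eq[OF n \<omega>])
    also have "\<dots> \<le> C * (2 * ?m)" by (intro mult_left_mono h2 C_nonneg)
    finally show ?thesis by simp
  qed
  define a where "a = vnorm ?xb"
  have na: "real n * a\<^sup>2 \<le> R * ?m"
  proof -
    have "a \<le> vnorm ?y + vnorm ?e" unfolding a_def xb by (rule vnorm_triangle[of _ "m n"]) auto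
    then have "a\<^sup>2 \<le> (vnorm ?y + vnorm ?e)\<^sup>2" by (intro power_mono) (auto simp: a_def)
    also have "\<dots> \<le> 2 * (vnorm ?y)\<^sup>2 + 2 * (vnorm ?e)\<^sup>2"
      using zero_le_power2[of "vnorm ?y - vnorm ?e"] by (simp add: power2_eq_square algebra_simps)
    finally have "real n * a\<^sup>2 \<le> real n * (2 * (vnorm ?y)\<^sup>2 + 2 * (vnorm ?e)\<^sup>2)" by (intro mult_left_mono) auto
    also have "\<dots> = 2 * (real n * (vnorm ?y)\<^sup>2) + 2 * (real n * (vnorm ?e)\<^sup>2)" by (simp add: algebra_simps)
    also have "\<dots> \<le> 2 * (2 * C * ?m) + 2 * ?m"
    proof -
      have "\<eta> * sqrt ?m \<le> 1 * ?m" using \<eta> sm by (intro mult_mono) auto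
      then show ?thesis using ny h4 by linarith
    qed
    finally show ?thesis by (simp add: R_def algebra_simps)
  qed
  have ab: "a * (B * sqrt ?m) \<le> B * sqrt R * (?m / sqrt (real n))"
  proof -
    have "a\<^sup>2 \<le> R * ?m / real n" using na n0 by (simp add: pos_le_divide_eq mult.commute)
    then have "a \<le> sqrt (R * ?m / real n)" by (rule real_le_rsqrt)
    also have "\<dots> = sqrt R * sqrt ?m / sqrt (real n)" by (simp add: real_sqrt_mult real_sqrt_divide)
    finally have "a * (B * sqrt ?m) \<le> sqrt R * sqrt ?m / sqrt (real n) * (B * sqrt ?m)"
      using B_nonneg by (intro mult_right_mono) auto
    also have "\<dots> = B * sqrt R * (sqrt ?m * sqrt ?m / sqrt (real n))" by simp
    finally show ?thesis by simp
  qed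
  have rate_eq: "rate n = sqrt ?m * (?m / sqrt (real n))"
  proof -
    have "sqrt (?m ^ 3) = sqrt (?m\<^sup>2 * ?m)" by (simp add: power3_eq_cube power2_eq_square)
    also have "\<dots> = ?m * sqrt ?m" by (simp add: real_sqrt_mult)
    finally show ?thesis by (simp add: rate_def real_sqrt_divide)
  qed
  have le_rate: "?m / sqrt (real n) \<le> rate n"
    unfolding rate_eq using mult_right_mono[OF s1, of "?m / sqrt (real n)"] by simp
  have Bc: "0 \<le> 8 * B * sqrt R / c" using B_nonneg R0 c_pos by simp
  have eps: "8 * (a * (B * sqrt ?m) / c) \<le> 8 * B * sqrt R / c * (?m / sqrt (real n))"
  proof -
    have "8 * (a * (B * sqrt ?m) / c) \<le> 8 * (B * sqrt R * (?m / sqrt (real n)) / c)"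
      by (intro mult_left_mono divide_right_mono ab) (use c_pos in auto)
    also have "\<dots> = 8 * B * sqrt R / c * (?m / sqrt (real n))" by (simp add: mult_ac)
    finally show ?thesis .
  qed
  interpret E: el_data "m n" n "x n \<omega>" "W n" "P n" c "\<eta> / sqrt ?m" "B * sqrt ?m"
  proof
    show "n \<ge> 1" by (rule n)
    show "x n \<omega> j \<in> carrier_vec (m n)" "vnorm (x n \<omega> j) \<le> B * sqrt ?m" if "j \<in> {1..n}" for j
      using x_carrier[OF n \<omega> that] x_bound[OF n \<omega> that] by auto
    show "W n \<in> carrier_mat (m n) (m n)" by (rule W_carrier)
    show "P n \<in> carrier_mat (m n) (m n)" "W n * P n = 1\<^sub>m (m n)" "0 < c" by (rule P[OF n], rule WP[OF n], rule c_pos)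
    show "0 \<le> \<eta> / sqrt ?m" using \<eta> by simp
    have "\<eta> / sqrt ?m \<le> \<eta> / 1" using \<eta> s1 by (intro divide_left_mono) auto
    then have "\<eta> / sqrt ?m \<le> \<eta>" by simp
    then show "\<eta> / sqrt ?m \<le> c / 2" by (rule order_trans[OF _ \<eta>(3)])
    show "scalar_prod u (W n *\<^sub>v v) = scalar_prod v (W n *\<^sub>v u)" if "u \<in> carrier_vec (m n)" "v \<in> carrier_vec (m n)" for u v
      by (rule W_symmetric[OF n that])
    show "c * (vnorm u)\<^sup>2 \<le> scalar_prod u (W n *\<^sub>v u)" if "u \<in> carrier_vec (m n)" for u by (rule W_lower[OF n that])
    show "\<bar>scalar_prod u (mat_avg (m n) n (\<lambda>j. outer (x n \<omega> j) (x n \<omega> j)) *\<^sub>v v) - scalar_prod u (W n *\<^sub>v v)\<bar> \<le> \<eta> / sqrt ?m * vnorm u * vnorm v"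
      if u: "u \<in> carrier_vec (m n)" and v: "v \<in> carrier_vec (m n)" for u v
    proof -
      have D: "W_hat n \<omega> - W n \<in> carrier_mat (m n) (m n)" using W_carrier[of n] by (rule minus_carrier_mat)
      have "scalar_prod u ((W_hat n \<omega> - W n) *\<^sub>v v) = scalar_prod u (W_hat n \<omega> *\<^sub>v v) - scalar_prod u (W n *\<^sub>v v)"
        using u v W_carrier[of n]
        by (simp add: minus_mult_distrib_mat_vec[OF W_hat_carrier W_carrier v] scalar_prod_minus_distrib[of u "m n"] mult_mat_vec_carrier[OF W_hat_carrier] mult_mat_vec_carrier[OF W_carrier])
      moreover have "op_norm (W_hat n \<omega> - W n) * vnorm u * vnorm v \<le> \<eta> / sqrt ?m * vnorm u * vnorm v"
        by (intro mult_right_mono h1) auto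
      ultimately show ?thesis using op_norm_bilinear[OF D u v] unfolding W_hat_def[symmetric] by simp
    qed
    show "8 * (vnorm (vec_avg (m n) n (x n \<omega>)) * (B * sqrt ?m) / c) \<le> 1 / 2"
    proof -
      have "8 * B * sqrt R / c * (?m / sqrt (real n)) \<le> 8 * B * sqrt R / c * rate n"
        by (rule mult_left_mono[OF le_rate Bc])
      then show ?thesis using eps small unfolding a_def by linarith
    qed
  qed
  have Ea: "E.a = a" by (simp add: E.a_def E.xbar_def a_def)
  have theta: "\<bar>real n * E.\<theta> - T n \<omega>\<bar> \<le> sqrt ?m * (\<eta> * (2 + 1 / c))"
  proof -
    have Pe: "P n *\<^sub>v ?e \<in> carrier_vec (m n)" and Py: "P n *\<^sub>v ?y \<in> carrier_vec (m n)" by (rule P_mult_carrier[OF n]; simp)+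
    have Pxb: "P n *\<^sub>v (?y + ?e) = P n *\<^sub>v ?y + P n *\<^sub>v ?e" by (rule mult_add_distrib_mat_vec[OF P[OF n]]) auto
    have "E.\<theta> = scalar_prod (?y + ?e) (P n *\<^sub>v ?y + P n *\<^sub>v ?e)" unfolding E.\<theta>_def E.p_def E.xbar_def xb Pxb ..
    also have "\<dots> = (scalar_prod ?y (P n *\<^sub>v ?y) + scalar_prod ?y (P n *\<^sub>v ?e)) + (scalar_prod ?e (P n *\<^sub>v ?y) + scalar_prod ?e (P n *\<^sub>v ?e))"
      using Pe Py by (simp add: add_scalar_prod_distrib[of ?y "m n" ?e] scalar_prod_add_distrib[of _ "m n"])
    also have "scalar_prod ?e (P n *\<^sub>v ?y) = scalar_prod ?y (P n *\<^sub>v ?e)" by (rule P_symmetric[OF n]) auto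
    finally have eq: "real n * E.\<theta> - T n \<omega> = 2 * cross n \<omega> + real n * scalar_prod ?e (P n *\<^sub>v ?e)"
      by (simp add: T_eq[OF n \<omega>] cross_def algebra_simps)
    have "0 \<le> real n * scalar_prod ?e (P n *\<^sub>v ?e)" using P_norm(3)[OF n e_carrier] by simp
    moreover have "real n * scalar_prod ?e (P n *\<^sub>v ?e) \<le> \<eta> * sqrt ?m / c"
    proof -
      have "real n * scalar_prod ?e (P n *\<^sub>v ?e) \<le> real n * ((vnorm ?e)\<^sup>2 / c)" by (intro mult_left_mono P_norm n) auto
      also have "\<dots> \<le> \<eta> * sqrt ?m / c" using divide_right_mono[OF h4, of c] c_pos by simp
      finally show ?thesis .
    qed
    moreover have "sqrt ?m * (\<eta> * (2 + 1 / c)) = 2 * (\<eta> * sqrt ?m) + \<eta> * sqrt ?m / c" by (simp add: algebra_simps)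
    ultimately show ?thesis unfolding eq using h3 by linarith
  qed
  have err: "E.err \<le> sqrt ?m * (\<eta> * (2 * R / c\<^sup>2) + 48 * B * sqrt R * R / c\<^sup>2 * rate n)"
  proof -
    have "E.\<epsilon> \<le> 8 * B * sqrt R / c * (?m / sqrt (real n))" unfolding E.\<epsilon>_def Ea by (rule eps)
    then have "6 * E.\<epsilon> / c \<le> 6 * (8 * B * sqrt R / c * (?m / sqrt (real n))) / c" using c_pos by (intro divide_right_mono mult_left_mono) auto
    then have "E.err \<le> (R * ?m) * (2 * (\<eta> / sqrt ?m) / c\<^sup>2 + 6 * (8 * B * sqrt R / c * (?m / sqrt (real n))) / c)"
      unfolding E.err_def Ea using \<eta> R0 m E.eps(1) c_pos by (intro mult_mono[OF na] add_mono) auto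
    also have "\<dots> = \<eta> * (2 * R / c\<^sup>2) * (?m / sqrt ?m) + 48 * B * sqrt R * R / c\<^sup>2 * (?m * (?m / sqrt (real n)))"
      by (simp add: algebra_simps power2_eq_square)
    also have "?m / sqrt ?m = sqrt ?m" using m by (simp add: real_div_sqrt)
    also have "?m * (?m / sqrt (real n)) = sqrt ?m * rate n" unfolding rate_eq using m by simp
    finally show ?thesis by (simp add: algebra_simps)
  qed
  have tot: "sqrt ?m * (\<eta> * (2 + 1 / c)) + sqrt ?m * (\<eta> * (2 * R / c\<^sup>2) + 48 * B * sqrt R * R / c\<^sup>2 * rate n) = \<delta>"
    unfolding \<delta>_def S_def by (simp only: distrib_left ac_simps)
  have "T n \<omega> - \<delta> \<le> real n * E.\<theta> - E.err" "real n * E.\<theta> + E.err \<le> T n \<omega> + \<delta>"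
    using theta err tot by linarith+
  then show ?thesis using E.lower E.upper by (meson ereal_less_eq(3) order_trans)
qed

lemma e_component_measurable:
  assumes n: "n \<ge> 1" and i: "i < m n" shows "(\<lambda>\<omega>. e n \<omega> $ i) \<in> borel_measurable (M n)"
proof -
  have "(\<lambda>\<omega>. vec_avg (m n) n (x n \<omega>) $ i - wbar n \<omega> $ i) \<in> borel_measurable (M n)"
    unfolding wbar_def by (intro borel_measurable_diff vec_avg_measurable x_measurable w_Z_measurable n i)
  moreover have "e n \<omega> $ i = vec_avg (m n) n (x n \<omega>) $ i - wbar n \<omega> $ i" for \<omega>
    using i by (simp add: e_def wbar_def vec_avg_def)
  ultimately show ?thesis by simp
qed

lemma e_norm_measurable: assumes n: "n \<ge> 1" shows "(\<lambda>\<omega>. vnorm (e n \<omega>)) \<in> borel_measurable (M n)"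
proof -
  have [measurable]: "(\<lambda>\<omega>. \<Sum>i<m n. (e n \<omega> $ i)\<^sup>2) \<in> borel_measurable (M n)"
    by (intro borel_measurable_sum borel_measurable_power e_component_measurable n) auto
  have "vnorm (e n \<omega>) = sqrt (\<Sum>i<m n. (e n \<omega> $ i)\<^sup>2)" for \<omega>
    using vnorm_square_sum[OF e_carrier[of n \<omega>]] vnorm_nonneg[of "e n \<omega>"] by (metis real_sqrt_abs abs_of_nonneg)
  then show ?thesis by simp
qed

lemma cross_measurable: assumes n: "n \<ge> 1" shows "cross n \<in> borel_measurable (M n)"
proof -
  have eq: "cross n \<omega> = real n * (\<Sum>i<m n. \<Sum>k<m n. wbar n \<omega> $ i * (P n $$ (i, k) * e n \<omega> $ k))" for \<omega>
    using P[OF n]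
    by (simp add: cross_def scalar_prod_def atLeast0LessThan sum_distrib_left carrier_vecD[OF e_carrier] carrier_matD[OF P[OF n]])
  have "(\<lambda>\<omega>. wbar n \<omega> $ i) \<in> borel_measurable (M n)" if "i < m n" for i
    unfolding wbar_def by (intro vec_avg_measurable w_Z_measurable n that) auto
  then show ?thesis unfolding eq[abs_def] using e_component_measurable[OF n]
    by (intro borel_measurable_times borel_measurable_sum borel_measurable_const) auto
qed

lemma W_hat_entry_measurable:
  assumes n: "n \<ge> 1" and ik: "i < m n" "k < m n" shows "(\<lambda>\<omega>. W_hat n \<omega> $$ (i, k)) \<in> borel_measurable (M n)"
  unfolding W_hat_def by (rule mat_avg_outer_measurable) (use x_carrier x_measurable n ik in auto)

lemma W_bar_entry_measurable:
  assumes n: "n \<ge> 1" and ik: "i < m n" "k < m n" shows "(\<lambda>\<omega>. W_bar n \<omega> $$ (i, k)) \<in> borel_measurable (M n)"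
  unfolding W_bar_def by (rule mat_avg_outer_measurable) (use w_carrier Z_space w_Z_measurable n ik in auto)

lemma op_norm_diff_measurable:
  assumes n: "n \<ge> 1"
  shows "(\<lambda>\<omega>. op_norm (W_hat n \<omega> - W n)) \<in> borel_measurable (M n)"
    "(\<lambda>\<omega>. op_norm (W_hat n \<omega> - W_bar n \<omega>)) \<in> borel_measurable (M n)"
    "(\<lambda>\<omega>. op_norm (W_bar n \<omega> - W n)) \<in> borel_measurable (M n)"
proof -
  have *: "(\<lambda>\<omega>. op_norm (A \<omega> - A' \<omega>)) \<in> borel_measurable (M n)"
    if "\<And>\<omega>. A \<omega> \<in> carrier_mat (m n) (m n)" "\<And>\<omega>. A' \<omega> \<in> carrier_mat (m n) (m n)"
      and "\<And>i k. i < m n \<Longrightarrow> k < m n \<Longrightarrow> (\<lambda>\<omega>. A \<omega> $$ (i, k)) \<in> borel_measurable (M n)"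
      and "\<And>i k. i < m n \<Longrightarrow> k < m n \<Longrightarrow> (\<lambda>\<omega>. A' \<omega> $$ (i, k)) \<in> borel_measurable (M n)" for A A'
  proof (rule op_norm_measurable[OF _ m_pos[OF n]])
    show "A \<omega> - A' \<omega> \<in> carrier_mat (m n) (m n)" for \<omega> using that(2) by (rule minus_carrier_mat)
    fix i k assume ik: "i < m n" "k < m n"
    have "(A \<omega> - A' \<omega>) $$ (i, k) = A \<omega> $$ (i, k) - A' \<omega> $$ (i, k)" for \<omega>
      using that(1,2)[of \<omega>] ik by simp
    then show "(\<lambda>\<omega>. (A \<omega> - A' \<omega>) $$ (i, k)) \<in> borel_measurable (M n)"
      using that(3,4)[OF ik] by simp
  qed
  show "(\<lambda>\<omega>. op_norm (W_hat n \<omega> - W n)) \<in> borel_measurable (M n)"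
    by (rule *) (use W_carrier W_hat_entry_measurable[OF n] in auto)
  show "(\<lambda>\<omega>. op_norm (W_hat n \<omega> - W_bar n \<omega>)) \<in> borel_measurable (M n)"
    by (rule *) (use W_bar_entry_measurable[OF n] W_hat_entry_measurable[OF n] in auto)
  show "(\<lambda>\<omega>. op_norm (W_bar n \<omega> - W n)) \<in> borel_measurable (M n)"
    by (rule *) (use W_carrier W_bar_entry_measurable[OF n] in auto)
qed

lemma neg2log_sublevel_measurable:
  assumes n: "n \<ge> 1" shows "{\<omega>\<in>space (M n). neg2log (el_ratio (m n) n (x n \<omega>)) \<le> ereal t} \<in> sets (M n)"
  unfolding neg2log_le_iff[OF el_ratio_nonneg]
  by (rule el_ratio_ge_measurable[OF n]) (use x_carrier x_measurable n in auto)

text \<open>The good event is the complement of four exceptional sets, three from the smallness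
  assumptions and one from \<open>T_exceeds_limit\<close>. There \<open>neg2log_close\<close> gives
  the closeness that \<open>asymptotic_cdf\<close> asks for.\<close>

theorem neg2log_asymptotics:
  assumes a1: "small_op M (\<lambda>n \<omega>. op_norm (W_hat n \<omega> - W n)) (\<lambda>n. real (m n) powr (- 1 / 2))"
    and a2: "small_op M cross (\<lambda>n. sqrt (real (m n)))"
    and a3: "small_op M (\<lambda>n \<omega>. real n * (vnorm (e n \<omega>))\<^sup>2) (\<lambda>n. sqrt (real (m n)))"
    and u: "u \<longlonglongrightarrow> y"
  shows "(\<lambda>n. measure (M n) {\<omega>\<in>space (M n). neg2log (el_ratio (m n) n (x n \<omega>)) \<le> ereal (real (m n) + u n * sqrt (2 * real (m n)))})
    \<longlonglongrightarrow> cdf std_normal_distribution y"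
proof (rule asymptotic_cdf[OF neg2log_sublevel_measurable _ u])
  fix \<epsilon> :: real assume \<epsilon>: "0 < \<epsilon>"
  have R0: "0 \<le> R" using C_nonneg by (simp add: R_def)
  have S0: "0 < S"
  proof -
    have "0 \<le> 2 * R / c\<^sup>2" "0 < 1 / c" using R0 c_pos by simp_all
    then show ?thesis unfolding S_def by linarith
  qed
  \<comment> \<open>One half of \<epsilon> is reserved for the random errors, through
    \<open>\<eta> * S\<close>, and the other half for the deterministic error governed by
    \<open>rate\<close>.\<close>
  define \<eta> where "\<eta> = min (min 1 (c / 2)) (\<epsilon> / (2 * S))"
  have \<eta>: "0 < \<eta>" "\<eta> \<le> 1" "\<eta> \<le> c / 2" "\<eta> * S \<le> \<epsilon> / 2"
  proof -
    show "0 < \<eta>" "\<eta> \<le> 1" "\<eta> \<le> c / 2" using c_pos \<epsilon> S0 by (auto simp: \<eta>_def)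
    have "\<eta> \<le> \<epsilon> / (2 * S)" by (simp add: \<eta>_def)
    then show "\<eta> * S \<le> \<epsilon> / 2" using S0 by (simp add: pos_le_divide_eq mult_ac)
  qed
  let ?A1 = "\<lambda>n. {\<omega>\<in>space (M n). \<eta> * real (m n) powr (- 1 / 2) < \<bar>op_norm (W_hat n \<omega> - W n)\<bar>}"
  let ?A2 = "\<lambda>n. {\<omega>\<in>space (M n). \<eta> * sqrt (real (m n)) < \<bar>cross n \<omega>\<bar>}"
  let ?A3 = "\<lambda>n. {\<omega>\<in>space (M n). \<eta> * sqrt (real (m n)) < \<bar>real n * (vnorm (e n \<omega>))\<^sup>2\<bar>}"
  let ?A4 = "\<lambda>n. {\<omega>\<in>space (M n). T n \<omega> > 2 * real (m n)}"
  let ?A = "\<lambda>n. (?A1 n \<union> ?A2 n) \<union> (?A3 n \<union> ?A4 n)"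
  let ?G = "\<lambda>n. space (M n) - ?A n"
  have sets: "?A1 n \<in> sets (M n)" "?A2 n \<in> sets (M n)" "?A3 n \<in> sets (M n)" "?A4 n \<in> sets (M n)" if n: "n \<ge> 1" for n
  proof -
    note [measurable] = op_norm_diff_measurable(1)[OF n] cross_measurable[OF n] e_norm_measurable[OF n] T_measurable[OF n]
    show "?A1 n \<in> sets (M n)" "?A2 n \<in> sets (M n)" "?A3 n \<in> sets (M n)" "?A4 n \<in> sets (M n)" by measurable
  qed
  have setA: "?A n \<in> sets (M n)" if "n \<ge> 1" for n
    by (intro sets.Un sets[OF that])
  have "(\<lambda>n. (measure (M n) (?A1 n) + measure (M n) (?A2 n)) + (measure (M n) (?A3 n) + measure (M n) (?A4 n))) \<longlonglongrightarrow> (0 + 0) + (0 + 0)"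
    using a1 a2 a3 \<eta>(1) by (intro tendsto_add T_exceeds_limit) (simp_all add: small_op_def)
  then have "(\<lambda>n. 1 - ((measure (M n) (?A1 n) + measure (M n) (?A2 n)) + (measure (M n) (?A3 n) + measure (M n) (?A4 n)))) \<longlonglongrightarrow> 1 - ((0 + 0) + (0 + 0))"
    by (intro tendsto_diff tendsto_const)
  then have lim: "(\<lambda>n. 1 - ((measure (M n) (?A1 n) + measure (M n) (?A2 n)) + (measure (M n) (?A3 n) + measure (M n) (?A4 n)))) \<longlonglongrightarrow> 1"
    by (simp only: add_0 diff_zero)
  have "(\<lambda>n. measure (M n) (?G n)) \<longlonglongrightarrow> 1"
  proof (rule tendsto_sandwich[OF _ _ lim tendsto_const])
    show "\<forall>\<^sub>F n in sequentially. 1 - ((measure (M n) (?A1 n) + measure (M n) (?A2 n)) + (measure (M n) (?A3 n) + measure (M n) (?A4 n))) \<le> measure (M n) (?G n)"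
      using eventually_ge_at_top[of 1]
    proof eventually_elim
      case (elim n)
      interpret prob_space "M n" by (rule prob_M[OF elim])
      have "prob (?A n) \<le> (prob (?A1 n) + prob (?A2 n)) + (prob (?A3 n) + prob (?A4 n))"
        using measure_Un_le[OF sets.Un[OF sets(1,2)[OF elim]] sets.Un[OF sets(3,4)[OF elim]]]
          measure_Un_le[OF sets(1,2)[OF elim]] measure_Un_le[OF sets(3,4)[OF elim]] by linarith
      then show ?case unfolding prob_compl[OF setA[OF elim]] by linarith
    qed
    show "\<forall>\<^sub>F n in sequentially. measure (M n) (?G n) \<le> 1"
      using eventually_ge_at_top[of 1]
    proof eventually_elim
      case (elim n)
      interpret prob_space "M n" by (rule prob_M[OF elim])
      show ?case by (rule prob_le_1)
    qed
  qed
  moreover have "\<forall>\<^sub>F n in sequentially. \<forall>\<omega>\<in>?G n.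
     ereal (T n \<omega> - \<epsilon> * sqrt (real (m n))) \<le> neg2log (el_ratio (m n) n (x n \<omega>)) \<and>
     neg2log (el_ratio (m n) n (x n \<omega>)) \<le> ereal (T n \<omega> + \<epsilon> * sqrt (real (m n)))"
  proof -
    have "(\<lambda>n. 8 * B * sqrt R / c * rate n) \<longlonglongrightarrow> 8 * B * sqrt R / c * 0" by (intro tendsto_intros rate_limit)
    then have e1: "\<forall>\<^sub>F n in sequentially. 8 * B * sqrt R / c * rate n < 1 / 2" by (rule order_tendstoD) simp
    have "(\<lambda>n. 48 * B * sqrt R * R / c\<^sup>2 * rate n) \<longlonglongrightarrow> 48 * B * sqrt R * R / c\<^sup>2 * 0" by (intro tendsto_intros rate_limit)
    then have e2: "\<forall>\<^sub>F n in sequentially. 48 * B * sqrt R * R / c\<^sup>2 * rate n < \<epsilon> / 2" by (rule order_tendstoD) (use \<epsilon> in simp)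
    show ?thesis using e1 e2 eventually_ge_at_top[of 1]
    proof eventually_elim
      case (elim n)
      have m: "0 < real (m n)" using m_pos[OF elim(3)] by simp
      show ?case
      proof
        fix \<omega> assume g: "\<omega> \<in> ?G n"
        then have \<omega>: "\<omega> \<in> space (M n)" by simp
        let ?\<delta> = "sqrt (real (m n)) * (\<eta> * S + 48 * B * sqrt R * R / c\<^sup>2 * rate n)"
        have "\<eta> * S + 48 * B * sqrt R * R / c\<^sup>2 * rate n \<le> \<epsilon>" using \<eta>(4) elim(2) by linarith
        then have "?\<delta> \<le> sqrt (real (m n)) * \<epsilon>" by (rule mult_left_mono) simp
        also have "\<dots> = \<epsilon> * sqrt (real (m n))" by (rule mult.commute)
        finally have d: "?\<delta> \<le> \<epsilon> * sqrt (real (m n))" .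
        have "ereal (T n \<omega> - ?\<delta>) \<le> neg2log (el_ratio (m n) n (x n \<omega>)) \<and> neg2log (el_ratio (m n) n (x n \<omega>)) \<le> ereal (T n \<omega> + ?\<delta>)"
        proof (rule neg2log_close[OF elim(3) \<omega> _ _ _ _ \<eta>(1,2,3)])
          show "op_norm (W_hat n \<omega> - W n) \<le> \<eta> / sqrt (real (m n))" using g \<omega> unfolding powr_minus_half[OF m] by auto
          show "T n \<omega> \<le> 2 * real (m n)" "\<bar>cross n \<omega>\<bar> \<le> \<eta> * sqrt (real (m n))" "real n * (vnorm (e n \<omega>))\<^sup>2 \<le> \<eta> * sqrt (real (m n))"
            using g \<omega> by auto
          show "8 * B * sqrt R / c * rate n \<le> 1 / 2" using elim(1) by simp
        qed
        moreover have "ereal (T n \<omega> - \<epsilon> * sqrt (real (m n))) \<le> ereal (T n \<omega> - ?\<delta>)" "ereal (T n \<omega> + ?\<delta>) \<le> ereal (T n \<omega> + \<epsilon> * sqrt (real (m n)))"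
          using d by simp_all
        ultimately show "ereal (T n \<omega> - \<epsilon> * sqrt (real (m n))) \<le> neg2log (el_ratio (m n) n (x n \<omega>)) \<and>
           neg2log (el_ratio (m n) n (x n \<omega>)) \<le> ereal (T n \<omega> + \<epsilon> * sqrt (real (m n)))" by (meson order_trans)
      qed
    qed
  qed
  ultimately show "\<exists>G. (\<forall>n\<ge>1. G n \<in> sets (M n)) \<and> (\<lambda>n. measure (M n) (G n)) \<longlonglongrightarrow> 1 \<and>
     (\<forall>\<^sub>F n in sequentially. \<forall>\<omega>\<in>G n. ereal (T n \<omega> - \<epsilon> * sqrt (real (m n))) \<le> neg2log (el_ratio (m n) n (x n \<omega>)) \<and>
       neg2log (el_ratio (m n) n (x n \<omega>)) \<le> ereal (T n \<omega> + \<epsilon> * sqrt (real (m n))))"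
    by (intro exI[of _ ?G] conjI allI impI sets.compl_sets setA)
qed

end

section \<open>Reduction of the three alternative conditions to the first\<close>

context el_estimator begin

interpretation Q: prob_space Q by (rule prob_Q)

definition D :: "nat \<Rightarrow> 'w \<Rightarrow> real" where
  "D n \<omega> = (1 / real n) * (\<Sum>j=1..n. (vnorm (x n \<omega> j - w n (Z n j \<omega>)))\<^sup>2)"

lemma D_measurable: assumes n: "n \<ge> 1" shows "D n \<in> borel_measurable (M n)"
proof -
  have "(\<lambda>\<omega>. (1 / real n) * (\<Sum>j=1..n. \<Sum>i<m n. (x n \<omega> j $ i - w n (Z n j \<omega>) $ i)\<^sup>2)) \<in> borel_measurable (M n)"
    by (intro borel_measurable_times borel_measurable_sum borel_measurable_const borel_measurable_power
        borel_measurable_diff x_measurable w_Z_measurable n) auto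
  moreover have "D n \<omega> = (1 / real n) * (\<Sum>j=1..n. \<Sum>i<m n. (x n \<omega> j $ i - w n (Z n j \<omega>) $ i)\<^sup>2)" if \<omega>: "\<omega> \<in> space (M n)" for \<omega>
  proof -
    have "(vnorm (x n \<omega> j - w n (Z n j \<omega>)))\<^sup>2 = (\<Sum>i<m n. (x n \<omega> j $ i - w n (Z n j \<omega>) $ i)\<^sup>2)" if j: "j \<in> {1..n}" for j
      using x_carrier[OF n \<omega> j] w_carrier[OF n Z_space[OF n j \<omega>]] by (subst vnorm_square_sum[of _ "m n"]) auto
    then show ?thesis unfolding D_def by simp
  qed
  ultimately show ?thesis by (simp cong: measurable_cong)
qed

text \<open>With \<open>x = y + d\<close> the difference of the two forms consists of one term
  quadratic in \<open>d\<close> and two mixed terms. Cauchy-Schwarz over the observations bounds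
  them by \<open>D\<close> and the square root of \<open>D\<close>; the form of \<open>W_bar\<close>
  is at most \<open>C + 1\<close> on unit vectors because \<open>W_bar\<close> is within 1 of
  \<open>W\<close>. The square root explains why the third condition is stated at rate
  \<open>1 / m\<close>.\<close>

lemma W_hat_minus_W_bar:
  assumes n: "n \<ge> 1" and \<omega>: "\<omega> \<in> space (M n)" and le: "op_norm (W_bar n \<omega> - W n) \<le> 1"
  shows "op_norm (W_hat n \<omega> - W_bar n \<omega>) \<le> D n \<omega> + 2 * sqrt (D n \<omega>) * sqrt (C + 1)"
proof (rule op_norm_le_bilinear[OF _ m_pos[OF n]])
  have D0: "0 \<le> D n \<omega>" by (simp add: D_def sum_nonneg)
  have n0: "0 < real n" using n by simp
  show carr: "W_hat n \<omega> - W_bar n \<omega> \<in> carrier_mat (m n) (m n)" using W_bar_carrier by (rule minus_carrier_mat)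
  show "0 \<le> D n \<omega> + 2 * sqrt (D n \<omega>) * sqrt (C + 1)" using D0 C_nonneg by simp
  define y where "y j = w n (Z n j \<omega>)" for j
  define d where "d j = x n \<omega> j - y j" for j
  have yc: "y j \<in> carrier_vec (m n)" and xc: "x n \<omega> j \<in> carrier_vec (m n)" and dc: "d j \<in> carrier_vec (m n)" if j: "j \<in> {1..n}" for j
    using x_carrier[OF n \<omega> j] w_carrier[OF n Z_space[OF n j \<omega>]] by (auto simp: y_def d_def)
  have dsq: "sqrt (\<Sum>j=1..n. (scalar_prod u (d j))\<^sup>2) \<le> sqrt (real n) * (vnorm u * sqrt (D n \<omega>))" if u: "u \<in> carrier_vec (m n)" for u
  proof -
    have "(\<Sum>j=1..n. (scalar_prod u (d j))\<^sup>2) \<le> (\<Sum>j=1..n. (vnorm u)\<^sup>2 * (vnorm (d j))\<^sup>2)"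
    proof (intro sum_mono)
      fix j assume j: "j \<in> {1..n}"
      from power_mono[OF vnorm_Cauchy_Schwarz[OF u dc[OF j]], of 2]
      show "(scalar_prod u (d j))\<^sup>2 \<le> (vnorm u)\<^sup>2 * (vnorm (d j))\<^sup>2" by (simp add: power_mult_distrib)
    qed
    also have "\<dots> = real n * ((vnorm u)\<^sup>2 * D n \<omega>)"
      using n0 unfolding sum_distrib_left[symmetric] by (simp add: D_def d_def y_def)
    finally have "sqrt (\<Sum>j=1..n. (scalar_prod u (d j))\<^sup>2) \<le> sqrt (real n * ((vnorm u)\<^sup>2 * D n \<omega>))" by (rule real_sqrt_le_mono)
    then show ?thesis by (simp add: real_sqrt_mult)
  qed
  have ysq: "sqrt (\<Sum>j=1..n. (scalar_prod v (y j))\<^sup>2) \<le> sqrt (real n) * (vnorm v * sqrt (C + 1))" if v: "v \<in> carrier_vec (m n)" for v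
  proof -
    have "(\<Sum>j=1..n. (scalar_prod v (y j))\<^sup>2) = real n * scalar_prod v (W_bar n \<omega> *\<^sub>v v)"
    proof -
      have "scalar_prod v (W_bar n \<omega> *\<^sub>v v) = (1 / real n) * (\<Sum>j=1..n. scalar_prod v (y j) * scalar_prod v (y j))"
        unfolding W_bar_def y_def by (rule scalar_prod_mat_avg_outer) (use yc y_def v in auto)
      then show ?thesis using n0 by (simp add: power2_eq_square)
    qed
    moreover have "scalar_prod v (W_bar n \<omega> *\<^sub>v v) \<le> (C + 1) * (vnorm v)\<^sup>2"
    proof -
      have dif: "W_bar n \<omega> - W n \<in> carrier_mat (m n) (m n)" using W_carrier[of n] by (rule minus_carrier_mat)
      have "scalar_prod v ((W_bar n \<omega> - W n) *\<^sub>v v) = scalar_prod v (W_bar n \<omega> *\<^sub>v v) - scalar_prod v (W n *\<^sub>v v)"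
        using v by (simp add: minus_mult_distrib_mat_vec[OF W_bar_carrier W_carrier v] scalar_prod_minus_distrib[of v "m n"]
            mult_mat_vec_carrier[OF W_bar_carrier] mult_mat_vec_carrier[OF W_carrier])
      moreover have "op_norm (W_bar n \<omega> - W n) * vnorm v * vnorm v \<le> 1 * vnorm v * vnorm v" by (intro mult_right_mono le) auto
      ultimately have "scalar_prod v (W_bar n \<omega> *\<^sub>v v) \<le> scalar_prod v (W n *\<^sub>v v) + vnorm v * vnorm v"
        using op_norm_bilinear[OF dif v v] by simp
      then show ?thesis using W_upper[OF n v] by (simp add: power2_eq_square algebra_simps)
    qed
    ultimately have "(\<Sum>j=1..n. (scalar_prod v (y j))\<^sup>2) \<le> real n * ((C + 1) * (vnorm v)\<^sup>2)" by (simp add: mult_left_mono)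
    then have "sqrt (\<Sum>j=1..n. (scalar_prod v (y j))\<^sup>2) \<le> sqrt (real n * ((C + 1) * (vnorm v)\<^sup>2))" by (rule real_sqrt_le_mono)
    then show ?thesis by (simp add: real_sqrt_mult mult_ac)
  qed
  have cs: "\<bar>\<Sum>j=1..n. f j * g j\<bar> \<le> sqrt (\<Sum>j=1..n. (f j)\<^sup>2) * sqrt (\<Sum>j=1..n. (g j)\<^sup>2)" for f g :: "nat \<Rightarrow> real"
  proof -
    have "\<bar>\<Sum>j=1..n. f j * g j\<bar> \<le> (\<Sum>j=1..n. \<bar>f j\<bar> * \<bar>g j\<bar>)" using sum_abs[of "\<lambda>j. f j * g j"] by (simp add: abs_mult)
    also have "\<dots> \<le> L2_set f {1..n} * L2_set g {1..n}" by (rule L2_set_mult_ineq)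
    finally show ?thesis by (simp add: L2_set_def)
  qed
  fix u v :: "real Matrix.vec" assume u: "u \<in> carrier_vec (m n)" and v: "v \<in> carrier_vec (m n)"
  have "scalar_prod u ((W_hat n \<omega> - W_bar n \<omega>) *\<^sub>v v) = scalar_prod u (W_hat n \<omega> *\<^sub>v v) - scalar_prod u (W_bar n \<omega> *\<^sub>v v)"
    using u v by (simp add: minus_mult_distrib_mat_vec[OF W_hat_carrier W_bar_carrier v] scalar_prod_minus_distrib[of u "m n"]
        mult_mat_vec_carrier[OF W_hat_carrier] mult_mat_vec_carrier[OF W_bar_carrier])
  also have "scalar_prod u (W_hat n \<omega> *\<^sub>v v) = (1 / real n) * (\<Sum>j=1..n. scalar_prod u (x n \<omega> j) * scalar_prod v (x n \<omega> j))"
    unfolding W_hat_def by (rule scalar_prod_mat_avg_outer) (use xc u v in auto)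
  also have "scalar_prod u (W_bar n \<omega> *\<^sub>v v) = (1 / real n) * (\<Sum>j=1..n. scalar_prod u (y j) * scalar_prod v (y j))"
    unfolding W_bar_def y_def by (rule scalar_prod_mat_avg_outer) (use yc y_def u v in auto)
  also have "(\<Sum>j=1..n. scalar_prod u (x n \<omega> j) * scalar_prod v (x n \<omega> j))
      = (\<Sum>j=1..n. scalar_prod u (d j) * scalar_prod v (d j)) + (\<Sum>j=1..n. scalar_prod u (d j) * scalar_prod v (y j))
       + (\<Sum>j=1..n. scalar_prod u (y j) * scalar_prod v (d j)) + (\<Sum>j=1..n. scalar_prod u (y j) * scalar_prod v (y j))"
    unfolding sum.distrib[symmetric]
  proof (intro sum.cong refl)
    fix j assume j: "j \<in> {1..n}"
    have "x n \<omega> j = d j + y j" using xc[OF j] yc[OF j] by (auto simp: d_def)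
    then show "scalar_prod u (x n \<omega> j) * scalar_prod v (x n \<omega> j) = scalar_prod u (d j) * scalar_prod v (d j) + scalar_prod u (d j) * scalar_prod v (y j)
       + scalar_prod u (y j) * scalar_prod v (d j) + scalar_prod u (y j) * scalar_prod v (y j)"
      using u v dc[OF j] yc[OF j] by (simp add: scalar_prod_add_distrib[of _ "m n"] algebra_simps)
  qed
  finally have eq: "scalar_prod u ((W_hat n \<omega> - W_bar n \<omega>) *\<^sub>v v) = (1 / real n) * ((\<Sum>j=1..n. scalar_prod u (d j) * scalar_prod v (d j))
       + (\<Sum>j=1..n. scalar_prod u (d j) * scalar_prod v (y j)) + (\<Sum>j=1..n. scalar_prod u (y j) * scalar_prod v (d j)))"
    by (simp add: algebra_simps)
  have sn: "sqrt (real n) * p * (sqrt (real n) * q) = real n * (p * q)" for p q using n0 by simp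
  have 1: "\<bar>\<Sum>j=1..n. scalar_prod u (d j) * scalar_prod v (d j)\<bar> \<le> real n * ((vnorm u * sqrt (D n \<omega>)) * (vnorm v * sqrt (D n \<omega>)))"
    unfolding sn[symmetric] using D0 by (intro order_trans[OF cs] mult_mono dsq u v mult_nonneg_nonneg) (auto simp: sum_nonneg)
  have 2: "\<bar>\<Sum>j=1..n. scalar_prod u (d j) * scalar_prod v (y j)\<bar> \<le> real n * ((vnorm u * sqrt (D n \<omega>)) * (vnorm v * sqrt (C + 1)))"
    unfolding sn[symmetric] using D0 by (intro order_trans[OF cs] mult_mono dsq ysq u v mult_nonneg_nonneg) (auto simp: sum_nonneg)
  have 3: "\<bar>\<Sum>j=1..n. scalar_prod u (y j) * scalar_prod v (d j)\<bar> \<le> real n * ((vnorm u * sqrt (C + 1)) * (vnorm v * sqrt (D n \<omega>)))"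
    unfolding sn[symmetric] using C_nonneg by (intro order_trans[OF cs] mult_mono dsq ysq u v mult_nonneg_nonneg) (auto simp: sum_nonneg)
  have abs3: "\<bar>p + q + r\<bar> \<le> p' + q' + r'" if "\<bar>p\<bar> \<le> p'" "\<bar>q\<bar> \<le> q'" "\<bar>r\<bar> \<le> r'" for p q r p' q' r' :: real
    using that by linarith
  have "\<bar>scalar_prod u ((W_hat n \<omega> - W_bar n \<omega>) *\<^sub>v v)\<bar> = (1 / real n) * \<bar>(\<Sum>j=1..n. scalar_prod u (d j) * scalar_prod v (d j))
       + (\<Sum>j=1..n. scalar_prod u (d j) * scalar_prod v (y j)) + (\<Sum>j=1..n. scalar_prod u (y j) * scalar_prod v (d j))\<bar>"
    unfolding eq abs_mult by simp
  also have "\<dots> \<le> (1 / real n) * (real n * ((vnorm u * sqrt (D n \<omega>)) * (vnorm v * sqrt (D n \<omega>)))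
     + real n * ((vnorm u * sqrt (D n \<omega>)) * (vnorm v * sqrt (C + 1))) + real n * ((vnorm u * sqrt (C + 1)) * (vnorm v * sqrt (D n \<omega>))))"
    by (intro mult_left_mono abs3 1 2 3) simp
  also have "\<dots> = (sqrt (D n \<omega>) * sqrt (D n \<omega>) + 2 * sqrt (D n \<omega>) * sqrt (C + 1)) * vnorm u * vnorm v"
    using n0 by (simp add: field_simps del: real_sqrt_mult_self)
  also have "sqrt (D n \<omega>) * sqrt (D n \<omega>) = D n \<omega>" using D0 by simp
  finally show "\<bar>scalar_prod u ((W_hat n \<omega> - W_bar n \<omega>) *\<^sub>v v)\<bar> \<le> (D n \<omega> + 2 * sqrt (D n \<omega>) * sqrt (C + 1)) * vnorm u * vnorm v" .
qed

lemma W_hat_triangle: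
  assumes n: "n \<ge> 1"
  shows "\<bar>op_norm (W_hat n \<omega> - W n)\<bar> \<le> \<bar>op_norm (W_hat n \<omega> - W_bar n \<omega>)\<bar> + \<bar>op_norm (W_bar n \<omega> - W n)\<bar>"
proof -
  have "W_hat n \<omega> - W n \<in> carrier_mat (m n) (m n)" using W_carrier[of n] by (rule minus_carrier_mat)
  from op_norm_nonneg[OF this m_pos[OF n]] op_norm_triangle_minus[OF W_hat_carrier W_bar_carrier W_carrier m_pos[OF n], of \<omega> \<omega>]
  show ?thesis by linarith
qed

text \<open>All comparisons pass through \<open>W_bar\<close>, whose distance to \<open>W\<close> is
  small at the required rate by \<open>W_bar_close\<close>. In the third case the same lemma also
  supplies the event on which \<open>W_hat_minus_W_bar\<close> is valid.\<close>

lemma W_hat_close: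
  assumes "small_op M (\<lambda>n \<omega>. op_norm (W_hat n \<omega> - W n)) (\<lambda>n. real (m n) powr (- 1 / 2)) \<or>
     small_op M (\<lambda>n \<omega>. op_norm (W_hat n \<omega> - W_bar n \<omega>)) (\<lambda>n. real (m n) powr (- 1 / 2)) \<or>
     small_op M D (\<lambda>n. real (m n) powr (- 1))"
  shows "small_op M (\<lambda>n \<omega>. op_norm (W_hat n \<omega> - W n)) (\<lambda>n. real (m n) powr (- 1 / 2))"
  using assms
proof (elim disjE)
  assume Y: "small_op M (\<lambda>n \<omega>. op_norm (W_hat n \<omega> - W_bar n \<omega>)) (\<lambda>n. real (m n) powr (- 1 / 2))"
  show ?thesis
  proof (rule small_op_add_mono[OF Y W_bar_close prob_M op_norm_diff_measurable(2,3)])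
    fix \<epsilon> :: real assume \<epsilon>: "0 < \<epsilon>"
    show "\<exists>\<delta>>0. \<exists>\<delta>'>0. \<forall>\<^sub>F n in sequentially. \<forall>\<omega>\<in>space (M n). 
      \<bar>op_norm (W_hat n \<omega> - W_bar n \<omega>)\<bar> \<le> \<delta> * real (m n) powr (- 1 / 2) \<longrightarrow> \<bar>op_norm (W_bar n \<omega> - W n)\<bar> \<le> \<delta>' * real (m n) powr (- 1 / 2)
       \<longrightarrow> \<bar>op_norm (W_hat n \<omega> - W n)\<bar> \<le> \<epsilon> * real (m n) powr (- 1 / 2)"
    proof (intro exI[of _ "\<epsilon> / 2"] conjI)
      show "\<forall>\<^sub>F n in sequentially. \<forall>\<omega>\<in>space (M n). 
        \<bar>op_norm (W_hat n \<omega> - W_bar n \<omega>)\<bar> \<le> \<epsilon> / 2 * real (m n) powr (- 1 / 2) \<longrightarrow> \<bar>op_norm (W_bar n \<omega> - W n)\<bar> \<le> \<epsilon> / 2 * real (m n) powr (- 1 / 2)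
         \<longrightarrow> \<bar>op_norm (W_hat n \<omega> - W n)\<bar> \<le> \<epsilon> * real (m n) powr (- 1 / 2)"
        using eventually_ge_at_top[of 1]
      proof eventually_elim
        case (elim n)
        show ?case
        proof (intro ballI impI)
          fix \<omega> assume "\<bar>op_norm (W_hat n \<omega> - W_bar n \<omega>)\<bar> \<le> \<epsilon> / 2 * real (m n) powr (- 1 / 2)" "\<bar>op_norm (W_bar n \<omega> - W n)\<bar> \<le> \<epsilon> / 2 * real (m n) powr (- 1 / 2)"
          from order_trans[OF W_hat_triangle[OF elim] add_mono[OF this]]
          show "\<bar>op_norm (W_hat n \<omega> - W n)\<bar> \<le> \<epsilon> * real (m n) powr (- 1 / 2)" by simp
        qed
      qed
    qed (use \<epsilon> in auto)
  qed
next
  assume Y: "small_op M D (\<lambda>n. real (m n) powr (- 1))"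
  show ?thesis
  proof (rule small_op_add_mono[OF Y W_bar_close prob_M D_measurable op_norm_diff_measurable(3)])
    fix \<epsilon> :: real assume \<epsilon>: "0 < \<epsilon>"
    \<comment> \<open>Once \<open>D\<close> is at most the square of \<open>s * r\<close>, with
      \<open>r\<close> the target rate and \<open>s * r \<le> 1\<close>, both \<open>D\<close> and
      its square root are at most \<open>s * r\<close>, and the bound of
      \<open>W_hat_minus_W_bar\<close> becomes \<open>k * s * r\<close>.\<close>
    define k where "k = 1 + 2 * sqrt (C + 1)"
    define s where "s = min 1 (\<epsilon> / (2 * k))"
    define s' where "s' = min 1 (\<epsilon> / 2)"
    have k: "0 < k" using C_nonneg by (simp add: k_def add_pos_nonneg)
    have s: "0 < s" "s \<le> 1" "s * k \<le> \<epsilon> / 2"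
    proof -
      show "0 < s" "s \<le> 1" using \<epsilon> k by (auto simp: s_def)
      have "s \<le> \<epsilon> / (2 * k)" by (simp add: s_def)
      then show "s * k \<le> \<epsilon> / 2" using k by (simp add: pos_le_divide_eq mult_ac)
    qed
    have s': "0 < s'" "s' \<le> 1" "s' \<le> \<epsilon> / 2" using \<epsilon> by (auto simp: s'_def)
    show "\<exists>\<delta>>0. \<exists>\<delta>'>0. \<forall>\<^sub>F n in sequentially. \<forall>\<omega>\<in>space (M n). 
      \<bar>D n \<omega>\<bar> \<le> \<delta> * real (m n) powr (- 1) \<longrightarrow> \<bar>op_norm (W_bar n \<omega> - W n)\<bar> \<le> \<delta>' * real (m n) powr (- 1 / 2)
       \<longrightarrow> \<bar>op_norm (W_hat n \<omega> - W n)\<bar> \<le> \<epsilon> * real (m n) powr (- 1 / 2)"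
    proof (rule exI[of _ "s\<^sup>2"], rule conjI[OF _ exI[of _ s'], OF _ conjI])
      show "0 < s\<^sup>2" "0 < s'" using s s' by auto
      show "\<forall>\<^sub>F n in sequentially. \<forall>\<omega>\<in>space (M n). 
        \<bar>D n \<omega>\<bar> \<le> s\<^sup>2 * real (m n) powr (- 1) \<longrightarrow> \<bar>op_norm (W_bar n \<omega> - W n)\<bar> \<le> s' * real (m n) powr (- 1 / 2)
         \<longrightarrow> \<bar>op_norm (W_hat n \<omega> - W n)\<bar> \<le> \<epsilon> * real (m n) powr (- 1 / 2)"
        using eventually_ge_at_top[of 1]
      proof eventually_elim
        case (elim n)
        have m: "1 \<le> real (m n)" using m_pos[OF elim] by simp
        define r where "r = 1 / sqrt (real (m n))"
        have r: "0 < r" "r \<le> 1" "r\<^sup>2 = real (m n) powr (- 1)" "r = real (m n) powr (- 1 / 2)"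
          using m powr_minus_half[of "real (m n)"] by (auto simp: r_def power_divide powr_minus_divide)
        show ?case
        proof (intro ballI impI)
          fix \<omega> assume \<omega>: "\<omega> \<in> space (M n)" and h: "\<bar>D n \<omega>\<bar> \<le> s\<^sup>2 * real (m n) powr (- 1)" "\<bar>op_norm (W_bar n \<omega> - W n)\<bar> \<le> s' * real (m n) powr (- 1 / 2)"
          have D0: "0 \<le> D n \<omega>" by (simp add: D_def sum_nonneg)
          have h1: "D n \<omega> \<le> (s * r)\<^sup>2" 
            unfolding power_mult_distrib r(3) by (rule order_trans[OF abs_ge_self h(1)])
          have h2: "\<bar>op_norm (W_bar n \<omega> - W n)\<bar> \<le> s' * r" using h(2) by (simp only: r(4))
          have sr: "0 < s * r" "s * r \<le> 1" using s r mult_mono[of s 1 r 1] by auto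
          have sD: "sqrt (D n \<omega>) \<le> s * r" using h1 sr by (intro real_le_lsqrt) auto
          have "s' * r \<le> 1" using s' r mult_mono[of s' 1 r 1] by auto
          then have "op_norm (W_bar n \<omega> - W n) \<le> 1" using h2 by linarith
          from W_hat_minus_W_bar[OF elim \<omega> this] 
          have "op_norm (W_hat n \<omega> - W_bar n \<omega>) \<le> D n \<omega> + 2 * sqrt (D n \<omega>) * sqrt (C + 1)" .
          also have "\<dots> \<le> s * r + 2 * (s * r) * sqrt (C + 1)"
          proof (intro add_mono mult_right_mono mult_left_mono sD)
            have "(s * r)\<^sup>2 \<le> (s * r) * 1" unfolding power2_eq_square using sr by (intro mult_left_mono) auto
            then show "D n \<omega> \<le> s * r" using h1 by simp
          qed (use C_nonneg in auto)
          also have "\<dots> = (s * k) * r" by (simp add: k_def algebra_simps)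
          also have "\<dots> \<le> \<epsilon> / 2 * r" using s r by (intro mult_right_mono) auto
          finally have h3: "op_norm (W_hat n \<omega> - W_bar n \<omega>) \<le> \<epsilon> / 2 * r" .
          have "W_hat n \<omega> - W_bar n \<omega> \<in> carrier_mat (m n) (m n)" using W_bar_carrier by (rule minus_carrier_mat)
          then have h4: "\<bar>op_norm (W_hat n \<omega> - W_bar n \<omega>)\<bar> \<le> \<epsilon> / 2 * r" using h3 op_norm_nonneg[OF _ m_pos[OF elim]] by simp
          have "s' * r \<le> \<epsilon> / 2 * r" using s' r by (intro mult_right_mono) auto
          then have h5: "\<bar>op_norm (W_bar n \<omega> - W n)\<bar> \<le> \<epsilon> / 2 * r" using h2 by linarith
          from order_trans[OF W_hat_triangle[OF elim] add_mono[OF h4 h5]]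
          show "\<bar>op_norm (W_hat n \<omega> - W n)\<bar> \<le> \<epsilon> * real (m n) powr (- 1 / 2)" unfolding r(4)[symmetric] by simp
        qed
      qed
    qed
  qed
qed

end

section \<open>Negligibility of the remainder in the sample mean\<close>

context el_estimator begin

interpretation Q: prob_space Q by (rule prob_Q)

lemma wbar_norm_measurable: assumes n: "n \<ge> 1" shows "(\<lambda>\<omega>. vnorm (wbar n \<omega>)) \<in> borel_measurable (M n)"
proof -
  have "(\<lambda>\<omega>. \<Sum>i<m n. (wbar n \<omega> $ i)\<^sup>2) \<in> borel_measurable (M n)"
    unfolding wbar_def by (intro borel_measurable_sum borel_measurable_power vec_avg_measurable w_Z_measurable n) auto
  then have [measurable]: "(\<lambda>\<omega>. sqrt (\<Sum>i<m n. (wbar n \<omega> $ i)\<^sup>2)) \<in> borel_measurable (M n)" by measurable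
  have "vnorm (wbar n \<omega>) = sqrt (\<Sum>i<m n. (wbar n \<omega> $ i)\<^sup>2)" for \<omega>
    using vnorm_square_sum[OF wbar_carrier[of n \<omega>]] vnorm_nonneg[of "wbar n \<omega>"] by (metis real_sqrt_abs abs_of_nonneg)
  then show ?thesis by simp
qed

lemma m_sqrt_infinity: "filterlim (\<lambda>n. sqrt (real (m n))) at_top sequentially"
  by (rule filterlim_compose[OF sqrt_at_top filterlim_compose[OF filterlim_real_sequentially m_infinity]])

text \<open>Unless \<open>T > 2 * m\<close>, the norm of \<open>wbar\<close> is at most of order
  sqrt (m / n), so multiplication by \<open>n * vnorm wbar\<close> turns the rate 1 / sqrt n into
  sqrt m.\<close>

lemma wbar_times_small:
  assumes f: "small_op M f (\<lambda>n. real n powr (- 1 / 2))" and fm: "\<And>n. n \<ge> 1 \<Longrightarrow> f n \<in> borel_measurable (M n)"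
  shows "small_op M (\<lambda>n \<omega>. real n * (vnorm (wbar n \<omega>) * f n \<omega>)) (\<lambda>n. sqrt (real (m n)))"
proof (rule small_op_add_mono[OF f _ prob_M fm])
  \<comment> \<open>an indicator is small at rate 0 as soon as its event has vanishing probability\<close>
  let ?Y = "\<lambda>n \<omega>. if T n \<omega> > 2 * real (m n) then 1 else 0 :: real"
  show "?Y n \<in> borel_measurable (M n)" if "n \<ge> 1" for n
    using T_measurable[OF that] by measurable
  show "small_op M ?Y (\<lambda>_. 0)"
    unfolding small_op_def
  proof (intro allI impI)
    fix \<epsilon> :: real
    have "{\<omega>\<in>space (M n). \<epsilon> * 0 < \<bar>?Y n \<omega>\<bar>} = {\<omega>\<in>space (M n). T n \<omega> > 2 * real (m n)}" for n by auto
    then show "(\<lambda>n. measure (M n) {\<omega>\<in>space (M n). \<epsilon> * 0 < \<bar>?Y n \<omega>\<bar>}) \<longlonglongrightarrow> 0" using T_exceeds_limit by simp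
  qed
  fix \<epsilon> :: real assume \<epsilon>: "0 < \<epsilon>"
  \<comment> \<open>The summand 1 keeps the divisor positive when \<open>C = 0\<close>.\<close>
  define k where "k = sqrt (2 * C) + 1"
  have k: "0 < k" using C_nonneg by (simp add: k_def add_nonneg_pos)
  show "\<exists>\<delta>>0. \<exists>\<delta>'>0. \<forall>\<^sub>F n in sequentially. \<forall>\<omega>\<in>space (M n).
     \<bar>f n \<omega>\<bar> \<le> \<delta> * real n powr (- 1 / 2) \<longrightarrow> \<bar>?Y n \<omega>\<bar> \<le> \<delta>' * 0 \<longrightarrow> \<bar>real n * (vnorm (wbar n \<omega>) * f n \<omega>)\<bar> \<le> \<epsilon> * sqrt (real (m n))"
  proof (rule exI[of _ "\<epsilon> / k"], rule conjI[OF _ exI[of _ 1], OF _ conjI])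
    show "0 < \<epsilon> / k" "0 < (1 :: real)" using \<epsilon> k by auto
    show "\<forall>\<^sub>F n in sequentially. \<forall>\<omega>\<in>space (M n).
       \<bar>f n \<omega>\<bar> \<le> \<epsilon> / k * real n powr (- 1 / 2) \<longrightarrow> \<bar>?Y n \<omega>\<bar> \<le> 1 * 0 \<longrightarrow> \<bar>real n * (vnorm (wbar n \<omega>) * f n \<omega>)\<bar> \<le> \<epsilon> * sqrt (real (m n))"
      using eventually_ge_at_top[of 1]
    proof eventually_elim
      case (elim n)
      have n0: "0 < real n" using elim by simp
      show ?case
      proof (intro ballI impI)
        fix \<omega> assume \<omega>: "\<omega> \<in> space (M n)" and h1: "\<bar>f n \<omega>\<bar> \<le> \<epsilon> / k * real n powr (- 1 / 2)" and "\<bar>?Y n \<omega>\<bar> \<le> 1 * 0"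
        then have T: "T n \<omega> \<le> 2 * real (m n)" by (simp split: if_splits)
        have "sqrt (real n) * vnorm (wbar n \<omega>) \<le> k * sqrt (real (m n))"
        proof -
          have "real n * (vnorm (wbar n \<omega>))\<^sup>2 \<le> real n * (C * scalar_prod (wbar n \<omega>) (P n *\<^sub>v wbar n \<omega>))"
            by (intro mult_left_mono norm_le_P_form elim wbar_carrier) auto
          also have "\<dots> = C * T n \<omega>" by (simp add: T_eq[OF elim \<omega>])
          also have "\<dots> \<le> C * (2 * real (m n))" by (intro mult_left_mono T C_nonneg)
          finally have "sqrt (real n * (vnorm (wbar n \<omega>))\<^sup>2) \<le> sqrt (C * (2 * real (m n)))" by (rule real_sqrt_le_mono)
          then have "sqrt (real n) * vnorm (wbar n \<omega>) \<le> sqrt (2 * C) * sqrt (real (m n))" by (simp add: real_sqrt_mult mult_ac)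
          also have "\<dots> \<le> k * sqrt (real (m n))" by (intro mult_right_mono) (auto simp: k_def)
          finally show ?thesis .
        qed
        moreover have "sqrt (real n) * \<bar>f n \<omega>\<bar> \<le> \<epsilon> / k"
        proof -
          have "sqrt (real n) * \<bar>f n \<omega>\<bar> \<le> sqrt (real n) * (\<epsilon> / k * (1 / sqrt (real n)))"
            using h1 unfolding powr_minus_half[OF n0] by (intro mult_left_mono) auto
          also have "\<dots> = \<epsilon> / k" using n0 by simp
          finally show ?thesis .
        qed
        ultimately have "(sqrt (real n) * vnorm (wbar n \<omega>)) * (sqrt (real n) * \<bar>f n \<omega>\<bar>) \<le> (k * sqrt (real (m n))) * (\<epsilon> / k)"
        proof (rule mult_mono)
          show "0 \<le> k * sqrt (real (m n))" "0 \<le> sqrt (real n) * \<bar>f n \<omega>\<bar>" using k by simp_all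
        qed
        moreover have "\<bar>real n * (vnorm (wbar n \<omega>) * f n \<omega>)\<bar> = (sqrt (real n) * vnorm (wbar n \<omega>)) * (sqrt (real n) * \<bar>f n \<omega>\<bar>)"
        proof -
          have "(sqrt (real n) * p) * (sqrt (real n) * q) = real n * (p * q)" for p q by simp
          then show ?thesis by (simp only: abs_mult abs_of_nonneg[OF vnorm_nonneg] abs_of_nat)
        qed
        moreover have "(k * sqrt (real (m n))) * (\<epsilon> / k) = \<epsilon> * sqrt (real (m n))" using k by simp
        ultimately show "\<bar>real n * (vnorm (wbar n \<omega>) * f n \<omega>)\<bar> \<le> \<epsilon> * sqrt (real (m n))" by (simp only:)
      qed
    qed
  qed
qed

text \<open>
  The part \<open>e1\<close> of the remainder is of smaller order than the sample mean, whereas \<open>e2\<close> has the same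
  order in a fixed dimension and is controlled by a variable \<open>Y\<close> of bounded mean.
\<close>

lemma remainder_small:
  fixes e1 e2 :: "nat \<Rightarrow> 'w \<Rightarrow> real Matrix.vec" and Y :: "nat \<Rightarrow> 'w \<Rightarrow> real" and L E :: real
  assumes e: "\<And>n \<omega>. n \<ge> 1 \<Longrightarrow> \<omega> \<in> space (M n) \<Longrightarrow> e n \<omega> = e1 n \<omega> - e2 n \<omega>"
    and e1: "\<And>n \<omega>. e1 n \<omega> \<in> carrier_vec (m n)" and e2: "\<And>n \<omega>. n \<ge> 1 \<Longrightarrow> e2 n \<omega> \<in> carrier_vec (m n)"
    and e1_small: "small_op M (\<lambda>n \<omega>. vnorm (e1 n \<omega>)) (\<lambda>n. real n powr (- 1 / 2))"
    and e1_meas: "\<And>n. n \<ge> 1 \<Longrightarrow> (\<lambda>\<omega>. vnorm (e1 n \<omega>)) \<in> borel_measurable (M n)"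
    and Y_int: "\<And>n. n \<ge> 1 \<Longrightarrow> integrable (M n) (Y n)" and Y_nonneg: "\<And>n \<omega>. 0 \<le> Y n \<omega>"
    and Y_E: "\<And>n. n \<ge> 1 \<Longrightarrow> (\<integral>\<omega>. Y n \<omega> \<partial>M n) \<le> E" and L: "0 \<le> L"
    and e2_norm: "\<And>n \<omega>. n \<ge> 1 \<Longrightarrow> \<omega> \<in> space (M n) \<Longrightarrow> real n * (vnorm (e2 n \<omega>))\<^sup>2 \<le> L * Y n \<omega>"
    and e2_cross: "\<And>n \<omega>. n \<ge> 1 \<Longrightarrow> \<omega> \<in> space (M n) \<Longrightarrow> \<bar>real n * scalar_prod (wbar n \<omega>) (P n *\<^sub>v e2 n \<omega>)\<bar> \<le> Y n \<omega>"
  shows "small_op M cross (\<lambda>n. sqrt (real (m n)))"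
    and "small_op M (\<lambda>n \<omega>. real n * (vnorm (e n \<omega>))\<^sup>2) (\<lambda>n. sqrt (real (m n)))"
proof -
  have Y_small: "small_op M Y (\<lambda>n. sqrt (real (m n)))"
  proof (rule small_op_Markov[where E="\<lambda>_. E"])
    \<comment> \<open>A bounded mean is set against a rate that tends to infinity; this is where
      contributions of fixed dimension vanish.\<close>
    show "(\<lambda>n. E / sqrt (real (m n))) \<longlonglongrightarrow> 0"
      by (rule tendsto_divide_0[OF tendsto_const filterlim_at_top_imp_at_infinity[OF m_sqrt_infinity]])
    show "0 < sqrt (real (m n))" if "n \<ge> 1" for n using m_pos[OF that] by simp
  qed (use prob_M Y_int Y_nonneg Y_E in auto)
  have Y_meas: "Y n \<in> borel_measurable (M n)" if "n \<ge> 1" for n using Y_int[OF that] by auto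
  have we_meas: "(\<lambda>\<omega>. real n * (vnorm (wbar n \<omega>) * vnorm (e1 n \<omega>))) \<in> borel_measurable (M n)" if "n \<ge> 1" for n
    using wbar_norm_measurable[OF that] e1_meas[OF that] by measurable
  show "small_op M cross (\<lambda>n. sqrt (real (m n)))"
  proof (rule small_op_add_mono[OF wbar_times_small[OF e1_small e1_meas] Y_small prob_M we_meas Y_meas])
    fix \<epsilon> :: real assume \<epsilon>: "0 < \<epsilon>"
    show "\<exists>\<delta>>0. \<exists>\<delta>'>0. \<forall>\<^sub>F n in sequentially. \<forall>\<omega>\<in>space (M n).
       \<bar>real n * (vnorm (wbar n \<omega>) * vnorm (e1 n \<omega>))\<bar> \<le> \<delta> * sqrt (real (m n)) \<longrightarrow> \<bar>Y n \<omega>\<bar> \<le> \<delta>' * sqrt (real (m n)) \<longrightarrow> \<bar>cross n \<omega>\<bar> \<le> \<epsilon> * sqrt (real (m n))"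
    proof (rule exI[of _ "\<epsilon> / 2 * c"], rule conjI[OF _ exI[of _ "\<epsilon> / 2"], OF _ conjI])
      show "0 < \<epsilon> / 2 * c" "0 < \<epsilon> / 2" using \<epsilon> c_pos by auto
      show "\<forall>\<^sub>F n in sequentially. \<forall>\<omega>\<in>space (M n).
         \<bar>real n * (vnorm (wbar n \<omega>) * vnorm (e1 n \<omega>))\<bar> \<le> \<epsilon> / 2 * c * sqrt (real (m n)) \<longrightarrow> \<bar>Y n \<omega>\<bar> \<le> \<epsilon> / 2 * sqrt (real (m n)) \<longrightarrow> \<bar>cross n \<omega>\<bar> \<le> \<epsilon> * sqrt (real (m n))"
        using eventually_ge_at_top[of 1]
      proof eventually_elim
        case (elim n)
        show ?case
        proof (intro ballI impI)
          fix \<omega> assume \<omega>: "\<omega> \<in> space (M n)" and h: "\<bar>real n * (vnorm (wbar n \<omega>) * vnorm (e1 n \<omega>))\<bar> \<le> \<epsilon> / 2 * c * sqrt (real (m n))"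
            "\<bar>Y n \<omega>\<bar> \<le> \<epsilon> / 2 * sqrt (real (m n))"
          have Pe: "P n *\<^sub>v e n \<omega> = P n *\<^sub>v e1 n \<omega> - P n *\<^sub>v e2 n \<omega>"
            unfolding e[OF elim \<omega>] by (rule mult_minus_distrib_mat_vec[OF P[OF elim] e1 e2[OF elim]])
          have eq: "cross n \<omega> = real n * scalar_prod (wbar n \<omega>) (P n *\<^sub>v e1 n \<omega>) - real n * scalar_prod (wbar n \<omega>) (P n *\<^sub>v e2 n \<omega>)"
            unfolding cross_def Pe using P_mult_carrier[OF elim e1] P_mult_carrier[OF elim e2[OF elim]]
            by (simp add: scalar_prod_minus_distrib[OF wbar_carrier] right_diff_distrib)
          have "\<bar>real n * scalar_prod (wbar n \<omega>) (P n *\<^sub>v e1 n \<omega>)\<bar> \<le> real n * (vnorm (wbar n \<omega>) * vnorm (P n *\<^sub>v e1 n \<omega>))"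
            unfolding abs_mult abs_of_nat by (intro mult_left_mono vnorm_Cauchy_Schwarz[OF wbar_carrier P_mult_carrier[OF elim e1]]) simp
          also have "\<dots> \<le> real n * (vnorm (wbar n \<omega>) * (vnorm (e1 n \<omega>) / c))"
            by (intro mult_left_mono P_norm(1)[OF elim e1]) auto
          also have "\<dots> = (real n * (vnorm (wbar n \<omega>) * vnorm (e1 n \<omega>))) / c" by simp
          also have "\<dots> \<le> (\<epsilon> / 2 * c * sqrt (real (m n))) / c"
            by (rule divide_right_mono[OF order_trans[OF abs_ge_self h(1)]]) (use c_pos in simp)
          also have "\<dots> = \<epsilon> / 2 * sqrt (real (m n))" using c_pos by simp
          finally have 1: "\<bar>real n * scalar_prod (wbar n \<omega>) (P n *\<^sub>v e1 n \<omega>)\<bar> \<le> \<epsilon> / 2 * sqrt (real (m n))" .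
          have 2: "\<bar>real n * scalar_prod (wbar n \<omega>) (P n *\<^sub>v e2 n \<omega>)\<bar> \<le> \<epsilon> / 2 * sqrt (real (m n))"
            using order_trans[OF e2_cross[OF elim \<omega>] order_trans[OF abs_ge_self h(2)]] .
          have "\<bar>p - q\<bar> \<le> r + r" if "\<bar>p\<bar> \<le> r" "\<bar>q\<bar> \<le> r" for p q r :: real using that by linarith
          from this[OF 1 2] show "\<bar>cross n \<omega>\<bar> \<le> \<epsilon> * sqrt (real (m n))" unfolding eq by simp
        qed
      qed
    qed
  qed
  show "small_op M (\<lambda>n \<omega>. real n * (vnorm (e n \<omega>))\<^sup>2) (\<lambda>n. sqrt (real (m n)))"
  proof (rule small_op_add_mono[OF e1_small Y_small prob_M e1_meas Y_meas])
    fix \<epsilon> :: real assume \<epsilon>: "0 < \<epsilon>"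
    define s where "s = sqrt \<epsilon> / 2"
    \<comment> \<open>Dividing by \<open>L + 1\<close> instead of \<open>L\<close> admits
      \<open>L = 0\<close>, the value used in \<open>remainder_plain\<close>.\<close>
    define s' where "s' = \<epsilon> / (4 * (L + 1))"
    have s: "0 < s" "s\<^sup>2 = \<epsilon> / 4" using \<epsilon> by (auto simp: s_def power_divide)
    have s': "0 < s'" "L * s' \<le> \<epsilon> / 4"
    proof -
      show "0 < s'" using \<epsilon> L by (simp add: s'_def)
      then have "L * s' \<le> (L + 1) * s'" by simp
      also have "\<dots> = \<epsilon> / 4"
      proof -
        have "k * (\<epsilon> / (4 * k)) = \<epsilon> / 4" if "k \<noteq> 0" for k using that by simp
        from this[of "L + 1"] L show ?thesis unfolding s'_def by linarith
      qed
      finally show "L * s' \<le> \<epsilon> / 4" .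
    qed
    show "\<exists>\<delta>>0. \<exists>\<delta>'>0. \<forall>\<^sub>F n in sequentially. \<forall>\<omega>\<in>space (M n).
       \<bar>vnorm (e1 n \<omega>)\<bar> \<le> \<delta> * real n powr (- 1 / 2) \<longrightarrow> \<bar>Y n \<omega>\<bar> \<le> \<delta>' * sqrt (real (m n)) \<longrightarrow> \<bar>real n * (vnorm (e n \<omega>))\<^sup>2\<bar> \<le> \<epsilon> * sqrt (real (m n))"
    proof (rule exI[of _ s], rule conjI[OF _ exI[of _ s'], OF _ conjI])
      show "0 < s" "0 < s'" by (rule s(1), rule s'(1))
      show "\<forall>\<^sub>F n in sequentially. \<forall>\<omega>\<in>space (M n).
         \<bar>vnorm (e1 n \<omega>)\<bar> \<le> s * real n powr (- 1 / 2) \<longrightarrow> \<bar>Y n \<omega>\<bar> \<le> s' * sqrt (real (m n)) \<longrightarrow> \<bar>real n * (vnorm (e n \<omega>))\<^sup>2\<bar> \<le> \<epsilon> * sqrt (real (m n))"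
        using eventually_ge_at_top[of 1]
      proof eventually_elim
        case (elim n)
        have n0: "0 < real n" using elim by simp
        have sm: "1 \<le> sqrt (real (m n))" using m_pos[OF elim] by simp
        show ?case
        proof (intro ballI impI)
          fix \<omega> assume \<omega>: "\<omega> \<in> space (M n)" and h: "\<bar>vnorm (e1 n \<omega>)\<bar> \<le> s * real n powr (- 1 / 2)" "\<bar>Y n \<omega>\<bar> \<le> s' * sqrt (real (m n))"
          have 1: "real n * (vnorm (e1 n \<omega>))\<^sup>2 \<le> \<epsilon> / 4 * sqrt (real (m n))"
          proof -
            have "vnorm (e1 n \<omega>) \<le> s * (1 / sqrt (real n))" using h(1) unfolding powr_minus_half[OF n0] by simp
            then have "(vnorm (e1 n \<omega>))\<^sup>2 \<le> (s * (1 / sqrt (real n)))\<^sup>2" by (intro power_mono) auto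
            also have "\<dots> = \<epsilon> / 4 / real n" using n0 by (simp add: power_divide s(2))
            finally have "real n * (vnorm (e1 n \<omega>))\<^sup>2 \<le> real n * (\<epsilon> / 4 / real n)" by (rule mult_left_mono) simp
            also have "\<dots> = \<epsilon> / 4 * 1" using n0 by simp
            also have "\<dots> \<le> \<epsilon> / 4 * sqrt (real (m n))" using \<epsilon> sm by (intro mult_left_mono) auto
            finally show ?thesis .
          qed
          have 2: "real n * (vnorm (e2 n \<omega>))\<^sup>2 \<le> \<epsilon> / 4 * sqrt (real (m n))"
          proof -
            have "real n * (vnorm (e2 n \<omega>))\<^sup>2 \<le> L * Y n \<omega>" by (rule e2_norm[OF elim \<omega>])
            also have "\<dots> \<le> L * (s' * sqrt (real (m n)))" using L order_trans[OF abs_ge_self h(2)] by (rule mult_left_mono[rotated])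
            also have "\<dots> = (L * s') * sqrt (real (m n))" by simp
            also have "\<dots> \<le> \<epsilon> / 4 * sqrt (real (m n))" using s'(2) by (intro mult_right_mono) auto
            finally show ?thesis .
          qed
          have "vnorm (e n \<omega>) \<le> vnorm (e1 n \<omega>) + vnorm (e2 n \<omega>)"
            unfolding e[OF elim \<omega>] by (rule vnorm_triangle_minus[OF e1 e2[OF elim]])
          then have "(vnorm (e n \<omega>))\<^sup>2 \<le> (vnorm (e1 n \<omega>) + vnorm (e2 n \<omega>))\<^sup>2" by (intro power_mono) auto
          also have "\<dots> \<le> 2 * (vnorm (e1 n \<omega>))\<^sup>2 + 2 * (vnorm (e2 n \<omega>))\<^sup>2"
            using zero_le_power2[of "vnorm (e1 n \<omega>) - vnorm (e2 n \<omega>)"] by (simp add: power2_eq_square algebra_simps)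
          finally have "real n * (vnorm (e n \<omega>))\<^sup>2 \<le> real n * (2 * (vnorm (e1 n \<omega>))\<^sup>2 + 2 * (vnorm (e2 n \<omega>))\<^sup>2)" by (rule mult_left_mono) simp
          also have "\<dots> = 2 * (real n * (vnorm (e1 n \<omega>))\<^sup>2) + 2 * (real n * (vnorm (e2 n \<omega>))\<^sup>2)" by (simp add: algebra_simps)
          also have "\<dots> \<le> 2 * (\<epsilon> / 4 * sqrt (real (m n))) + 2 * (\<epsilon> / 4 * sqrt (real (m n)))" by (intro add_mono mult_left_mono 1 2) auto
          also have "\<dots> = \<epsilon> * sqrt (real (m n))" by simp
          finally show "\<bar>real n * (vnorm (e n \<omega>))\<^sup>2\<bar> \<le> \<epsilon> * sqrt (real (m n))" by simp
        qed
      qed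
    qed
  qed
qed

lemma remainder_plain:
  assumes "small_op M (\<lambda>n \<omega>. vnorm (e n \<omega>)) (\<lambda>n. real n powr (- 1 / 2))"
  shows "small_op M cross (\<lambda>n. sqrt (real (m n)))"
    and "small_op M (\<lambda>n \<omega>. real n * (vnorm (e n \<omega>))\<^sup>2) (\<lambda>n. sqrt (real (m n)))"
proof -
  have z: "e n \<omega> = e n \<omega> - 0\<^sub>v (m n)" for n \<omega> using e_carrier[of n \<omega>] by auto
  have P0: "P n *\<^sub>v 0\<^sub>v (m n) = 0\<^sub>v (m n)" if "n \<ge> 1" for n
    using P[OF that] by (intro eq_vecI) (auto simp: scalar_prod_def)
  have "small_op M cross (\<lambda>n. sqrt (real (m n))) \<and> small_op M (\<lambda>n \<omega>. real n * (vnorm (e n \<omega>))\<^sup>2) (\<lambda>n. sqrt (real (m n)))"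
    by (intro conjI remainder_small[where ?e1.0=e and ?e2.0="\<lambda>n \<omega>. 0\<^sub>v (m n)" and Y="\<lambda>n \<omega>. 0" and L=0 and E=0])
       (use assms z e_norm_measurable P0 in \<open>simp_all add: scalar_prod_right_zero[OF wbar_carrier]\<close>)
  then show "small_op M cross (\<lambda>n. sqrt (real (m n)))"
    and "small_op M (\<lambda>n \<omega>. real n * (vnorm (e n \<omega>))\<^sup>2) (\<lambda>n. sqrt (real (m n)))" by auto
qed

end

lemma small_op_cong:
  assumes "\<And>n \<omega>. n \<ge> 1 \<Longrightarrow> \<omega> \<in> space (M n) \<Longrightarrow> X n \<omega> = Y n \<omega>" "small_op M X a"
  shows "small_op M Y a"
  unfolding small_op_def
proof (intro allI impI)
  fix \<epsilon> :: real assume "0 < \<epsilon>"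
  then have l: "(\<lambda>n. measure (M n) {\<omega>\<in>space (M n). \<bar>X n \<omega>\<bar> > \<epsilon> * a n}) \<longlonglongrightarrow> 0" using assms(2) by (simp add: small_op_def)
  have "\<forall>\<^sub>F n in sequentially. measure (M n) {\<omega>\<in>space (M n). \<bar>X n \<omega>\<bar> > \<epsilon> * a n} = measure (M n) {\<omega>\<in>space (M n). \<bar>Y n \<omega>\<bar> > \<epsilon> * a n}"
    using eventually_ge_at_top[of 1]
  proof eventually_elim
    case (elim n)
    show ?case using assms(1)[OF elim] by (intro arg_cong[where f="measure (M n)"]) auto
  qed
  from Lim_transform_eventually[OF l this] show "(\<lambda>n. measure (M n) {\<omega>\<in>space (M n). \<bar>Y n \<omega>\<bar> > \<epsilon> * a n}) \<longlonglongrightarrow> 0" .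
qed

section \<open>Remainders of projection type\<close>

locale el_projection = el_estimator Q M Z m w W P B c C x
  for Q :: "'z measure" and M :: "nat \<Rightarrow> 'w measure" and Z m w W P B c C x +
  fixes \<psi> :: "'z \<Rightarrow> real Matrix.vec" and q :: nat and A :: "nat \<Rightarrow> real mat"
  assumes psi_meas: "vec_measurable Q q \<psi>" and psi_sq: "integrable Q (\<lambda>z. (vnorm (\<psi> z))\<^sup>2)"
    and psi_mean: "vec_integral Q q \<psi> = 0\<^sub>v q"
    and psi_cov: "mat_integral Q q q (\<lambda>z. outer (\<psi> z) (\<psi> z)) = 1\<^sub>m q"
    and A_def: "\<And>n. A n = mat_integral Q (m n) q (\<lambda>z. outer (w n z) (\<psi> z))"
begin

interpretation Q: prob_space Q by (rule prob_Q)

lemma psi_carrier: "z \<in> space Q \<Longrightarrow> \<psi> z \<in> carrier_vec q"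
  using psi_meas by (simp add: vec_measurable_def)

lemma psi_component_measurable: "l < q \<Longrightarrow> (\<lambda>z. \<psi> z $ l) \<in> borel_measurable Q"
  using psi_meas by (simp add: vec_measurable_def)

lemma psi_component:
  assumes l: "l < q"
  shows "integrable Q (\<lambda>z. (\<psi> z $ l)\<^sup>2)" "integrable Q (\<lambda>z. \<psi> z $ l)" "(\<integral>z. \<psi> z $ l \<partial>Q) = 0" "(\<integral>z. (\<psi> z $ l)\<^sup>2 \<partial>Q) = 1"
proof -
  note [measurable] = psi_component_measurable[OF l]
  have le: "(\<psi> z $ l)\<^sup>2 \<le> (vnorm (\<psi> z))\<^sup>2" if "z \<in> space Q" for z
    unfolding vnorm_square_sum[OF psi_carrier[OF that]] using l by (intro member_le_sum) auto
  show i2: "integrable Q (\<lambda>z. (\<psi> z $ l)\<^sup>2)"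
    by (rule Bochner_Integration.integrable_bound[OF psi_sq]) (use le in auto)
  show "integrable Q (\<lambda>z. \<psi> z $ l)"
  proof (rule Bochner_Integration.integrable_bound)
    show "integrable Q (\<lambda>z. 1 + (\<psi> z $ l)\<^sup>2)" using i2 by simp
    have "\<bar>t\<bar> \<le> 1 + t\<^sup>2" for t :: real
    proof -
      have "0 \<le> (\<bar>t\<bar> - 1)\<^sup>2" by simp
      then have "2 * \<bar>t\<bar> \<le> 1 + t\<^sup>2" by (simp add: power2_diff)
      then show ?thesis using abs_ge_zero[of t] by linarith
    qed
    then show "AE z in Q. norm (\<psi> z $ l) \<le> norm (1 + (\<psi> z $ l)\<^sup>2)" by (intro AE_I2) simp
  qed measurable
  show "(\<integral>z. \<psi> z $ l \<partial>Q) = 0"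
    using arg_cong[OF psi_mean, of "\<lambda>v. v $ l"] l by (simp add: vec_integral_def)
  have "(\<integral>z. outer (\<psi> z) (\<psi> z) $$ (l, l) \<partial>Q) = 1"
    using arg_cong[OF psi_cov, of "\<lambda>v. v $$ (l, l)"] l by (simp add: mat_integral_def)
  moreover have "(\<integral>z. outer (\<psi> z) (\<psi> z) $$ (l, l) \<partial>Q) = (\<integral>z. (\<psi> z $ l)\<^sup>2 \<partial>Q)"
    using psi_carrier[THEN carrier_vecD] l by (intro Bochner_Integration.integral_cong) (auto simp: outer_def power2_eq_square)
  ultimately show "(\<integral>z. (\<psi> z $ l)\<^sup>2 \<partial>Q) = 1" by simp
qed

lemma A_carrier [simp]: "A n \<in> carrier_mat (m n) q"
  unfolding A_def by (rule moment_matrix_carrier)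

lemma col_A_carrier [simp]: "l < q \<Longrightarrow> col (A n) l \<in> carrier_vec (m n)"
  using A_carrier[of n] by (auto simp: carrier_matD)

text \<open>The pairing is the integral of \<open>scalar_prod u (w n z)\<close> against a component
  of \<psi>. Cauchy-Schwarz uses that this component has second moment 1 and that the form of
  \<open>W\<close> is at most \<open>C\<close>. The columns of \<open>A n\<close> are therefore
  bounded independently of the growing dimension.\<close>

lemma scalar_prod_col_A:
  assumes n: "n \<ge> 1" and l: "l < q" and u: "u \<in> carrier_vec (m n)"
  shows "\<bar>scalar_prod u (col (A n) l)\<bar> \<le> sqrt C * vnorm u"
proof -
  note [measurable] = psi_component_measurable[OF l]
  have int: "integrable Q (\<lambda>z. w n z $ i * \<psi> z $ l)" if i: "i < m n" for i
  proof (rule Bochner_Integration.integrable_bound)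
    show "integrable Q (\<lambda>z. (B * sqrt (real (m n))) * \<psi> z $ l)" using psi_component(2)[OF l] by simp
    show "(\<lambda>z. w n z $ i * \<psi> z $ l) \<in> borel_measurable Q" using w_component_measurable[OF n i] by measurable
    show "AE z in Q. norm (w n z $ i * \<psi> z $ l) \<le> norm (B * sqrt (real (m n)) * \<psi> z $ l)"
    proof (rule AE_I2)
      fix z assume z: "z \<in> space Q"
      have "\<bar>w n z $ i\<bar> * \<bar>\<psi> z $ l\<bar> \<le> \<bar>B * sqrt (real (m n))\<bar> * \<bar>\<psi> z $ l\<bar>"
        by (intro mult_right_mono order_trans[OF w_component_bound[OF n z i] abs_ge_self]) simp
      then show "norm (w n z $ i * \<psi> z $ l) \<le> norm (B * sqrt (real (m n)) * \<psi> z $ l)" by (simp add: abs_mult)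
    qed
  qed
  have eq: "scalar_prod u (w n z) * \<psi> z $ l = (\<Sum>i<m n. u $ i * (w n z $ i * \<psi> z $ l))" if "z \<in> space Q" for z
    using w_carrier[OF n that] by (simp add: scalar_prod_def atLeast0LessThan sum_distrib_left sum_distrib_right mult_ac)
  have A_entry: "A n $$ (i, l) = (\<integral>z. w n z $ i * \<psi> z $ l \<partial>Q)" if "i < m n" for i
    unfolding A_def mat_integral_def using that l w_carrier[OF n, THEN carrier_vecD] psi_carrier[THEN carrier_vecD]
    by (auto simp: outer_def intro!: Bochner_Integration.integral_cong)
  have "(\<integral>z. scalar_prod u (w n z) * \<psi> z $ l \<partial>Q) = (\<integral>z. (\<Sum>i<m n. u $ i * (w n z $ i * \<psi> z $ l)) \<partial>Q)"
    by (intro Bochner_Integration.integral_cong refl eq)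
  also have "\<dots> = (\<Sum>i<m n. u $ i * A n $$ (i, l))"
    using int A_entry by (subst Bochner_Integration.integral_sum) (auto intro!: sum.cong)
  also have "\<dots> = scalar_prod u (col (A n) l)"
    using l carrier_matD[OF A_carrier[of n]] by (simp add: scalar_prod_def atLeast0LessThan)
  finally have sp: "scalar_prod u (col (A n) l) = (\<integral>z. scalar_prod u (w n z) * \<psi> z $ l \<partial>Q)" ..
  have ip: "integrable Q (\<lambda>z. scalar_prod u (w n z) * \<psi> z $ l)"
  proof -
    have "integrable Q (\<lambda>z. \<Sum>i<m n. u $ i * (w n z $ i * \<psi> z $ l))"
      by (intro Bochner_Integration.integrable_sum integrable_mult_right int) auto
    then show ?thesis by (simp cong: Bochner_Integration.integrable_cong add: eq)
  qed
  have "(scalar_prod u (col (A n) l))\<^sup>2 \<le> (\<integral>z. (scalar_prod u (w n z))\<^sup>2 \<partial>Q) * (\<integral>z. (\<psi> z $ l)\<^sup>2 \<partial>Q)"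
    unfolding sp using scalar_prod_w_mult(1)[OF n u u] psi_component[OF l] ip scalar_prod_w(1)[OF n u]
    by (intro Q.Cauchy_Schwarz_integral) (auto simp: power2_eq_square)
  also have "\<dots> = scalar_prod u (W n *\<^sub>v u)" using scalar_prod_w_mult(2)[OF n u u] psi_component(4)[OF l] by (simp add: power2_eq_square)
  also have "\<dots> \<le> C * (vnorm u)\<^sup>2" by (rule W_upper[OF n u])
  finally have "sqrt ((scalar_prod u (col (A n) l))\<^sup>2) \<le> sqrt (C * (vnorm u)\<^sup>2)" by (rule real_sqrt_le_mono)
  then show ?thesis by (simp add: real_sqrt_mult)
qed

lemma col_A_norm: "n \<ge> 1 \<Longrightarrow> l < q \<Longrightarrow> vnorm (col (A n) l) \<le> sqrt C"
  using C_nonneg by (intro vnorm_le_scalar_prod[of _ "m n"] scalar_prod_col_A) auto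

definition psibar :: "nat \<Rightarrow> 'w \<Rightarrow> real Matrix.vec" where
  "psibar n \<omega> = vec_avg q n (\<lambda>j. \<psi> (Z n j \<omega>))"

definition Apsi :: "nat \<Rightarrow> 'w \<Rightarrow> real Matrix.vec" where
  "Apsi n \<omega> = A n *\<^sub>v psibar n \<omega>"

lemma psibar_carrier [simp]: "psibar n \<omega> \<in> carrier_vec q" by (simp add: psibar_def)
lemma Apsi_carrier [simp]: "Apsi n \<omega> \<in> carrier_vec (m n)" unfolding Apsi_def by (rule mult_mat_vec_carrier[OF A_carrier psibar_carrier])

lemma scalar_prod_A_mult:
  assumes u: "u \<in> carrier_vec (m n)" and y: "y \<in> carrier_vec q"
  shows "scalar_prod u (A n *\<^sub>v y) = (\<Sum>l<q. scalar_prod u (col (A n) l) * y $ l)"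
proof -
  have "scalar_prod u (A n *\<^sub>v y) = (\<Sum>i<m n. \<Sum>l<q. u $ i * A n $$ (i, l) * y $ l)"
    using y carrier_matD[OF A_carrier[of n]] by (simp add: scalar_prod_def atLeast0LessThan sum_distrib_left mult_ac)
  also have "\<dots> = (\<Sum>l<q. \<Sum>i<m n. u $ i * A n $$ (i, l) * y $ l)" by (rule sum.swap)
  also have "\<dots> = (\<Sum>l<q. scalar_prod u (col (A n) l) * y $ l)"
    using carrier_matD[OF A_carrier[of n]] by (simp add: scalar_prod_def atLeast0LessThan sum_distrib_right)
  finally show ?thesis .
qed

lemma vec_avg_projection:
  assumes n: "n \<ge> 1" and \<omega>: "\<omega> \<in> space (M n)"
  shows "vec_avg (m n) n (\<lambda>j. w n (Z n j \<omega>) - A n *\<^sub>v \<psi> (Z n j \<omega>)) = wbar n \<omega> - Apsi n \<omega>"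
proof (rule eq_vecI)
  fix i assume "i < dim_vec (wbar n \<omega> - Apsi n \<omega>)"
  then have i: "i < m n" by (simp add: carrier_vecD[OF Apsi_carrier])
  note Zs = Z_space[OF n _ \<omega>]
  have pc: "\<psi> (Z n j \<omega>) \<in> carrier_vec q" and wc: "w n (Z n j \<omega>) \<in> carrier_vec (m n)" if "j \<in> {1..n}" for j
    using psi_carrier[OF Zs[OF that]] w_carrier[OF n Zs[OF that]] by auto
  have Ai: "(A n *\<^sub>v y) $ i = (\<Sum>l<q. A n $$ (i, l) * y $ l)" if "y \<in> carrier_vec q" for y
    using that i carrier_matD[OF A_carrier[of n]] by (simp add: scalar_prod_def atLeast0LessThan)
  have "(\<Sum>j=1..n. (w n (Z n j \<omega>) - A n *\<^sub>v \<psi> (Z n j \<omega>)) $ i) = (\<Sum>j=1..n. w n (Z n j \<omega>) $ i - (A n *\<^sub>v \<psi> (Z n j \<omega>)) $ i)"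
    using i carrier_matD[OF A_carrier[of n]] by (intro sum.cong refl) (simp del: index_mult_mat_vec)
  also have "\<dots> = (\<Sum>j=1..n. w n (Z n j \<omega>) $ i) - (\<Sum>j=1..n. \<Sum>l<q. A n $$ (i, l) * \<psi> (Z n j \<omega>) $ l)"
    using Ai[OF pc] by (simp only: sum_subtractf) simp
  also have "(\<Sum>j=1..n. \<Sum>l<q. A n $$ (i, l) * \<psi> (Z n j \<omega>) $ l) = (\<Sum>l<q. A n $$ (i, l) * (\<Sum>j=1..n. \<psi> (Z n j \<omega>) $ l))"
    by (subst sum.swap) (simp add: sum_distrib_left)
  also have "\<dots> = (\<Sum>l<q. A n $$ (i, l) * (real n * psibar n \<omega> $ l))"
    using n by (intro sum.cong refl) (simp add: psibar_def vec_avg_def)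
  also have "\<dots> = real n * Apsi n \<omega> $ i"
    unfolding Apsi_def Ai[OF psibar_carrier] by (simp add: sum_distrib_left mult_ac)
  finally show "vec_avg (m n) n (\<lambda>j. w n (Z n j \<omega>) - A n *\<^sub>v \<psi> (Z n j \<omega>)) $ i = (wbar n \<omega> - Apsi n \<omega>) $ i"
    using i n by (simp add: vec_avg_def wbar_def carrier_vecD[OF Apsi_carrier] diff_divide_distrib)
qed (simp add: vec_avg_def carrier_vecD[OF Apsi_carrier])

text \<open>Each mixed term is a sum over \<open>l\<close> of products of two scalar averages, so
  the sum of their squares dominates it. The squares are written with normalised sums of centred
  variables, whose means follow from \<open>iid_centred_sum_square\<close>.\<close>

definition Y :: "nat \<Rightarrow> 'w \<Rightarrow> real" where
  "Y n \<omega> = (\<Sum>l<q. (1 / real n) * (\<Sum>j=1..n. \<psi> (Z n j \<omega>) $ l)\<^sup>2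
      + (1 / real n) * (\<Sum>j=1..n. scalar_prod (P n *\<^sub>v col (A n) l) (w n (Z n j \<omega>)))\<^sup>2)"

text \<open>For a column \<open>a\<close> of \<open>A n\<close>, the variable
  \<open>scalar_prod (P n *\<^sub>v a) (w n z)\<close> has second moment
  \<open>scalar_prod a (P n *\<^sub>v a)\<close>, at most \<open>C / c\<close> by the bound on the
  columns; a component of \<psi> has second moment 1. The number of summands is the fixed
  \<open>q\<close>.\<close>

lemma Y_moment:
  assumes n: "n \<ge> 1"
  shows "integrable (M n) (Y n)" "(\<integral>\<omega>. Y n \<omega> \<partial>M n) \<le> real q * (1 + C / c)"
proof -
  interpret prob_space "M n" by (rule prob_M[OF n])
  note iid = iid_centred_sum_square[OF indep[OF n] distr[OF n]]
  have 1: "integrable (M n) (\<lambda>\<omega>. (\<Sum>j=1..n. \<psi> (Z n j \<omega>) $ l)\<^sup>2)" "(\<integral>\<omega>. (\<Sum>j=1..n. \<psi> (Z n j \<omega>) $ l)\<^sup>2 \<partial>M n) = real n"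
    if l: "l < q" for l
    using iid[OF _ psi_component(2,1,3)[OF l]] psi_component(4)[OF l] by auto
  have 2: "integrable (M n) (\<lambda>\<omega>. (\<Sum>j=1..n. scalar_prod (P n *\<^sub>v col (A n) l) (w n (Z n j \<omega>)))\<^sup>2) \<and>
     (\<integral>\<omega>. (\<Sum>j=1..n. scalar_prod (P n *\<^sub>v col (A n) l) (w n (Z n j \<omega>)))\<^sup>2 \<partial>M n) \<le> real n * (C / c)"
    if l: "l < q" for l
  proof -
    let ?a = "col (A n) l" let ?p = "P n *\<^sub>v ?a"
    have a: "?a \<in> carrier_vec (m n)" using l by simp
    have p: "?p \<in> carrier_vec (m n)" by (rule P_mult_carrier[OF n a])
    have i2: "integrable Q (\<lambda>z. (scalar_prod ?p (w n z))\<^sup>2)" using scalar_prod_w_mult(1)[OF n p p] by (simp add: power2_eq_square)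
    have "(\<integral>z. (scalar_prod ?p (w n z))\<^sup>2 \<partial>Q) = scalar_prod ?p (W n *\<^sub>v ?p)"
      using scalar_prod_w_mult(2)[OF n p p] by (simp add: power2_eq_square)
    also have "\<dots> = scalar_prod ?a ?p" unfolding W_P[OF n a] by (rule comm_scalar_prod[OF p a])
    also have "\<dots> \<le> (vnorm ?a)\<^sup>2 / c" by (rule P_norm(2)[OF n a])
    also have "\<dots> \<le> (sqrt C)\<^sup>2 / c" using c_pos by (intro divide_right_mono power_mono col_A_norm n l) auto
    also have "\<dots> = C / c" using C_nonneg by simp
    finally have le: "real n * (\<integral>z. (scalar_prod ?p (w n z))\<^sup>2 \<partial>Q) \<le> real n * (C / c)" by (rule mult_left_mono) simp
    show ?thesis using iid[OF _ scalar_prod_w(1)[OF n p] i2 scalar_prod_w(2)[OF n p]] le by auto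
  qed
  have int: "integrable (M n) (\<lambda>\<omega>. (1 / real n) * (\<Sum>j=1..n. \<psi> (Z n j \<omega>) $ l)\<^sup>2
      + (1 / real n) * (\<Sum>j=1..n. scalar_prod (P n *\<^sub>v col (A n) l) (w n (Z n j \<omega>)))\<^sup>2)" if l: "l < q" for l
    using 1(1)[OF l] 2[OF l] by (intro Bochner_Integration.integrable_add integrable_mult_right) auto
  show "integrable (M n) (Y n)" unfolding Y_def[abs_def] by (intro Bochner_Integration.integrable_sum int) auto
  have "(\<integral>\<omega>. Y n \<omega> \<partial>M n) = (\<Sum>l<q. \<integral>\<omega>. (1 / real n) * (\<Sum>j=1..n. \<psi> (Z n j \<omega>) $ l)\<^sup>2
      + (1 / real n) * (\<Sum>j=1..n. scalar_prod (P n *\<^sub>v col (A n) l) (w n (Z n j \<omega>)))\<^sup>2 \<partial>M n)"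
    unfolding Y_def by (intro Bochner_Integration.integral_sum int) auto
  also have "\<dots> \<le> (\<Sum>l<q. 1 + C / c)"
  proof (intro sum_mono)
    fix l assume "l \<in> {..<q}"
    then have l: "l < q" by simp
    let ?f = "\<lambda>\<omega>. (\<Sum>j=1..n. \<psi> (Z n j \<omega>) $ l)\<^sup>2" and ?g = "\<lambda>\<omega>. (\<Sum>j=1..n. scalar_prod (P n *\<^sub>v col (A n) l) (w n (Z n j \<omega>)))\<^sup>2"
    have f: "integrable (M n) ?f" "(\<integral>\<omega>. ?f \<omega> \<partial>M n) = real n" and g: "integrable (M n) ?g" "(\<integral>\<omega>. ?g \<omega> \<partial>M n) \<le> real n * (C / c)"
      using 1[OF l] 2[OF l] by auto
    have "(\<integral>\<omega>. (1 / real n) * ?f \<omega> + (1 / real n) * ?g \<omega> \<partial>M n) = (1 / real n) * (\<integral>\<omega>. ?f \<omega> \<partial>M n) + (1 / real n) * (\<integral>\<omega>. ?g \<omega> \<partial>M n)"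
      using f(1) g(1) by (subst Bochner_Integration.integral_add) (auto intro!: integrable_mult_right)
    also have "\<dots> \<le> (1 / real n) * real n + (1 / real n) * (real n * (C / c))"
      using f(2) g(2) by (intro add_mono mult_left_mono) auto
    also have "\<dots> = 1 + C / c" using n by simp
    finally show "(\<integral>\<omega>. (1 / real n) * ?f \<omega> + (1 / real n) * ?g \<omega> \<partial>M n) \<le> 1 + C / c" .
  qed
  finally show "(\<integral>\<omega>. Y n \<omega> \<partial>M n) \<le> real q * (1 + C / c)" by simp
qed

lemma Y_eq:
  assumes n: "n \<ge> 1" and \<omega>: "\<omega> \<in> space (M n)"
  shows "Y n \<omega> = (\<Sum>l<q. real n * (psibar n \<omega> $ l)\<^sup>2 + real n * (scalar_prod (P n *\<^sub>v wbar n \<omega>) (col (A n) l))\<^sup>2)"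
  unfolding Y_def
proof (intro sum.cong refl)
  fix l assume "l \<in> {..<q}"
  then have l: "l < q" by simp
  have n0: "real n \<noteq> 0" using n by simp
  have sc: "(1 / real n) * s\<^sup>2 = real n * ((1 / real n) * s)\<^sup>2" for s using n0 by (simp add: power2_eq_square)
  have ps: "(1 / real n) * (\<Sum>j=1..n. \<psi> (Z n j \<omega>) $ l) = psibar n \<omega> $ l" using l by (simp add: psibar_def vec_avg_def)
  have a: "col (A n) l \<in> carrier_vec (m n)" using l by simp
  have "(1 / real n) * (\<Sum>j=1..n. scalar_prod (P n *\<^sub>v col (A n) l) (w n (Z n j \<omega>))) = scalar_prod (P n *\<^sub>v col (A n) l) (wbar n \<omega>)"
    by (rule scalar_prod_wbar[OF n \<omega> P_mult_carrier[OF n a], symmetric])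
  also have "\<dots> = scalar_prod (wbar n \<omega>) (P n *\<^sub>v col (A n) l)" by (rule comm_scalar_prod[OF P_mult_carrier[OF n a] wbar_carrier])
  also have "\<dots> = scalar_prod (col (A n) l) (P n *\<^sub>v wbar n \<omega>)" by (rule P_symmetric[OF n wbar_carrier a])
  also have "\<dots> = scalar_prod (P n *\<^sub>v wbar n \<omega>) (col (A n) l)" by (rule comm_scalar_prod[OF a P_mult_carrier[OF n wbar_carrier]])
  finally have pw: "(1 / real n) * (\<Sum>j=1..n. scalar_prod (P n *\<^sub>v col (A n) l) (w n (Z n j \<omega>))) = scalar_prod (P n *\<^sub>v wbar n \<omega>) (col (A n) l)" .
  show "(1 / real n) * (\<Sum>j=1..n. \<psi> (Z n j \<omega>) $ l)\<^sup>2 + (1 / real n) * (\<Sum>j=1..n. scalar_prod (P n *\<^sub>v col (A n) l) (w n (Z n j \<omega>)))\<^sup>2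
    = real n * (psibar n \<omega> $ l)\<^sup>2 + real n * (scalar_prod (P n *\<^sub>v wbar n \<omega>) (col (A n) l))\<^sup>2"
    unfolding sc ps pw ..
qed

text \<open>Moving \<open>P\<close> over to \<open>wbar\<close> and expanding along the columns of
  \<open>A n\<close> leaves \<open>q\<close> products, each bounded by a sum of two squares
  occurring in \<open>Y\<close>.\<close>

lemma Apsi_cross:
  assumes n: "n \<ge> 1" and \<omega>: "\<omega> \<in> space (M n)"
  shows "\<bar>real n * scalar_prod (wbar n \<omega>) (P n *\<^sub>v Apsi n \<omega>)\<bar> \<le> Y n \<omega>"
proof -
  have pw: "P n *\<^sub>v wbar n \<omega> \<in> carrier_vec (m n)" by (rule P_mult_carrier[OF n wbar_carrier])
  have "scalar_prod (wbar n \<omega>) (P n *\<^sub>v Apsi n \<omega>) = scalar_prod (Apsi n \<omega>) (P n *\<^sub>v wbar n \<omega>)"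
    by (rule P_symmetric[OF n wbar_carrier Apsi_carrier])
  also have "\<dots> = scalar_prod (P n *\<^sub>v wbar n \<omega>) (Apsi n \<omega>)" by (rule comm_scalar_prod[OF Apsi_carrier pw])
  also have "\<dots> = (\<Sum>l<q. scalar_prod (P n *\<^sub>v wbar n \<omega>) (col (A n) l) * psibar n \<omega> $ l)"
    unfolding Apsi_def by (rule scalar_prod_A_mult[OF pw psibar_carrier])
  finally have "\<bar>real n * scalar_prod (wbar n \<omega>) (P n *\<^sub>v Apsi n \<omega>)\<bar> = \<bar>\<Sum>l<q. real n * (scalar_prod (P n *\<^sub>v wbar n \<omega>) (col (A n) l) * psibar n \<omega> $ l)\<bar>"
    by (simp add: sum_distrib_left)
  also have "\<dots> \<le> (\<Sum>l<q. real n * \<bar>scalar_prod (P n *\<^sub>v wbar n \<omega>) (col (A n) l) * psibar n \<omega> $ l\<bar>)"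
    by (rule order_trans[OF sum_abs]) (simp add: abs_mult)
  also have "\<dots> \<le> (\<Sum>l<q. real n * ((psibar n \<omega> $ l)\<^sup>2 + (scalar_prod (P n *\<^sub>v wbar n \<omega>) (col (A n) l))\<^sup>2))"
  proof (intro sum_mono mult_left_mono)
    fix l
    have "\<bar>p * r\<bar> \<le> r\<^sup>2 + p\<^sup>2" for p r :: real
    proof -
      have "0 \<le> (\<bar>p\<bar> - \<bar>r\<bar>)\<^sup>2" by simp
      then have "2 * (\<bar>p\<bar> * \<bar>r\<bar>) \<le> r\<^sup>2 + p\<^sup>2" by (simp add: power2_diff)
      moreover have "0 \<le> \<bar>p\<bar> * \<bar>r\<bar>" by simp
      ultimately show ?thesis unfolding abs_mult by linarith
    qed
    then show "\<bar>scalar_prod (P n *\<^sub>v wbar n \<omega>) (col (A n) l) * psibar n \<omega> $ l\<bar> \<le> (psibar n \<omega> $ l)\<^sup>2 + (scalar_prod (P n *\<^sub>v wbar n \<omega>) (col (A n) l))\<^sup>2" .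
  qed simp
  also have "\<dots> = Y n \<omega>" unfolding Y_eq[OF n \<omega>] by (simp only: distrib_left)
  finally show ?thesis .
qed

text \<open>By duality and the column bound, the norm is at most sqrt C times the sum of the
  absolute components of \<open>psibar\<close>. Cauchy-Schwarz over the \<open>q\<close> components
  costs the factor \<open>q\<close>.\<close>

lemma Apsi_norm:
  assumes n: "n \<ge> 1" and \<omega>: "\<omega> \<in> space (M n)"
  shows "real n * (vnorm (Apsi n \<omega>))\<^sup>2 \<le> (C * real q) * Y n \<omega>"
proof -
  have "vnorm (Apsi n \<omega>) \<le> sqrt C * (\<Sum>l<q. \<bar>psibar n \<omega> $ l\<bar>)"
  proof (rule vnorm_le_scalar_prod[OF Apsi_carrier])
    show "0 \<le> sqrt C * (\<Sum>l<q. \<bar>psibar n \<omega> $ l\<bar>)" using C_nonneg by (intro mult_nonneg_nonneg sum_nonneg) auto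
    fix u :: "real Matrix.vec" assume u: "u \<in> carrier_vec (m n)"
    have "\<bar>scalar_prod u (Apsi n \<omega>)\<bar> \<le> (\<Sum>l<q. \<bar>scalar_prod u (col (A n) l)\<bar> * \<bar>psibar n \<omega> $ l\<bar>)"
      unfolding Apsi_def scalar_prod_A_mult[OF u psibar_carrier] by (rule order_trans[OF sum_abs]) (simp add: abs_mult)
    also have "\<dots> \<le> (\<Sum>l<q. (sqrt C * vnorm u) * \<bar>psibar n \<omega> $ l\<bar>)"
      by (intro sum_mono mult_right_mono scalar_prod_col_A n u) auto
    also have "\<dots> = sqrt C * (\<Sum>l<q. \<bar>psibar n \<omega> $ l\<bar>) * vnorm u" by (simp add: sum_distrib_left sum_distrib_right mult_ac)
    finally show "\<bar>scalar_prod u (Apsi n \<omega>)\<bar> \<le> sqrt C * (\<Sum>l<q. \<bar>psibar n \<omega> $ l\<bar>) * vnorm u" .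
  qed
  then have "(vnorm (Apsi n \<omega>))\<^sup>2 \<le> (sqrt C * (\<Sum>l<q. \<bar>psibar n \<omega> $ l\<bar>))\<^sup>2" by (intro power_mono) auto
  also have "\<dots> = C * (\<Sum>l<q. \<bar>psibar n \<omega> $ l\<bar>)\<^sup>2" using C_nonneg by (simp add: power_mult_distrib)
  also have "\<dots> \<le> C * (real q * (\<Sum>l<q. (psibar n \<omega> $ l)\<^sup>2))"
    using C_nonneg sum_squared_le_sum_of_squares[of "\<lambda>l. \<bar>psibar n \<omega> $ l\<bar>" "{..<q}"] by (intro mult_left_mono) (auto simp: mult.commute)
  finally have "real n * (vnorm (Apsi n \<omega>))\<^sup>2 \<le> real n * (C * (real q * (\<Sum>l<q. (psibar n \<omega> $ l)\<^sup>2)))" by (rule mult_left_mono) simp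
  also have "\<dots> = (C * real q) * (\<Sum>l<q. real n * (psibar n \<omega> $ l)\<^sup>2)" by (simp add: sum_distrib_left mult_ac)
  also have "\<dots> \<le> (C * real q) * Y n \<omega>"
    unfolding Y_eq[OF n \<omega>] using C_nonneg by (intro mult_left_mono sum_mono) auto
  finally show ?thesis .
qed

text \<open>The hypothesis makes \<open>e + Apsi\<close> small, not \<open>e\<close>; so
  \<open>e\<close> is split into this sum and \<open>Apsi\<close>, and \<open>Y\<close> controls the
  latter.\<close>

lemma remainder_projection:
  assumes small: "small_op M (\<lambda>n \<omega>. vnorm (vec_avg (m n) n (x n \<omega>)
      - vec_avg (m n) n (\<lambda>j. w n (Z n j \<omega>) - A n *\<^sub>v \<psi> (Z n j \<omega>)))) (\<lambda>n. real n powr (- 1 / 2))"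
  shows "small_op M cross (\<lambda>n. sqrt (real (m n)))"
    and "small_op M (\<lambda>n \<omega>. real n * (vnorm (e n \<omega>))\<^sup>2) (\<lambda>n. sqrt (real (m n)))"
proof -
  define e1 where "e1 n \<omega> = e n \<omega> + Apsi n \<omega>" for n \<omega>
  have e1c: "e1 n \<omega> \<in> carrier_vec (m n)" for n \<omega> by (simp add: e1_def)
  have ee: "e n \<omega> = e1 n \<omega> - Apsi n \<omega>" for n \<omega>
    unfolding e1_def by (rule eq_vecI) (auto simp: carrier_vecD[OF Apsi_carrier] carrier_vecD[OF e_carrier])
  have e1_eq: "vec_avg (m n) n (x n \<omega>) - vec_avg (m n) n (\<lambda>j. w n (Z n j \<omega>) - A n *\<^sub>v \<psi> (Z n j \<omega>)) = e1 n \<omega>"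
    if "n \<ge> 1" "\<omega> \<in> space (M n)" for n \<omega>
    unfolding vec_avg_projection[OF that] e1_def e_def
    by (rule eq_vecI) (auto simp: carrier_vecD[OF Apsi_carrier] carrier_vecD[OF wbar_carrier] carrier_vecD[OF vec_avg_carrier])
  have e1_small: "small_op M (\<lambda>n \<omega>. vnorm (e1 n \<omega>)) (\<lambda>n. real n powr (- 1 / 2))"
    by (rule small_op_cong[OF _ small]) (simp add: e1_eq)
  have Apsi_m: "(\<lambda>\<omega>. Apsi n \<omega> $ i) \<in> borel_measurable (M n)" if n: "n \<ge> 1" and i: "i < m n" for n i
  proof -
    have "Apsi n \<omega> $ i = (\<Sum>l<q. A n $$ (i, l) * psibar n \<omega> $ l)" for \<omega>
      unfolding Apsi_def using i by (simp add: scalar_prod_def atLeast0LessThan carrier_matD[OF A_carrier] carrier_vecD[OF psibar_carrier])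
    moreover have "(\<lambda>\<omega>. psibar n \<omega> $ l) \<in> borel_measurable (M n)" if "l < q" for l
      unfolding psibar_def using measurable_compose[OF Z_measurable psi_component_measurable] n that by (intro vec_avg_measurable) auto
    ultimately show ?thesis by simp
  qed
  have e1_meas: "(\<lambda>\<omega>. vnorm (e1 n \<omega>)) \<in> borel_measurable (M n)" if n: "n \<ge> 1" for n
  proof -
    have "(\<lambda>\<omega>. \<Sum>i<m n. (e n \<omega> $ i + Apsi n \<omega> $ i)\<^sup>2) \<in> borel_measurable (M n)"
      by (intro borel_measurable_sum borel_measurable_power borel_measurable_add e_component_measurable Apsi_m n) auto
    then have [measurable]: "(\<lambda>\<omega>. sqrt (\<Sum>i<m n. (e n \<omega> $ i + Apsi n \<omega> $ i)\<^sup>2)) \<in> borel_measurable (M n)" by measurable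
    have "vnorm (e1 n \<omega>) = sqrt (\<Sum>i<m n. (e n \<omega> $ i + Apsi n \<omega> $ i)\<^sup>2)" for \<omega>
    proof -
      have "(vnorm (e1 n \<omega>))\<^sup>2 = (\<Sum>i<m n. (e n \<omega> $ i + Apsi n \<omega> $ i)\<^sup>2)"
        unfolding vnorm_square_sum[OF e1c] by (simp add: e1_def carrier_vecD[OF Apsi_carrier])
      then show ?thesis using vnorm_nonneg[of "e1 n \<omega>"] by (metis real_sqrt_abs abs_of_nonneg)
    qed
    then show ?thesis by simp
  qed
  have Y0: "0 \<le> Y n \<omega>" for n \<omega> by (simp add: Y_def sum_nonneg)
  have CQ: "0 \<le> C * real q" using C_nonneg by simp
  note rs = remainder_small[OF ee e1c Apsi_carrier e1_small e1_meas Y_moment(1) Y0 Y_moment(2) CQ Apsi_norm Apsi_cross]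
  show "small_op M cross (\<lambda>n. sqrt (real (m n)))"
    and "small_op M (\<lambda>n \<omega>. real n * (vnorm (e n \<omega>))\<^sup>2) (\<lambda>n. sqrt (real (m n)))" by (rule rs; assumption)+
qed

end

section \<open>Asymptotic normality\<close>

text \<open>For \<open>r = 0\<close> both inequalities are false, since an infinite value stays
  infinite under real shifts and positive scaling.\<close>

lemma neg2log_standardized_le_iff:
  assumes s: "0 < s"
  shows "(neg2log r - ereal a + ereal b) / ereal s \<le> ereal y \<longleftrightarrow> neg2log r \<le> ereal (a - b + y * s)"
proof (cases "r = 0")
  case True
  then show ?thesis using s by (simp add: neg2log_def)
next
  case False
  then show ?thesis using s by (simp add: neg2log_def pos_divide_le_eq algebra_simps)
qed

theorem corollary7p5:
  fixes Q :: "'z measure"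
    and M :: "nat \<Rightarrow> 'w measure"
    and Z :: "nat \<Rightarrow> nat \<Rightarrow> 'w \<Rightarrow> 'z"
    and m :: "nat \<Rightarrow> nat"
    and w :: "nat \<Rightarrow> 'z \<Rightarrow> real Matrix.vec"
    and h :: "nat \<Rightarrow> (nat \<Rightarrow> 'z) \<Rightarrow> 'z \<Rightarrow> real Matrix.vec"
    and w_hat :: "nat \<Rightarrow> 'w \<Rightarrow> 'z \<Rightarrow> real Matrix.vec"
    and W :: "nat \<Rightarrow> real Matrix.mat"
    and W_bar W_hat :: "nat \<Rightarrow> 'w \<Rightarrow> real Matrix.mat"
    and R_hat :: "nat \<Rightarrow> 'w \<Rightarrow> real"
    and B :: real
    and q :: nat
  assumes prob_Q: "prob_space Q"
    and prob_M: "\<And>n. n \<ge> 1 \<Longrightarrow> prob_space (M n)"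
    and indep: "\<And>n. n \<ge> 1 \<Longrightarrow> prob_space.indep_vars (M n) (\<lambda>_. Q) (Z n) {1..n}"
    and distr: "\<And>n j. n \<ge> 1 \<Longrightarrow> j \<in> {1..n} \<Longrightarrow> distr (M n) Q (Z n j) = Q"
    and m_pos: "\<And>n. n \<ge> 1 \<Longrightarrow> m n \<ge> 1"
    and m_infinity: "filterlim m at_top sequentially"
    and w_meas: "\<And>n. n \<ge> 1 \<Longrightarrow> vec_measurable Q (m n) (w n)"
    and w_mean: "\<And>n. n \<ge> 1 \<Longrightarrow> vec_integral Q (m n) (w n) = 0\<^sub>v (m n)"
    and w_sq: "\<And>n. n \<ge> 1 \<Longrightarrow> integrable Q (\<lambda>z. (vnorm (w n z))\<^sup>2)"
    and W_def: "\<And>n. W n = mat_integral Q (m n) (m n) (\<lambda>z. outer (w n z) (w n z))"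
    and w_hat_def: "\<And>n \<omega> z. w_hat n \<omega> z = h n (\<lambda>j\<in>{1..n}. Z n j \<omega>) z"
    and w_hat_dim: "\<And>n \<omega> z. n \<ge> 1 \<Longrightarrow> \<omega> \<in> space (M n) \<Longrightarrow> z \<in> space Q \<Longrightarrow>
          w_hat n \<omega> z \<in> carrier_vec (m n)"
    and w_hat_meas: "\<And>n j. n \<ge> 1 \<Longrightarrow> j \<in> {1..n} \<Longrightarrow>
          vec_measurable (M n) (m n) (\<lambda>\<omega>. w_hat n \<omega> (Z n j \<omega>))"
    and W_bar_def: "\<And>n \<omega>. W_bar n \<omega> =
          mat_avg (m n) n (\<lambda>j. outer (w n (Z n j \<omega>)) (w n (Z n j \<omega>)))"
    and W_hat_def: "\<And>n \<omega>. W_hat n \<omega> =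
          mat_avg (m n) n (\<lambda>j. outer (w_hat n \<omega> (Z n j \<omega>)) (w_hat n \<omega> (Z n j \<omega>)))"
    and R_hat_def: "\<And>n \<omega>. R_hat n \<omega> = el_ratio (m n) n (\<lambda>j. w_hat n \<omega> (Z n j \<omega>))"
    and regular: "regular_seq m W"
    and w_bound: "\<And>n z. n \<ge> 1 \<Longrightarrow> z \<in> space Q \<Longrightarrow> vnorm (w n z) \<le> B * sqrt (real (m n))"
    and w_hat_bound: "\<And>n \<omega> z. n \<ge> 1 \<Longrightarrow> \<omega> \<in> space (M n) \<Longrightarrow> z \<in> space Q \<Longrightarrow>
          vnorm (w_hat n \<omega> z) \<le> B * sqrt (real (m n))"
    and growth: "(\<lambda>n. real (m n) ^ 3) \<in> o(\<lambda>n. real n)"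
    and one_of_three:
      "small_op M (\<lambda>n \<omega>. op_norm (W_hat n \<omega> - W n)) (\<lambda>n. real (m n) powr (-1/2)) \<or>
       small_op M (\<lambda>n \<omega>. op_norm (W_hat n \<omega> - W_bar n \<omega>)) (\<lambda>n. real (m n) powr (-1/2)) \<or>
       small_op M (\<lambda>n \<omega>. (1 / real n) *
           (\<Sum>j=1..n. (vnorm (w_hat n \<omega> (Z n j \<omega>) - w n (Z n j \<omega>)))\<^sup>2))
         (\<lambda>n. real (m n) powr (-1))"
    and q_pos: "q \<ge> 1"
  shows
    "(small_op M (\<lambda>n \<omega>. vnorm (vec_avg (m n) n (\<lambda>j. w_hat n \<omega> (Z n j \<omega>))
                               - vec_avg (m n) n (\<lambda>j. w n (Z n j \<omega>))))
        (\<lambda>n. real n powr (-1/2))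
      \<longrightarrow> asymp_std_normal M (\<lambda>n \<omega>.
            (neg2log (R_hat n \<omega>) - ereal (real (m n))) / ereal (sqrt (2 * real (m n)))))
     \<and>
     (\<forall>(\<psi> :: 'z \<Rightarrow> real Matrix.vec) (A :: nat \<Rightarrow> real Matrix.mat).
        vec_measurable Q q \<psi> \<and>
        integrable Q (\<lambda>z. (vnorm (\<psi> z))\<^sup>2) \<and>
        vec_integral Q q \<psi> = 0\<^sub>v q \<and>
        mat_integral Q q q (\<lambda>z. outer (\<psi> z) (\<psi> z)) = 1\<^sub>m q \<and>
        (\<forall>n. A n = mat_integral Q (m n) q (\<lambda>z. outer (w n z) (\<psi> z))) \<and>
        small_op M (\<lambda>n \<omega>. vnorm (vec_avg (m n) n (\<lambda>j. w_hat n \<omega> (Z n j \<omega>))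
                   - vec_avg (m n) n (\<lambda>j. w n (Z n j \<omega>) - A n *\<^sub>v \<psi> (Z n j \<omega>))))
          (\<lambda>n. real n powr (-1/2)) \<and>
        (\<lambda>n. mtrace (transpose_mat (A n) * the (mat_inverse (W n)) * A n)) \<longlonglongrightarrow> real q
      \<longrightarrow> asymp_std_normal M (\<lambda>n \<omega>.
            (neg2log (R_hat n \<omega>) - ereal (real (m n)) + ereal (real q))
              / ereal (sqrt (2 * (real (m n) - real q)))))"
proof -
  have W_carrier: "W n \<in> carrier_mat (m n) (m n)" for n unfolding W_def by (rule moment_matrix_carrier)
  obtain c C where c: "0 < c" and C: "0 \<le> C"
    and lower: "\<And>n u. n \<ge> 1 \<Longrightarrow> u \<in> carrier_vec (m n) \<Longrightarrow> c * (vnorm u)\<^sup>2 \<le> scalar_prod u (W n *\<^sub>v u)"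
    and upper: "\<And>n u. n \<ge> 1 \<Longrightarrow> u \<in> carrier_vec (m n) \<Longrightarrow> scalar_prod u (W n *\<^sub>v u) \<le> C * (vnorm u)\<^sup>2"
    using regular_seq_bounds[OF regular W_carrier] by metis
  \<comment> \<open>The lower bound from regularity makes each \<open>W n\<close> with
    \<open>n \<ge> 1\<close> positive definite, hence invertible.\<close>
  have "\<exists>P. P \<in> carrier_mat (m n) (m n) \<and> W n * P = 1\<^sub>m (m n) \<and> P * W n = 1\<^sub>m (m n)" if n: "n \<ge> 1" for n
  proof (rule positive_definite_inverse[OF W_carrier])
    fix v :: "real Matrix.vec" assume v: "v \<in> carrier_vec (m n)" "v \<noteq> 0\<^sub>v (m n)"
    then have "vnorm v \<noteq> 0" by (simp add: vnorm_eq_0_iff)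
    then have "0 < c * (vnorm v)\<^sup>2" using c by simp
    then show "0 < scalar_prod v (W n *\<^sub>v v)" using lower[OF n v(1)] by linarith
  qed blast
  then have "\<exists>P. \<forall>n\<ge>1. P n \<in> carrier_mat (m n) (m n) \<and> W n * P n = 1\<^sub>m (m n) \<and> P n * W n = 1\<^sub>m (m n)" by metis
  then obtain P where P: "\<And>n. n \<ge> 1 \<Longrightarrow> P n \<in> carrier_mat (m n) (m n)" "\<And>n. n \<ge> 1 \<Longrightarrow> W n * P n = 1\<^sub>m (m n)"
    "\<And>n. n \<ge> 1 \<Longrightarrow> P n * W n = 1\<^sub>m (m n)" by blast
  define x where "x n \<omega> j = w_hat n \<omega> (Z n j \<omega>)" for n \<omega> j
  have setting: "el_setting Q M Z m w W P B c C"
    by (rule el_setting.intro) (fact prob_Q prob_M indep distr m_pos m_infinity w_meas w_mean W_def w_bound growth c C lower upper P)+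
  then interpret S: el_setting Q M Z m w W P B c C .
  interpret E: el_estimator Q M Z m w W P B c C x
  proof (rule el_estimator.intro[OF setting], rule el_estimator_axioms.intro)
    fix n \<omega> j assume n: "n \<ge> 1" and \<omega>: "\<omega> \<in> space (M n)" and j: "j \<in> {1..n}"
    show "x n \<omega> j \<in> carrier_vec (m n)" unfolding x_def by (rule w_hat_dim[OF n \<omega> S.Z_space[OF n j \<omega>]])
    show "vnorm (x n \<omega> j) \<le> B * sqrt (real (m n))" unfolding x_def by (rule w_hat_bound[OF n \<omega> S.Z_space[OF n j \<omega>]])
  next
    fix n j i assume "n \<ge> 1" "j \<in> {1..n}" "i < m n"
    then show "(\<lambda>\<omega>. x n \<omega> j $ i) \<in> borel_measurable (M n)" using w_hat_meas[of n j] unfolding x_def vec_measurable_def by blast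
  qed
  have W_hat_eq: "W_hat n \<omega> = E.W_hat n \<omega>" and W_bar_eq: "W_bar n \<omega> = S.W_bar n \<omega>" for n \<omega>
    unfolding W_hat_def E.W_hat_def W_bar_def S.W_bar_def x_def by (rule refl)+
  have D_eq: "E.D n \<omega> = (1 / real n) * (\<Sum>j=1..n. (vnorm (w_hat n \<omega> (Z n j \<omega>) - w n (Z n j \<omega>)))\<^sup>2)" for n \<omega>
    unfolding E.D_def x_def by (rule refl)
  have R_eq: "R_hat n \<omega> = el_ratio (m n) n (x n \<omega>)" for n \<omega> unfolding R_hat_def x_def by (rule refl)
  have avg_eq: "vec_avg (m n) n (\<lambda>j. w_hat n \<omega> (Z n j \<omega>)) = vec_avg (m n) n (x n \<omega>)" for n \<omega>
    unfolding x_def by (rule refl)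
  have a1: "small_op M (\<lambda>n \<omega>. op_norm (E.W_hat n \<omega> - W n)) (\<lambda>n. real (m n) powr (- 1 / 2))"
    using one_of_three unfolding W_hat_eq W_bar_eq D_eq[symmetric] by (intro E.W_hat_close) simp
  have m_real: "filterlim (\<lambda>n. real (m n)) at_top sequentially"
    by (rule filterlim_compose[OF filterlim_real_sequentially m_infinity])
  show ?thesis
  proof (intro conjI impI allI)
    assume small: "small_op M (\<lambda>n \<omega>. vnorm (vec_avg (m n) n (\<lambda>j. w_hat n \<omega> (Z n j \<omega>))
                               - vec_avg (m n) n (\<lambda>j. w n (Z n j \<omega>)))) (\<lambda>n. real n powr (-1/2))"
    have e_small: "small_op M (\<lambda>n \<omega>. vnorm (E.e n \<omega>)) (\<lambda>n. real n powr (- 1 / 2))"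
      using small unfolding avg_eq E.e_def S.wbar_def by simp
    show "asymp_std_normal M (\<lambda>n \<omega>. (neg2log (R_hat n \<omega>) - ereal (real (m n))) / ereal (sqrt (2 * real (m n))))"
      unfolding asymp_std_normal_def weak_conv_def
    proof (intro allI impI)
      fix y :: real
      have lim: "(\<lambda>n. measure (M n) {\<omega>\<in>space (M n). neg2log (el_ratio (m n) n (x n \<omega>)) \<le> ereal (real (m n) + y * sqrt (2 * real (m n)))})
        \<longlonglongrightarrow> cdf std_normal_distribution y"
        by (rule E.neg2log_asymptotics[OF a1 E.remainder_plain[OF e_small] tendsto_const])
      have ev: "\<forall>\<^sub>F n in sequentially. measure (M n) {\<omega>\<in>space (M n). neg2log (el_ratio (m n) n (x n \<omega>)) \<le> ereal (real (m n) + y * sqrt (2 * real (m n)))}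
        = measure (M n) {\<omega>\<in>space (M n). (neg2log (R_hat n \<omega>) - ereal (real (m n))) / ereal (sqrt (2 * real (m n))) \<le> ereal y}"
        using eventually_ge_at_top[of 1]
      proof eventually_elim
        case (elim n)
        have s: "0 < sqrt (2 * real (m n))" using m_pos[OF elim] by simp
        show ?case using neg2log_standardized_le_iff[OF s, of _ "real (m n)" 0 y] by (simp add: R_eq)
      qed
      show "(\<lambda>n. measure (M n) {\<omega>\<in>space (M n). (neg2log (R_hat n \<omega>) - ereal (real (m n))) / ereal (sqrt (2 * real (m n))) \<le> ereal y})
        \<longlonglongrightarrow> cdf std_normal_distribution y"
        by (rule Lim_transform_eventually[OF lim ev])
    qed
  next
    fix \<psi> :: "'z \<Rightarrow> real Matrix.vec" and A :: "nat \<Rightarrow> real Matrix.mat"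
    assume h: "vec_measurable Q q \<psi> \<and>
        integrable Q (\<lambda>z. (vnorm (\<psi> z))\<^sup>2) \<and>
        vec_integral Q q \<psi> = 0\<^sub>v q \<and>
        mat_integral Q q q (\<lambda>z. outer (\<psi> z) (\<psi> z)) = 1\<^sub>m q \<and>
        (\<forall>n. A n = mat_integral Q (m n) q (\<lambda>z. outer (w n z) (\<psi> z))) \<and>
        small_op M (\<lambda>n \<omega>. vnorm (vec_avg (m n) n (\<lambda>j. w_hat n \<omega> (Z n j \<omega>))
                   - vec_avg (m n) n (\<lambda>j. w n (Z n j \<omega>) - A n *\<^sub>v \<psi> (Z n j \<omega>))))
          (\<lambda>n. real n powr (-1/2)) \<and>
        (\<lambda>n. mtrace (transpose_mat (A n) * the (mat_inverse (W n)) * A n)) \<longlonglongrightarrow> real q"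
    interpret F: el_projection Q M Z m w W P B c C x \<psi> q A
      by (rule el_projection.intro[OF E.el_estimator_axioms], rule el_projection_axioms.intro) (use h in blast)+
    have p_small: "small_op M (\<lambda>n \<omega>. vnorm (vec_avg (m n) n (x n \<omega>)
      - vec_avg (m n) n (\<lambda>j. w n (Z n j \<omega>) - A n *\<^sub>v \<psi> (Z n j \<omega>)))) (\<lambda>n. real n powr (- 1 / 2))"
      using h unfolding avg_eq by blast
    \<comment> \<open>Solves \<open>m + u * sqrt (2 * m) = m - q + y * sqrt (2 * (m - q))\<close>,
      so the event of part (ii) at \<open>y\<close> is an event with the centring and scale of part
      (i) at a moving point.\<close>
    define u where "u y n = (y * sqrt (2 * (real (m n) - real q)) - real q) / sqrt (2 * real (m n))" for y n
    have u: "u y \<longlonglongrightarrow> y" for y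
    proof -
      have "((\<lambda>t. (y * sqrt (2 * (t - real q)) - real q) / sqrt (2 * t)) \<longlongrightarrow> y) at_top" by real_asymp
      from filterlim_compose[OF this m_real] show ?thesis unfolding u_def[abs_def] .
    qed
    show "asymp_std_normal M (\<lambda>n \<omega>. (neg2log (R_hat n \<omega>) - ereal (real (m n)) + ereal (real q)) / ereal (sqrt (2 * (real (m n) - real q))))"
      unfolding asymp_std_normal_def weak_conv_def
    proof (intro allI impI)
      fix y :: real
      have lim: "(\<lambda>n. measure (M n) {\<omega>\<in>space (M n). neg2log (el_ratio (m n) n (x n \<omega>)) \<le> ereal (real (m n) + u y n * sqrt (2 * real (m n)))})
        \<longlonglongrightarrow> cdf std_normal_distribution y"
        by (rule E.neg2log_asymptotics[OF a1 F.remainder_projection[OF p_small] u])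
      \<comment> \<open>Ensures a positive scale, without which the standardised inequality cannot
        be rearranged.\<close>
      have "\<forall>\<^sub>F n in sequentially. real q + 1 \<le> real (m n)" using m_real by (simp add: filterlim_at_top)
      then have ev: "\<forall>\<^sub>F n in sequentially. measure (M n) {\<omega>\<in>space (M n). neg2log (el_ratio (m n) n (x n \<omega>)) \<le> ereal (real (m n) + u y n * sqrt (2 * real (m n)))}
        = measure (M n) {\<omega>\<in>space (M n). (neg2log (R_hat n \<omega>) - ereal (real (m n)) + ereal (real q)) / ereal (sqrt (2 * (real (m n) - real q))) \<le> ereal y}"
      proof eventually_elim
        case (elim n)
        have s: "0 < sqrt (2 * (real (m n) - real q))" using elim by simp
        have "real (m n) + u y n * sqrt (2 * real (m n)) = real (m n) - real q + y * sqrt (2 * (real (m n) - real q))"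
          using elim by (simp add: u_def)
        then show ?case using neg2log_standardized_le_iff[OF s, of _ "real (m n)" "real q" y] by (simp only: R_eq)
      qed
      show "(\<lambda>n. measure (M n) {\<omega>\<in>space (M n). (neg2log (R_hat n \<omega>) - ereal (real (m n)) + ereal (real q)) / ereal (sqrt (2 * (real (m n) - real q))) \<le> ereal y})
        \<longlonglongrightarrow> cdf std_normal_distribution y"
        by (rule Lim_transform_eventually[OF lim ev])
    qed
  qed
qed

end
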